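(* Let $\beta\in(1,2)$ and $0<H<1-1/\beta$. Let $L=(L_t)_{t\in\mathbb{R}}$ be a two-sided $\beta$-stable Lévy process, and let $(X_t)_{t\in\mathbb{R}}$ be the linear fractional stable noise $$X_t=Y_t-Y_{t-1},\qquad Y_t=\int_{-\infty}^t\Big\{(t-s)_+^{H-1/\beta}-(-s)_+^{H-1/\beta}\Big\}\,dL_s .$$ Let $f\in C_b^2(\mathbb{R})$, $V_n=n^{-1/2}\sum_{t=1}^n(f(X_t)-\mathbb{E}[f(X_1)])$, $v_n=\sqrt{\mathrm{var}(V_n)}$, suppose that $v^2=\sum_{j\in\mathbb{Z}}\mathrm{cov}(f(X_0),f(X_j))$ satisfies $v^2>0$, and let $Z\sim\mathcal{N}(0,1)$. Then there is a constant $C>0$ not depending on $n$ such that, for all $n\in\mathbb{N}$ with $v_n>0$, $$d_W(v_n^{-1}V_n,Z)\le C\,n^{(1+\beta(H-1))/2}\qquad\text{and}\qquad d_K(v_n^{-1}V_n,Z)\le C\,n^{(1+\beta(H-1))/4}.$$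
   Context: $C_b^2(\mathbb{R})$ is the space of twice continuously differentiable $f:\mathbb{R}\to\mathbb{R}$ with $f,f',f''$ bounded. $x_+=\max(x,0)$, and $x_+^a$ is $x^a$ for $x>0$ and $0$ for $x\le 0$. Stochastic integrals of deterministic functions with respect to $L$ are understood in the usual sense of Rajput and Rosiński; $L_0=0$ a.s. The Wasserstein distance is $d_W(F,G)=\sup_h|\mathbb{E}[h(F)]-\mathbb{E}[h(G)]|$, the supremum being over all functions $h:\mathbb{R}\to\mathbb{R}$ that are Lipschitz with constant at most $1$. The Kolmogorov distance is $d_K(F,G)=\sup_{x\in\mathbb{R}}|\mathbb{P}(F\le x)-\mathbb{P}(G\le x)|$. *)

theory Defs
  imports "HOL-Probability.Probability"
begin

definition conv_in_prob :: "'a measure \<Rightarrow> (nat \<Rightarrow> 'a \<Rightarrow> real) \<Rightarrow> ('a \<Rightarrow> real) \<Rightarrow> bool" where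
  "conv_in_prob M F G \<longleftrightarrow>
     (\<forall>\<epsilon>>0. (\<lambda>n. measure M {\<omega> \<in> space M. \<bar>F n \<omega> - G \<omega>\<bar> > \<epsilon>}) \<longlonglongrightarrow> 0)"

definition covariance :: "'a measure \<Rightarrow> ('a \<Rightarrow> real) \<Rightarrow> ('a \<Rightarrow> real) \<Rightarrow> real" where
  "covariance M F G = (\<integral>\<omega>. (F \<omega> - (\<integral>\<eta>. F \<eta> \<partial>M)) * (G \<omega> - (\<integral>\<eta>. G \<eta> \<partial>M)) \<partial>M)"

definition var :: "'a measure \<Rightarrow> ('a \<Rightarrow> real) \<Rightarrow> real" where
  "var M F = covariance M F F"

text \<open>Valued in the extended reals, so that the supremum is meaningful without a
  boundedness proof.\<close>

definition wasserstein_dist ::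
    "'a measure \<Rightarrow> ('a \<Rightarrow> real) \<Rightarrow> 'b measure \<Rightarrow> ('b \<Rightarrow> real) \<Rightarrow> ereal" where
  "wasserstein_dist M F N G =
     (SUP h \<in> {h :: real \<Rightarrow> real. 1-lipschitz_on UNIV h}.
        ereal \<bar>(\<integral>\<omega>. h (F \<omega>) \<partial>M) - (\<integral>\<omega>. h (G \<omega>) \<partial>N)\<bar>)"

definition kolmogorov_dist ::
    "'a measure \<Rightarrow> ('a \<Rightarrow> real) \<Rightarrow> 'b measure \<Rightarrow> ('b \<Rightarrow> real) \<Rightarrow> ereal" where
  "kolmogorov_dist M F N G =
     (SUP x :: real. ereal \<bar>measure M {\<omega> \<in> space M. F \<omega> \<le> x} - measure N {\<omega> \<in> space N. G \<omega> \<le> x}\<bar>)"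

definition C_b2 :: "(real \<Rightarrow> real) set" where
  "C_b2 = {f. \<exists>f' f''.
     (\<forall>x. (f has_real_derivative f' x) (at x)) \<and>
     (\<forall>x. (f' has_real_derivative f'' x) (at x)) \<and>
     continuous_on UNIV f'' \<and>
     bounded (range f) \<and> bounded (range f') \<and> bounded (range f'')}"

definition two_sided_levy_process :: "'a measure \<Rightarrow> (real \<Rightarrow> 'a \<Rightarrow> real) \<Rightarrow> bool" where
  "two_sided_levy_process M L \<longleftrightarrow>
     prob_space M \<and>
     (\<forall>t. L t \<in> borel_measurable M) \<and>
     (AE \<omega> in M. L 0 \<omega> = 0) \<and>
     (\<forall>(ts :: nat \<Rightarrow> real) n. strict_mono ts \<longrightarrow>
        prob_space.indep_vars M (\<lambda>_. borel) (\<lambda>i \<omega>. L (ts (Suc i)) \<omega> - L (ts i) \<omega>) {..<n}) \<and>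
     (\<forall>s t h. 0 \<le> h \<longrightarrow>
        distr M borel (\<lambda>\<omega>. L (s + h) \<omega> - L s \<omega>) = distr M borel (\<lambda>\<omega>. L (t + h) \<omega> - L t \<omega>)) \<and>
     (\<forall>t. \<forall>\<epsilon>>0. ((\<lambda>s. measure M {\<omega> \<in> space M. \<bar>L s \<omega> - L t \<omega>\<bar> > \<epsilon>}) \<longlongrightarrow> 0) (at t)) \<and>
     (AE \<omega> in M. \<forall>t. continuous (at_right t) (\<lambda>s. L s \<omega>) \<and>
                     (\<exists>l. ((\<lambda>s. L s \<omega>) \<longlongrightarrow> l) (at_left t)))"

text \<open>Stability with index \<open>\<beta>\<close>: if \<open>X\<^sub>1, X\<^sub>2, X\<close> are i.i.d. with law \<open>\<mu>\<close>, then
  \<open>a X\<^sub>1 + b X\<^sub>2\<close> has the law of \<open>(a\<^sup>\<beta> + b\<^sup>\<beta>)\<^bsup>1/\<beta>\<^esup> X + d\<close> for some real \<open>d\<close>. Point masses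
  are excluded. Neither symmetry nor strict stability is required.\<close>

definition stable_law :: "real \<Rightarrow> real measure \<Rightarrow> bool" where
  "stable_law \<beta> \<mu> \<longleftrightarrow>
     (\<nexists>c. \<mu> = return borel c) \<and>
     (\<forall>a>0. \<forall>b>0. \<exists>d.
        convolution (distr \<mu> borel (\<lambda>x. a * x)) (distr \<mu> borel (\<lambda>x. b * x)) =
        distr \<mu> borel (\<lambda>x. (a powr \<beta> + b powr \<beta>) powr (1 / \<beta>) * x + d))"

definition stable_levy_process :: "'a measure \<Rightarrow> real \<Rightarrow> (real \<Rightarrow> 'a \<Rightarrow> real) \<Rightarrow> bool" where
  "stable_levy_process M \<beta> L \<longleftrightarrow>
     two_sided_levy_process M L \<and> stable_law \<beta> (distr M borel (L 1))"

text \<open>The independently scattered random measure generated by \<open>L\<close>, on the \<open>\<delta>\<close>-ring of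
  bounded Borel sets. Its values outside that ring are irrelevant. It is determined by \<open>L\<close> up to
  almost sure equality on each bounded Borel set.\<close>

definition levy_random_measure ::
    "'a measure \<Rightarrow> (real \<Rightarrow> 'a \<Rightarrow> real) \<Rightarrow> (real set \<Rightarrow> 'a \<Rightarrow> real) \<Rightarrow> bool" where
  "levy_random_measure M L \<Lambda> \<longleftrightarrow>
     (\<forall>A \<in> sets borel. bounded A \<longrightarrow> \<Lambda> A \<in> borel_measurable M) \<and>
     (\<forall>A :: nat \<Rightarrow> real set.
        (\<forall>n. A n \<in> sets borel \<and> bounded (A n)) \<and> disjoint_family A \<longrightarrow>
        prob_space.indep_vars M (\<lambda>_. borel) (\<lambda>n. \<Lambda> (A n)) UNIV \<and>
        (bounded (\<Union>n. A n) \<longrightarrow>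
           (AE \<omega> in M. (\<lambda>n. \<Lambda> (A n) \<omega>) sums \<Lambda> (\<Union>n. A n) \<omega>))) \<and>
     (\<forall>s t. s \<le> t \<longrightarrow> (AE \<omega> in M. \<Lambda> {s<..t} \<omega> = L t \<omega> - L s \<omega>))"

definition integrand_step :: "(real \<Rightarrow> real) \<Rightarrow> bool" where
  "integrand_step \<phi> \<longleftrightarrow> simple_function borel \<phi> \<and> bounded {s. \<phi> s \<noteq> 0}"

definition step_integral ::
    "(real set \<Rightarrow> 'a \<Rightarrow> real) \<Rightarrow> real set \<Rightarrow> (real \<Rightarrow> real) \<Rightarrow> 'a \<Rightarrow> real" where
  "step_integral \<Lambda> A \<phi> \<omega> = (\<Sum>y \<in> range \<phi> - {0}. y * \<Lambda> (A \<inter> \<phi> -` {y}) \<omega>)"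

text \<open>The Rajput--Rosinski integral of a deterministic function over the real line. By stationarity
  of the increments the control measure of the random measure generated by a nondegenerate \<open>L\<close> is a
  positive multiple of Lebesgue measure, whence the null sets below. The integral is
  determined up to almost sure equality.\<close>

definition has_levy_integral ::
    "'a measure \<Rightarrow> (real \<Rightarrow> 'a \<Rightarrow> real) \<Rightarrow> (real \<Rightarrow> real) \<Rightarrow> ('a \<Rightarrow> real) \<Rightarrow> bool" where
  "has_levy_integral M L g I \<longleftrightarrow>
     g \<in> borel_measurable borel \<and> I \<in> borel_measurable M \<and>
     (\<exists>\<Lambda> \<phi>. levy_random_measure M L \<Lambda> \<and>
        (\<forall>n. integrand_step (\<phi> n)) \<and>
        (AE s in lborel. (\<lambda>n. \<phi> n s) \<longlonglongrightarrow> g s) \<and>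
        (\<forall>A \<in> sets borel. \<exists>J \<in> borel_measurable M.
           conv_in_prob M (\<lambda>n. step_integral \<Lambda> A (\<phi> n)) J) \<and>
        conv_in_prob M (\<lambda>n. step_integral \<Lambda> UNIV (\<phi> n)) I)"

text \<open>\<open>pos_powr x a\<close> is \<open>x\<^sub>+\<^sup>a\<close>; it vanishes for \<open>x \<le> 0\<close> also when \<open>a \<le> 0\<close>, as \<open>0 powr a = 0\<close>.\<close>

definition pos_powr :: "real \<Rightarrow> real \<Rightarrow> real" where
  "pos_powr x a = max x 0 powr a"

text \<open>The kernel is integrated over the whole line. For \<open>t \<ge> 0\<close> this is the integral over
  \<open>(-\<infinity>, t]\<close>, the kernel being zero on \<open>(t, \<infinity>)\<close>. For \<open>t < 0\<close> the kernel is
  nonzero on \<open>(t, 0)\<close>, and that part is needed for the increments of the motion to be stationary.\<close>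

definition linear_fractional_stable_motion ::
    "'a measure \<Rightarrow> (real \<Rightarrow> 'a \<Rightarrow> real) \<Rightarrow> real \<Rightarrow> real \<Rightarrow> (real \<Rightarrow> 'a \<Rightarrow> real) \<Rightarrow> bool" where
  "linear_fractional_stable_motion M L \<beta> H Y \<longleftrightarrow>
     (\<forall>t. has_levy_integral M L
        (\<lambda>s. pos_powr (t - s) (H - 1 / \<beta>) - pos_powr (- s) (H - 1 / \<beta>)) (Y t))"

end

theory Submission
  imports Defs "HOL-Real_Asymp.Real_Asymp"
begin

text \<open>Put \<open>\<gamma> = \<beta>(1 - H) - 1\<close>, so that \<open>0 < \<gamma> < 1\<close> and the two exponents are \<open>-\<gamma>/2\<close> and \<open>-\<gamma>/4\<close>.

The variable \<open>X\<^sub>t\<close> is a moving average of the increments of \<open>L\<close>. It is approximated by Riemann sums,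
which are functions of finitely many independent increments, grouped into blocks of unit length.
Replacing one block at lag \<open>d\<close> before \<open>t\<close> by an independent copy changes \<open>X\<^sub>t\<close> by a quantity whose square,
truncated at one, has mean of order \<open>(d + 1)\<^sup>-\<^sup>2\<^sup>-\<^sup>\<gamma>\<close>. Indeed, the kernel of the noise has a power tail there, and sums
of independent stable increments are stable (\<open>block_weight_lag_bound\<close>). As \<open>f\<close> has two bounded derivatives,
increments and mixed second increments of \<open>f(X\<^sub>t)\<close> are controlled by truncated differences and their products.

A centred function \<open>W\<close> of independent coordinates is the sum of its martingale differences. Expanding
\<open>\<phi>(W)\<close> around \<open>W\<close> with one coordinate averaged out reduces \<open>\<phi>'(W) - W \<phi>(W)\<close> to two terms
(\<open>stein_bound\<close>). The first is a truncated third moment of the influences of the coordinates. The second is \<open>\<phi>'(W) (1 - U)\<close>, where the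
mean of \<open>U\<close> is the variance of \<open>W\<close>, and the variance of \<open>U\<close> is bounded by the Efron--Stein inequality and
the mixed second increments; for \<open>V\<^sub>n / v\<^sub>n\<close> it is of order \<open>1/n\<close>. The third moment determines the rate
(\<open>stein_rate\<close>). The influence of a block is \<open>n\<^sup>-\<^sup>1\<^sup>/\<^sup>2\<close> times a sum over lags \<open>d\<close> of terms whose \<open>L\<^sup>2\<close>-norm is of order
\<open>d\<close> to the power \<open>-1 - \<gamma>/2\<close> and, as they are at most one, whose \<open>L\<^sup>3\<close>-norm is of order \<open>d\<close> to the power \<open>-(2 + \<gamma>)/3\<close>. The latter is
not summable. Using it only for \<open>d\<close> below \<open>n\<^sup>1\<^sup>/\<^sup>2\<close>, and the \<open>L\<^sup>2\<close>-norm above, yields \<open>n\<^sup>-\<^sup>\<gamma>\<^sup>/\<^sup>2\<close> for both parts.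

The integral \<open>Y\<^sub>t\<close> is given by some sequence of step functions whose integrals over every Borel set
converge in probability. The law of \<open>L\<^sub>1\<close> may be skewed, so it enters through the squared modulus of its
characteristic function, which for the integral of a step function \<open>\<psi>\<close> determines the integral of \<open>\<bar>\<psi>\<bar>\<^sup>\<beta>\<close>. Hence these
integrals converge on every Borel set, and a sliding hump argument turns this into convergence in the mean
(\<open>setwise_convergent_powr_imp_Lp\<close>). So all approximations in \<open>L\<^sup>\<beta>\<close> and \<open>L\<^sup>1\<close> have the same limit, in
particular the Riemann sums (\<open>levy_integral_approx\<close>, \<open>noise_riemann\<close>).

The Riemann sums inherit stationarity from the increments of \<open>L\<close>. Therefore \<open>v\<^sub>n\<^sup>2\<close> converges to \<open>v\<^sup>2\<close>, the
positive values of \<open>v\<^sub>n\<close> have a positive lower bound, and one constant serves all \<open>n\<close> with \<open>v\<^sub>n > 0\<close>.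
The Kolmogorov distance follows from the estimate for Lipschitz functions by comparing
indicators of half-lines with ramps of width \<open>n\<^sup>-\<^sup>\<gamma>\<^sup>/\<^sup>4\<close>.\<close>

section \<open>Stein's equation with a Lipschitz right-hand side\<close>

lemma lipschitz_mean_bound:
  fixes h :: "real \<Rightarrow> real"
  assumes h: "1-lipschitz_on UNIV h"
  defines "m \<equiv> \<integral>y. h y * std_normal_density y \<partial>lborel"
  shows "integrable lborel (\<lambda>y. h y * std_normal_density y)" and "\<bar>h x - m\<bar> \<le> \<bar>x\<bar> + 1"
    and "integrable lborel (\<lambda>y. \<bar>y\<bar> * std_normal_density y)" and "(\<integral>y. \<bar>y\<bar> * std_normal_density y \<partial>lborel) \<le> 1"
proof -
  have lip: "\<bar>h x - h y\<bar> \<le> \<bar>x - y\<bar>" for x y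
    using lipschitz_onD[OF h, of x y] by (simp add: dist_real_def)
  have "continuous_on UNIV h" by (rule lipschitz_on_continuous_on[OF h])
  then have hm[measurable]: "h \<in> borel_measurable borel" by (rule borel_measurable_continuous_onI)
  show i1: "integrable lborel (\<lambda>y. \<bar>y\<bar> * std_normal_density y)"
    using integrable_std_normal_moment_abs[of 1] by (simp add: mult.commute)
  have i0: "integrable lborel (\<lambda>y. c * std_normal_density y)" for c by simp
  show ih: "integrable lborel (\<lambda>y. h y * std_normal_density y)"
  proof (rule Bochner_Integration.integrable_bound)
    show "integrable lborel (\<lambda>y. \<bar>h 0\<bar> * std_normal_density y + \<bar>y\<bar> * std_normal_density y)"
      by (intro Bochner_Integration.integrable_add i0 i1)
    show "AE y in lborel. norm (h y * std_normal_density y) \<le> norm (\<bar>h 0\<bar> * std_normal_density y + \<bar>y\<bar> * std_normal_density y)"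
    proof (rule AE_I2)
      fix y :: real
      have "\<bar>h y\<bar> \<le> \<bar>h 0\<bar> + \<bar>y\<bar>" using lip[of y 0] by simp
      then have "\<bar>h y\<bar> * std_normal_density y \<le> (\<bar>h 0\<bar> + \<bar>y\<bar>) * std_normal_density y"
        by (intro mult_right_mono) auto
      then show "norm (h y * std_normal_density y) \<le> norm (\<bar>h 0\<bar> * std_normal_density y + \<bar>y\<bar> * std_normal_density y)"
        by (simp add: abs_mult algebra_simps)
    qed
  qed measurable
  have i2: "integrable lborel (\<lambda>y. y\<^sup>2 * std_normal_density y)" "(\<integral>y. y\<^sup>2 * std_normal_density y \<partial>lborel) = 1"
    using std_normal_moment_even[of 1] by (auto simp: has_bochner_integral_iff mult.commute)
  show E1: "(\<integral>y. \<bar>y\<bar> * std_normal_density y \<partial>lborel) \<le> 1"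
  proof -
    have "(\<integral>y. \<bar>y\<bar> * std_normal_density y \<partial>lborel) \<le> (\<integral>y. (1/2) * std_normal_density y + (1/2) * (y\<^sup>2 * std_normal_density y) \<partial>lborel)"
    proof (intro integral_mono i1 Bochner_Integration.integrable_add i0 integrable_mult_right i2)
      fix y :: real
      have "0 \<le> (1 - \<bar>y\<bar>)\<^sup>2" by simp
      then have "\<bar>y\<bar> \<le> 1/2 + 1/2 * y\<^sup>2" by (simp add: power2_eq_square algebra_simps)
      then have "\<bar>y\<bar> * std_normal_density y \<le> (1/2 + 1/2 * y\<^sup>2) * std_normal_density y" by (intro mult_right_mono) auto
      then show "\<bar>y\<bar> * std_normal_density y \<le> (1/2) * std_normal_density y + (1/2) * (y\<^sup>2 * std_normal_density y)"
        by (simp add: algebra_simps)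
    qed
    also have "\<dots> = 1" using i2 by simp
    finally show ?thesis .
  qed
  have "h x - m = (\<integral>y. h x * std_normal_density y - h y * std_normal_density y \<partial>lborel)"
    unfolding m_def using ih by simp
  then have "\<bar>h x - m\<bar> \<le> (\<integral>y. \<bar>h x * std_normal_density y - h y * std_normal_density y\<bar> \<partial>lborel)"
    by (simp only: integral_abs_bound)
  also have "\<dots> \<le> (\<integral>y. \<bar>x\<bar> * std_normal_density y + \<bar>y\<bar> * std_normal_density y \<partial>lborel)"
  proof (intro integral_mono Bochner_Integration.integrable_add i0 i1)
    fix y :: real
    have "\<bar>h x - h y\<bar> \<le> \<bar>x\<bar> + \<bar>y\<bar>" using lip[of x y] by simp
    then have "\<bar>h x - h y\<bar> * std_normal_density y \<le> (\<bar>x\<bar> + \<bar>y\<bar>) * std_normal_density y"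
      by (intro mult_right_mono) auto
    then show "\<bar>h x * std_normal_density y - h y * std_normal_density y\<bar> \<le> \<bar>x\<bar> * std_normal_density y + \<bar>y\<bar> * std_normal_density y"
      by (simp add: abs_mult left_diff_distrib[symmetric] distrib_right)
  qed (use ih in auto)
  also have "\<dots> \<le> \<bar>x\<bar> + 1" using E1 i1 by simp
  finally show "\<bar>h x - m\<bar> \<le> \<bar>x\<bar> + 1" .
qed

text \<open>The solution is \<open>G / n\<close>, where \<open>n\<close> is the normal density and \<open>G\<close> the integral of \<open>(h - m) n\<close> up to the
given point. It vanishes at both ends because \<open>m\<close> is the mean of \<open>h\<close>. Since
\<open>\<bar>h - m\<bar>\<close> is at most \<open>\<bar>x\<bar> + 1\<close>, the derivative of \<open>2 n - s G\<close> has a sign outside of \<open>[-1, 1]\<close>, which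
bounds \<open>\<bar>G\<bar>\<close> by \<open>2 n\<close> there.\<close>

lemma stein_equation_bounded_solution:
  fixes h :: "real \<Rightarrow> real"
  assumes h: "1-lipschitz_on UNIV h"
  defines "m \<equiv> \<integral>y. h y * std_normal_density y \<partial>lborel"
  obtains \<phi> where "\<And>x. (\<phi> has_real_derivative (x * \<phi> x + (h x - m))) (at x)"
    and "\<And>x. \<bar>\<phi> x\<bar> \<le> 2 * sqrt (2 * pi) * exp (1/2)"
proof -
  define n where "n = std_normal_density"
  have n_eq: "n x = 1 / sqrt (2 * pi) * exp (- x\<^sup>2 / 2)" for x by (simp add: n_def std_normal_density_def)
  have n_pos: "0 < n x" for x unfolding n_eq by (simp add: pi_gt_zero)
  have n_der: "(n has_real_derivative (- x * n x)) (at x)" for x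
  proof -
    have "((\<lambda>x. 1 / sqrt (2 * pi) * exp (- x\<^sup>2 / 2)) has_real_derivative 1 / sqrt (2 * pi) * (exp (- x\<^sup>2 / 2) * - x)) (at x)"
      by (intro DERIV_cmult) (auto intro!: derivative_eq_intros)
    then show ?thesis unfolding n_eq[abs_def] by (simp only: mult_ac)
  qed
  define p where "p x = (h x - m) * n x" for x
  note mb = lipschitz_mean_bound[OF h, folded m_def n_def]
  have hc: "continuous_on S h" for S by (rule continuous_on_subset[OF lipschitz_on_continuous_on[OF h]]) simp
  have nc: "continuous_on S n" for S using n_der by (meson DERIV_isCont continuous_at_imp_continuous_on)
  have pc: "continuous_on S p" for S unfolding p_def[abs_def] by (intro continuous_intros hc nc)
  have p_meas[measurable]: "p \<in> borel_measurable borel" using pc by (rule borel_measurable_continuous_onI)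
  have ip: "integrable lborel p"
    unfolding p_def[abs_def] left_diff_distrib using mb(1) by (auto simp: n_def)
  have Ep: "(\<integral>x. p x \<partial>lborel) = 0"
    unfolding p_def left_diff_distrib using mb(1) by (simp add: n_def m_def)
  have p_bound: "\<bar>p x\<bar> \<le> (\<bar>x\<bar> + 1) * n x" for x
    unfolding p_def abs_mult using mb(2)[of x] n_pos[of x] by (auto intro!: mult_right_mono)
  define G where "G w = (\<integral>x. indicator {..w} x * p x \<partial>lborel)" for w
  have iG: "integrable lborel (\<lambda>x. indicator A x * p x)" if "A \<in> sets borel" for A
    using integrable_mult_indicator[OF _ ip, of A] that by simp
  have G_der: "(G has_real_derivative p w) (at w)" for w
  proof -
    have eq: "G x = G (w - 1) + integral {w - 1..x} p" if "x \<in> {w - 1..w + 1}" for x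
    proof -
      have "G x - G (w - 1) = (\<integral>y. indicator {w - 1<..x} y * p y \<partial>lborel)"
        unfolding G_def using that
        by (subst Bochner_Integration.integral_diff[symmetric])
           (auto intro!: iG Bochner_Integration.integral_cong split: split_indicator)
      also have "\<dots> = (\<integral>y. indicator {w - 1..x} y * p y \<partial>lborel)"
        by (intro integral_cong_AE) (use AE_lborel_singleton[of "w - 1"] in \<open>auto elim!: eventually_mono split: split_indicator\<close>)
      also have "\<dots> = integral {w - 1..x} p"
      proof -
        have "set_integrable lborel {w - 1..x} p" using iG[of "{w-1..x}"] by (simp add: set_integrable_def)
        from set_borel_integral_eq_integral(2)[OF this] show ?thesis by (simp add: set_lebesgue_integral_def)
      qed
      finally show ?thesis by simp
    qed
    have "((\<lambda>x. G (w - 1) + integral {w - 1..x} p) has_real_derivative p w) (at w within {w - 1..w + 1})"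
      by (auto intro!: derivative_eq_intros integral_has_real_derivative pc)
    then have "((\<lambda>x. G (w - 1) + integral {w - 1..x} p) has_real_derivative p w) (at w)"
      by (subst (asm) at_within_interior) auto
    moreover have "\<forall>\<^sub>F x in nhds w. G x = G (w - 1) + integral {w - 1..x} p"
      by (rule eventually_mono[OF eventually_nhds_in_open[of "{w - 1<..<w + 1}"]]) (auto intro!: eq)
    ultimately show ?thesis by (subst DERIV_cong_ev[OF refl _ refl]) auto
  qed
  have G_lim: "((\<lambda>w. G (\<sigma> * w)) \<longlongrightarrow> 0) at_top" if \<sigma>: "\<sigma> = 1 \<or> \<sigma> = - 1" for \<sigma>
  proof -
    let ?l = "\<lambda>x. if \<sigma> = 1 then p x else 0"
    have "((\<lambda>w. \<integral>x. indicator {..\<sigma> * w} x * p x \<partial>lborel) \<longlongrightarrow> (\<integral>x. ?l x \<partial>lborel)) at_top"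
    proof (rule integral_dominated_convergence_at_top[where w="\<lambda>x. \<bar>p x\<bar>"])
      show "integrable lborel (\<lambda>x. \<bar>p x\<bar>)" using ip by simp
      show "AE x in lborel. ((\<lambda>w. indicator {..\<sigma> * w} x * p x) \<longlongrightarrow> ?l x) at_top"
      proof (rule AE_I2)
        fix x show "((\<lambda>w. indicator {..\<sigma> * w} x * p x) \<longlongrightarrow> ?l x) at_top"
          by (rule tendsto_eventually, rule eventually_mono[OF eventually_gt_at_top[of "\<bar>x\<bar>"]]) (use \<sigma> in \<open>auto split: split_indicator\<close>)
      qed
    qed (auto simp: indicator_def)
    then show ?thesis using \<sigma> by (auto simp: G_def[symmetric] Ep)
  qed
  have n_top: "(n \<longlongrightarrow> 0) at_top" "((\<lambda>w. n (- w)) \<longlongrightarrow> 0) at_top"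
  proof -
    have "((\<lambda>x. 1 / sqrt (2 * pi) * exp (- x\<^sup>2 / 2)) \<longlongrightarrow> 1 / sqrt (2 * pi) * 0) at_top"
      by (intro tendsto_mult_left) real_asymp
    then show "(n \<longlongrightarrow> 0) at_top" unfolding n_eq[abs_def] by simp
    then show "((\<lambda>w. n (- w)) \<longlongrightarrow> 0) at_top" unfolding n_eq[abs_def] by simp
  qed
  have tail: "s * G (\<sigma> * w) \<le> 2 * n (\<sigma> * w)" if w: "1 \<le> w" and s: "\<bar>s\<bar> = 1" and \<sigma>: "\<sigma> = 1 \<or> \<sigma> = - 1" for s \<sigma> w
  proof -
    let ?F = "\<lambda>x. 2 * n (\<sigma> * x) - s * G (\<sigma> * x)"
    have "0 \<le> ?F w"
    proof (rule tendsto_upperbound[where F = "at_top :: real filter" and f = ?F])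
      show "(?F \<longlongrightarrow> 0) at_top"
        using \<sigma> tendsto_diff[OF tendsto_mult_left[OF n_top(1), of 2] tendsto_mult_left[OF G_lim[OF \<sigma>], of s]]
          tendsto_diff[OF tendsto_mult_left[OF n_top(2), of 2] tendsto_mult_left[OF G_lim[OF \<sigma>], of s]] by auto
      have "?F x \<le> ?F w" if "w < x" for x
      proof (rule DERIV_nonpos_imp_nonincreasing[of w x ?F])
        fix y assume y: "w \<le> y" "y \<le> x"
        have "(?F has_real_derivative (2 * (- (\<sigma> * y) * n (\<sigma> * y) * \<sigma>) - s * (p (\<sigma> * y) * \<sigma>))) (at y)"
          by (intro DERIV_diff DERIV_cmult DERIV_chain2[OF n_der] DERIV_chain2[OF G_der])
            (auto intro!: derivative_eq_intros)
        moreover have "2 * (- (\<sigma> * y) * n (\<sigma> * y) * \<sigma>) - s * (p (\<sigma> * y) * \<sigma>) \<le> 0"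
        proof -
          have "\<bar>s * (p (\<sigma> * y) * \<sigma>)\<bar> = \<bar>p (\<sigma> * y)\<bar>" using s \<sigma> by (auto simp: abs_mult)
          also have "\<dots> \<le> (\<bar>\<sigma> * y\<bar> + 1) * n (\<sigma> * y)" by (rule p_bound)
          also have "\<dots> \<le> (2 * y) * n (\<sigma> * y)" using y w \<sigma> n_pos[of "\<sigma> * y"] by (intro mult_right_mono) auto
          finally show ?thesis using \<sigma> by auto
        qed
        ultimately show "\<exists>z. (?F has_real_derivative z) (at y) \<and> z \<le> 0" by blast
      qed (use that in simp)
      then show "\<forall>\<^sub>F x in at_top. ?F x \<le> ?F w" by (intro eventually_mono[OF eventually_gt_at_top[of w]])
    qed simp
    then show ?thesis by simp
  qed
  have mid: "\<bar>G w\<bar> \<le> 2" for w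
  proof -
    have "\<bar>G w\<bar> \<le> (\<integral>x. \<bar>indicator {..w} x * p x\<bar> \<partial>lborel)" unfolding G_def by (rule integral_abs_bound)
    also have "\<dots> \<le> (\<integral>x. \<bar>x\<bar> * n x + n x \<partial>lborel)"
    proof (intro integral_mono)
      fix x show "\<bar>indicator {..w} x * p x\<bar> \<le> \<bar>x\<bar> * n x + n x"
        using p_bound[of x] n_pos[of x] by (auto simp: algebra_simps split: split_indicator)
    qed (use iG mb(3) in \<open>auto simp: n_def\<close>)
    also have "\<dots> \<le> 2" using mb(3,4) by (simp add: n_def)
    finally show ?thesis .
  qed
  show thesis
  proof (rule that[of "\<lambda>w. G w / n w"])
    fix x
    show "((\<lambda>w. G w / n w) has_real_derivative (x * (G x / n x) + (h x - m))) (at x)"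
      using n_pos[of x] by (auto intro!: derivative_eq_intros G_der n_der simp: p_def field_simps power2_eq_square)
    have e: "1 \<le> sqrt (2 * pi)" using pi_ge_two by (intro real_le_rsqrt) simp
    have ee: "1 \<le> exp (1/2 :: real)" by simp
    show "\<bar>G x / n x\<bar> \<le> 2 * sqrt (2 * pi) * exp (1/2)"
    proof (cases "\<bar>x\<bar> \<le> 1")
      case True
      then have "x\<^sup>2 \<le> 1" by (simp add: abs_square_le_1)
      then have "exp (x\<^sup>2 / 2) \<le> exp (1/2 :: real)" by simp
      moreover have "\<bar>G x / n x\<bar> = \<bar>G x\<bar> * (sqrt (2 * pi) * exp (x\<^sup>2 / 2))"
        unfolding n_eq by (simp add: exp_minus field_simps abs_mult)
      ultimately have "\<bar>G x / n x\<bar> \<le> 2 * (sqrt (2 * pi) * exp (1/2))"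
        using mid[of x] by (simp only:) (intro mult_mono, auto)
      then show ?thesis by simp
    next
      case False
      then have "1 * G x \<le> 2 * n x \<and> (-1) * G x \<le> 2 * n x"
        using tail[of x 1 1] tail[of x "-1" 1] tail[of "- x" 1 "-1"] tail[of "- x" "-1" "-1"] by (cases "0 \<le> x") auto
      then have "\<bar>G x / n x\<bar> \<le> 2" using n_pos[of x] by (simp add: abs_le_iff divide_simps)
      also have "\<dots> \<le> 2 * sqrt (2 * pi) * exp (1/2)"
        using mult_mono[OF e ee] by simp
      finally show ?thesis .
    qed
  qed
qed

lemma one_plus_abs_le: "1 + \<bar>x\<bar> \<le> 2 * (1 + x\<^sup>2)" for x :: real
proof -
  have "0 \<le> (1 - \<bar>x\<bar>)\<^sup>2" by simp
  then have "2 * \<bar>x\<bar> \<le> 1 + x\<^sup>2" by (simp add: power2_diff)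
  moreover have "0 \<le> x\<^sup>2" by simp
  ultimately show ?thesis by argo
qed

text \<open>For a bounded solution of Stein's equation, \<open>\<phi>' = x \<phi> + h - m\<close> grows linearly, and its local
Lipschitz constant quadratically. The last clause joins the resulting Taylor estimate for close points to the
linear estimate for distant ones; it lets moments of order lower than three control the remainder.\<close>

definition stein_regular :: "real \<Rightarrow> (real \<Rightarrow> real) \<Rightarrow> (real \<Rightarrow> real) \<Rightarrow> bool" where
  "stein_regular C \<phi> \<phi>' \<longleftrightarrow> continuous_on UNIV \<phi> \<and> continuous_on UNIV \<phi>' \<and>
     (\<forall>x. \<bar>\<phi>' x\<bar> \<le> C * (1 + \<bar>x\<bar>)) \<and>
     (\<forall>x y. \<bar>\<phi>' y - \<phi>' x\<bar> \<le> C * (1 + x\<^sup>2) * \<bar>y - x\<bar>) \<and>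
     (\<forall>x y. \<bar>\<phi> y - \<phi> x - \<phi>' x * (y - x)\<bar> \<le> C * (1 + x\<^sup>2) * min ((y - x)\<^sup>2) \<bar>y - x\<bar>)"

lemma stein_regularD:
  assumes "stein_regular C \<phi> \<phi>'"
  shows "continuous_on UNIV \<phi>" "continuous_on UNIV \<phi>'"
    and "\<And>x. \<bar>\<phi>' x\<bar> \<le> C * (1 + \<bar>x\<bar>)" and "\<And>x y. \<bar>\<phi>' y - \<phi>' x\<bar> \<le> C * (1 + x\<^sup>2) * \<bar>y - x\<bar>"
    and "\<And>x y. \<bar>\<phi> y - \<phi> x - \<phi>' x * (y - x)\<bar> \<le> C * (1 + x\<^sup>2) * min ((y - x)\<^sup>2) \<bar>y - x\<bar>"
  using assms by (auto simp: stein_regular_def)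

lemma stein_equation_solution:
  obtains C :: real where "0 \<le> C"
    and "\<And>h. 1-lipschitz_on UNIV h \<Longrightarrow> \<exists>\<phi> \<phi>'. stein_regular C \<phi> \<phi>' \<and>
      (\<forall>x. \<phi>' x - x * \<phi> x = h x - (\<integral>y. h y * std_normal_density y \<partial>lborel))"
proof -
  define K where "K = 2 * sqrt (2 * pi) * exp (1/2)"
  have K: "0 \<le> K" by (simp add: K_def)
  \<comment> \<open>large enough for all three estimates; the largest demand comes from the Taylor estimate at distance more than one\<close>
  define C where "C = 5 * K + 5"
  have "\<exists>\<phi> \<phi>'. stein_regular C \<phi> \<phi>' \<and> (\<forall>x. \<phi>' x - x * \<phi> x = h x - (\<integral>y. h y * std_normal_density y \<partial>lborel))"
    if h: "1-lipschitz_on UNIV h" for h :: "real \<Rightarrow> real"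
  proof -
    define m where "m = (\<integral>y. h y * std_normal_density y \<partial>lborel)"
    obtain \<phi> where der: "\<And>x. (\<phi> has_real_derivative (x * \<phi> x + (h x - m))) (at x)" and bd: "\<And>x. \<bar>\<phi> x\<bar> \<le> K"
      using stein_equation_bounded_solution[OF h, folded m_def K_def] by blast
    define \<phi>' where "\<phi>' x = x * \<phi> x + (h x - m)" for x
    have der': "(\<phi> has_real_derivative \<phi>' x) (at x)" for x using der by (simp add: \<phi>'_def)
    have c1: "continuous_on UNIV \<phi>" using der by (meson DERIV_isCont continuous_at_imp_continuous_on)
    have c2: "continuous_on UNIV \<phi>'"
      unfolding \<phi>'_def[abs_def] by (intro continuous_intros c1 lipschitz_on_continuous_on[OF h])
    have growth: "\<bar>\<phi>' x\<bar> \<le> (K + 1) * (1 + \<bar>x\<bar>)" for x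
    proof -
      have "\<bar>\<phi>' x\<bar> \<le> \<bar>x\<bar> * \<bar>\<phi> x\<bar> + \<bar>h x - m\<bar>" unfolding \<phi>'_def abs_mult[symmetric] by (rule abs_triangle_ineq)
      also have "\<dots> \<le> \<bar>x\<bar> * K + (\<bar>x\<bar> + 1)"
        by (intro add_mono mult_left_mono bd lipschitz_mean_bound(2)[OF h, folded m_def]) auto
      finally show ?thesis using K by (simp add: algebra_simps)
    qed
    have lip0: "\<bar>\<phi> y - \<phi> x\<bar> \<le> (2 * K + 2) * (2 + \<bar>x\<bar>) * \<bar>y - x\<bar>" for x y
    proof (cases "\<bar>y - x\<bar> \<le> 1")
      case True
      have "norm (\<phi> y - \<phi> x) \<le> ((2 * K + 2) * (2 + \<bar>x\<bar>)) * norm (y - x)"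
      proof (rule field_differentiable_bound[of "{x - 1..x + 1}"])
        fix z assume z: "z \<in> {x - 1..x + 1}"
        show "(\<phi> has_real_derivative \<phi>' z) (at z within {x - 1..x + 1})"
          using der' by (rule DERIV_subset) simp
        have "\<bar>\<phi>' z\<bar> \<le> (K + 1) * (1 + \<bar>z\<bar>)" by (rule growth)
        also have "\<dots> \<le> (2 * K + 2) * (2 + \<bar>x\<bar>)" using z K by (intro mult_mono) auto
        finally show "norm (\<phi>' z) \<le> (2 * K + 2) * (2 + \<bar>x\<bar>)" by simp
      qed (use True in auto)
      then show ?thesis by simp
    next
      case False
      have "\<bar>\<phi> y - \<phi> x\<bar> \<le> 2 * K" using bd[of x] bd[of y] by linarith
      also have "\<dots> \<le> ((2 * K + 2) * (2 + \<bar>x\<bar>)) * 1" using K by (simp add: algebra_simps)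
      also have "\<dots> \<le> (2 * K + 2) * (2 + \<bar>x\<bar>) * \<bar>y - x\<bar>" using False K by (intro mult_left_mono) auto
      finally show ?thesis .
    qed
    have lip: "\<bar>\<phi>' y - \<phi>' x\<bar> \<le> C * (1 + x\<^sup>2) * \<bar>y - x\<bar>" for x y
    proof -
      have "\<phi>' y - \<phi>' x = x * (\<phi> y - \<phi> x) + (y - x) * \<phi> y + (h y - h x)"
        by (simp add: \<phi>'_def algebra_simps)
      then have "\<bar>\<phi>' y - \<phi>' x\<bar> \<le> \<bar>x\<bar> * \<bar>\<phi> y - \<phi> x\<bar> + \<bar>y - x\<bar> * \<bar>\<phi> y\<bar> + \<bar>h y - h x\<bar>"
        unfolding abs_mult[symmetric] by linarith
      also have "\<dots> \<le> \<bar>x\<bar> * ((2 * K + 2) * (2 + \<bar>x\<bar>) * \<bar>y - x\<bar>) + \<bar>y - x\<bar> * K + \<bar>y - x\<bar>"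
        using lipschitz_onD[OF h, of y x] by (intro add_mono mult_left_mono lip0 bd) (auto simp: dist_real_def)
      also have "\<dots> = ((2 * K + 2) * (\<bar>x\<bar> * (2 + \<bar>x\<bar>)) + K + 1) * \<bar>y - x\<bar>" by (simp add: algebra_simps)
      also have "\<dots> \<le> (C * (1 + x\<^sup>2)) * \<bar>y - x\<bar>"
      proof (rule mult_right_mono)
        have "0 \<le> (1 - \<bar>x\<bar>)\<^sup>2" by simp
        then have "2 * \<bar>x\<bar> \<le> 1 + x\<^sup>2" by (simp add: power2_diff)
        moreover have "\<bar>x\<bar> * (2 + \<bar>x\<bar>) = 2 * \<bar>x\<bar> + x\<^sup>2" by (simp add: power2_eq_square distrib_left)
        ultimately have "\<bar>x\<bar> * (2 + \<bar>x\<bar>) \<le> 2 * (1 + x\<^sup>2)" by argo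
        then have "(2 * K + 2) * (\<bar>x\<bar> * (2 + \<bar>x\<bar>)) \<le> (2 * K + 2) * (2 * (1 + x\<^sup>2))" using K by (intro mult_left_mono) auto
        moreover have "K + 1 \<le> (K + 1) * (1 + x\<^sup>2)" using K by (simp add: algebra_simps)
        ultimately show "(2 * K + 2) * (\<bar>x\<bar> * (2 + \<bar>x\<bar>)) + K + 1 \<le> C * (1 + x\<^sup>2)"
          by (simp add: C_def algebra_simps)
      qed simp
      finally show ?thesis .
    qed
    have taylor: "\<bar>\<phi> y - \<phi> x - \<phi>' x * (y - x)\<bar> \<le> C * (1 + x\<^sup>2) * min ((y - x)\<^sup>2) \<bar>y - x\<bar>" for x y
    proof (cases "\<bar>y - x\<bar> \<le> 1")
      case True
      have "norm ((\<phi> y - \<phi>' x * y) - (\<phi> x - \<phi>' x * x)) \<le> (C * (1 + x\<^sup>2) * \<bar>y - x\<bar>) * norm (y - x)"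
      proof (rule field_differentiable_bound[of "closed_segment x y"])
        fix z assume z: "z \<in> closed_segment x y"
        show "((\<lambda>z. \<phi> z - \<phi>' x * z) has_real_derivative (\<phi>' z - \<phi>' x)) (at z within closed_segment x y)"
          by (auto intro!: derivative_eq_intros DERIV_subset[OF der'])
        have "\<bar>\<phi>' z - \<phi>' x\<bar> \<le> C * (1 + x\<^sup>2) * \<bar>z - x\<bar>" by (rule lip)
        also have "\<dots> \<le> C * (1 + x\<^sup>2) * \<bar>y - x\<bar>"
          using K z by (intro mult_left_mono) (auto simp: C_def closed_segment_eq_real_ivl split: if_splits)
        finally show "norm (\<phi>' z - \<phi>' x) \<le> C * (1 + x\<^sup>2) * \<bar>y - x\<bar>" by simp
      qed auto
      moreover have "(y - x)\<^sup>2 \<le> \<bar>y - x\<bar>"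
        using True mult_left_le[of "\<bar>y - x\<bar>" "\<bar>y - x\<bar>"] by (simp add: power2_eq_square)
      moreover have "\<bar>y - x\<bar> * \<bar>y - x\<bar> = (y - x)\<^sup>2" by (simp add: power2_eq_square)
      moreover have "(\<phi> y - \<phi>' x * y) - (\<phi> x - \<phi>' x * x) = \<phi> y - \<phi> x - \<phi>' x * (y - x)" by (simp add: right_diff_distrib)
      ultimately show ?thesis by (simp add: min_absorb1 mult.assoc)
    next
      case False
      have "\<bar>\<phi> y - \<phi> x - \<phi>' x * (y - x)\<bar> \<le> \<bar>\<phi> y\<bar> + \<bar>\<phi> x\<bar> + \<bar>\<phi>' x\<bar> * \<bar>y - x\<bar>" unfolding abs_mult[symmetric] by linarith
      also have "\<dots> \<le> K + K + (K + 1) * (1 + \<bar>x\<bar>) * \<bar>y - x\<bar>" by (intro add_mono bd mult_right_mono growth) auto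
      also have "\<dots> \<le> (2 * K) * \<bar>y - x\<bar> + (K + 1) * (1 + \<bar>x\<bar>) * \<bar>y - x\<bar>"
        using False K mult_left_mono[of 1 "\<bar>y - x\<bar>" "2 * K"] by simp
      also have "\<dots> = (2 * K + (K + 1) * (1 + \<bar>x\<bar>)) * \<bar>y - x\<bar>" by (simp add: algebra_simps)
      also have "\<dots> \<le> (C * (1 + x\<^sup>2)) * \<bar>y - x\<bar>"
      proof (rule mult_right_mono)
        have "1 + \<bar>x\<bar> \<le> 2 * (1 + x\<^sup>2)" by (rule one_plus_abs_le)
        then have "(K + 1) * (1 + \<bar>x\<bar>) \<le> (K + 1) * (2 * (1 + x\<^sup>2))" using K by (intro mult_left_mono) auto
        moreover have "2 * K * 1 \<le> 2 * (K + 1) * (1 + x\<^sup>2)" using K by (intro mult_mono) auto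
        moreover have "0 \<le> (K + 1) * (1 + x\<^sup>2)" using K by (intro mult_nonneg_nonneg) auto
        moreover have "C * (1 + x\<^sup>2) = 5 * ((K + 1) * (1 + x\<^sup>2))" by (simp add: C_def algebra_simps)
        ultimately show "2 * K + (K + 1) * (1 + \<bar>x\<bar>) \<le> C * (1 + x\<^sup>2)" by linarith
      qed simp
      also have "\<bar>y - x\<bar> = min ((y - x)\<^sup>2) \<bar>y - x\<bar>"
      proof -
        have "1 * \<bar>y - x\<bar> \<le> \<bar>y - x\<bar> * \<bar>y - x\<bar>" using False by (intro mult_right_mono) auto
        then show ?thesis by (simp add: min_absorb2 power2_eq_square)
      qed
      finally show ?thesis .
    qed
    have "\<bar>\<phi>' x\<bar> \<le> C * (1 + \<bar>x\<bar>)" for x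
      by (rule order_trans[OF growth]) (use K in \<open>auto simp: C_def intro!: mult_right_mono\<close>)
    then show ?thesis
      using c1 c2 lip taylor
      by (intro exI[of _ \<phi>] exI[of _ \<phi>']) (simp add: \<phi>'_def m_def[symmetric] stein_regular_def)
  qed
  then show thesis using that[of C] K by (auto simp: C_def)
qed

section \<open>Functions of independent coordinates\<close>

locale independent_coordinates = finite_product_prob_space M "{..<N}"
  for M :: "nat \<Rightarrow> 'c measure" and N :: nat
begin

abbreviation \<P> :: "(nat \<Rightarrow> 'c) measure" where "\<P> \<equiv> PiM {..<N} M"

definition bounded_rv :: "((nat \<Rightarrow> 'c) \<Rightarrow> real) \<Rightarrow> bool" where
  "bounded_rv F \<longleftrightarrow> F \<in> borel_measurable \<P> \<and> (\<exists>B. \<forall>w\<in>space \<P>. \<bar>F w\<bar> \<le> B)"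

text \<open>Averaging over coordinate \<open>k\<close> is the conditional expectation given all other
coordinates; as a function on the product it still takes all coordinates as arguments.\<close>

definition avg :: "nat \<Rightarrow> ((nat \<Rightarrow> 'c) \<Rightarrow> real) \<Rightarrow> (nat \<Rightarrow> 'c) \<Rightarrow> real" where
  "avg k F w = (\<integral>y. F (w(k := y)) \<partial>M k)"

primrec cond_avg :: "nat \<Rightarrow> ((nat \<Rightarrow> 'c) \<Rightarrow> real) \<Rightarrow> (nat \<Rightarrow> 'c) \<Rightarrow> real" where
  "cond_avg 0 F = F"
| "cond_avg (Suc k) F = avg k (cond_avg k F)"

definition mart_diff :: "nat \<Rightarrow> ((nat \<Rightarrow> 'c) \<Rightarrow> real) \<Rightarrow> (nat \<Rightarrow> 'c) \<Rightarrow> real" where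
  "mart_diff k F w = cond_avg k F w - cond_avg (Suc k) F w"

lemma upd_space: "w \<in> space \<P> \<Longrightarrow> k < N \<Longrightarrow> y \<in> space (M k) \<Longrightarrow> w(k := y) \<in> space \<P>"
  by (auto simp: space_PiM PiE_iff extensional_def)

lemma coord_space: "w \<in> space \<P> \<Longrightarrow> k < N \<Longrightarrow> w k \<in> space (M k)"
  by (auto simp: space_PiM PiE_iff)

lemma measurable_upd:
  assumes "k < N"
  shows "(\<lambda>(w, y). w(k := y)) \<in> \<P> \<Otimes>\<^sub>M M k \<rightarrow>\<^sub>M \<P>"
proof -
  have "insert k {..<N} = {..<N}" using assms by auto
  then show ?thesis using measurable_add_dim[of k "{..<N}" M] by simp
qed

lemma measurable_upd1:
  assumes "k < N" "w \<in> space \<P>"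
  shows "(\<lambda>y. w(k := y)) \<in> M k \<rightarrow>\<^sub>M \<P>"
  using measurable_compose[OF measurable_Pair1'[OF assms(2)] measurable_upd[OF assms(1)]] by simp

lemma bounded_rv_measurable: "bounded_rv F \<Longrightarrow> F \<in> borel_measurable \<P>"
  by (simp add: bounded_rv_def)

lemma bounded_rv_integrable: "bounded_rv F \<Longrightarrow> integrable \<P> F"
  unfolding bounded_rv_def by (auto intro!: P.integrable_const_bound AE_I2)

lemma bounded_rv_section:
  assumes "bounded_rv F" "k < N" "w \<in> space \<P>"
  shows "integrable (M k) (\<lambda>y. F (w(k := y)))"
proof -
  obtain B where B: "\<And>w. w\<in>space \<P> \<Longrightarrow> \<bar>F w\<bar> \<le> B"
    using assms(1) by (auto simp: bounded_rv_def)
  show ?thesis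
    using measurable_compose[OF measurable_upd1[OF assms(2,3)] bounded_rv_measurable[OF assms(1)]]
    by (intro M.integrable_const_bound[of _ B] AE_I2) (auto intro!: B upd_space assms(2,3))
qed

lemma bounded_rv_const [intro, simp]: "bounded_rv (\<lambda>_. c)"
  by (auto simp: bounded_rv_def)

lemma bounded_rv_add:
  assumes "bounded_rv F" "bounded_rv G" shows "bounded_rv (\<lambda>w. F w + G w)"
proof -
  obtain B C where B: "\<And>w. w\<in>space \<P> \<Longrightarrow> \<bar>F w\<bar> \<le> B" and C: "\<And>w. w\<in>space \<P> \<Longrightarrow> \<bar>G w\<bar> \<le> C"
    using assms by (auto simp: bounded_rv_def)
  have "\<forall>w\<in>space \<P>. \<bar>F w + G w\<bar> \<le> B + C" using B C by (metis abs_triangle_ineq add_mono order_trans)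
  then show ?thesis using assms by (auto simp: bounded_rv_def)
qed

lemma bounded_rv_mult:
  assumes "bounded_rv F" "bounded_rv G" shows "bounded_rv (\<lambda>w. F w * G w)"
proof -
  obtain B C where B: "\<And>w. w\<in>space \<P> \<Longrightarrow> \<bar>F w\<bar> \<le> B" and C: "\<And>w. w\<in>space \<P> \<Longrightarrow> \<bar>G w\<bar> \<le> C"
    using assms by (auto simp: bounded_rv_def)
  have "\<forall>w\<in>space \<P>. \<bar>F w * G w\<bar> \<le> \<bar>B\<bar> * \<bar>C\<bar>"
    unfolding abs_mult by (intro ballI mult_mono) (auto intro: order_trans[OF B] order_trans[OF C])
  then show ?thesis using assms by (auto simp: bounded_rv_def)
qed

lemma bounded_rv_diff:
  assumes "bounded_rv F" "bounded_rv G" shows "bounded_rv (\<lambda>w. F w - G w)"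
  using bounded_rv_add[OF assms(1) bounded_rv_mult[OF bounded_rv_const[of "-1"] assms(2)]] by simp

lemma bounded_rv_sum: "(\<And>i. i \<in> I \<Longrightarrow> bounded_rv (F i)) \<Longrightarrow> bounded_rv (\<lambda>w. \<Sum>i\<in>I. F i w)"
  by (induction I rule: infinite_finite_induct) (auto intro!: bounded_rv_add)

lemma bounded_rv_compose:
  fixes \<phi> :: "real \<Rightarrow> real"
  assumes F: "bounded_rv F" and \<phi>: "continuous_on UNIV \<phi>"
  shows "bounded_rv (\<lambda>w. \<phi> (F w))"
proof -
  obtain B where B: "\<And>w. w\<in>space \<P> \<Longrightarrow> \<bar>F w\<bar> \<le> B" using F by (auto simp: bounded_rv_def)
  have "compact (\<phi> ` {-B..B})" by (intro compact_continuous_image continuous_on_subset[OF \<phi>]) auto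
  then obtain C where C: "\<And>x. x \<in> {-B..B} \<Longrightarrow> \<bar>\<phi> x\<bar> \<le> C"
    by (metis bounded_iff compact_imp_bounded image_eqI real_norm_def)
  have "\<forall>w\<in>space \<P>. \<bar>\<phi> (F w)\<bar> \<le> C" using B C by (metis abs_le_iff atLeastAtMost_iff minus_le_iff)
  moreover have "\<phi> \<in> borel_measurable borel" using \<phi> by (rule borel_measurable_continuous_onI)
  ultimately show ?thesis using F by (auto simp: bounded_rv_def)
qed

lemma bounded_rv_abs: "bounded_rv F \<Longrightarrow> bounded_rv (\<lambda>w. \<bar>F w\<bar>)"
  by (rule bounded_rv_compose) (auto intro!: continuous_intros)

lemma bounded_rv_power: "bounded_rv F \<Longrightarrow> bounded_rv (\<lambda>w. F w ^ n)"
  by (rule bounded_rv_compose[of F "\<lambda>x. x ^ n"]) (auto intro!: continuous_intros)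

lemma bounded_rv_coord:
  assumes "k < N" "b \<in> borel_measurable (M k)" "\<And>x. x \<in> space (M k) \<Longrightarrow> \<bar>b x\<bar> \<le> B"
  shows "bounded_rv (\<lambda>w. b (w k))"
proof -
  have "(\<lambda>w. b (w k)) \<in> borel_measurable \<P>"
    by (rule measurable_compose[OF measurable_component_singleton]) (use assms in auto)
  then show ?thesis using assms coord_space by (auto simp: bounded_rv_def intro!: exI[of _ B])
qed

lemma bounded_rv_avg:
  assumes F: "bounded_rv F" and k: "k < N"
  shows "bounded_rv (avg k F)"
proof -
  obtain B where B: "\<And>w. w\<in>space \<P> \<Longrightarrow> \<bar>F w\<bar> \<le> B" using F by (auto simp: bounded_rv_def)
  have m: "case_prod (\<lambda>w y. F (w(k := y))) \<in> borel_measurable (\<P> \<Otimes>\<^sub>M M k)"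
    using measurable_compose[OF measurable_upd[OF k] bounded_rv_measurable[OF F]]
    by (simp add: case_prod_beta')
  have "avg k F \<in> borel_measurable \<P>"
    unfolding avg_def[abs_def] by (rule M.borel_measurable_lebesgue_integral[OF m])
  moreover have "\<bar>avg k F w\<bar> \<le> B" if "w \<in> space \<P>" for w
  proof -
    have "\<bar>avg k F w\<bar> \<le> (\<integral>y. \<bar>F (w(k := y))\<bar> \<partial>M k)" unfolding avg_def by (rule integral_abs_bound)
    also have "\<dots> \<le> (\<integral>y. B \<partial>M k)"
      using bounded_rv_section[OF F k that] by (intro integral_mono) (auto intro!: B upd_space k that)
    finally show ?thesis by (simp add: M.prob_space del: fun_upd_apply)
  qed
  ultimately show ?thesis by (auto simp: bounded_rv_def)
qed

lemma integral_avg: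
  assumes F: "bounded_rv F" and k: "k < N"
  shows "(\<integral>w. avg k F w \<partial>\<P>) = (\<integral>w. F w \<partial>\<P>)"
proof -
  let ?J = "{..<N} - {k}"
  have J: "insert k ?J = {..<N}" "finite ?J" "k \<notin> ?J" using k by auto
  have 1: "(\<integral>w. G w \<partial>\<P>) = (\<integral>x. \<integral>y. G (x(k := y)) \<partial>M k \<partial>PiM ?J M)" if "bounded_rv G" for G
    using product_integral_insert[OF J(2,3), of G] bounded_rv_integrable[OF that] J(1) by simp
  have "(\<integral>w. avg k F w \<partial>\<P>) = (\<integral>x. \<integral>y. avg k F (x(k := y)) \<partial>M k \<partial>PiM ?J M)"
    by (rule 1[OF bounded_rv_avg[OF F k]])
  also have "\<dots> = (\<integral>x. \<integral>z. F (x(k := z)) \<partial>M k \<partial>PiM ?J M)"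
    by (simp add: avg_def M.prob_space)
  finally show ?thesis using 1[OF F] by simp
qed

lemma bounded_rv_cond_avg: "bounded_rv F \<Longrightarrow> k \<le> N \<Longrightarrow> bounded_rv (cond_avg k F)"
  by (induction k) (auto intro: bounded_rv_avg)

lemma integral_cond_avg:
  "bounded_rv F \<Longrightarrow> k \<le> N \<Longrightarrow> (\<integral>w. cond_avg k F w \<partial>\<P>) = (\<integral>w. F w \<partial>\<P>)"
  by (induction k) (auto simp: integral_avg bounded_rv_cond_avg)

lemma avg_upd_same: "avg k F (w(k := y)) = avg k F w"
  by (simp add: avg_def)

lemma cond_avg_upd: "j < k \<Longrightarrow> cond_avg k F (w(j := y)) = cond_avg k F w"
proof (induction k arbitrary: w)
  case (Suc k)
  show ?case
  proof (cases "j = k")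
    case True
    then show ?thesis by (simp add: avg_upd_same del: fun_upd_apply)
  next
    case False
    then have "cond_avg k F (w(j := y, k := z)) = cond_avg k F (w(k := z))" for z
      using Suc by (subst fun_upd_twist) (auto simp del: fun_upd_apply)
    then show ?thesis by (simp add: avg_def del: fun_upd_apply)
  qed
qed simp

text \<open>After all coordinates have been averaged out, changing the coordinates of one point into those of
another, one at a time, does not change the value.\<close>

lemma cond_avg_all:
  assumes F: "bounded_rv F" and w: "w \<in> space \<P>"
  shows "cond_avg N F w = (\<integral>w. F w \<partial>\<P>)"
proof -
  have eq: "cond_avg N F w' = cond_avg N F w" if w': "w' \<in> space \<P>" for w'
  proof -
    define h where "h i = (\<lambda>j. if j < i then w' j else w j)" for i
    have upd: "h (Suc i) = (h i)(i := w' i)" for i by (auto simp: h_def fun_eq_iff less_Suc_eq)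
    have "i \<le> N \<Longrightarrow> cond_avg N F (h i) = cond_avg N F (h 0)" for i
      by (induction i) (auto simp: upd cond_avg_upd)
    from this[of N] have "cond_avg N F (h N) = cond_avg N F (h 0)" by simp
    moreover have "h N = w'" using w w' by (auto simp: h_def fun_eq_iff space_PiM PiE_iff extensional_def)
    moreover have "h 0 = w" by (simp add: h_def)
    ultimately show ?thesis by simp
  qed
  have "(\<integral>w'. cond_avg N F w' \<partial>\<P>) = (\<integral>w'. cond_avg N F w \<partial>\<P>)"
    by (intro Bochner_Integration.integral_cong refl eq)
  then show ?thesis using integral_cond_avg[OF F order_refl] by (simp add: P.prob_space)
qed

lemma sum_mart_diff: "(\<Sum>k<n. mart_diff k F w) = F w - cond_avg n F w"
  unfolding mart_diff_def by (induction n) auto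

lemma bounded_rv_mart_diff: "bounded_rv F \<Longrightarrow> k < N \<Longrightarrow> bounded_rv (mart_diff k F)"
  unfolding mart_diff_def[abs_def]
  by (intro bounded_rv_diff bounded_rv_cond_avg) auto

lemma mart_diff_eq:
  assumes "bounded_rv F" "k < N" "w \<in> space \<P>"
  shows "mart_diff k F w = (\<integral>y. (cond_avg k F w - cond_avg k F (w(k := y))) \<partial>M k)"
  using bounded_rv_section[OF bounded_rv_cond_avg[OF assms(1)] assms(2,3)] assms(2)
  by (simp add: mart_diff_def avg_def M.prob_space)

lemma integral_pull_out:
  assumes F: "bounded_rv F" and G: "bounded_rv G" and k: "k < N"
    and ind: "\<And>w y. G (w(k := y)) = G w"
  shows "(\<integral>w. G w * F w \<partial>\<P>) = (\<integral>w. G w * avg k F w \<partial>\<P>)"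
proof -
  have "(\<integral>w. G w * F w \<partial>\<P>) = (\<integral>w. avg k (\<lambda>w. G w * F w) w \<partial>\<P>)"
    by (rule integral_avg[OF bounded_rv_mult[OF G F] k, symmetric])
  then show ?thesis by (simp add: avg_def ind)
qed

lemma avg_mart_diff:
  assumes "bounded_rv F" "k < N" "w \<in> space \<P>"
  shows "avg k (mart_diff k F) w = 0"
proof -
  have i: "integrable (M k) (\<lambda>y. cond_avg k F (w(k := y)))"
    by (intro bounded_rv_section bounded_rv_cond_avg assms) (use assms in auto)
  show ?thesis
    unfolding avg_def mart_diff_def using i
    by (simp add: cond_avg_upd avg_upd_same M.prob_space avg_def)
qed

lemma integral_mart_diff_orthogonal:
  assumes F: "bounded_rv F" and G: "bounded_rv G" and k: "k < N"
    and ind: "\<And>w y. G (w(k := y)) = G w"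
  shows "(\<integral>w. G w * mart_diff k F w \<partial>\<P>) = 0"
proof -
  have "(\<integral>w. G w * mart_diff k F w \<partial>\<P>) = (\<integral>w. G w * avg k (mart_diff k F) w \<partial>\<P>)"
    by (rule integral_pull_out[OF bounded_rv_mart_diff[OF F k] G k ind])
  also have "\<dots> = (\<integral>w. 0 \<partial>\<P>)"
    by (intro Bochner_Integration.integral_cong refl) (simp add: avg_mart_diff[OF F k])
  finally show ?thesis by simp
qed

lemma integral_coord:
  fixes b :: "'c \<Rightarrow> real"
  assumes "k < N" "b \<in> borel_measurable (M k)" "\<And>x. x \<in> space (M k) \<Longrightarrow> \<bar>b x\<bar> \<le> B"
  shows "(\<integral>w. b (w k) \<partial>\<P>) = (\<integral>x. b x \<partial>M k)"
  using integral_avg[OF bounded_rv_coord[of k b B] assms(1)] assms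
  by (simp add: avg_def P.prob_space)

text \<open>The bound does not involve the coordinate that is averaged out, unless that is \<open>j\<close> itself, where both averages coincide.\<close>

lemma cond_avg_increment_bound:
  assumes F: "bounded_rv F" and j: "j < N" and b: "\<And>x y. x \<in> space (M j) \<Longrightarrow> y \<in> space (M j) \<Longrightarrow> 0 \<le> b x y"
    and inc: "\<And>w y. w \<in> space \<P> \<Longrightarrow> y \<in> space (M j) \<Longrightarrow> \<bar>F w - F (w(j := y))\<bar> \<le> b (w j) y"
    and k: "k \<le> N" and w: "w \<in> space \<P>" and y: "y \<in> space (M j)"
  shows "\<bar>cond_avg k F w - cond_avg k F (w(j := y))\<bar> \<le> b (w j) y"
  using k w
proof (induction k arbitrary: w)
  case 0
  then show ?case using inc y by (simp del: fun_upd_apply)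
next
  case (Suc k)
  then have k: "k < N" by simp
  show ?case
  proof (cases "j = k")
    case True
    then show ?thesis using avg_upd_same b coord_space[OF Suc(3) j] y by (simp del: fun_upd_apply)
  next
    case False
    have wj: "w(j := y) \<in> space \<P>" using upd_space Suc(3) j y by simp
    note bF = bounded_rv_cond_avg[OF F less_imp_le[OF k]]
    note i1 = bounded_rv_section[OF bF k Suc(3)] and i2 = bounded_rv_section[OF bF k wj]
    have "\<bar>avg k (cond_avg k F) w - avg k (cond_avg k F) (w(j := y))\<bar>
        = \<bar>\<integral>z. cond_avg k F (w(k := z)) - cond_avg k F (w(j := y, k := z)) \<partial>M k\<bar>"
      unfolding avg_def using i1 i2 by simp
    also have "\<dots> \<le> (\<integral>z. \<bar>cond_avg k F (w(k := z)) - cond_avg k F (w(j := y, k := z))\<bar> \<partial>M k)"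
      by (rule integral_abs_bound)
    also have "\<dots> \<le> (\<integral>z. b (w j) y \<partial>M k)"
    proof (intro integral_mono)
      fix z assume z: "z \<in> space (M k)"
      show "\<bar>cond_avg k F (w(k := z)) - cond_avg k F (w(j := y, k := z))\<bar> \<le> b (w j) y"
        using Suc.IH[OF less_imp_le[OF k] upd_space[OF Suc(3) k z]]
        unfolding fun_upd_other[OF False] fun_upd_twist[OF False, of w y z] .
    qed (use i1 i2 in auto)
    finally show ?thesis by (simp add: M.prob_space del: fun_upd_apply)
  qed
qed

text \<open>As for first increments, except that the bound depends on the point only through the two
coordinates in question, which are therefore held fixed.\<close>

lemma cond_avg_second_increment_bound:
  assumes F: "bounded_rv F" and i: "i < N" and j: "j < N" and ij: "i \<noteq> j" and B: "0 \<le> B"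
    and inc: "\<And>w. w \<in> space \<P> \<Longrightarrow> w i = x \<Longrightarrow> w j = x' \<Longrightarrow>
        \<bar>F w - F (w(i := y)) - F (w(j := z)) + F (w(i := y, j := z))\<bar> \<le> B"
    and y: "y \<in> space (M i)" and z: "z \<in> space (M j)"
    and k: "k \<le> N" and w: "w \<in> space \<P>" and wx: "w i = x" "w j = x'"
  shows "\<bar>cond_avg k F w - cond_avg k F (w(i := y)) - cond_avg k F (w(j := z))
           + cond_avg k F (w(i := y, j := z))\<bar> \<le> B"
  using k w wx
proof (induction k arbitrary: w)
  case 0
  then show ?case using inc by (simp del: fun_upd_apply)
next
  case (Suc k)
  then have k: "k < N" by simp
  consider "i = k" | "j = k" | "i \<noteq> k" "j \<noteq> k" by blast
  then show ?case
  proof cases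
    case 1
    then show ?thesis using avg_upd_same[of k] ij B by (simp add: fun_upd_twist[of k j] del: fun_upd_apply)
  next
    case 2
    then show ?thesis using avg_upd_same[of k] ij B by (simp del: fun_upd_apply)
  next
    case 3
    note bF = bounded_rv_cond_avg[OF F less_imp_le[OF k]]
    have wi: "w(i := y) \<in> space \<P>" "w(j := z) \<in> space \<P>" "w(i := y, j := z) \<in> space \<P>"
      using upd_space Suc(3) i j y z by simp_all
    let ?G = "cond_avg k F"
    note ii = bounded_rv_section[OF bF k Suc(3)] wi[THEN bounded_rv_section[OF bF k]]
    let ?D = "\<lambda>u. ?G (w(k := u)) - ?G (w(i := y, k := u)) - ?G (w(j := z, k := u)) + ?G (w(i := y, j := z, k := u))"
    have "\<bar>avg k ?G w - avg k ?G (w(i := y)) - avg k ?G (w(j := z)) + avg k ?G (w(i := y, j := z))\<bar>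
        = \<bar>\<integral>u. ?D u \<partial>M k\<bar>"
      unfolding avg_def using ii by simp
    also have "\<dots> \<le> (\<integral>u. \<bar>?D u\<bar> \<partial>M k)"
      by (rule integral_abs_bound)
    also have "\<dots> \<le> (\<integral>u. B \<partial>M k)"
    proof (intro integral_mono)
      fix u assume u: "u \<in> space (M k)"
      have "w(i := y, k := u) = w(k := u, i := y)" "w(j := z, k := u) = w(k := u, j := z)"
        "w(i := y, j := z, k := u) = w(k := u, i := y, j := z)"
        using 3 ij by (auto simp: fun_eq_iff)
      moreover have "(w(k := u)) i = x" "(w(k := u)) j = x'" using 3 Suc.prems by auto
      ultimately show "\<bar>?D u\<bar> \<le> B"
        using Suc.IH[OF less_imp_le[OF k] upd_space[OF Suc(3) k u]] by (simp only:)
    qed (use ii in auto)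
    finally show ?thesis by (simp add: M.prob_space del: fun_upd_apply)
  qed
qed

text \<open>The Efron--Stein inequality. Averaging out coordinate \<open>k\<close> reduces the second moment by that of a
martingale difference, which is an average of increments in coordinate \<open>k\<close>. The mean \<open>B j\<close> of the increment bound over the
new value of the coordinate is passed separately to allow an estimate in closed form.\<close>

lemma variance_le_sum_increments:
  assumes F: "bounded_rv F"
    and b: "\<And>j x y. j < N \<Longrightarrow> x \<in> space (M j) \<Longrightarrow> y \<in> space (M j) \<Longrightarrow> 0 \<le> b j x y"
    and int_b: "\<And>j x. j < N \<Longrightarrow> x \<in> space (M j) \<Longrightarrow> integrable (M j) (b j x)"
    and B: "\<And>j. j < N \<Longrightarrow> B j \<in> borel_measurable (M j)"
    and B_le: "\<And>j x. j < N \<Longrightarrow> x \<in> space (M j) \<Longrightarrow> \<bar>B j x\<bar> \<le> C j"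
    and bB: "\<And>j x. j < N \<Longrightarrow> x \<in> space (M j) \<Longrightarrow> (\<integral>y. b j x y \<partial>M j) \<le> B j x"
    and inc: "\<And>j w y. j < N \<Longrightarrow> w \<in> space \<P> \<Longrightarrow> y \<in> space (M j) \<Longrightarrow> \<bar>F w - F (w(j := y))\<bar> \<le> b j (w j) y"
  shows "(\<integral>w. (F w - (\<integral>w. F w \<partial>\<P>))\<^sup>2 \<partial>\<P>) \<le> (\<Sum>j<N. \<integral>x. (B j x)\<^sup>2 \<partial>M j)"
proof -
  let ?E = "\<lambda>F. \<integral>w. F w \<partial>\<P>"
  define m where "m = ?E F"
  have step: "?E (\<lambda>w. (cond_avg k F w)\<^sup>2) - ?E (\<lambda>w. (cond_avg (Suc k) F w)\<^sup>2) \<le> (\<integral>x. (B k x)\<^sup>2 \<partial>M k)"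
    if k: "k < N" for k
  proof -
    let ?G = "cond_avg k F" and ?A = "cond_avg (Suc k) F"
    have bG: "bounded_rv ?G" and bA: "bounded_rv ?A"
      using k by (auto intro!: bounded_rv_cond_avg bounded_rv_avg F)
    have ii: "integrable \<P> (\<lambda>w. (?G w)\<^sup>2)" "integrable \<P> (\<lambda>w. (?A w)\<^sup>2)" "integrable \<P> (\<lambda>w. ?A w * ?G w)"
      by (intro bounded_rv_integrable bounded_rv_power bounded_rv_mult bG bA)+
    have "?E (\<lambda>w. ?A w * ?G w) = ?E (\<lambda>w. ?A w * ?A w)"
      using integral_pull_out[OF bG bA k] by (simp add: avg_upd_same)
    then have "?E (\<lambda>w. (?G w)\<^sup>2) - ?E (\<lambda>w. (?A w)\<^sup>2) = ?E (\<lambda>w. (?G w)\<^sup>2) - 2 * ?E (\<lambda>w. ?A w * ?G w) + ?E (\<lambda>w. (?A w)\<^sup>2)"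
      by (simp add: power2_eq_square)
    also have "\<dots> = ?E (\<lambda>w. (mart_diff k F w)\<^sup>2)"
      using ii by (simp add: mart_diff_def power2_diff mult_ac)
    also have "\<dots> \<le> ?E (\<lambda>w. (B k (w k))\<^sup>2)"
    proof (intro integral_mono)
      show "integrable \<P> (\<lambda>w. (mart_diff k F w)\<^sup>2)" "integrable \<P> (\<lambda>w. (B k (w k))\<^sup>2)"
        by (intro bounded_rv_integrable bounded_rv_power bounded_rv_mart_diff F k
              bounded_rv_coord[OF k B[OF k] B_le[OF k]] | assumption)+
      fix w assume w: "w \<in> space \<P>"
      have wk: "w k \<in> space (M k)" by (rule coord_space[OF w k])
      note i = bounded_rv_section[OF bG k w]
      have "\<bar>mart_diff k F w\<bar> \<le> (\<integral>y. \<bar>?G w - ?G (w(k := y))\<bar> \<partial>M k)"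
        unfolding mart_diff_eq[OF F k w] by (rule integral_abs_bound)
      also have "\<dots> \<le> (\<integral>y. b k (w k) y \<partial>M k)"
        by (intro integral_mono int_b[OF k wk] integrable_abs Bochner_Integration.integrable_diff i
           cond_avg_increment_bound[OF F k b[OF k] inc[OF k] _ w]) (use k in auto)
      also have "\<dots> \<le> B k (w k)" by (rule bB[OF k wk])
      finally show "(mart_diff k F w)\<^sup>2 \<le> (B k (w k))\<^sup>2"
        by (metis abs_ge_zero abs_le_square_iff abs_of_nonneg order_trans)
    qed
    also have "\<dots> = (\<integral>x. (B k x)\<^sup>2 \<partial>M k)"
    proof (rule integral_coord[OF k])
      show "\<bar>(B k x)\<^sup>2\<bar> \<le> (C k)\<^sup>2" if "x \<in> space (M k)" for x
        using B_le[OF k that] by (simp add: abs_le_square_iff[symmetric])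
    qed (use B[OF k] in auto)
    finally show ?thesis .
  qed
  have "?E (\<lambda>w. (F w - m)\<^sup>2) = ?E (\<lambda>w. (F w)\<^sup>2) - m\<^sup>2"
  proof -
    have "?E (\<lambda>w. (F w - m)\<^sup>2) = ?E (\<lambda>w. (F w)\<^sup>2) + m\<^sup>2 - 2 * ?E F * m"
      using bounded_rv_integrable[OF bounded_rv_power[OF F, of 2]] bounded_rv_integrable[OF F]
      by (simp add: power2_diff P.prob_space)
    then show ?thesis by (simp add: m_def power2_eq_square)
  qed
  also have "m\<^sup>2 = ?E (\<lambda>w. (cond_avg N F w)\<^sup>2)"
  proof -
    have "?E (\<lambda>w. (cond_avg N F w)\<^sup>2) = ?E (\<lambda>w. m\<^sup>2)"
      by (intro Bochner_Integration.integral_cong refl) (simp add: cond_avg_all[OF F] m_def)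
    then show ?thesis by (simp add: P.prob_space)
  qed
  also have "?E (\<lambda>w. (F w)\<^sup>2) - ?E (\<lambda>w. (cond_avg N F w)\<^sup>2)
      = (\<Sum>k<N. ?E (\<lambda>w. (cond_avg k F w)\<^sup>2) - ?E (\<lambda>w. (cond_avg (Suc k) F w)\<^sup>2))"
    by (subst sum_lessThan_telescope') simp
  also have "\<dots> \<le> (\<Sum>k<N. \<integral>x. (B k x)\<^sup>2 \<partial>M k)"
    by (intro sum_mono step) auto
  finally show ?thesis by (simp add: m_def)
qed

end

section \<open>A bound on Stein's functional\<close>

lemma integral_mult_le_Cauchy_Schwarz:
  fixes f g :: "'a \<Rightarrow> real"
  assumes "integrable M (\<lambda>x. (f x)\<^sup>2)" "integrable M (\<lambda>x. (g x)\<^sup>2)" "integrable M (\<lambda>x. f x * g x)"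
    and f: "(\<integral>x. (f x)\<^sup>2 \<partial>M) \<le> a\<^sup>2" and g: "(\<integral>x. (g x)\<^sup>2 \<partial>M) \<le> b\<^sup>2" and a: "0 \<le> a" and b: "0 \<le> b"
  shows "(\<integral>x. f x * g x \<partial>M) \<le> a * b"
proof -
  have [measurable]: "(\<lambda>x. f x * g x) \<in> borel_measurable M" using assms(3) by auto
  have [measurable]: "(\<lambda>x. \<bar>f x\<bar>) \<in> borel_measurable M" "(\<lambda>x. \<bar>g x\<bar>) \<in> borel_measurable M"
    using assms(1,2)[THEN borel_measurable_integrable, THEN measurable_compose, OF borel_measurable_sqrt] by simp_all
  have "(\<integral>\<^sup>+x. ennreal \<bar>f x\<bar> * ennreal \<bar>g x\<bar> \<partial>M)\<^sup>2 \<le> (\<integral>\<^sup>+x. (ennreal \<bar>f x\<bar>)\<^sup>2 \<partial>M) * (\<integral>\<^sup>+x. (ennreal \<bar>g x\<bar>)\<^sup>2 \<partial>M)"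
    by (rule Cauchy_Schwarz_nn_integral) measurable
  also have "\<dots> = ennreal (\<integral>x. (f x)\<^sup>2 \<partial>M) * ennreal (\<integral>x. (g x)\<^sup>2 \<partial>M)"
    using assms(1,2) by (simp add: ennreal_power nn_integral_eq_integral)
  also have "\<dots> \<le> ennreal (a\<^sup>2) * ennreal (b\<^sup>2)" by (intro mult_mono ennreal_leI f g) auto
  also have "(\<integral>\<^sup>+x. ennreal \<bar>f x\<bar> * ennreal \<bar>g x\<bar> \<partial>M) = ennreal (\<integral>x. \<bar>f x * g x\<bar> \<partial>M)"
    using integrable_abs[OF assms(3)] by (subst nn_integral_eq_integral[symmetric]) (auto simp: abs_mult ennreal_mult)
  finally have "(\<integral>x. \<bar>f x * g x\<bar> \<partial>M)\<^sup>2 \<le> (a * b)\<^sup>2"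
    by (simp add: ennreal_power ennreal_mult[symmetric] power_mult_distrib)
  then have "(\<integral>x. \<bar>f x * g x\<bar> \<partial>M) \<le> a * b" using a b by (simp add: power2_le_iff_abs_le)
  moreover have "(\<integral>x. f x * g x \<partial>M) \<le> (\<integral>x. \<bar>f x * g x\<bar> \<partial>M)" using assms(3) by (intro integral_mono) auto
  ultimately show ?thesis by linarith
qed

text \<open>The model is \<open>W = lam (\<Sum>t. f(S\<^sub>t))\<close>, where \<open>S\<^sub>t\<close> is a sum of functions of the single coordinates and
\<open>q t k x y\<close> is the change of \<open>S\<^sub>t\<close>, truncated at one, when \<open>x\<close> is replaced by \<open>y\<close> in coordinate \<open>k\<close>. Mixed second increments are bounded
by products, and \<open>a t k\<close> bounds the \<open>L\<^sup>2\<close>-norm of \<open>q t k\<close>.\<close>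

locale smooth_functional = independent_coordinates M N for M :: "nat \<Rightarrow> 'c measure" and N +
  fixes W :: "(nat \<Rightarrow> 'c) \<Rightarrow> real" and T :: "'t set" and q :: "'t \<Rightarrow> nat \<Rightarrow> 'c \<Rightarrow> 'c \<Rightarrow> real"
    and lam :: real and a :: "'t \<Rightarrow> nat \<Rightarrow> real"
  assumes finite_T: "finite T" and bounded_W: "bounded_rv W" and lam_nonneg: "0 \<le> lam"
    and q_measurable: "\<And>t k. t \<in> T \<Longrightarrow> k < N \<Longrightarrow> case_prod (q t k) \<in> borel_measurable (M k \<Otimes>\<^sub>M M k)"
    and q_nonneg: "\<And>t k x y. 0 \<le> q t k x y" and q_le_1: "\<And>t k x y. q t k x y \<le> 1"
    and a_nonneg: "\<And>t k. 0 \<le> a t k"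
    and q_square: "\<And>t k. t \<in> T \<Longrightarrow> k < N \<Longrightarrow> (\<integral>x. \<integral>y. (q t k x y)\<^sup>2 \<partial>M k \<partial>M k) \<le> (a t k)\<^sup>2"
    and increment: "\<And>k w y. k < N \<Longrightarrow> w \<in> space \<P> \<Longrightarrow> y \<in> space (M k) \<Longrightarrow>
      \<bar>W w - W (w(k := y))\<bar> \<le> lam * (\<Sum>t\<in>T. q t k (w k) y)"
    and second_increment: "\<And>j k w y z. j < N \<Longrightarrow> k < N \<Longrightarrow> j \<noteq> k \<Longrightarrow> w \<in> space \<P> \<Longrightarrow> y \<in> space (M j) \<Longrightarrow> z \<in> space (M k) \<Longrightarrow>
      \<bar>W w - W (w(j := y)) - W (w(k := z)) + W (w(j := y, k := z))\<bar>
        \<le> lam * (\<Sum>t\<in>T. q t j (w j) y * q t k (w k) z)"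
begin

definition \<alpha> :: "'t \<Rightarrow> nat \<Rightarrow> 'c \<Rightarrow> real" where
  "\<alpha> t k x = (\<integral>y. q t k x y \<partial>M k)"

definition influence :: "nat \<Rightarrow> 'c \<Rightarrow> real" where
  "influence k x = lam * (\<Sum>t\<in>T. \<alpha> t k x)"

lemma q_integrable: "t \<in> T \<Longrightarrow> k < N \<Longrightarrow> x \<in> space (M k) \<Longrightarrow> integrable (M k) (q t k x)"
  using measurable_compose[OF measurable_Pair1'[of x "M k" "M k"] q_measurable[of t k]]
  by (intro M.integrable_const_bound[of _ 1] AE_I2) (auto simp: q_nonneg q_le_1)

lemma \<alpha>_measurable [measurable]: "t \<in> T \<Longrightarrow> k < N \<Longrightarrow> \<alpha> t k \<in> borel_measurable (M k)"
  unfolding \<alpha>_def[abs_def] by (rule M.borel_measurable_lebesgue_integral[OF q_measurable])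

lemma \<alpha>_nonneg: "0 \<le> \<alpha> t k x"
  by (auto simp: \<alpha>_def q_nonneg)

lemma \<alpha>_le_1: "t \<in> T \<Longrightarrow> k < N \<Longrightarrow> x \<in> space (M k) \<Longrightarrow> \<alpha> t k x \<le> 1"
  using integral_mono[of "M k" "q t k x" "\<lambda>_. 1"] q_integrable[of t k x]
  by (simp add: \<alpha>_def q_le_1 M.prob_space)

lemma \<alpha>_prod_integrable:
  "s \<in> T \<Longrightarrow> t \<in> T \<Longrightarrow> k < N \<Longrightarrow> integrable (M k) (\<lambda>x. \<alpha> s k x * \<alpha> t k x)"
  by (intro M.integrable_const_bound[of _ 1] AE_I2)
     (auto simp: abs_mult \<alpha>_nonneg intro!: mult_le_one \<alpha>_le_1)

lemma \<alpha>_power_integrable: "t \<in> T \<Longrightarrow> k < N \<Longrightarrow> integrable (M k) (\<lambda>x. \<alpha> t k x ^ n)"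
  by (intro M.integrable_const_bound[of _ 1] AE_I2)
     (auto simp: \<alpha>_nonneg abs_mult power_abs intro!: power_le_one \<alpha>_le_1)

text \<open>Jensen's inequality in the second argument of \<open>q\<close>.\<close>

lemma \<alpha>_square:
  assumes "t \<in> T" "k < N" shows "(\<integral>x. (\<alpha> t k x)\<^sup>2 \<partial>M k) \<le> (a t k)\<^sup>2"
proof -
  have m: "case_prod (\<lambda>x y. (q t k x y)\<^sup>2) \<in> borel_measurable (M k \<Otimes>\<^sub>M M k)"
    using q_measurable[OF assms] by (simp add: case_prod_beta')
  have q2i: "integrable (M k) (\<lambda>y. (q t k x y)\<^sup>2)" if "x \<in> space (M k)" for x
    using measurable_compose[OF measurable_Pair1'[OF that] m]
    by (intro M.integrable_const_bound[of _ 1] AE_I2) (auto simp: q_nonneg q_le_1 power_le_one)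
  have q2le: "(\<integral>y. (q t k x y)\<^sup>2 \<partial>M k) \<le> 1" if "x \<in> space (M k)" for x
    using integral_mono[OF q2i[OF that], of "\<lambda>_. 1"] by (simp add: q_nonneg q_le_1 power_le_one M.prob_space)
  have "(\<integral>x. (\<alpha> t k x)\<^sup>2 \<partial>M k) \<le> (\<integral>x. \<integral>y. (q t k x y)\<^sup>2 \<partial>M k \<partial>M k)"
  proof (rule integral_mono)
    show "integrable (M k) (\<lambda>x. (\<alpha> t k x)\<^sup>2)" by (rule \<alpha>_power_integrable[OF assms])
    show "integrable (M k) (\<lambda>x. \<integral>y. (q t k x y)\<^sup>2 \<partial>M k)"
      using M.borel_measurable_lebesgue_integral[OF m] q2le
      by (intro M.integrable_const_bound[of _ 1] AE_I2) auto
    fix x assume x: "x \<in> space (M k)"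
    have "0 \<le> (\<integral>y. (q t k x y - \<alpha> t k x)\<^sup>2 \<partial>M k)" by simp
    also have "\<dots> = (\<integral>y. (q t k x y)\<^sup>2 \<partial>M k) - (\<alpha> t k x)\<^sup>2"
      using q_integrable[OF assms x] q2i[OF x]
      by (simp add: power2_diff M.prob_space \<alpha>_def[symmetric]) (simp add: power2_eq_square)
    finally show "(\<alpha> t k x)\<^sup>2 \<le> (\<integral>y. (q t k x y)\<^sup>2 \<partial>M k)" by simp
  qed
  also have "\<dots> \<le> (a t k)\<^sup>2" by (rule q_square[OF assms])
  finally show ?thesis .
qed

lemma \<alpha>_prod: "s \<in> T \<Longrightarrow> t \<in> T \<Longrightarrow> k < N \<Longrightarrow> (\<integral>x. \<alpha> s k x * \<alpha> t k x \<partial>M k) \<le> a s k * a t k"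
  by (intro integral_mult_le_Cauchy_Schwarz \<alpha>_power_integrable \<alpha>_prod_integrable \<alpha>_square a_nonneg)

lemma influence_nonneg: "0 \<le> influence k x"
  by (auto simp: influence_def \<alpha>_nonneg lam_nonneg intro!: mult_nonneg_nonneg sum_nonneg)

lemma influence_measurable [measurable]: "k < N \<Longrightarrow> influence k \<in> borel_measurable (M k)"
  unfolding influence_def[abs_def] by measurable

lemma influence_bounded: "k < N \<Longrightarrow> x \<in> space (M k) \<Longrightarrow> influence k x \<le> lam * card T"
  using sum_mono[of T "\<lambda>t. \<alpha> t k x" "\<lambda>_. 1"] lam_nonneg
  by (auto simp: influence_def \<alpha>_le_1 intro!: mult_left_mono)

lemma influence_power_bounded: "k < N \<Longrightarrow> x \<in> space (M k) \<Longrightarrow> \<bar>influence k x ^ n\<bar> \<le> (lam * card T) ^ n"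
  using influence_bounded[of k x] influence_nonneg[of k x] by (simp add: power_abs power_mono)

lemma influence_power_integrable: "k < N \<Longrightarrow> integrable (M k) (\<lambda>x. influence k x ^ n)"
  using influence_power_bounded
  by (intro M.integrable_const_bound[of _ "(lam * card T) ^ n"] AE_I2) auto

lemma sum_\<alpha>_square:
  assumes k: "k < N" and S: "S \<subseteq> T"
  shows "integrable (M k) (\<lambda>x. (\<Sum>t\<in>S. \<alpha> t k x)\<^sup>2)" and "(\<integral>x. (\<Sum>t\<in>S. \<alpha> t k x)\<^sup>2 \<partial>M k) \<le> (\<Sum>t\<in>S. a t k)\<^sup>2"
proof -
  have i: "integrable (M k) (\<lambda>x. \<alpha> s k x * \<alpha> t k x)" if "s \<in> S" "t \<in> S" for s t
    using \<alpha>_prod_integrable k S that by auto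
  show "integrable (M k) (\<lambda>x. (\<Sum>t\<in>S. \<alpha> t k x)\<^sup>2)"
    unfolding power2_eq_square sum_product by (intro Bochner_Integration.integrable_sum i)
  have "(\<integral>x. (\<Sum>t\<in>S. \<alpha> t k x)\<^sup>2 \<partial>M k) = (\<Sum>s\<in>S. \<Sum>t\<in>S. \<integral>x. \<alpha> s k x * \<alpha> t k x \<partial>M k)"
    unfolding power2_eq_square sum_product using i by simp
  also have "\<dots> \<le> (\<Sum>s\<in>S. \<Sum>t\<in>S. a s k * a t k)"
    using k S by (intro sum_mono \<alpha>_prod) auto
  finally show "(\<integral>x. (\<Sum>t\<in>S. \<alpha> t k x)\<^sup>2 \<partial>M k) \<le> (\<Sum>t\<in>S. a t k)\<^sup>2" by (simp add: power2_eq_square sum_product)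
qed

lemma influence_square: "k < N \<Longrightarrow> (\<integral>x. (influence k x)\<^sup>2 \<partial>M k) \<le> (lam * (\<Sum>t\<in>T. a t k))\<^sup>2"
  using sum_\<alpha>_square(2)[of k T] by (simp add: influence_def power_mult_distrib mult_left_mono)

text \<open>Stated for a general \<open>G\<close>, as it is applied to \<open>W\<close> and to partial averages of \<open>W\<close>: a martingale
difference is the deviation of a partial average from its own average.\<close>

lemma abs_deviation_le:
  assumes k: "k < N" and w: "w \<in> space \<P>" and G: "bounded_rv G"
    and inc: "\<And>y. y \<in> space (M k) \<Longrightarrow> \<bar>G w - G (w(k := y))\<bar> \<le> lam * (\<Sum>t\<in>T. q t k (w k) y)"
  shows "\<bar>G w - avg k G w\<bar> \<le> influence k (w k)"
proof -
  note wk = coord_space[OF w k] and i = bounded_rv_section[OF G k w]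
  have "\<bar>G w - avg k G w\<bar> = \<bar>\<integral>y. G w - G (w(k := y)) \<partial>M k\<bar>"
    using i by (simp add: avg_def M.prob_space)
  also have "\<dots> \<le> (\<integral>y. \<bar>G w - G (w(k := y))\<bar> \<partial>M k)" by (rule integral_abs_bound)
  also have "\<dots> \<le> (\<integral>y. lam * (\<Sum>t\<in>T. q t k (w k) y) \<partial>M k)"
    using k wk i by (intro integral_mono inc) (auto intro!: q_integrable)
  also have "\<dots> = influence k (w k)"
    using q_integrable[OF _ k wk] by (simp add: influence_def \<alpha>_def)
  finally show ?thesis .
qed

lemma abs_diff_avg_le: "k < N \<Longrightarrow> w \<in> space \<P> \<Longrightarrow> \<bar>W w - avg k W w\<bar> \<le> influence k (w k)"
  by (intro abs_deviation_le bounded_W increment)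

lemma abs_mart_diff_le:
  assumes k: "k < N" and w: "w \<in> space \<P>"
  shows "\<bar>mart_diff k W w\<bar> \<le> influence k (w k)"
  unfolding mart_diff_def cond_avg.simps
proof (rule abs_deviation_le[OF k w bounded_rv_cond_avg[OF bounded_W less_imp_le[OF k]]])
  fix y assume "y \<in> space (M k)"
  then show "\<bar>cond_avg k W w - cond_avg k W (w(k := y))\<bar> \<le> lam * (\<Sum>t\<in>T. q t k (w k) y)"
    using k w by (intro cond_avg_increment_bound[OF bounded_W k _ increment[OF k]])
      (auto intro!: mult_nonneg_nonneg sum_nonneg q_nonneg lam_nonneg)
qed

lemma deviation_second_increment:
  assumes j: "j < N" and k: "k < N" and w: "w \<in> space \<P>" and y: "y \<in> space (M j)" and G: "bounded_rv G"
    and inc: "\<And>z. z \<in> space (M k) \<Longrightarrow> \<bar>G w - G (w(j := y)) - G (w(k := z)) + G (w(j := y, k := z))\<bar>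
        \<le> lam * (\<Sum>t\<in>T. q t j (w j) y * q t k (w k) z)"
  shows "\<bar>(G w - avg k G w) - (G (w(j := y)) - avg k G (w(j := y)))\<bar> \<le> lam * (\<Sum>t\<in>T. q t j (w j) y * \<alpha> t k (w k))"
proof -
  note wk = coord_space[OF w k]
  have wj: "w(j := y) \<in> space \<P>" using upd_space w j y by simp
  note i = bounded_rv_section[OF G k w] bounded_rv_section[OF G k wj]
  let ?D = "\<lambda>z. G w - G (w(j := y)) - G (w(k := z)) + G (w(j := y, k := z))"
  have "\<bar>(G w - avg k G w) - (G (w(j := y)) - avg k G (w(j := y)))\<bar> = \<bar>\<integral>z. ?D z \<partial>M k\<bar>"
    unfolding avg_def using i by (simp add: M.prob_space)
  also have "\<dots> \<le> (\<integral>z. \<bar>?D z\<bar> \<partial>M k)" by (rule integral_abs_bound)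
  also have "\<dots> \<le> (\<integral>z. lam * (\<Sum>t\<in>T. q t j (w j) y * q t k (w k) z) \<partial>M k)"
    using i k wk by (intro integral_mono inc) (auto intro!: q_integrable)
  also have "\<dots> = lam * (\<Sum>t\<in>T. q t j (w j) y * \<alpha> t k (w k))"
    using q_integrable[OF _ k wk] by (simp add: \<alpha>_def)
  finally show ?thesis .
qed

lemma second_increment_mart_diff:
  assumes j: "j < N" and k: "k < N" and jk: "j \<noteq> k" and w: "w \<in> space \<P>" and y: "y \<in> space (M j)"
  shows "\<bar>mart_diff k W w - mart_diff k W (w(j := y))\<bar> \<le> lam * (\<Sum>t\<in>T. q t j (w j) y * \<alpha> t k (w k))"
  unfolding mart_diff_def cond_avg.simps
proof (rule deviation_second_increment[OF j k w y bounded_rv_cond_avg[OF bounded_W less_imp_le[OF k]]])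
  fix z assume z: "z \<in> space (M k)"
  show "\<bar>cond_avg k W w - cond_avg k W (w(j := y)) - cond_avg k W (w(k := z)) + cond_avg k W (w(j := y, k := z))\<bar>
      \<le> lam * (\<Sum>t\<in>T. q t j (w j) y * q t k (w k) z)" (is "_ \<le> ?B")
  proof (rule cond_avg_second_increment_bound[OF bounded_W j k jk _ _ y z less_imp_le[OF k] w refl refl])
    show "0 \<le> ?B" by (intro mult_nonneg_nonneg sum_nonneg q_nonneg lam_nonneg)
    show "\<bar>W w' - W (w'(j := y)) - W (w'(k := z)) + W (w'(j := y, k := z))\<bar> \<le> ?B"
      if "w' \<in> space \<P>" "w' j = w j" "w' k = w k" for w'
      using second_increment[OF j k jk that(1) y z] that by simp
  qed
qed

lemma second_increment_diff_avg:
  assumes "j < N" "k < N" "j \<noteq> k" "w \<in> space \<P>" "y \<in> space (M j)"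
  shows "\<bar>(W w - avg k W w) - (W (w(j := y)) - avg k W (w(j := y)))\<bar> \<le> lam * (\<Sum>t\<in>T. q t j (w j) y * \<alpha> t k (w k))"
  by (intro deviation_second_increment bounded_W second_increment assms)

text \<open>Up to the Taylor remainder, the mean of \<open>W \<phi>(W)\<close> is that of \<open>\<phi>'(W) U\<close>. The average over coordinate \<open>k\<close> in \<open>U_summand k\<close>
is possible because \<open>\<phi>'\<close> is first evaluated at \<open>avg k W\<close>, which ignores that coordinate; it makes the increments of \<open>U_summand k\<close>
products of influences of different coordinates.\<close>

definition U_summand :: "nat \<Rightarrow> (nat \<Rightarrow> 'c) \<Rightarrow> real" where
  "U_summand k = avg k (\<lambda>w. mart_diff k W w * (W w - avg k W w))"

definition U :: "(nat \<Rightarrow> 'c) \<Rightarrow> real" where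
  "U w = (\<Sum>k<N. U_summand k w)"

lemma bounded_rv_diff_avg: "k < N \<Longrightarrow> bounded_rv (\<lambda>w. W w - avg k W w)"
  by (intro bounded_rv_diff bounded_W bounded_rv_avg)

lemma bounded_rv_U_prod: "k < N \<Longrightarrow> bounded_rv (\<lambda>w. mart_diff k W w * (W w - avg k W w))"
  by (intro bounded_rv_mult bounded_rv_diff_avg bounded_rv_mart_diff bounded_W)

lemma bounded_rv_U_summand: "k < N \<Longrightarrow> bounded_rv (U_summand k)"
  unfolding U_summand_def by (intro bounded_rv_avg bounded_rv_U_prod)

lemma bounded_rv_U: "bounded_rv U"
  unfolding U_def[abs_def] by (intro bounded_rv_sum bounded_rv_U_summand) auto

lemma U_summand_bound:
  assumes k: "k < N" and w: "w \<in> space \<P>"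
  shows "\<bar>U_summand k w\<bar> \<le> (\<integral>x. (influence k x)\<^sup>2 \<partial>M k)"
proof -
  have "\<bar>U_summand k w\<bar> \<le> (\<integral>z. \<bar>mart_diff k W (w(k := z)) * (W (w(k := z)) - avg k W (w(k := z)))\<bar> \<partial>M k)"
    unfolding U_summand_def avg_def[of _ "\<lambda>w. mart_diff k W w * _ w"] by (rule integral_abs_bound)
  also have "\<dots> \<le> (\<integral>z. (influence k z)\<^sup>2 \<partial>M k)"
  proof (intro integral_mono integrable_abs influence_power_integrable[OF k])
    show "integrable (M k) (\<lambda>z. mart_diff k W (w(k := z)) * (W (w(k := z)) - avg k W (w(k := z))))"
      by (rule bounded_rv_section[OF bounded_rv_U_prod[OF k] k w])
    fix z assume z: "z \<in> space (M k)"
    note wz = upd_space[OF w k z]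
    show "\<bar>mart_diff k W (w(k := z)) * (W (w(k := z)) - avg k W (w(k := z)))\<bar> \<le> (influence k z)\<^sup>2"
      using abs_mart_diff_le[OF k wz] abs_diff_avg_le[OF k wz] influence_nonneg
      by (auto simp: abs_mult power2_eq_square simp del: fun_upd_apply simp add: fun_upd_same intro!: mult_mono)
  qed
  finally show ?thesis .
qed

text \<open>The increment of a product of two deviations has one factor that is a mixed second increment and one
that is at most the influence of \<open>k\<close>. Averaging over coordinate \<open>k\<close> leaves products of \<open>\<alpha> s k\<close> and \<open>\<alpha> t k\<close>, whose means are bounded by
the Cauchy--Schwarz inequality.\<close>

lemma U_summand_increment:
  assumes j: "j < N" and k: "k < N" and w: "w \<in> space \<P>" and y: "y \<in> space (M j)"
  shows "\<bar>U_summand k w - U_summand k (w(j := y))\<bar>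
    \<le> 2 * lam\<^sup>2 * (\<Sum>t\<in>T. q t j (w j) y * (\<Sum>s\<in>T. a s k * a t k))"
proof (cases "j = k")
  case True
  then have "U_summand k (w(j := y)) = U_summand k w" by (simp add: U_summand_def avg_upd_same del: fun_upd_apply)
  then show ?thesis
    by (auto intro!: mult_nonneg_nonneg sum_nonneg q_nonneg a_nonneg)
next
  case jk: False
  let ?P = "mart_diff k W" and ?d = "\<lambda>w. W w - avg k W w"
  have wj: "w(j := y) \<in> space \<P>" using upd_space w j y by simp
  note i = bounded_rv_section[OF bounded_rv_U_prod[OF k] k w] bounded_rv_section[OF bounded_rv_U_prod[OF k] k wj]
  let ?D = "\<lambda>z. ?P (w(k := z)) * ?d (w(k := z)) - ?P (w(j := y, k := z)) * ?d (w(j := y, k := z))"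
  let ?R = "\<lambda>z. 2 * lam * (\<Sum>t\<in>T. q t j (w j) y * (influence k z * \<alpha> t k z))"
  have inf_eq: "influence k z * \<alpha> t k z = lam * (\<Sum>s\<in>T. \<alpha> s k z * \<alpha> t k z)" for z t
    by (simp add: influence_def sum_distrib_right mult.assoc)
  have iR: "integrable (M k) (\<lambda>z. influence k z * \<alpha> t k z)" if "t \<in> T" for t
    unfolding inf_eq using \<alpha>_prod_integrable[OF _ that k] by auto
  have "\<bar>U_summand k w - U_summand k (w(j := y))\<bar> = \<bar>\<integral>z. ?D z \<partial>M k\<bar>"
    unfolding U_summand_def avg_def[of _ "\<lambda>w. mart_diff k W w * _ w"] using i by simp
  also have "\<dots> \<le> (\<integral>z. \<bar>?D z\<bar> \<partial>M k)" by (rule integral_abs_bound)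
  also have "\<dots> \<le> (\<integral>z. ?R z \<partial>M k)"
  proof (rule integral_mono)
    show "integrable (M k) (\<lambda>z. \<bar>?D z\<bar>)" using i by auto
    show "integrable (M k) ?R" using iR by auto
    fix z assume z: "z \<in> space (M k)"
    let ?w = "w(k := z)"
    have w1: "?w \<in> space \<P>" by (rule upd_space[OF w k z])
    have w2: "?w(j := y) \<in> space \<P>" by (rule upd_space[OF w1 j y])
    have tw: "w(j := y, k := z) = ?w(j := y)" using jk by (rule fun_upd_twist)
    have at: "?w k = z" "?w j = w j" "(?w(j := y)) k = z" using jk by auto
    define S where "S = lam * (\<Sum>t\<in>T. q t j (w j) y * \<alpha> t k z)"
    have S: "0 \<le> S" unfolding S_def by (intro mult_nonneg_nonneg sum_nonneg q_nonneg lam_nonneg \<alpha>_nonneg)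
    have 1: "\<bar>?P ?w - ?P (?w(j := y))\<bar> \<le> S"
      using second_increment_mart_diff[OF j k jk w1 y] unfolding at S_def .
    have 2: "\<bar>?d ?w - ?d (?w(j := y))\<bar> \<le> S"
      using second_increment_diff_avg[OF j k jk w1 y] unfolding at S_def .
    have 3: "\<bar>?d ?w\<bar> \<le> influence k z" using abs_diff_avg_le[OF k w1] unfolding at .
    have 4: "\<bar>?P (?w(j := y))\<bar> \<le> influence k z" using abs_mart_diff_le[OF k w2] unfolding at .
    have "?D z = (?P ?w - ?P (?w(j := y))) * ?d ?w + ?P (?w(j := y)) * (?d ?w - ?d (?w(j := y)))"
      unfolding tw by (simp add: algebra_simps del: fun_upd_apply)
    then have "\<bar>?D z\<bar> \<le> \<bar>?P ?w - ?P (?w(j := y))\<bar> * \<bar>?d ?w\<bar> + \<bar>?P (?w(j := y))\<bar> * \<bar>?d ?w - ?d (?w(j := y))\<bar>"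
      by (simp only: abs_mult[symmetric] abs_triangle_ineq)
    also have "\<dots> \<le> S * influence k z + influence k z * S"
      using S influence_nonneg by (intro add_mono mult_mono 1 2 3 4) auto
    also have "\<dots> = ?R z" by (simp add: S_def sum_distrib_left sum_distrib_right mult_ac sum.distrib[symmetric])
    finally show "\<bar>?D z\<bar> \<le> ?R z" .
  qed
  also have "\<dots> = 2 * lam * (\<Sum>t\<in>T. q t j (w j) y * (lam * (\<Sum>s\<in>T. \<integral>z. \<alpha> s k z * \<alpha> t k z \<partial>M k)))"
    using iR \<alpha>_prod_integrable k by (simp add: inf_eq)
  also have "\<dots> \<le> 2 * lam * (\<Sum>t\<in>T. q t j (w j) y * (lam * (\<Sum>s\<in>T. a s k * a t k)))"
    using k by (intro mult_left_mono sum_mono \<alpha>_prod q_nonneg lam_nonneg) (auto simp: lam_nonneg)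
  also have "\<dots> = 2 * lam\<^sup>2 * (\<Sum>t\<in>T. q t j (w j) y * (\<Sum>s\<in>T. a s k * a t k))"
    by (simp add: power2_eq_square sum_distrib_left mult_ac)
  finally show ?thesis .
qed

lemma sum_row_products:
  assumes D: "\<And>t. t \<in> T \<Longrightarrow> (\<Sum>k<N. \<Sum>s\<in>T. a s k * a t k) \<le> D"
  shows "(\<Sum>k<N. (\<Sum>t\<in>T. a t k)\<^sup>2) \<le> D * card T"
proof -
  have "(\<Sum>k<N. (\<Sum>t\<in>T. a t k)\<^sup>2) = (\<Sum>k<N. \<Sum>t\<in>T. \<Sum>s\<in>T. a s k * a t k)"
    by (simp add: power2_eq_square sum_product mult.commute)
  also have "\<dots> = (\<Sum>t\<in>T. \<Sum>k<N. \<Sum>s\<in>T. a s k * a t k)" by (rule sum.swap)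
  also have "\<dots> \<le> (\<Sum>t\<in>T. D)" by (intro sum_mono D)
  finally show ?thesis by (simp add: mult.commute)
qed

lemma variance_U:
  assumes D: "\<And>t. t \<in> T \<Longrightarrow> (\<Sum>k<N. \<Sum>s\<in>T. a s k * a t k) \<le> D" and D0: "0 \<le> D"
  shows "(\<integral>w. (U w - (\<integral>w. U w \<partial>\<P>))\<^sup>2 \<partial>\<P>) \<le> 4 * lam ^ 4 * D ^ 3 * card T"
proof -
  have fac: "2 * lam\<^sup>2 * D * (\<Sum>t\<in>T. \<alpha> t j x) = 2 * lam * D * influence j x" for j x
    by (simp add: influence_def power2_eq_square)
  have "(\<integral>w. (U w - (\<integral>w. U w \<partial>\<P>))\<^sup>2 \<partial>\<P>) \<le> (\<Sum>j<N. \<integral>x. (2 * lam * D * influence j x)\<^sup>2 \<partial>M j)"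
  proof (rule variance_le_sum_increments[OF bounded_rv_U])
    fix j x assume j: "j < N" and x: "x \<in> space (M j)"
    show "integrable (M j) (\<lambda>y. 2 * lam\<^sup>2 * D * (\<Sum>t\<in>T. q t j x y))"
      using q_integrable[OF _ j x] by auto
    show "(\<integral>y. 2 * lam\<^sup>2 * D * (\<Sum>t\<in>T. q t j x y) \<partial>M j) \<le> 2 * lam * D * influence j x"
      using q_integrable[OF _ j x] by (simp add: fac[symmetric] \<alpha>_def)
    show "\<bar>2 * lam * D * influence j x\<bar> \<le> 2 * lam * D * (lam * card T)"
      using influence_bounded[OF j x] influence_nonneg lam_nonneg D0 by (auto simp: abs_mult intro!: mult_left_mono)
    fix y assume y: "y \<in> space (M j)"
    show "0 \<le> 2 * lam\<^sup>2 * D * (\<Sum>t\<in>T. q t j x y)"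
      by (intro mult_nonneg_nonneg sum_nonneg q_nonneg D0) auto
  next
    fix j w y assume j: "j < N" and w: "w \<in> space \<P>" and y: "y \<in> space (M j)"
    have "\<bar>U w - U (w(j := y))\<bar> \<le> (\<Sum>k<N. \<bar>U_summand k w - U_summand k (w(j := y))\<bar>)"
      unfolding U_def sum_subtractf[symmetric] by (rule sum_abs)
    also have "\<dots> \<le> (\<Sum>k<N. 2 * lam\<^sup>2 * (\<Sum>t\<in>T. q t j (w j) y * (\<Sum>s\<in>T. a s k * a t k)))"
      by (intro sum_mono U_summand_increment j w y) auto
    also have "\<dots> = 2 * lam\<^sup>2 * (\<Sum>t\<in>T. q t j (w j) y * (\<Sum>k<N. \<Sum>s\<in>T. a s k * a t k))"
      by (simp add: sum_distrib_left) (subst sum.swap, simp)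
    also have "\<dots> \<le> 2 * lam\<^sup>2 * (\<Sum>t\<in>T. q t j (w j) y * D)"
      by (intro mult_left_mono sum_mono D q_nonneg) auto
    also have "\<dots> = 2 * lam\<^sup>2 * D * (\<Sum>t\<in>T. q t j (w j) y)"
      by (simp add: sum_distrib_left mult_ac)
    finally show "\<bar>U w - U (w(j := y))\<bar> \<le> 2 * lam\<^sup>2 * D * (\<Sum>t\<in>T. q t j (w j) y)" .
  qed auto
  also have "\<dots> = (\<Sum>j<N. (2 * lam * D)\<^sup>2 * (\<integral>x. (influence j x)\<^sup>2 \<partial>M j))"
    by (simp add: power_mult_distrib)
  also have "\<dots> \<le> (\<Sum>j<N. (2 * lam * D)\<^sup>2 * (lam * (\<Sum>t\<in>T. a t j))\<^sup>2)"
    by (intro sum_mono mult_left_mono influence_square) auto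
  also have "\<dots> = 4 * lam ^ 4 * D\<^sup>2 * (\<Sum>j<N. (\<Sum>t\<in>T. a t j)\<^sup>2)"
    unfolding sum_distrib_left[of "4 * lam ^ 4 * D\<^sup>2"]
    by (intro sum.cong refl) (simp add: power_mult_distrib power2_eq_square power4_eq_xxxx mult_ac)
  also have "\<dots> \<le> 4 * lam ^ 4 * D\<^sup>2 * (D * card T)"
    using sum_row_products[OF D] by (intro mult_left_mono) auto
  finally show ?thesis by (simp add: eval_nat_numeral mult_ac)
qed

lemma integral_U: "(\<integral>w. U w \<partial>\<P>) = (\<integral>w. (W w)\<^sup>2 \<partial>\<P>)"
  if EW: "(\<integral>w. W w \<partial>\<P>) = 0"
proof -
  have "(\<integral>w. U w \<partial>\<P>) = (\<Sum>k<N. \<integral>w. U_summand k w \<partial>\<P>)"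
    unfolding U_def using bounded_rv_integrable[OF bounded_rv_U_summand] by simp
  also have "\<dots> = (\<Sum>k<N. \<integral>w. mart_diff k W w * W w \<partial>\<P>)"
  proof (intro sum.cong refl)
    fix k assume "k \<in> {..<N}"
    then have k: "k < N" by simp
    note i = bounded_rv_integrable[OF bounded_rv_mult, OF bounded_rv_mart_diff bounded_W, OF bounded_W k]
      bounded_rv_integrable[OF bounded_rv_mult, OF bounded_rv_mart_diff bounded_rv_avg, OF bounded_W k bounded_W k]
    have "(\<integral>w. U_summand k w \<partial>\<P>) = (\<integral>w. mart_diff k W w * (W w - avg k W w) \<partial>\<P>)"
      unfolding U_summand_def by (rule integral_avg[OF bounded_rv_U_prod[OF k] k])
    also have "\<dots> = (\<integral>w. mart_diff k W w * W w \<partial>\<P>) - (\<integral>w. avg k W w * mart_diff k W w \<partial>\<P>)"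
      using i by (simp add: right_diff_distrib mult.commute)
    also have "(\<integral>w. avg k W w * mart_diff k W w \<partial>\<P>) = 0"
      by (rule integral_mart_diff_orthogonal[OF bounded_W bounded_rv_avg[OF bounded_W k] k avg_upd_same])
    finally show "(\<integral>w. U_summand k w \<partial>\<P>) = (\<integral>w. mart_diff k W w * W w \<partial>\<P>)" by simp
  qed
  also have "\<dots> = (\<integral>w. (\<Sum>k<N. mart_diff k W w * W w) \<partial>\<P>)"
    using bounded_rv_integrable[OF bounded_rv_mult, OF bounded_rv_mart_diff bounded_W, OF bounded_W] by simp
  also have "\<dots> = (\<integral>w. (W w)\<^sup>2 \<partial>\<P>)"
    by (intro Bochner_Integration.integral_cong refl)
       (simp add: sum_distrib_right[symmetric] sum_mart_diff cond_avg_all[OF bounded_W] EW power2_eq_square)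
  finally show ?thesis .
qed

lemma integral_avg_square_le:
  assumes k: "k < N"
  shows "(\<integral>w. (avg k W w)\<^sup>2 \<partial>\<P>) \<le> (\<integral>w. (W w)\<^sup>2 \<partial>\<P>)"
proof -
  have bA: "bounded_rv (avg k W)" by (rule bounded_rv_avg[OF bounded_W k])
  note i = bounded_rv_integrable[OF bounded_rv_power[OF bA, of 2]] bounded_rv_integrable[OF bounded_rv_power[OF bounded_W, of 2]]
     bounded_rv_integrable[OF bounded_rv_mult[OF bounded_W bA]]
  have "(\<integral>w. avg k W w * W w \<partial>\<P>) = (\<integral>w. avg k W w * avg k W w \<partial>\<P>)"
    by (rule integral_pull_out[OF bounded_W bA k avg_upd_same])
  moreover have "0 \<le> (\<integral>w. (W w - avg k W w)\<^sup>2 \<partial>\<P>)" by simp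
  moreover have "(\<integral>w. (W w - avg k W w)\<^sup>2 \<partial>\<P>)
     = (\<integral>w. (W w)\<^sup>2 \<partial>\<P>) + (\<integral>w. (avg k W w)\<^sup>2 \<partial>\<P>) - 2 * (\<integral>w. avg k W w * W w \<partial>\<P>)"
    using i by (simp add: power2_diff mult.assoc mult.commute[of "avg k W _"] mult.left_commute[of _ 2])
  ultimately show ?thesis unfolding power2_eq_square by linarith
qed

text \<open>\<open>avg k W\<close> does not depend on coordinate \<open>k\<close>, and averaging does not increase the second moment.\<close>

lemma integral_growth_times_coord:
  assumes k: "k < N" and b: "b \<in> borel_measurable (M k)" "\<And>x. x \<in> space (M k) \<Longrightarrow> 0 \<le> b x"
    and b_le: "\<And>x. x \<in> space (M k) \<Longrightarrow> b x \<le> B"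
  shows "(\<integral>w. (1 + (avg k W w)\<^sup>2) * b (w k) \<partial>\<P>) \<le> (1 + (\<integral>w. (W w)\<^sup>2 \<partial>\<P>)) * (\<integral>x. b x \<partial>M k)"
proof -
  have bA: "bounded_rv (avg k W)" by (rule bounded_rv_avg[OF bounded_W k])
  have bG: "bounded_rv (\<lambda>w. 1 + (avg k W w)\<^sup>2)" by (intro bounded_rv_add bounded_rv_power bA) simp
  have bb: "bounded_rv (\<lambda>w. b (w k))" by (rule bounded_rv_coord[OF k b(1), of B]) (simp add: b b_le)
  have "(\<integral>w. (1 + (avg k W w)\<^sup>2) * b (w k) \<partial>\<P>) = (\<integral>w. (1 + (avg k W w)\<^sup>2) * avg k (\<lambda>w. b (w k)) w \<partial>\<P>)"
    by (rule integral_pull_out[OF bb bG k]) (simp add: avg_upd_same del: fun_upd_apply)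
  also have "\<dots> = (\<integral>w. 1 + (avg k W w)\<^sup>2 \<partial>\<P>) * (\<integral>x. b x \<partial>M k)"
    by (simp add: avg_def)
  also have "\<dots> = (1 + (\<integral>w. (avg k W w)\<^sup>2 \<partial>\<P>)) * (\<integral>x. b x \<partial>M k)"
    using bounded_rv_integrable[OF bounded_rv_power[OF bA, of 2]] by (simp add: P.prob_space)
  also have "\<dots> \<le> (1 + (\<integral>w. (W w)\<^sup>2 \<partial>\<P>)) * (\<integral>x. b x \<partial>M k)"
    using integral_avg_square_le[OF k] b by (intro mult_right_mono Bochner_Integration.integral_nonneg) auto
  finally show ?thesis .
qed

text \<open>For each \<open>k\<close>, \<open>\<phi>(W)\<close> is expanded around \<open>avg k W\<close>, which is orthogonal to the martingale difference.
The remainder is at most the influence times its square or its first power, whichever is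
smaller, and the factor \<open>1 + (avg k W)\<^sup>2\<close> is independent of coordinate \<open>k\<close>. Moving \<open>\<phi>'\<close> back to \<open>W\<close> costs a product of
two moments of the influence. The remaining term \<open>\<phi>'(W) (1 - U)\<close> is estimated by the Cauchy--Schwarz inequality.\<close>

lemma stein_bound:
  fixes \<phi> \<phi>' :: "real \<Rightarrow> real"
  assumes EW: "(\<integral>w. W w \<partial>\<P>) = 0" and s2: "s2 = (\<integral>w. (W w)\<^sup>2 \<partial>\<P>)"
    and D: "\<And>t. t \<in> T \<Longrightarrow> (\<Sum>k<N. \<Sum>s\<in>T. a s k * a t k) \<le> D" and D0: "0 \<le> D"
    and reg: "stein_regular C \<phi> \<phi>'"
    and C: "0 \<le> C"
  shows "\<bar>\<integral>w. \<phi>' (W w) - W w * \<phi> (W w) \<partial>\<P>\<bar>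
    \<le> C * (1 + s2) * (\<Sum>k<N. (\<integral>x. min (influence k x ^ 3) ((influence k x)\<^sup>2) \<partial>M k)
                        + (\<integral>x. influence k x \<partial>M k) * (\<integral>x. (influence k x)\<^sup>2 \<partial>M k))
      + C * sqrt (2 + 2 * s2) * sqrt (4 * lam ^ 4 * D ^ 3 * card T + (1 - s2)\<^sup>2)"
proof -
  note im = bounded_rv_integrable[OF bounded_rv_mult]
  let ?E = "\<lambda>F. \<integral>w. F w \<partial>\<P>"
  let ?m3 = "\<lambda>k x. min (influence k x ^ 3) ((influence k x)\<^sup>2)"
  note cont = stein_regularD(1,2)[OF reg] and growth = stein_regularD(3)[OF reg]
    and lip = stein_regularD(4)[OF reg] and taylor = stein_regularD(5)[OF reg]
  note b\<phi> = bounded_rv_compose[OF bounded_W cont(1)] and b\<phi>' = bounded_rv_compose[OF bounded_W cont(2)]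
  have m3: "?m3 k \<in> borel_measurable (M k)" "\<And>x. 0 \<le> ?m3 k x" "\<And>x. x \<in> space (M k) \<Longrightarrow> ?m3 k x \<le> (lam * card T)\<^sup>2"
    if "k < N" for k
    using that influence_power_bounded[OF that, of _ 2] influence_nonneg by (auto simp: min_le_iff_disj)
  have local: "\<bar>?E (\<lambda>w. mart_diff k W w * \<phi> (W w)) - ?E (\<lambda>w. \<phi>' (W w) * U_summand k w)\<bar>
      \<le> C * (1 + s2) * ((\<integral>x. ?m3 k x \<partial>M k) + (\<integral>x. influence k x \<partial>M k) * (\<integral>x. (influence k x)\<^sup>2 \<partial>M k))"
    if k: "k < N" for k
  proof -
    let ?A = "avg k W" and ?P = "mart_diff k W" and ?d = "\<lambda>w. W w - avg k W w"
    have bA: "bounded_rv ?A" by (rule bounded_rv_avg[OF bounded_W k])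
    have bP: "bounded_rv ?P" by (rule bounded_rv_mart_diff[OF bounded_W k])
    have bd: "bounded_rv ?d" by (rule bounded_rv_diff_avg[OF k])
    note b\<phi>A = bounded_rv_compose[OF bA cont(1)] and b\<phi>'A = bounded_rv_compose[OF bA cont(2)]
    have bU: "bounded_rv (U_summand k)" by (rule bounded_rv_U_summand[OF k])
    let ?i2 = "\<integral>x. (influence k x)\<^sup>2 \<partial>M k"
    let ?R = "\<lambda>w. ?P w * (\<phi> (W w) - \<phi> (?A w) - \<phi>' (?A w) * ?d w)"
    let ?S = "\<lambda>w. (\<phi>' (?A w) - \<phi>' (W w)) * U_summand k w"
    have bR: "bounded_rv ?R" and bS: "bounded_rv ?S"
      by (intro bounded_rv_mult bounded_rv_diff bP bd b\<phi> b\<phi>A b\<phi>' b\<phi>'A bU)+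
    \<comment> \<open>the zeroth and first order terms of the expansion\<close>
    have z1: "?E (\<lambda>w. \<phi> (?A w) * ?P w) = 0"
      by (rule integral_mart_diff_orthogonal[OF bounded_W b\<phi>A k]) (simp only: avg_upd_same)
    have z2: "?E (\<lambda>w. \<phi>' (?A w) * (?P w * ?d w)) = ?E (\<lambda>w. \<phi>' (?A w) * U_summand k w)"
      unfolding U_summand_def
      by (rule integral_pull_out[OF bounded_rv_U_prod[OF k] b\<phi>'A k]) (simp only: avg_upd_same)
    have "?E ?R = ?E (\<lambda>w. ?P w * \<phi> (W w)) - ?E (\<lambda>w. \<phi> (?A w) * ?P w) - ?E (\<lambda>w. \<phi>' (?A w) * (?P w * ?d w))"
      using im[OF bP b\<phi>] im[OF b\<phi>A bP]
        im[OF b\<phi>'A bounded_rv_mult[OF bP bd]]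
      by (subst Bochner_Integration.integral_diff[symmetric], simp, simp)+
         (auto intro!: Bochner_Integration.integral_cong simp: algebra_simps)
    moreover have "?E ?S = ?E (\<lambda>w. \<phi>' (?A w) * U_summand k w) - ?E (\<lambda>w. \<phi>' (W w) * U_summand k w)"
      using im[OF b\<phi>'A bU] im[OF b\<phi>' bU]
      by (simp add: left_diff_distrib)
    ultimately have "?E (\<lambda>w. ?P w * \<phi> (W w)) - ?E (\<lambda>w. \<phi>' (W w) * U_summand k w) = ?E ?R + ?E ?S"
      using z1 z2 by simp
    then have "\<bar>?E (\<lambda>w. ?P w * \<phi> (W w)) - ?E (\<lambda>w. \<phi>' (W w) * U_summand k w)\<bar> \<le> \<bar>?E ?R\<bar> + \<bar>?E ?S\<bar>"
      by simp
    also have "\<bar>?E ?R\<bar> \<le> C * ((1 + s2) * (\<integral>x. ?m3 k x \<partial>M k))"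
    proof -
      have bm: "bounded_rv (\<lambda>w. (1 + (?A w)\<^sup>2) * ?m3 k (w k))"
        by (intro bounded_rv_mult bounded_rv_add bounded_rv_power bA bounded_rv_const
              bounded_rv_coord[OF k m3(1)[OF k], of "(lam * card T)\<^sup>2"])
           (use m3[OF k] in auto)
      have "\<bar>?E ?R\<bar> \<le> ?E (\<lambda>w. \<bar>?R w\<bar>)" by (rule integral_abs_bound)
      also have "\<dots> \<le> ?E (\<lambda>w. C * ((1 + (?A w)\<^sup>2) * ?m3 k (w k)))"
      proof (intro integral_mono bounded_rv_integrable bounded_rv_abs bR bounded_rv_mult[OF bounded_rv_const bm])
        fix w assume w: "w \<in> space \<P>"
        define x where "x = influence k (w k)"
        have x: "0 \<le> x" "\<bar>?P w\<bar> \<le> x" "\<bar>?d w\<bar> \<le> x"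
          using abs_mart_diff_le[OF k w] abs_diff_avg_le[OF k w] influence_nonneg by (auto simp: x_def)
        have d2: "(?d w)\<^sup>2 \<le> x\<^sup>2" using x by (metis abs_le_square_iff abs_of_nonneg)
        have "\<bar>?R w\<bar> \<le> x * (C * (1 + (?A w)\<^sup>2) * min ((?d w)\<^sup>2) \<bar>?d w\<bar>)"
          unfolding abs_mult by (intro mult_mono x taylor abs_ge_zero)
        also have "\<dots> \<le> x * (C * (1 + (?A w)\<^sup>2) * min (x\<^sup>2) x)"
          using x d2 C by (intro mult_left_mono min.mono) auto
        also have "\<dots> = C * ((1 + (?A w)\<^sup>2) * (x * min (x\<^sup>2) x))" by simp
        also have "x * min (x\<^sup>2) x = min (x ^ 3) (x\<^sup>2)"
          using x(1) by (simp add: min_mult_distrib_left power2_eq_square power3_eq_cube mult_ac)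
        finally show "\<bar>?R w\<bar> \<le> C * ((1 + (?A w)\<^sup>2) * ?m3 k (w k))" by (simp add: x_def)
      qed
      also have "\<dots> = C * ?E (\<lambda>w. (1 + (?A w)\<^sup>2) * ?m3 k (w k))" by simp
      also have "\<dots> \<le> C * ((1 + s2) * (\<integral>x. ?m3 k x \<partial>M k))"
        unfolding s2 using m3[OF k] by (intro mult_left_mono integral_growth_times_coord k C) auto
      finally show ?thesis .
    qed
    also have "\<bar>?E ?S\<bar> \<le> C * ((1 + s2) * (\<integral>x. influence k x \<partial>M k) * ?i2)"
    proof -
      have bi: "bounded_rv (\<lambda>w. (1 + (?A w)\<^sup>2) * influence k (w k))"
        by (intro bounded_rv_mult bounded_rv_add bounded_rv_power bA bounded_rv_const
              bounded_rv_coord[OF k influence_measurable[OF k], of "lam * card T"])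
           (use influence_nonneg influence_bounded[OF k] in auto)
      have "\<bar>?E ?S\<bar> \<le> ?E (\<lambda>w. \<bar>?S w\<bar>)" by (rule integral_abs_bound)
      also have "\<dots> \<le> ?E (\<lambda>w. C * ?i2 * ((1 + (?A w)\<^sup>2) * influence k (w k)))"
      proof (intro integral_mono bounded_rv_integrable bounded_rv_abs bS bounded_rv_mult[OF bounded_rv_const bi])
        fix w assume w: "w \<in> space \<P>"
        have "\<bar>\<phi>' (?A w) - \<phi>' (W w)\<bar> \<le> C * (1 + (?A w)\<^sup>2) * \<bar>?d w\<bar>"
          using lip[of "W w" "?A w"] by (simp add: abs_minus_commute)
        also have "\<dots> \<le> C * (1 + (?A w)\<^sup>2) * influence k (w k)"
          using C by (intro mult_left_mono abs_diff_avg_le[OF k w]) auto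
        finally have "\<bar>?S w\<bar> \<le> (C * (1 + (?A w)\<^sup>2) * influence k (w k)) * ?i2"
          unfolding abs_mult using C by (intro mult_mono U_summand_bound[OF k w]) (auto simp: influence_nonneg)
        then show "\<bar>?S w\<bar> \<le> C * ?i2 * ((1 + (?A w)\<^sup>2) * influence k (w k))" by (simp add: mult_ac)
      qed
      also have "\<dots> = C * ?i2 * ?E (\<lambda>w. (1 + (?A w)\<^sup>2) * influence k (w k))" by simp
      also have "\<dots> \<le> C * ?i2 * ((1 + s2) * (\<integral>x. influence k x \<partial>M k))"
        unfolding s2 using C influence_nonneg influence_bounded[OF k]
        by (intro mult_left_mono integral_growth_times_coord k influence_measurable mult_nonneg_nonneg) auto
      finally show ?thesis by (simp add: mult_ac)
    qed
    finally show ?thesis by (simp add: algebra_simps)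
  qed
  have eq1: "?E (\<lambda>w. W w * \<phi> (W w)) = (\<Sum>k<N. ?E (\<lambda>w. mart_diff k W w * \<phi> (W w)))"
  proof -
    have "?E (\<lambda>w. W w * \<phi> (W w)) = ?E (\<lambda>w. \<Sum>k<N. mart_diff k W w * \<phi> (W w))"
      by (intro Bochner_Integration.integral_cong refl)
         (simp add: sum_distrib_right[symmetric] sum_mart_diff cond_avg_all[OF bounded_W] EW)
    also have "\<dots> = (\<Sum>k<N. ?E (\<lambda>w. mart_diff k W w * \<phi> (W w)))"
      using im[OF bounded_rv_mart_diff[OF bounded_W] b\<phi>] by simp
    finally show ?thesis .
  qed
  have eq2: "?E (\<lambda>w. \<phi>' (W w) * U w) = (\<Sum>k<N. ?E (\<lambda>w. \<phi>' (W w) * U_summand k w))"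
    unfolding U_def sum_distrib_left
    using im[OF b\<phi>' bounded_rv_U_summand] by simp
  have 1: "\<bar>?E (\<lambda>w. W w * \<phi> (W w)) - ?E (\<lambda>w. \<phi>' (W w) * U w)\<bar>
     \<le> (\<Sum>k<N. C * (1 + s2) * ((\<integral>x. ?m3 k x \<partial>M k) + (\<integral>x. influence k x \<partial>M k) * (\<integral>x. (influence k x)\<^sup>2 \<partial>M k)))"
    unfolding eq1 eq2 sum_subtractf[symmetric] by (intro order_trans[OF sum_abs] sum_mono local) auto
  let ?V = "4 * lam ^ 4 * D ^ 3 * card T + (1 - s2)\<^sup>2"
  have s20: "0 \<le> s2" unfolding s2 by simp
  have bU1: "bounded_rv (\<lambda>w. 1 - U w)" by (intro bounded_rv_diff bounded_rv_const bounded_rv_U)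
  have bW1: "bounded_rv (\<lambda>w. 1 + \<bar>W w\<bar>)" by (intro bounded_rv_add bounded_rv_const bounded_rv_abs bounded_W)
  have 2: "\<bar>?E (\<lambda>w. \<phi>' (W w) * (1 - U w))\<bar> \<le> C * (sqrt (2 + 2 * s2) * sqrt ?V)"
  proof -
    have "\<bar>?E (\<lambda>w. \<phi>' (W w) * (1 - U w))\<bar> \<le> ?E (\<lambda>w. \<bar>\<phi>' (W w) * (1 - U w)\<bar>)" by (rule integral_abs_bound)
    also have "\<dots> \<le> ?E (\<lambda>w. C * ((1 + \<bar>W w\<bar>) * \<bar>1 - U w\<bar>))"
    proof (intro integral_mono bounded_rv_integrable bounded_rv_abs bounded_rv_mult b\<phi>' bU1 bW1 bounded_rv_const)
      fix w show "\<bar>\<phi>' (W w) * (1 - U w)\<bar> \<le> C * ((1 + \<bar>W w\<bar>) * \<bar>1 - U w\<bar>)"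
        unfolding abs_mult mult.assoc[symmetric] by (intro mult_right_mono growth) auto
    qed
    also have "\<dots> = C * ?E (\<lambda>w. (1 + \<bar>W w\<bar>) * \<bar>1 - U w\<bar>)" by simp
    also have "\<dots> \<le> C * (sqrt (2 + 2 * s2) * sqrt ?V)"
    proof (intro mult_left_mono C integral_mult_le_Cauchy_Schwarz real_sqrt_ge_zero)
      show "integrable \<P> (\<lambda>w. (1 + \<bar>W w\<bar>)\<^sup>2)" "integrable \<P> (\<lambda>w. \<bar>1 - U w\<bar>\<^sup>2)" "integrable \<P> (\<lambda>w. (1 + \<bar>W w\<bar>) * \<bar>1 - U w\<bar>)"
        by (intro bounded_rv_integrable bounded_rv_power bounded_rv_mult bounded_rv_abs bU1 bW1)+
      have "?E (\<lambda>w. (1 + \<bar>W w\<bar>)\<^sup>2) \<le> ?E (\<lambda>w. 2 + 2 * (W w)\<^sup>2)"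
      proof (intro integral_mono bounded_rv_integrable bounded_rv_power bounded_rv_add bounded_rv_mult bounded_rv_abs bounded_rv_const bounded_W)
        fix w have "0 \<le> (1 - \<bar>W w\<bar>)\<^sup>2" by simp
        then show "(1 + \<bar>W w\<bar>)\<^sup>2 \<le> 2 + 2 * (W w)\<^sup>2" by (simp add: power2_eq_square algebra_simps)
      qed
      also have "\<dots> = 2 + 2 * s2"
        using bounded_rv_integrable[OF bounded_rv_power[OF bounded_W, of 2]] by (simp add: s2 P.prob_space)
      finally show "?E (\<lambda>w. (1 + \<bar>W w\<bar>)\<^sup>2) \<le> (sqrt (2 + 2 * s2))\<^sup>2" using s20 by simp
      have EU: "?E U = s2" using integral_U[OF EW] s2 by simp
      have "?E (\<lambda>w. \<bar>1 - U w\<bar>\<^sup>2) = ?E (\<lambda>w. (U w - s2)\<^sup>2 + 2 * (s2 - 1) * (U w - s2) + (1 - s2)\<^sup>2)"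
        by (intro Bochner_Integration.integral_cong refl) (simp add: power2_eq_square algebra_simps)
      also have "\<dots> = ?E (\<lambda>w. (U w - s2)\<^sup>2) + (1 - s2)\<^sup>2"
        using bounded_rv_integrable[OF bounded_rv_power[OF bounded_rv_diff[OF bounded_rv_U bounded_rv_const[of s2]], of 2]]
          bounded_rv_integrable[OF bounded_rv_U] by (simp add: P.prob_space EU)
      also have "\<dots> \<le> ?V" using variance_U[OF D D0] EU by simp
      finally show "?E (\<lambda>w. \<bar>1 - U w\<bar>\<^sup>2) \<le> (sqrt ?V)\<^sup>2" using D0 lam_nonneg by simp
    qed (use s20 D0 lam_nonneg in auto)
    finally show ?thesis .
  qed
  have "?E (\<lambda>w. \<phi>' (W w) - W w * \<phi> (W w)) = ?E (\<lambda>w. \<phi>' (W w) * (1 - U w)) - (?E (\<lambda>w. W w * \<phi> (W w)) - ?E (\<lambda>w. \<phi>' (W w) * U w))"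
    using bounded_rv_integrable[OF b\<phi>'] im[OF bounded_W b\<phi>]
      im[OF b\<phi>' bounded_rv_U] by (simp add: right_diff_distrib)
  with 1 2 show ?thesis by (simp add: sum_distrib_left[symmetric])
qed

end

text \<open>Jensen's inequality for the cube, with weights proportional to \<open>p\<close>: a norm estimate in \<open>L\<^sup>3\<close> in
which the norms of the summands may be replaced by upper bounds.\<close>

lemma cube_of_sum_le:
  fixes x p :: "'t \<Rightarrow> real"
  assumes S: "finite S" and p: "\<And>t. t \<in> S \<Longrightarrow> 0 < p t" and x: "\<And>t. t \<in> S \<Longrightarrow> 0 \<le> x t"
  shows "(\<Sum>t\<in>S. x t) ^ 3 \<le> (\<Sum>t\<in>S. p t)\<^sup>2 * (\<Sum>t\<in>S. x t ^ 3 / (p t)\<^sup>2)"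
proof (cases "S = {}")
  case False
  define P where "P = (\<Sum>t\<in>S. p t)"
  have P: "0 < P" unfolding P_def using S False p by (intro sum_pos) auto
  have "(\<Sum>t\<in>S. (p t / P) *\<^sub>R (x t / p t)) ^ 3 \<le> (\<Sum>t\<in>S. (p t / P) * (x t / p t) ^ 3)"
  proof -
    have c: "convex_on {0::real..} (\<lambda>x. x ^ 3)" by (rule convex_power_odd) simp
    have "(\<Sum>t\<in>S. p t / P) = 1" using P by (simp add: P_def sum_divide_distrib[symmetric])
    then show ?thesis
      using convex_on_sum[OF S False c, of "\<lambda>t. p t / P" "\<lambda>t. x t / p t"] P p x by (simp add: less_imp_le)
  qed
  also have "(\<Sum>t\<in>S. (p t / P) *\<^sub>R (x t / p t)) = (\<Sum>t\<in>S. x t) / P"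
    unfolding sum_divide_distrib by (intro sum.cong refl) (use p in force)
  also have "(\<Sum>t\<in>S. (p t / P) * (x t / p t) ^ 3) = (\<Sum>t\<in>S. x t ^ 3 / (p t)\<^sup>2) / P"
    unfolding sum_divide_distrib
  proof (intro sum.cong refl)
    fix t assume "t \<in> S"
    with p[of t] P show "(p t / P) * (x t / p t) ^ 3 = x t ^ 3 / (p t)\<^sup>2 / P"
      by (simp add: power_divide power2_eq_square power3_eq_cube mult_ac)
  qed
  finally have "((\<Sum>t\<in>S. x t) / P) ^ 3 * P ^ 3 \<le> (\<Sum>t\<in>S. x t ^ 3 / (p t)\<^sup>2) / P * P ^ 3"
    using P by (intro mult_right_mono) auto
  then show ?thesis using P by (simp add: power_divide P_def[symmetric] power2_eq_square power3_eq_cube mult_ac)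
qed simp

lemma min_cube_square_le:
  fixes x y :: real
  assumes "0 \<le> x" "0 \<le> y"
  shows "min ((x + y) ^ 3) ((x + y)\<^sup>2) \<le> 8 * x ^ 3 + 4 * y\<^sup>2"
proof (cases "y \<le> x")
  case True
  have "(x + y) ^ 3 \<le> (2 * x) ^ 3" using True assms by (intro power_mono) auto
  then show ?thesis by (simp add: power_mult_distrib min.coboundedI1 add_increasing2)
next
  case False
  have "(x + y)\<^sup>2 \<le> (2 * y)\<^sup>2" using False assms by (intro power_mono) auto
  then show ?thesis using assms by (simp add: power_mult_distrib min.coboundedI2 add_increasing)
qed

context smooth_functional
begin

lemma influence_first_moment:
  assumes k: "k < N" shows "(\<integral>x. influence k x \<partial>M k) \<le> lam * (\<Sum>t\<in>T. a t k)"
proof -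
  have "(\<integral>x. influence k x * 1 \<partial>M k) \<le> lam * (\<Sum>t\<in>T. a t k) * 1"
    using influence_power_integrable[OF k, of 2] influence_power_integrable[OF k, of 1] influence_square[OF k] lam_nonneg
    by (intro integral_mult_le_Cauchy_Schwarz) (auto simp: M.prob_space intro!: mult_nonneg_nonneg sum_nonneg a_nonneg)
  then show ?thesis by simp
qed

text \<open>The part of the sum over \<open>S\<close> is estimated in \<open>L\<^sup>3\<close>, the rest in \<open>L\<^sup>2\<close>. As \<open>\<alpha>\<close> is at most one, its third moment is
at most its second, so that \<open>p t\<close> bounds the \<open>L\<^sup>3\<close>-norm up to a constant.\<close>

lemma influence_min_moment:
  assumes k: "k < N" and S: "S \<subseteq> T" and p: "\<And>t. t \<in> S \<Longrightarrow> 0 < p t"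
    and ap: "\<And>t. t \<in> S \<Longrightarrow> (a t k)\<^sup>2 \<le> A * p t ^ 3"
  shows "(\<integral>x. min (influence k x ^ 3) ((influence k x)\<^sup>2) \<partial>M k)
    \<le> 8 * lam ^ 3 * A * (\<Sum>t\<in>S. p t) ^ 3 + 4 * (lam * (\<Sum>t\<in>T - S. a t k))\<^sup>2"
proof -
  have finS: "finite S" using S finite_T by (rule finite_subset)
  let ?P = "\<Sum>t\<in>S. p t"
  let ?x = "\<lambda>x. lam * (\<Sum>t\<in>S. \<alpha> t k x)" and ?y = "\<lambda>x. lam * (\<Sum>t\<in>T - S. \<alpha> t k x)"
  have split: "influence k x = ?x x + ?y x" for x
    unfolding influence_def sum.subset_diff[OF S finite_T] by (simp add: distrib_left)
  have xy: "0 \<le> ?x x" "0 \<le> ?y x" for x using lam_nonneg by (auto intro!: mult_nonneg_nonneg sum_nonneg \<alpha>_nonneg)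
  have i3: "integrable (M k) (\<lambda>x. \<alpha> t k x ^ 3 / (p t)\<^sup>2)" if "t \<in> S" for t
    using \<alpha>_power_integrable[of t k 3] that S k by auto
  have iy: "integrable (M k) (\<lambda>x. (?y x)\<^sup>2)"
    unfolding power_mult_distrib using sum_\<alpha>_square(1)[OF k, of "T - S"] by auto
  let ?z = "\<lambda>x. 8 * (lam ^ 3 * (?P\<^sup>2 * (\<Sum>t\<in>S. \<alpha> t k x ^ 3 / (p t)\<^sup>2))) + 4 * (?y x)\<^sup>2"
  have "(\<integral>x. min (influence k x ^ 3) ((influence k x)\<^sup>2) \<partial>M k) \<le> (\<integral>x. ?z x \<partial>M k)"
  proof (rule integral_mono)
    show "integrable (M k) (\<lambda>x. min (influence k x ^ 3) ((influence k x)\<^sup>2))"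
      using influence_power_integrable[OF k] by (intro Bochner_Integration.integrable_min)
    show "integrable (M k) ?z"
      by (intro Bochner_Integration.integrable_add integrable_mult_right Bochner_Integration.integrable_sum[of S] i3 iy)
    fix x
    have "(?x x) ^ 3 \<le> lam ^ 3 * (?P\<^sup>2 * (\<Sum>t\<in>S. \<alpha> t k x ^ 3 / (p t)\<^sup>2))"
      unfolding power_mult_distrib using lam_nonneg p \<alpha>_nonneg finS by (intro mult_left_mono cube_of_sum_le) auto
    then show "min (influence k x ^ 3) ((influence k x)\<^sup>2) \<le> ?z x"
      unfolding split using min_cube_square_le[OF xy, of x x] by linarith
  qed
  also have "\<dots> = 8 * (lam ^ 3 * (?P\<^sup>2 * (\<Sum>t\<in>S. (\<integral>x. \<alpha> t k x ^ 3 \<partial>M k) / (p t)\<^sup>2))) + 4 * (\<integral>x. (?y x)\<^sup>2 \<partial>M k)"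
    using i3 iy by (subst Bochner_Integration.integral_add) auto
  also have "\<dots> \<le> 8 * (lam ^ 3 * (?P\<^sup>2 * (\<Sum>t\<in>S. A * p t))) + 4 * (lam * (\<Sum>t\<in>T - S. a t k))\<^sup>2"
  proof (intro add_mono mult_left_mono sum_mono)
    show "(\<integral>x. (?y x)\<^sup>2 \<partial>M k) \<le> (lam * (\<Sum>t\<in>T - S. a t k))\<^sup>2"
      using sum_\<alpha>_square(2)[OF k, of "T - S"] by (auto simp: power_mult_distrib intro!: mult_left_mono)
    fix t assume t: "t \<in> S"
    have "(\<integral>x. \<alpha> t k x ^ 3 \<partial>M k) \<le> (\<integral>x. \<alpha> t k x ^ 2 \<partial>M k)"
      using t S k by (intro integral_mono \<alpha>_power_integrable power_decreasing \<alpha>_nonneg \<alpha>_le_1) auto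
    also have "\<dots> \<le> (a t k)\<^sup>2" using t S k by (intro \<alpha>_square) auto
    also have "\<dots> \<le> A * p t ^ 3" by (rule ap[OF t])
    finally have "(\<integral>x. \<alpha> t k x ^ 3 \<partial>M k) / (p t)\<^sup>2 \<le> A * p t ^ 3 / (p t)\<^sup>2" by (intro divide_right_mono) auto
    also have "\<dots> = A * p t" using p[OF t] by (simp add: power2_eq_square power3_eq_cube)
    finally show "(\<integral>x. \<alpha> t k x ^ 3 \<partial>M k) / (p t)\<^sup>2 \<le> A * p t" .
  qed (use lam_nonneg in auto)
  finally show ?thesis
    by (simp add: sum_distrib_left[symmetric] power2_eq_square power3_eq_cube mult_ac)
qed

end

section \<open>Sums of powers of lags\<close>

lemma powr_increment_ge:
  fixes d q :: real
  assumes d: "0 < d \<or> d = 0 \<and> q < 1" and q: "0 < q" "q \<noteq> 1"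
  shows "(d + 1) powr (- q) \<le> ((d + 1) powr (1 - q) - d powr (1 - q)) / (1 - q)"
proof (cases "d = 0")
  case True
  then show ?thesis using d q by simp
next
  case False
  then have "\<exists>z>d. z < d + 1 \<and> (d + 1) powr (1 - q) - d powr (1 - q) = (d + 1 - d) * ((1 - q) * z powr (1 - q - 1))"
    using d by (intro MVT2 has_real_derivative_powr) auto
  then obtain z where z: "d < z" "z < d + 1" "(d + 1) powr (1 - q) - d powr (1 - q) = (1 - q) * z powr (- q)" by auto
  have "(d + 1) powr (- q) \<le> z powr (- q)" using z d q by (intro powr_mono2') auto
  then show ?thesis using q z(3) by simp
qed

lemma sum_powr_tail_le:
  assumes q: "1 < q" and r: "0 < r"
  shows "(\<Sum>i\<in>{r..<R}. (real i + 1) powr (- q)) \<le> real r powr (1 - q) / (q - 1)"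
proof -
  have "(\<Sum>i\<in>{r..<r + l}. (real i + 1) powr (- q)) \<le> (real r powr (1 - q) - real (r + l) powr (1 - q)) / (q - 1)" for l
  proof (induction l)
    case (Suc l)
    have "(real (r + l) + 1) powr (- q) \<le> ((real (r + l) + 1) powr (1 - q) - real (r + l) powr (1 - q)) / (1 - q)"
      using r q by (intro powr_increment_ge) auto
    also have "\<dots> = (real (r + l) powr (1 - q) - (real (r + l) + 1) powr (1 - q)) / (q - 1)"
      by (metis minus_diff_eq minus_divide_divide)
    finally show ?case using Suc by (simp add: diff_divide_distrib add_ac)
  qed simp
  note this[of "R - r"]
  also have "(real r powr (1 - q) - real (r + (R - r)) powr (1 - q)) / (q - 1) \<le> real r powr (1 - q) / (q - 1)"
    using q by (intro divide_right_mono) auto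
  finally have "(\<Sum>i\<in>{r..<r + (R - r)}. (real i + 1) powr (- q)) \<le> real r powr (1 - q) / (q - 1)" .
  moreover have "{r..<R} \<subseteq> {r..<r + (R - r)}" by auto
  ultimately show ?thesis using sum_mono2[of "{r..<r + (R - r)}" "{r..<R}" "\<lambda>i. (real i + 1) powr (- q)"] by simp
qed

lemma sum_powr_le:
  assumes q: "0 < q" "q < 1"
  shows "(\<Sum>i<r. (real i + 1) powr (- q)) \<le> real r powr (1 - q) / (1 - q)"
proof (induction r)
  case (Suc r)
  have "(real r + 1) powr (- q) \<le> ((real r + 1) powr (1 - q) - real r powr (1 - q)) / (1 - q)"
    using q by (intro powr_increment_ge) auto
  then show ?case using Suc by (simp add: diff_divide_distrib add_ac)
qed (use q in simp)

text \<open>Negative lags have weight zero: what happens after time \<open>t\<close> does not influence the noise at \<open>t\<close>.\<close>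

definition lag_weight :: "real \<Rightarrow> int \<Rightarrow> real" where
  "lag_weight q d = (if d < 0 then 0 else (real_of_int d + 1) powr (- q))"

lemma lag_weight_nonneg: "0 \<le> lag_weight q d" by (simp add: lag_weight_def)

lemma sum_lag_weight_reindex:
  assumes A: "finite A" and B: "finite B" "\<And>d. d \<in> A \<Longrightarrow> 0 \<le> d \<Longrightarrow> nat d \<in> B"
  shows "(\<Sum>d\<in>A. lag_weight q d) \<le> (\<Sum>i\<in>B. (real i + 1) powr (- q))"
proof -
  have "(\<Sum>d\<in>A. lag_weight q d) = (\<Sum>d\<in>{d \<in> A. 0 \<le> d}. lag_weight q d)"
    using A by (intro sum.mono_neutral_right) (auto simp: lag_weight_def)
  also have "\<dots> = (\<Sum>i\<in>nat ` {d \<in> A. 0 \<le> d}. (real i + 1) powr (- q))"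
    by (subst sum.reindex) (auto simp: inj_on_def lag_weight_def intro!: sum.cong)
  also have "\<dots> \<le> (\<Sum>i\<in>B. (real i + 1) powr (- q))" using B by (intro sum_mono2) auto
  finally show ?thesis .
qed

lemma sum_lag_weight_le:
  assumes q: "1 < q" and A: "finite A"
  shows "(\<Sum>d\<in>A. lag_weight q d) \<le> q / (q - 1)"
proof -
  obtain R where R: "\<And>d. d \<in> A \<Longrightarrow> nat d < R"
    using A finite_nat_set_iff_bounded[of "nat ` A"] by auto
  have "(\<Sum>d\<in>A. lag_weight q d) \<le> (\<Sum>i\<in>{0..<Suc R}. (real i + 1) powr (- q))"
    using R by (intro sum_lag_weight_reindex A) (auto intro: less_SucI)
  also have "\<dots> = 1 + (\<Sum>i\<in>{1..<Suc R}. (real i + 1) powr (- q))"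
    by (subst sum.atLeast_Suc_lessThan) auto
  also have "\<dots> \<le> 1 + real 1 powr (1 - q) / (q - 1)" by (intro add_left_mono sum_powr_tail_le q) simp
  also have "\<dots> = q / (q - 1)" using q by (simp add: field_simps)
  finally show ?thesis .
qed

lemma sum_lag_weight_tail_le:
  assumes q: "1 < q" and A: "finite A" "A \<subseteq> {int r..}" and r: "0 < r"
  shows "(\<Sum>d\<in>A. lag_weight q d) \<le> real r powr (1 - q) / (q - 1)"
proof -
  obtain R where R: "\<And>d. d \<in> A \<Longrightarrow> nat d < R"
    using A finite_nat_set_iff_bounded[of "nat ` A"] by auto
  have "(\<Sum>d\<in>A. lag_weight q d) \<le> (\<Sum>i\<in>{r..<R}. (real i + 1) powr (- q))"
    using R A by (intro sum_lag_weight_reindex) auto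
  also have "\<dots> \<le> real r powr (1 - q) / (q - 1)" by (rule sum_powr_tail_le[OF q r])
  finally show ?thesis .
qed

lemma sum_lag_weight_head_le:
  assumes q: "0 < q" "q < 1" and A: "finite A" "A \<subseteq> {..<int r}"
  shows "(\<Sum>d\<in>A. lag_weight q d) \<le> real r powr (1 - q) / (1 - q)"
proof -
  have "(\<Sum>d\<in>A. lag_weight q d) \<le> (\<Sum>i<r. (real i + 1) powr (- q))"
    using A by (intro sum_lag_weight_reindex) auto
  also have "\<dots> \<le> real r powr (1 - q) / (1 - q)" by (rule sum_powr_le[OF q])
  finally show ?thesis .
qed

text \<open>Schur's test: all but one of the factors are bounded by the row sums, the last is summed over columns.\<close>

lemma sum_power_row_sums_le:
  fixes w :: "'t \<Rightarrow> nat \<Rightarrow> real"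
  assumes w: "\<And>t k. 0 \<le> w t k" and row: "\<And>k. k < N \<Longrightarrow> (\<Sum>t\<in>T. w t k) \<le> Q" and col: "\<And>t. t \<in> T \<Longrightarrow> (\<Sum>k<N. w t k) \<le> Q"
    and Q: "0 \<le> Q"
  shows "(\<Sum>k<N. (\<Sum>t\<in>T. w t k) ^ Suc j) \<le> real (card T) * Q ^ Suc j"
proof -
  have "(\<Sum>k<N. (\<Sum>t\<in>T. w t k) ^ Suc j) \<le> (\<Sum>k<N. (\<Sum>t\<in>T. w t k) * Q ^ j)"
    unfolding power_Suc using w row by (intro sum_mono mult_left_mono power_mono sum_nonneg) auto
  also have "\<dots> = (\<Sum>t\<in>T. \<Sum>k<N. w t k) * Q ^ j" unfolding sum_distrib_right[symmetric] by (subst sum.swap) simp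
  also have "\<dots> \<le> (\<Sum>t\<in>T. Q) * Q ^ j" using col Q by (intro mult_right_mono sum_mono) auto
  finally show ?thesis by simp
qed

section \<open>The rate for sums over time with decaying dependence\<close>

text \<open>The arguments of \<open>f\<close> will have no second moment. Boundedness of \<open>f\<close> allows all its
increments to be truncated at one.\<close>

definition truncated_smooth :: "real \<Rightarrow> (real \<Rightarrow> real) \<Rightarrow> bool" where
  "truncated_smooth c f \<longleftrightarrow> f \<in> borel_measurable borel \<and> (\<forall>x. \<bar>f x\<bar> \<le> c) \<and> (\<forall>x y. \<bar>f x - f y\<bar> \<le> c * min 1 \<bar>x - y\<bar>) \<and>
     (\<forall>x u v. \<bar>f x - f (x + u) - f (x + v) + f (x + u + v)\<bar> \<le> c * (min 1 \<bar>u\<bar> * min 1 \<bar>v\<bar>))"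

lemma truncated_smoothD:
  assumes "truncated_smooth c f"
  shows "0 \<le> c" "f \<in> borel_measurable borel" "\<And>x. \<bar>f x\<bar> \<le> c" "\<And>x y. \<bar>f x - f y\<bar> \<le> c * min 1 \<bar>x - y\<bar>"
    and "\<And>x y. \<bar>f x - f y\<bar> \<le> c * \<bar>x - y\<bar>"
    and "\<And>x u v. \<bar>f x - f (x + u) - f (x + v) + f (x + u + v)\<bar> \<le> c * (min 1 \<bar>u\<bar> * min 1 \<bar>v\<bar>)"
proof -
  show "f \<in> borel_measurable borel" and b: "\<And>x. \<bar>f x\<bar> \<le> c" and i: "\<And>x y. \<bar>f x - f y\<bar> \<le> c * min 1 \<bar>x - y\<bar>"
    and "\<And>x u v. \<bar>f x - f (x + u) - f (x + v) + f (x + u + v)\<bar> \<le> c * (min 1 \<bar>u\<bar> * min 1 \<bar>v\<bar>)"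
    using assms by (auto simp: truncated_smooth_def)
  show c: "0 \<le> c" using b[of 0] by linarith
  show "\<bar>f x - f y\<bar> \<le> c * \<bar>x - y\<bar>" for x y
    using i[of x y] mult_left_mono[OF min.cobounded2[of 1 "\<bar>x - y\<bar>"] c] by linarith
qed

lemma C_b2_imp_truncated_smooth:
  assumes "f \<in> C_b2"
  obtains c where "truncated_smooth c f"
proof -
  from assms obtain f' f'' where f': "\<And>x. (f has_real_derivative f' x) (at x)" and f'': "\<And>x. (f' has_real_derivative f'' x) (at x)"
    and bd: "bounded (range f)" "bounded (range f')" "bounded (range f'')"
    by (auto simp: C_b2_def)
  obtain B0 B1 B2 where B012: "\<And>x. \<bar>f x\<bar> \<le> B0" "\<And>x. \<bar>f' x\<bar> \<le> B1" "\<And>x. \<bar>f'' x\<bar> \<le> B2"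
    using bd by (auto simp: bounded_iff)
  define B where "B = max B0 (max B1 B2)"
  have B: "\<bar>f x\<bar> \<le> B" "\<bar>f' x\<bar> \<le> B" "\<bar>f'' x\<bar> \<le> B" for x
    using B012[of x] by (auto simp: B_def)
  have B0: "0 \<le> B" using B(1)[of 0] by linarith
  have lip: "\<bar>g x - g y\<bar> \<le> D * \<bar>x - y\<bar>"
    if "\<And>z. (g has_real_derivative g' z) (at z)" "\<And>z. \<bar>g' z\<bar> \<le> D" for g g' :: "real \<Rightarrow> real" and D x y
    using field_differentiable_bound[of UNIV g g' D x y] that by simp
  have lf: "\<bar>f x - f y\<bar> \<le> B * \<bar>x - y\<bar>" for x y by (rule lip[OF f' B(2)])
  have lf': "\<bar>f' x - f' y\<bar> \<le> B * \<bar>x - y\<bar>" for x y by (rule lip[OF f'' B(3)])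
  have dd: "\<bar>(f (x + v) - f x) - (f (y + v) - f y)\<bar> \<le> B * \<bar>v\<bar> * \<bar>x - y\<bar>" for x y v
  proof (rule lip)
    show "((\<lambda>z. f (z + v) - f z) has_real_derivative f' (z + v) - f' z) (at z)" for z
      using f' by (auto intro!: derivative_eq_intros DERIV_shift[THEN iffD1] simp: DERIV_shift)
    show "\<bar>f' (z + v) - f' z\<bar> \<le> B * \<bar>v\<bar>" for z using lf'[of "z + v" z] by simp
  qed
  show thesis
  proof (rule that[of "4 * B"], unfold truncated_smooth_def, intro conjI allI)
    have "continuous_on UNIV f" using f' by (auto intro!: DERIV_continuous_on)
    then show "f \<in> borel_measurable borel" by (rule borel_measurable_continuous_onI)
    show "\<bar>f x\<bar> \<le> 4 * B" for x using B(1)[of x] by linarith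
    show "\<bar>f x - f y\<bar> \<le> 4 * B * min 1 \<bar>x - y\<bar>" for x y
      using B(1)[of x] B(1)[of y] lf[of x y] mult_nonneg_nonneg[OF B0 abs_ge_zero[of "x - y"]] by (auto simp: min_def)
    \<comment> \<open>four estimates, one for each choice of the two minima\<close>
    show "\<bar>f x - f (x + u) - f (x + v) + f (x + u + v)\<bar> \<le> 4 * B * (min 1 \<bar>u\<bar> * min 1 \<bar>v\<bar>)" for x u v
    proof -
      let ?d = "f x - f (x + u) - f (x + v) + f (x + u + v)"
      have "\<bar>?d\<bar> \<le> 4 * B" using B(1)[of x] B(1)[of "x + u"] B(1)[of "x + v"] B(1)[of "x + u + v"] by linarith
      moreover have "\<bar>?d\<bar> \<le> 2 * (B * \<bar>u\<bar>)" using lf[of x "x + u"] lf[of "x + u + v" "x + v"] by (simp add: algebra_simps)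
      moreover have "\<bar>?d\<bar> \<le> 2 * (B * \<bar>v\<bar>)" using lf[of x "x + v"] lf[of "x + u + v" "x + u"] by (simp add: algebra_simps)
      moreover have "\<bar>?d\<bar> \<le> B * \<bar>v\<bar> * \<bar>u\<bar>" using dd[of "x + u" v x] by (simp add: algebra_simps)
      moreover have "0 \<le> B * \<bar>u\<bar>" "0 \<le> B * \<bar>v\<bar>" "0 \<le> B * \<bar>v\<bar> * \<bar>u\<bar>" using B0 by auto
      ultimately show ?thesis by (auto simp: min_def mult_ac)
    qed
  qed
qed

lemma (in independent_coordinates) smooth_functional_of_linear_sums:
  fixes x :: "'t \<Rightarrow> nat \<Rightarrow> 'c \<Rightarrow> real" and f :: "real \<Rightarrow> real"
  assumes T: "finite T" and x[measurable]: "\<And>t k. t \<in> T \<Longrightarrow> k < N \<Longrightarrow> x t k \<in> borel_measurable (M k)"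
    and f: "truncated_smooth c f"
    and s: "0 \<le> s" and a: "\<And>t k. 0 \<le> a t k"
    and sq: "\<And>t k. t \<in> T \<Longrightarrow> k < N \<Longrightarrow> (\<integral>y. \<integral>z. min 1 ((x t k y - x t k z)\<^sup>2) \<partial>M k \<partial>M k) \<le> (a t k)\<^sup>2"
  shows "smooth_functional M N (\<lambda>w. s * (\<Sum>t\<in>T. f (\<Sum>k<N. x t k (w k)) - e t)) T
    (\<lambda>t k y z. min 1 \<bar>x t k y - x t k z\<bar>) (s * c) a"
proof -
  note c = truncated_smoothD(1)[OF f] and [measurable] = truncated_smoothD(2)[OF f] and fb = truncated_smoothD(3)[OF f]
    and f1 = truncated_smoothD(4)[OF f] and f2 = truncated_smoothD(6)[OF f]
  define S where "S t w = (\<Sum>k<N. x t k (w k))" for t and w :: "nat \<Rightarrow> 'c"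
  define W where "W w = s * (\<Sum>t\<in>T. f (S t w) - e t)" for w
  have S_upd: "S t (w(k := y)) = S t w + (x t k y - x t k (w k))" if "k < N" for t k y w
  proof -
    have "S t (w(k := y)) = x t k y + (\<Sum>i\<in>{..<N} - {k}. x t i (w i))"
      unfolding S_def using that by (subst sum.remove[of _ k]) (auto intro!: sum.cong)
    moreover have "S t w = x t k (w k) + (\<Sum>i\<in>{..<N} - {k}. x t i (w i))"
      unfolding S_def using that by (subst sum.remove[of _ k]) auto
    ultimately show ?thesis by simp
  qed
  have Sm[measurable]: "S t \<in> borel_measurable \<P>" if [simp]: "t \<in> T" for t
    unfolding S_def by measurable
  have Wm: "W \<in> borel_measurable \<P>" unfolding W_def by measurable
  have "smooth_functional M N W T (\<lambda>t k y z. min 1 \<bar>x t k y - x t k z\<bar>) (s * c) a"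
  proof
    show "finite T" by (rule T)
    show "bounded_rv W"
      unfolding bounded_rv_def
    proof (intro conjI exI ballI)
      fix w
      have "\<bar>\<Sum>t\<in>T. f (S t w) - e t\<bar> \<le> (\<Sum>t\<in>T. \<bar>f (S t w) - e t\<bar>)" by (rule sum_abs)
      also have "\<dots> \<le> (\<Sum>t\<in>T. c + \<bar>e t\<bar>)"
      proof (rule sum_mono)
        fix t show "\<bar>f (S t w) - e t\<bar> \<le> c + \<bar>e t\<bar>" using fb[of "S t w"] by linarith
      qed
      finally show "\<bar>W w\<bar> \<le> s * (\<Sum>t\<in>T. c + \<bar>e t\<bar>)" using s by (auto simp: W_def abs_mult intro!: mult_left_mono)
    qed (rule Wm)
    show "0 \<le> s * c" using s c by simp
    show "case_prod (\<lambda>y z. min 1 \<bar>x t k y - x t k z\<bar>) \<in> borel_measurable (M k \<Otimes>\<^sub>M M k)" if [simp]: "t \<in> T" "k < N" for t k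
      by measurable
    show "0 \<le> min 1 \<bar>x t k y - x t k z\<bar>" "min 1 \<bar>x t k y - x t k z\<bar> \<le> 1" for t k y z by auto
    show "0 \<le> a t k" for t k by (rule a)
    show "(\<integral>y. \<integral>z. (min 1 \<bar>x t k y - x t k z\<bar>)\<^sup>2 \<partial>M k \<partial>M k) \<le> (a t k)\<^sup>2" if "t \<in> T" "k < N" for t k
    proof -
      have "(min 1 \<bar>r\<bar>)\<^sup>2 = min 1 (r\<^sup>2)" for r :: real
        by (auto simp: min_def abs_le_square_iff[of 1 r, simplified] not_le)
      then show ?thesis using sq[OF that] by simp
    qed
    have f1': "\<bar>f r - f (r + u)\<bar> \<le> c * min 1 \<bar>u\<bar>" for r u using f1[of r "r + u"] by simp
    show "\<bar>W w - W (w(k := y))\<bar> \<le> s * c * (\<Sum>t\<in>T. min 1 \<bar>x t k (w k) - x t k y\<bar>)" if "k < N" for k w y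
    proof -
      have "W w - W (w(k := y)) = s * (\<Sum>t\<in>T. f (S t w) - f (S t w + (x t k y - x t k (w k))))"
        by (simp add: W_def S_upd[OF that] sum_subtractf right_diff_distrib del: fun_upd_apply)
      also have "\<bar>\<dots>\<bar> \<le> s * (\<Sum>t\<in>T. c * min 1 \<bar>x t k (w k) - x t k y\<bar>)"
        unfolding abs_mult abs_of_nonneg[OF s]
        by (subst abs_minus_commute) (intro mult_left_mono order.trans[OF sum_abs] sum_mono s f1')
      finally show ?thesis by (simp add: sum_distrib_left mult.assoc)
    qed
    show "\<bar>W w - W (w(j := y)) - W (w(k := z)) + W (w(j := y, k := z))\<bar>
        \<le> s * c * (\<Sum>t\<in>T. min 1 \<bar>x t j (w j) - x t j y\<bar> * min 1 \<bar>x t k (w k) - x t k z\<bar>)"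
      if "j < N" "k < N" "j \<noteq> k" for j k w y z
    proof -
      let ?u = "\<lambda>t. x t j y - x t j (w j)" and ?v = "\<lambda>t. x t k z - x t k (w k)"
      have S2: "S t (w(j := y, k := z)) = S t w + ?u t + ?v t" for t
        using S_upd[OF that(2), of t "w(j := y)" z] S_upd[OF that(1), of t w y] that(3) by simp
      have eq: "W w - W (w(j := y)) - W (w(k := z)) + W (w(j := y, k := z))
          = s * (\<Sum>t\<in>T. f (S t w) - f (S t w + ?u t) - f (S t w + ?v t) + f (S t w + ?u t + ?v t))"
        unfolding W_def S_upd[OF that(1)] S_upd[OF that(2), of _ w] S2
        by (simp add: sum_subtractf sum.distrib right_diff_distrib distrib_left)
      have sym: "\<bar>?u t\<bar> = \<bar>x t j (w j) - x t j y\<bar>" "\<bar>?v t\<bar> = \<bar>x t k (w k) - x t k z\<bar>" for t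
        by (rule abs_minus_commute)+
      have "\<bar>W w - W (w(j := y)) - W (w(k := z)) + W (w(j := y, k := z))\<bar> \<le> s * (\<Sum>t\<in>T. c * (min 1 \<bar>?u t\<bar> * min 1 \<bar>?v t\<bar>))"
        unfolding eq abs_mult abs_of_nonneg[OF s]
        by (rule mult_left_mono[OF order.trans[OF sum_abs] s], rule sum_mono, rule f2)
      then show ?thesis unfolding sym by (simp only: sum_distrib_left mult.assoc)
    qed
  qed
  then show ?thesis by (simp only: W_def[abs_def] S_def)
qed

lemma banded_sum_bounds:
  fixes g :: "int \<Rightarrow> real"
  assumes g: "\<And>d. 0 \<le> g d" and fsum: "\<And>A. finite A \<Longrightarrow> (\<Sum>d\<in>A. g d) \<le> Q"
  shows "(\<Sum>t\<in>{1..int n}. g (t + \<delta> - int k)) \<le> Q" and "(\<Sum>k<N. g (t + \<delta> - int k)) \<le> Q"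
    and "(\<Sum>k<N. (\<Sum>t\<in>{1..int n}. g (t + \<delta> - int k)) ^ Suc j) \<le> real n * Q ^ Suc j"
proof -
  show row: "(\<Sum>t\<in>{1..int n}. g (t + \<delta> - int k)) \<le> Q" for k
    using fsum[OF finite_imageI[OF finite_atLeastAtMost_int], of "\<lambda>t. t + \<delta> - int k" 1 "int n"]
    by (subst (asm) sum.reindex) (auto simp: inj_on_def)
  show col: "(\<Sum>k<N. g (t + \<delta> - int k)) \<le> Q" for t
    using fsum[OF finite_imageI[OF finite_lessThan], of "\<lambda>k. t + \<delta> - int k" N]
    by (subst (asm) sum.reindex) (auto simp: inj_on_def)
  show "(\<Sum>k<N. (\<Sum>t\<in>{1..int n}. g (t + \<delta> - int k)) ^ Suc j) \<le> real n * Q ^ Suc j"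
    using sum_power_row_sums_le[of "\<lambda>t k. g (t + \<delta> - int k)" N "{1..int n}" Q j] row col g fsum[of "{}"] by simp
qed

text \<open>The first three summands stem from low lags, from high lags, and from the product of moments; the last from \<open>1 - U\<close>.\<close>

definition stein_rate_const :: "real \<Rightarrow> real \<Rightarrow> real \<Rightarrow> real \<Rightarrow> real" where
  "stein_rate_const C A \<gamma> \<kappa> =
     C * (16 * \<kappa> ^ 3 * A\<^sup>2 / ((1 - \<gamma>) / 3) ^ 3 + 16 * \<kappa>\<^sup>2 * A\<^sup>2 / \<gamma>\<^sup>2 + (\<kappa> * A * ((1 + \<gamma> / 2) / (\<gamma> / 2))) ^ 3)
     + 2 * C * (2 * \<kappa>\<^sup>2 * sqrt ((A * ((1 + \<gamma> / 2) / (\<gamma> / 2))) ^ 6) + 1)"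

lemma stein_rate_const_nonneg:
  "0 \<le> C \<Longrightarrow> 0 \<le> A \<Longrightarrow> 0 < \<gamma> \<Longrightarrow> \<gamma> < 1 \<Longrightarrow> 0 \<le> \<kappa> \<Longrightarrow> 0 \<le> stein_rate_const C A \<gamma> \<kappa>"
  unfolding stein_rate_const_def by (intro add_nonneg_nonneg mult_nonneg_nonneg divide_nonneg_nonneg zero_le_power real_sqrt_ge_zero) auto

text \<open>With \<open>lam\<close> of order \<open>n\<^sup>-\<^sup>1\<^sup>/\<^sup>2\<close>, all row and column sums of the weights are bounded, so the variance of \<open>U\<close> and the product of
moments are of order \<open>1 / n\<close> and of order \<open>n\<^sup>-\<^sup>1\<^sup>/\<^sup>2\<close>. In the truncated third moment, the lags below \<open>r\<close> contribute
\<open>n\<^sup>-\<^sup>1\<^sup>/\<^sup>2\<close> times the cube of the partial sum up to \<open>r\<close> of the powers \<open>-(2 + \<gamma>)/3\<close>, that is \<open>r\<close> to the power \<open>1 - \<gamma>\<close>; the lags above \<open>r\<close> contribute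
the square of the tail sum of the powers \<open>-1 - \<gamma>/2\<close>, that is \<open>r\<close> to the power \<open>-\<gamma>\<close>. For \<open>r\<close> near the square root of \<open>n\<close> both are
of order \<open>n\<close> to the power \<open>-\<gamma>/2\<close>. The second moment \<open>s2\<close> is near one, as the functional
will approximate a standardized one.\<close>

lemma stein_rate:
  fixes n :: nat and \<phi> \<phi>' :: "real \<Rightarrow> real"
  assumes sf: "smooth_functional M N W {1..int n} q lam (\<lambda>t k. A * lag_weight (1 + \<gamma> / 2) (t + \<delta> - int k))"
    and n: "0 < n" and A: "0 \<le> A" and \<gamma>: "0 < \<gamma>" "\<gamma> < 1" and \<kappa>: "0 \<le> \<kappa>" and lam: "lam \<le> \<kappa> * real n powr (- (1/2))"
    and EW: "(\<integral>w. W w \<partial>PiM {..<N} M) = 0" and s2: "s2 = (\<integral>w. (W w)\<^sup>2 \<partial>PiM {..<N} M)"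
    and reg: "stein_regular C \<phi> \<phi>'"
    and C: "0 \<le> C"
  shows "\<bar>\<integral>w. \<phi>' (W w) - W w * \<phi> (W w) \<partial>PiM {..<N} M\<bar>
    \<le> stein_rate_const C A \<gamma> \<kappa> * (1 + s2) * (real n powr (- \<gamma> / 2) + \<bar>1 - s2\<bar>)"
proof -
  let ?a = "\<lambda>t k. A * lag_weight (1 + \<gamma> / 2) (t + \<delta> - int k)"
  let ?s = "\<lambda>(g :: int \<Rightarrow> real) k. \<Sum>t\<in>{1..int n}. g (t + \<delta> - int k)"
  interpret smooth_functional M N W "{1..int n}" q lam ?a by (rule sf)
  let ?e = "\<lambda>k. (\<integral>x. min (influence k x ^ 3) ((influence k x)\<^sup>2) \<partial>M k) + (\<integral>x. influence k x \<partial>M k) * (\<integral>x. (influence k x)\<^sup>2 \<partial>M k)"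
  define g where "g = lag_weight (1 + \<gamma> / 2)"
  define P where "P = (1 + \<gamma> / 2) / (\<gamma> / 2)"
  define p where "p = (2 + \<gamma>) / 3"
  define r where "r = nat \<lceil>sqrt (real n)\<rceil>"
  have r: "sqrt (real n) \<le> real r" "real r \<le> 2 * sqrt (real n)" "0 < r"
  proof -
    have "1 \<le> sqrt (real n)" using n by simp
    then show "sqrt (real n) \<le> real r" "real r \<le> 2 * sqrt (real n)" "0 < r" unfolding r_def by linarith+
  qed
  \<comment> \<open>\<open>h\<close> and \<open>l\<close> are the weights of low lags in \<open>L\<^sup>3\<close> and of high lags in \<open>L\<^sup>2\<close>\<close>
  define h where "h d = (if 0 \<le> d \<and> d < int r then lag_weight p d else 0)" for d
  define l where "l d = (if int r \<le> d then lag_weight (1 + \<gamma> / 2) d else 0)" for d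
  define S where "S k = {t \<in> {1..int n}. 0 \<le> t + \<delta> - int k \<and> t + \<delta> - int k < int r}" for k
  define Q where "Q = real r powr ((1 - \<gamma>) / 3) / ((1 - \<gamma>) / 3)"
  define R where "R = real r powr (- \<gamma> / 2) / (\<gamma> / 2)"
  define X where "X = real n powr (- \<gamma> / 2)"
  have gp: "0 \<le> g d" "0 \<le> h d" "0 \<le> l d" for d by (auto simp: g_def h_def l_def lag_weight_nonneg)
  have P0: "0 \<le> P" "0 \<le> Q" "0 \<le> R" and X0: "0 \<le> X" using \<gamma> by (auto simp: P_def Q_def R_def X_def)
  have gs: "(\<Sum>d\<in>B. g d) \<le> P" if "finite B" for B
    using sum_lag_weight_le[of "1 + \<gamma> / 2" B] that \<gamma> by (simp add: g_def P_def)
  have hs: "(\<Sum>d\<in>B. h d) \<le> Q" if "finite B" for B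
  proof -
    have "(\<Sum>d\<in>B. h d) = (\<Sum>d\<in>{d \<in> B. 0 \<le> d \<and> d < int r}. lag_weight p d)"
      using that by (auto simp: h_def sum.If_cases Int_def)
    also have "\<dots> \<le> real r powr (1 - p) / (1 - p)" using that \<gamma> by (intro sum_lag_weight_head_le) (auto simp: p_def)
    also have "1 - p = (1 - \<gamma>) / 3" by (simp add: p_def field_simps)
    finally show ?thesis by (simp add: Q_def)
  qed
  have ls: "(\<Sum>d\<in>B. l d) \<le> R" if "finite B" for B
  proof -
    have "(\<Sum>d\<in>B. l d) = (\<Sum>d\<in>{d \<in> B. int r \<le> d}. lag_weight (1 + \<gamma> / 2) d)"
      using that by (auto simp: l_def sum.If_cases Int_def)
    also have "\<dots> \<le> real r powr (1 - (1 + \<gamma> / 2)) / (1 + \<gamma> / 2 - 1)" using that \<gamma> r(3) by (intro sum_lag_weight_tail_le) auto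
    finally show ?thesis by (simp add: R_def)
  qed
  note bg = banded_sum_bounds[of g, OF gp(1) gs] and bh = banded_sum_bounds[of h, OF gp(2) hs] and bl = banded_sum_bounds[of l, OF gp(3) ls]
  have D: "(\<Sum>k<N. \<Sum>s\<in>{1..int n}. ?a s k * (?a t k)) \<le> (A * P)\<^sup>2" for t
  proof -
    have "(\<Sum>k<N. \<Sum>s\<in>{1..int n}. A * g (s + \<delta> - int k) * (A * g (t + \<delta> - int k)))
        = A\<^sup>2 * (\<Sum>k<N. g (t + \<delta> - int k) * (\<Sum>s\<in>{1..int n}. g (s + \<delta> - int k)))"
      by (simp add: sum_distrib_left power2_eq_square mult_ac)
    also have "\<dots> \<le> A\<^sup>2 * (\<Sum>k<N. g (t + \<delta> - int k) * P)" by (intro mult_left_mono sum_mono bg(1) gp) auto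
    also have "\<dots> = A\<^sup>2 * ((\<Sum>k<N. g (t + \<delta> - int k)) * P)" by (simp add: sum_distrib_right)
    also have "\<dots> \<le> A\<^sup>2 * (P * P)" by (intro mult_left_mono mult_right_mono bg(2) P0) auto
    finally show ?thesis by (simp add: g_def power2_eq_square mult_ac)
  qed
  have lam_pow: "lam ^ i * real n \<le> \<kappa> ^ i * real n powr (1 - real i / 2)" for i
  proof -
    have "lam ^ i \<le> (\<kappa> * real n powr (- (1/2))) ^ i" by (rule power_mono[OF lam lam_nonneg])
    then have "lam ^ i * real n \<le> (\<kappa> * real n powr (- (1/2))) ^ i * real n" by (rule mult_right_mono) simp
    also have "\<dots> = \<kappa> ^ i * (real n powr (- real i / 2) * real n powr 1)"
      using n by (simp add: power_mult_distrib powr_power)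
    also have "\<dots> = \<kappa> ^ i * real n powr (1 - real i / 2)" by (simp only: powr_add[symmetric]) (simp add: algebra_simps)
    finally show ?thesis .
  qed
  have half_le: "real n powr (- (1/2)) \<le> X" unfolding X_def using n \<gamma> by (intro powr_mono) auto
  have Q3: "Q ^ 3 \<le> 2 * real n powr ((1 - \<gamma>) / 2) / ((1 - \<gamma>) / 3) ^ 3"
  proof -
    have "Q ^ 3 = real r powr (1 - \<gamma>) / ((1 - \<gamma>) / 3) ^ 3" using r(3) by (simp add: Q_def power_divide powr_power diff_divide_distrib)
    also have "real r powr (1 - \<gamma>) \<le> (2 * sqrt (real n)) powr (1 - \<gamma>)" using r \<gamma> by (intro powr_mono2) auto
    also have "\<dots> = 2 powr (1 - \<gamma>) * real n powr ((1 - \<gamma>) / 2)" using n by (simp add: powr_mult powr_half_sqrt[symmetric] powr_powr)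
    also have "\<dots> \<le> 2 powr 1 * real n powr ((1 - \<gamma>) / 2)" using \<gamma> by (intro mult_right_mono powr_mono) auto
    finally show ?thesis using \<gamma> by (simp add: divide_right_mono)
  qed
  have R2: "R\<^sup>2 \<le> 4 * X / \<gamma>\<^sup>2"
  proof -
    have "R\<^sup>2 = 4 * real r powr (- \<gamma>) / \<gamma>\<^sup>2" using r(3) by (simp add: R_def power_divide powr_power)
    also have "real r powr (- \<gamma>) \<le> sqrt (real n) powr (- \<gamma>)" using r n \<gamma> by (intro powr_mono2') auto
    also have "\<dots> = X" using n by (simp add: X_def powr_half_sqrt[symmetric] powr_powr)
    finally show ?thesis using \<gamma> by (simp add: divide_right_mono)
  qed
  have E3: "(\<Sum>k<N. ?e k)
    \<le> (16 * \<kappa> ^ 3 * A\<^sup>2 / ((1 - \<gamma>) / 3) ^ 3 + 16 * \<kappa>\<^sup>2 * A\<^sup>2 / \<gamma>\<^sup>2 + (\<kappa> * A * P) ^ 3) * X"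
  proof -
    have "?e k
       \<le> 8 * lam ^ 3 * A\<^sup>2 * ?s h k ^ Suc 2 + 4 * lam\<^sup>2 * A\<^sup>2 * ?s l k ^ Suc 1
         + lam ^ 3 * A ^ 3 * ?s g k ^ Suc 2" if k: "k < N" for k
    proof -
      have "(\<integral>x. min (influence k x ^ 3) ((influence k x)\<^sup>2) \<partial>M k)
          \<le> 8 * lam ^ 3 * A\<^sup>2 * (\<Sum>t\<in>S k. lag_weight p (t + \<delta> - int k)) ^ 3
            + 4 * (lam * (\<Sum>t\<in>{1..int n} - S k. ?a t k))\<^sup>2"
      proof (rule influence_min_moment[OF k])
        show "S k \<subseteq> {1..int n}" by (auto simp: S_def)
        fix t assume t: "t \<in> S k"
        then have d: "0 \<le> t + \<delta> - int k" by (simp add: S_def)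
        then show "0 < lag_weight p (t + \<delta> - int k)" by (simp add: lag_weight_def)
        have "((real_of_int d + 1) powr (- (1 + \<gamma> / 2)))\<^sup>2 = ((real_of_int d + 1) powr (- p)) ^ 3" if "0 \<le> d" for d
          using that by (simp add: powr_power p_def add_divide_distrib)
        from this[OF d] show "(?a t k)\<^sup>2 \<le> A\<^sup>2 * lag_weight p (t + \<delta> - int k) ^ 3"
          using d by (simp only: lag_weight_def power_mult_distrib not_less[symmetric] if_False order_refl)
      qed
      moreover have "(\<Sum>t\<in>S k. lag_weight p (t + \<delta> - int k)) = ?s h k"
        by (rule sum.mono_neutral_cong_left) (auto simp: S_def h_def)
      moreover have "(\<Sum>t\<in>{1..int n} - S k. ?a t k) = A * ?s l k"
        unfolding sum_distrib_left by (rule sum.mono_neutral_cong_left) (auto simp: S_def l_def lag_weight_def)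
      moreover have "(\<integral>x. influence k x \<partial>M k) * (\<integral>x. (influence k x)\<^sup>2 \<partial>M k)
          \<le> (lam * (A * ?s g k)) * (lam * (A * ?s g k))\<^sup>2"
        using influence_first_moment[OF k] influence_square[OF k] lam_nonneg A
        unfolding g_def sum_distrib_left[symmetric]
        by (intro mult_mono) (auto intro!: mult_nonneg_nonneg sum_nonneg lag_weight_nonneg)
      ultimately show ?thesis by (simp add: power2_eq_square power3_eq_cube mult_ac)
    qed
    then have "(\<Sum>k<N. ?e k)
       \<le> (\<Sum>k<N. 8 * lam ^ 3 * A\<^sup>2 * ?s h k ^ Suc 2 + 4 * lam\<^sup>2 * A\<^sup>2 * ?s l k ^ Suc 1
         + lam ^ 3 * A ^ 3 * ?s g k ^ Suc 2)"
      by (intro sum_mono) simp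
    also have "\<dots> = 8 * lam ^ 3 * A\<^sup>2 * (\<Sum>k<N. ?s h k ^ Suc 2)
        + 4 * lam\<^sup>2 * A\<^sup>2 * (\<Sum>k<N. ?s l k ^ Suc 1)
        + lam ^ 3 * A ^ 3 * (\<Sum>k<N. ?s g k ^ Suc 2)"
      by (simp only: sum.distrib sum_distrib_left)
    also have "\<dots> \<le> 8 * lam ^ 3 * A\<^sup>2 * (real n * Q ^ Suc 2) + 4 * lam\<^sup>2 * A\<^sup>2 * (real n * R ^ Suc 1) + lam ^ 3 * A ^ 3 * (real n * P ^ Suc 2)"
      using lam_nonneg A by (intro add_mono mult_left_mono bh(3) bl(3) bg(3)) auto
    also have "\<dots> = 8 * A\<^sup>2 * ((lam ^ 3 * real n) * Q ^ 3) + 4 * A\<^sup>2 * ((lam\<^sup>2 * real n) * R\<^sup>2) + A ^ 3 * P ^ 3 * (lam ^ 3 * real n)"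
      by (simp add: power2_eq_square power3_eq_cube mult_ac)
    also have "\<dots> \<le> 8 * A\<^sup>2 * ((\<kappa> ^ 3 * real n powr (- (1/2))) * (2 * real n powr ((1 - \<gamma>) / 2) / ((1 - \<gamma>) / 3) ^ 3))
        + 4 * A\<^sup>2 * (\<kappa>\<^sup>2 * (4 * X / \<gamma>\<^sup>2)) + A ^ 3 * P ^ 3 * (\<kappa> ^ 3 * X)"
    proof -
      have l3: "lam ^ 3 * real n \<le> \<kappa> ^ 3 * real n powr (- (1/2))" using lam_pow[of 3] by simp
      have l2: "lam\<^sup>2 * real n \<le> \<kappa>\<^sup>2" using lam_pow[of 2] n by simp
      have l3': "lam ^ 3 * real n \<le> \<kappa> ^ 3 * X" using l3 mult_left_mono[OF half_le zero_le_power[OF \<kappa>, of 3]] by simp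
      have nn: "0 \<le> \<kappa> ^ 3 * real n powr (- (1/2))" "0 \<le> Q ^ 3" "0 \<le> \<kappa>\<^sup>2" "0 \<le> R\<^sup>2" "0 \<le> 8 * A\<^sup>2" "0 \<le> 4 * A\<^sup>2" "0 \<le> A ^ 3 * P ^ 3"
        using \<kappa> A P0 by auto
      show ?thesis
        by (rule add_mono[OF add_mono[OF mult_left_mono[OF mult_mono[OF l3 Q3 nn(1,2)] nn(5)]
          mult_left_mono[OF mult_mono[OF l2 R2 nn(3,4)] nn(6)]] mult_left_mono[OF l3' nn(7)]])
    qed
    also have "(\<kappa> ^ 3 * real n powr (- (1/2))) * (2 * real n powr ((1 - \<gamma>) / 2) / ((1 - \<gamma>) / 3) ^ 3) = 2 * \<kappa> ^ 3 * X / ((1 - \<gamma>) / 3) ^ 3"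
    proof -
      have "real n powr (- (1/2)) * real n powr ((1 - \<gamma>) / 2) = X"
        unfolding X_def powr_add[symmetric] by (simp add: diff_divide_distrib)
      then show ?thesis by (simp add: mult_ac)
    qed
    finally show ?thesis by (simp add: distrib_left distrib_right power_mult_distrib mult_ac)
  qed
  have s20: "0 \<le> s2" unfolding s2 by simp
  have D3: "sqrt (4 * lam ^ 4 * ((A * P)\<^sup>2) ^ 3 * card {1..int n} + (1 - s2)\<^sup>2) \<le> 2 * \<kappa>\<^sup>2 * sqrt ((A * P) ^ 6) * X + \<bar>1 - s2\<bar>"
  proof -
    have "4 * lam ^ 4 * ((A * P)\<^sup>2) ^ 3 * card {1..int n} = 4 * (A * P) ^ 6 * (lam ^ 4 * real n)"
      by (simp add: power_mult[symmetric] mult_ac)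
    also have "\<dots> \<le> 4 * (A * P) ^ 6 * (\<kappa> ^ 4 * real n powr - 1)"
      using lam_pow[of 4] A P0 by (intro mult_left_mono) auto
    finally have le: "4 * lam ^ 4 * ((A * P)\<^sup>2) ^ 3 * card {1..int n} \<le> 4 * (A * P) ^ 6 * (\<kappa> ^ 4 * real n powr - 1)" .
    have "sqrt (4 * (A * P) ^ 6 * (\<kappa> ^ 4 * real n powr - 1)) = 2 * sqrt ((A * P) ^ 6) * (\<kappa>\<^sup>2 * real n powr (- (1/2)))"
    proof -
      have "sqrt (\<kappa> ^ 4) = \<kappa>\<^sup>2" by (rule real_sqrt_unique) (auto simp: power_mult[symmetric])
      moreover have "sqrt (real n powr - 1) = real n powr (- (1/2))"
        by (rule real_sqrt_unique) (use n in \<open>auto simp: powr_power\<close>)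
      moreover have "sqrt 4 = (2 :: real)" by simp
      ultimately show ?thesis by (simp only: real_sqrt_mult mult.assoc)
    qed
    also have "\<dots> \<le> 2 * sqrt ((A * P) ^ 6) * (\<kappa>\<^sup>2 * X)"
      by (intro mult_left_mono half_le) (use A P0 in auto)
    finally have "sqrt (4 * lam ^ 4 * ((A * P)\<^sup>2) ^ 3 * card {1..int n}) \<le> 2 * sqrt ((A * P) ^ 6) * (\<kappa>\<^sup>2 * X)"
      using real_sqrt_le_mono[OF le] by linarith
    moreover have "sqrt (4 * lam ^ 4 * ((A * P)\<^sup>2) ^ 3 * card {1..int n} + (1 - s2)\<^sup>2)
        \<le> sqrt (4 * lam ^ 4 * ((A * P)\<^sup>2) ^ 3 * card {1..int n}) + sqrt ((1 - s2)\<^sup>2)"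
      using A P0 by (intro sqrt_add_le_add_sqrt) auto
    ultimately show ?thesis by (simp add: mult_ac)
  qed
  have sq22: "sqrt (2 + 2 * s2) \<le> 2 * (1 + s2)"
  proof (rule real_le_lsqrt)
    have "(2 * (1 + s2))\<^sup>2 = 4 + 8 * s2 + 4 * s2\<^sup>2" by (simp add: power2_eq_square algebra_simps)
    then show "2 + 2 * s2 \<le> (2 * (1 + s2))\<^sup>2" using s20 zero_le_power2[of s2] by linarith
  qed (use s20 in auto)
  let ?E = "16 * \<kappa> ^ 3 * A\<^sup>2 / ((1 - \<gamma>) / 3) ^ 3 + 16 * \<kappa>\<^sup>2 * A\<^sup>2 / \<gamma>\<^sup>2 + (\<kappa> * A * P) ^ 3"
  let ?F = "2 * \<kappa>\<^sup>2 * sqrt ((A * P) ^ 6)"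
  have EF0: "0 \<le> ?E" "0 \<le> ?F" using \<kappa> A \<gamma> P0 by auto
  have "\<bar>\<integral>w. \<phi>' (W w) - W w * \<phi> (W w) \<partial>PiM {..<N} M\<bar>
      \<le> C * (1 + s2) * (\<Sum>k<N. ?e k)
       + C * sqrt (2 + 2 * s2) * sqrt (4 * lam ^ 4 * ((A * P)\<^sup>2) ^ 3 * card {1..int n} + (1 - s2)\<^sup>2)"
    by (rule stein_bound[OF EW s2 D _ reg C]) simp
  also have "\<dots> \<le> C * (1 + s2) * (?E * X) + C * (2 * (1 + s2)) * (?F * X + \<bar>1 - s2\<bar>)"
    using C s20 by (intro add_mono mult_left_mono mult_mono E3 D3 sq22) auto
  also have "\<dots> = (1 + s2) * (C * ?E * X + 2 * C * ?F * X + 2 * C * \<bar>1 - s2\<bar>)" by (simp add: algebra_simps)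
  also have "\<dots> \<le> (1 + s2) * ((C * ?E + 2 * C * (?F + 1)) * (X + \<bar>1 - s2\<bar>))"
  proof (rule mult_left_mono)
    have "C * e * X + 2 * C * f * X + 2 * C * d \<le> (C * e + 2 * C * (f + 1)) * (X + d)" if "0 \<le> e" "0 \<le> f" "0 \<le> d" for e f d
    proof -
      have "0 \<le> C * e * d" "0 \<le> C * f * d" "0 \<le> C * X" using that C X0 by auto
      then show ?thesis by (simp add: algebra_simps)
    qed
    from this[OF EF0 abs_ge_zero]
    show "C * ?E * X + 2 * C * ?F * X + 2 * C * \<bar>1 - s2\<bar> \<le> (C * ?E + 2 * C * (?F + 1)) * (X + \<bar>1 - s2\<bar>)" .
  qed (use s20 in simp)
  also have "\<dots> = stein_rate_const C A \<gamma> \<kappa> * (1 + s2) * (X + \<bar>1 - s2\<bar>)"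
    unfolding stein_rate_const_def P_def by (simp only: ac_simps)
  finally show ?thesis by (simp only: X_def)
qed

section \<open>From setwise convergence to convergence in the mean\<close>

text \<open>A sliding hump argument, as for the Vitali--Hahn--Saks theorem. On the set \<open>E m\<close>, where \<open>\<phi> n\<close> is
at most one for all \<open>n \<ge> m\<close>, dominated convergence applies; for fixed \<open>n\<close>, the mass of \<open>\<phi> n\<close> outside \<open>E m\<close> is
small for large \<open>m\<close>. If the positive parts do not vanish, a subsequence can be chosen whose \<open>i\<close>-th member has almost all its
mass in a ring \<open>D i\<close>, and the rings are disjoint. Let \<open>A\<close> collect, from every second ring, the points at which
the corresponding function is positive. The integrals over \<open>A\<close> then alternate between
values above \<open>e / 2\<close> and values below \<open>e / 4\<close>.\<close>

lemma setwise_convergent_imp_pos_part_null: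
  fixes \<phi> :: "nat \<Rightarrow> real \<Rightarrow> real"
  assumes int: "\<And>n. integrable lborel (\<phi> n)"
    and lim: "AE s in lborel. (\<lambda>n. \<phi> n s) \<longlonglongrightarrow> 0"
    and conv: "\<And>A. A \<in> sets borel \<Longrightarrow> convergent (\<lambda>n. \<integral>s. indicator A s * \<phi> n s \<partial>lborel)"
  shows "(\<lambda>n. \<integral>s. max (\<phi> n s) 0 \<partial>lborel) \<longlonglongrightarrow> 0"
proof (rule ccontr)
  have [measurable]: "\<phi> n \<in> borel_measurable borel" for n using int[of n] by auto
  define E where "E m = {s. \<bar>s\<bar> \<le> real m \<and> (\<forall>n\<ge>m. \<bar>\<phi> n s\<bar> \<le> 1)}" for m
  have E_meas[measurable]: "E m \<in> sets borel" for m unfolding E_def by measurable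
  have E_mono: "E m \<subseteq> E m'" if "m \<le> m'" for m m' using that by (force simp: E_def)
  have iA: "integrable lborel (\<lambda>s. indicator A s * \<bar>\<phi> n s\<bar>)" if "A \<in> sets borel" for A n
    using integrable_mult_indicator[OF _ integrable_abs[OF int], of A n] that by simp
  have iA': "integrable lborel (\<lambda>s. indicator A s * \<phi> n s)" if "A \<in> sets borel" for A n
    using integrable_mult_indicator[OF _ int, of A n] that by simp
  have ip: "integrable lborel (\<lambda>s. max (\<phi> n s) 0)" for n using int by simp
  have inner: "(\<lambda>n. \<integral>s. indicator (E m) s * \<bar>\<phi> n s\<bar> \<partial>lborel) \<longlonglongrightarrow> 0" for m
  proof -
    have "(\<lambda>n. \<integral>s. indicator (E m) s * \<bar>\<phi> (n + m) s\<bar> \<partial>lborel) \<longlonglongrightarrow> integral\<^sup>L lborel (\<lambda>s::real. 0)"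
    proof (rule integral_dominated_convergence[where w = "indicator {- real m..real m}"])
      show "integrable lborel (indicat_real {- real m..real m})" by simp
      show "AE s in lborel. (\<lambda>n. indicator (E m) s * \<bar>\<phi> (n + m) s\<bar>) \<longlonglongrightarrow> 0"
        using lim
      proof eventually_elim
        case (elim s)
        from tendsto_mult_left[OF tendsto_rabs_zero[OF LIMSEQ_ignore_initial_segment[OF elim, of m]], of "indicator (E m) s"]
        show ?case by simp
      qed
      show "AE s in lborel. norm (indicator (E m) s * \<bar>\<phi> (n + m) s\<bar>) \<le> indicator {- real m..real m} s" for n
        by (intro AE_I2) (auto simp: E_def abs_le_iff split: split_indicator)
    qed measurable
    then show ?thesis by (subst LIMSEQ_offset) (auto simp: LIMSEQ_offset[where k = m])
  qed
  have outer: "(\<lambda>m. \<integral>s. indicator (- E m) s * \<bar>\<phi> n s\<bar> \<partial>lborel) \<longlonglongrightarrow> 0" for n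
  proof -
    have "(\<lambda>m. \<integral>s. indicator (- E m) s * \<bar>\<phi> n s\<bar> \<partial>lborel) \<longlonglongrightarrow> integral\<^sup>L lborel (\<lambda>s::real. 0)"
    proof (rule integral_dominated_convergence[where w = "\<lambda>s. \<bar>\<phi> n s\<bar>"])
      show "integrable lborel (\<lambda>s. \<bar>\<phi> n s\<bar>)" using int by simp
      show "AE s in lborel. (\<lambda>m. indicator (- E m) s * \<bar>\<phi> n s\<bar>) \<longlonglongrightarrow> 0"
        using lim
      proof eventually_elim
        case (elim s)
        from LIMSEQ_D[OF elim, of 1] obtain N where N: "\<And>n. n \<ge> N \<Longrightarrow> \<bar>\<phi> n s\<bar> < 1" by auto
        obtain K :: nat where K: "\<bar>s\<bar> \<le> real K" using real_arch_simple by blast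
        have "s \<in> E m" if "m \<ge> max N K" for m
          using that order_trans[OF K, of "real m"] less_imp_le[OF N] by (auto simp: E_def)
        then show ?case
          by (intro tendsto_eventually eventually_sequentiallyI[of "max N K"]) (auto split: split_indicator)
      qed
    qed (auto split: split_indicator)
    then show ?thesis by simp
  qed
  assume "\<not> ?thesis"
  then obtain e where e: "0 < e" and inf: "\<And>N. \<exists>n\<ge>N. e \<le> (\<integral>s. max (\<phi> n s) 0 \<partial>lborel)"
    unfolding LIMSEQ_iff by (auto simp: not_less abs_of_nonneg)
  \<comment> \<open>two errors of size \<open>e'\<close>, counted twice, leave \<open>e / 2\<close> on the rings in \<open>A\<close>; counted once, they make \<open>e / 4\<close> on the others\<close>
  define e' where "e' = e / 8"
  have e': "0 < e'" using e by (simp add: e'_def)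
  let ?out = "\<lambda>n m. (\<integral>s. indicator (- E m) s * \<bar>\<phi> n s\<bar> \<partial>lborel) < e'"
  let ?in = "\<lambda>n m. (\<integral>s. indicator (E m) s * \<bar>\<phi> n s\<bar> \<partial>lborel) < e'"
  have out_ex: "\<exists>m'\<ge>m. ?out n m'" for n m
  proof -
    from order_tendstoD(2)[OF outer e'] have "\<forall>\<^sub>F m' in sequentially. ?out n m'" .
    then have "\<forall>\<^sub>F m' in sequentially. ?out n m' \<and> m \<le> m'" using eventually_ge_at_top by (rule eventually_conj)
    from eventually_happens'[OF sequentially_bot this] show ?thesis by blast
  qed
  have "\<exists>nm :: nat \<Rightarrow> nat \<times> nat. \<forall>i. (?out (fst (nm i)) (snd (nm i)) \<and> e \<le> (\<integral>s. max (\<phi> (fst (nm i)) s) 0 \<partial>lborel)) \<and>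
      (fst (nm i) < fst (nm (Suc i)) \<and> snd (nm i) \<le> snd (nm (Suc i)) \<and> ?in (fst (nm (Suc i))) (snd (nm i)))"
  proof (rule dependent_nat_choice)
    obtain n where "e \<le> (\<integral>s. max (\<phi> n s) 0 \<partial>lborel)" using inf[of 0] by blast
    then show "\<exists>nm. ?out (fst nm) (snd nm) \<and> e \<le> (\<integral>s. max (\<phi> (fst nm) s) 0 \<partial>lborel)"
      using out_ex[of 0 n] by auto
  next
    fix nm :: "nat \<times> nat" and i :: nat
    from order_tendstoD(2)[OF inner e', of "snd nm"] obtain N where N: "\<And>n. n \<ge> N \<Longrightarrow> ?in n (snd nm)"
      by (auto simp: eventually_sequentially)
    obtain n where n: "n \<ge> max N (Suc (fst nm))" "e \<le> (\<integral>s. max (\<phi> n s) 0 \<partial>lborel)" using inf by blast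
    obtain m where "m \<ge> snd nm" "?out n m" using out_ex by blast
    then show "\<exists>nm'. (?out (fst nm') (snd nm') \<and> e \<le> (\<integral>s. max (\<phi> (fst nm') s) 0 \<partial>lborel)) \<and>
       fst nm < fst nm' \<and> snd nm \<le> snd nm' \<and> ?in (fst nm') (snd nm)"
      using n N by (intro exI[of _ "(n, m)"]) auto
  qed
  then obtain nm :: "nat \<Rightarrow> nat \<times> nat" where nm: "\<And>i. ?out (fst (nm i)) (snd (nm i))"
      "\<And>i. e \<le> (\<integral>s. max (\<phi> (fst (nm i)) s) 0 \<partial>lborel)" "\<And>i. fst (nm i) < fst (nm (Suc i))"
      "\<And>i. snd (nm i) \<le> snd (nm (Suc i))" "\<And>i. ?in (fst (nm (Suc i))) (snd (nm i))"
    by blast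
  define n m where "n i = fst (nm i)" and "m i = snd (nm i)" for i
  note nm' = nm[folded n_def m_def]
  have m_mono: "m i \<le> m j" if "i \<le> j" for i j using lift_Suc_mono_le[of m i j] nm'(4) that by blast
  define D where "D i = E (m (Suc i)) - E (m i)" for i
  have D_disj: "i = j" if "s \<in> D i" "s \<in> D j" for i j s
  proof -
    have "\<not> i < j" if "s \<in> D i" "s \<in> D j" for i j
      using that E_mono[OF m_mono[of "Suc i" j]] by (auto simp: D_def)
    then show ?thesis using that by (cases i j rule: linorder_cases) auto
  qed
  define A where "A = (\<Union>k. D (2 * k) \<inter> {s. 0 < \<phi> (n (Suc (2 * k))) s})"
  have A_meas[measurable]: "A \<in> sets borel" unfolding A_def D_def by measurable
  have A_even: "s \<in> A \<longleftrightarrow> 0 < \<phi> (n (Suc (2 * k))) s" if "s \<in> D (2 * k)" for s k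
  proof
    assume "s \<in> A"
    then obtain j where j: "s \<in> D (2 * j)" "0 < \<phi> (n (Suc (2 * j))) s" by (auto simp: A_def)
    with D_disj[OF j(1) that] show "0 < \<phi> (n (Suc (2 * k))) s" by simp
  qed (use that in \<open>auto simp: A_def\<close>)
  have A_odd: "s \<notin> A" if "s \<in> D (Suc (2 * k))" for s k
  proof
    assume "s \<in> A"
    then obtain j where "s \<in> D (2 * j)" by (auto simp: A_def)
    from D_disj[OF this that] show False by presburger
  qed
  let ?I = "\<lambda>j. \<integral>s. indicator A s * \<phi> (n j) s \<partial>lborel"
  have bad_le: "(\<integral>s. indicator (E (m i)) s * \<bar>\<phi> (n (Suc i)) s\<bar> + indicator (- E (m (Suc i))) s * \<bar>\<phi> (n (Suc i)) s\<bar> \<partial>lborel) \<le> 2 * e'" for i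
    using nm'(5)[of i] nm'(1)[of "Suc i"] by (subst Bochner_Integration.integral_add) (auto intro!: iA)
  have even: "e / 2 \<le> ?I (Suc (2 * k))" for k
  proof -
    let ?j = "Suc (2 * k)"
    let ?bad = "\<lambda>s. indicator (E (m (2 * k))) s * \<bar>\<phi> (n ?j) s\<bar> + indicator (- E (m ?j)) s * \<bar>\<phi> (n ?j) s\<bar>"
    have "e - 2 * (2 * e') \<le> (\<integral>s. max (\<phi> (n ?j) s) 0 \<partial>lborel) - 2 * (\<integral>s. ?bad s \<partial>lborel)"
      using nm'(2)[of ?j] bad_le[of "2 * k"] by simp
    also have "\<dots> = (\<integral>s. max (\<phi> (n ?j) s) 0 - 2 * ?bad s \<partial>lborel)"
      using ip iA[of "E _"] iA[of "- E _"] by simp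
    also have "\<dots> \<le> ?I ?j"
    proof (rule integral_mono)
      show "integrable lborel (\<lambda>s. max (\<phi> (n ?j) s) 0 - 2 * ?bad s)"
        using ip iA[of "E _"] iA[of "- E _"] by simp
      fix s :: real
      show "max (\<phi> (n ?j) s) 0 - 2 * ?bad s \<le> indicator A s * \<phi> (n ?j) s"
      proof (cases "s \<in> D (2 * k)")
        case True
        then show ?thesis using A_even[OF True] by (auto simp: D_def split: split_indicator)
      next
        case False
        then show ?thesis by (auto simp: D_def split: split_indicator)
      qed
    qed (auto intro!: iA')
    finally show ?thesis by (simp add: e'_def)
  qed
  have odd: "?I (Suc (Suc (2 * k))) \<le> e / 4" for k
  proof -
    let ?j = "Suc (Suc (2 * k))"
    let ?bad = "\<lambda>s. indicator (E (m (Suc (2 * k)))) s * \<bar>\<phi> (n ?j) s\<bar> + indicator (- E (m ?j)) s * \<bar>\<phi> (n ?j) s\<bar>"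
    have "?I ?j \<le> (\<integral>s. ?bad s \<partial>lborel)"
    proof (rule integral_mono)
      show "integrable lborel ?bad" using iA[of "E _"] iA[of "- E _"] by simp
      fix s :: real
      show "indicator A s * \<phi> (n ?j) s \<le> ?bad s"
      proof (cases "s \<in> D (Suc (2 * k))")
        case True
        then show ?thesis using A_odd[OF True] by (auto simp: D_def split: split_indicator)
      next
        case False
        then show ?thesis by (auto simp: D_def split: split_indicator)
      qed
    qed (auto intro!: iA')
    also have "\<dots> \<le> 2 * e'" by (rule bad_le)
    finally show ?thesis by (simp add: e'_def)
  qed
  from conv[OF A_meas] obtain L where L: "(\<lambda>i. \<integral>s. indicator A s * \<phi> i s \<partial>lborel) \<longlonglongrightarrow> L"
    by (auto simp: convergent_def)
  have sn: "strict_mono n" using nm'(3) by (simp add: strict_mono_Suc_iff)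
  have Ln: "?I \<longlonglongrightarrow> L" using LIMSEQ_subseq_LIMSEQ[OF L sn] by (simp add: o_def)
  have "strict_mono (\<lambda>k::nat. Suc (2 * k))" "strict_mono (\<lambda>k::nat. Suc (Suc (2 * k)))" by (auto simp: strict_mono_Suc_iff)
  from this[THEN LIMSEQ_subseq_LIMSEQ[OF Ln]]
  have "(\<lambda>k. ?I (Suc (2 * k))) \<longlonglongrightarrow> L" "(\<lambda>k. ?I (Suc (Suc (2 * k)))) \<longlonglongrightarrow> L" by (simp_all add: o_def)
  from LIMSEQ_le_const[OF this(1)] LIMSEQ_le_const2[OF this(2)] even odd have "e / 2 \<le> L" "L \<le> e / 4" by blast+
  then show False using e by simp
qed

lemma setwise_convergent_imp_L1_null:
  fixes \<phi> :: "nat \<Rightarrow> real \<Rightarrow> real"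
  assumes int: "\<And>n. integrable lborel (\<phi> n)"
    and lim: "AE s in lborel. (\<lambda>n. \<phi> n s) \<longlonglongrightarrow> 0"
    and conv: "\<And>A. A \<in> sets borel \<Longrightarrow> convergent (\<lambda>n. \<integral>s. indicator A s * \<phi> n s \<partial>lborel)"
  shows "(\<lambda>n. \<integral>s. \<bar>\<phi> n s\<bar> \<partial>lborel) \<longlonglongrightarrow> 0"
proof -
  have 1: "(\<lambda>n. \<integral>s. max (\<phi> n s) 0 \<partial>lborel) \<longlonglongrightarrow> 0"
    by (rule setwise_convergent_imp_pos_part_null[OF assms])
  have "(\<lambda>n. \<integral>s. max (- \<phi> n s) 0 \<partial>lborel) \<longlonglongrightarrow> 0"
  proof (rule setwise_convergent_imp_pos_part_null)
    show "AE s in lborel. (\<lambda>n. - \<phi> n s) \<longlonglongrightarrow> 0"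
      using lim by eventually_elim (use tendsto_minus in fastforce)
    show "convergent (\<lambda>n. \<integral>s. indicator A s * - \<phi> n s \<partial>lborel)" if "A \<in> sets borel" for A
      using conv[OF that] by (simp flip: convergent_minus_iff)
  qed (use int in simp)
  from tendsto_add[OF 1 this]
  have "(\<lambda>n. (\<integral>s. max (\<phi> n s) 0 \<partial>lborel) + (\<integral>s. max (- \<phi> n s) 0 \<partial>lborel)) \<longlonglongrightarrow> 0" by simp
  moreover have "(\<integral>s. \<bar>\<phi> n s\<bar> \<partial>lborel) = (\<integral>s. max (\<phi> n s) 0 \<partial>lborel) + (\<integral>s. max (- \<phi> n s) 0 \<partial>lborel)" for n
  proof -
    have "\<bar>\<phi> n s\<bar> = max (\<phi> n s) 0 + max (- \<phi> n s) 0" for s by auto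
    then show ?thesis using int[of n] by simp
  qed
  ultimately show ?thesis by simp
qed

lemma powr_abs_diff_le:
  fixes a b p :: real
  assumes "0 < p"
  shows "\<bar>a - b\<bar> powr p \<le> 2 powr p * (\<bar>a\<bar> powr p + \<bar>b\<bar> powr p)"
proof -
  have "\<bar>a - b\<bar> powr p \<le> (2 * max \<bar>a\<bar> \<bar>b\<bar>) powr p" using assms by (intro powr_mono2) auto
  also have "\<dots> = 2 powr p * (max \<bar>a\<bar> \<bar>b\<bar>) powr p" by (simp add: powr_mult)
  also have "(max \<bar>a\<bar> \<bar>b\<bar>) powr p \<le> \<bar>a\<bar> powr p + \<bar>b\<bar> powr p" by (simp add: max_def)
  finally show ?thesis by simp
qed

lemma Lp_distance:
  fixes f g h :: "real \<Rightarrow> real"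
  assumes p: "0 < p" and [measurable]: "f \<in> borel_measurable borel" "g \<in> borel_measurable borel" "h \<in> borel_measurable borel"
    and i: "integrable lborel (\<lambda>s. \<bar>f s\<bar> powr p)" "integrable lborel (\<lambda>s. \<bar>g s\<bar> powr p)" "integrable lborel (\<lambda>s. \<bar>h s\<bar> powr p)"
  shows "integrable lborel (\<lambda>s. \<bar>f s - g s\<bar> powr p)"
    and "(\<integral>s. indicator A s * \<bar>f s - h s\<bar> powr p \<partial>lborel)
      \<le> 2 powr p * ((\<integral>s. \<bar>f s - g s\<bar> powr p \<partial>lborel) + (\<integral>s. \<bar>h s - g s\<bar> powr p \<partial>lborel))"
proof -
  have id: "integrable lborel (\<lambda>s. \<bar>u s - g s\<bar> powr p)"
    if [measurable]: "u \<in> borel_measurable borel" and u: "integrable lborel (\<lambda>s. \<bar>u s\<bar> powr p)" for u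
    by (rule Bochner_Integration.integrable_bound[of _ "\<lambda>s. 2 powr p * (\<bar>u s\<bar> powr p + \<bar>g s\<bar> powr p)"])
       (use powr_abs_diff_le[OF p] u i(2) in auto)
  show "integrable lborel (\<lambda>s. \<bar>f s - g s\<bar> powr p)" by (intro id i(1)) simp
  have ih: "integrable lborel (\<lambda>s. \<bar>h s - g s\<bar> powr p)" by (intro id i(3)) simp
  have "(\<integral>s. indicator A s * \<bar>f s - h s\<bar> powr p \<partial>lborel) \<le> (\<integral>s. 2 powr p * (\<bar>f s - g s\<bar> powr p + \<bar>h s - g s\<bar> powr p) \<partial>lborel)"
  proof (rule integral_mono')
    show "indicator A s * \<bar>f s - h s\<bar> powr p \<le> 2 powr p * (\<bar>f s - g s\<bar> powr p + \<bar>h s - g s\<bar> powr p)" for s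
      using powr_abs_diff_le[OF p, of "f s - g s" "h s - g s"] by (auto split: split_indicator)
  qed (use id[OF _ i(1)] ih in auto)
  then show "(\<integral>s. indicator A s * \<bar>f s - h s\<bar> powr p \<partial>lborel)
      \<le> 2 powr p * ((\<integral>s. \<bar>f s - g s\<bar> powr p \<partial>lborel) + (\<integral>s. \<bar>h s - g s\<bar> powr p \<partial>lborel))"
    using id[OF _ i(1)] ih by simp
qed

text \<open>By the previous lemma the powers of \<open>\<phi> n\<close> converge in \<open>L\<^sup>1\<close>. Up to a multiple of their distance to the power of
\<open>g\<close>, the power of the difference is dominated by that of \<open>g\<close>.\<close>

lemma setwise_convergent_powr_imp_Lp:
  fixes \<phi> :: "nat \<Rightarrow> real \<Rightarrow> real" and g :: "real \<Rightarrow> real"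
  assumes p: "0 < p"
    and [measurable]: "\<And>n. \<phi> n \<in> borel_measurable borel" "g \<in> borel_measurable borel"
    and int: "\<And>n. integrable lborel (\<lambda>s. \<bar>\<phi> n s\<bar> powr p)" and int_g: "integrable lborel (\<lambda>s. \<bar>g s\<bar> powr p)"
    and lim: "AE s in lborel. (\<lambda>n. \<phi> n s) \<longlonglongrightarrow> g s"
    and conv: "\<And>A. A \<in> sets borel \<Longrightarrow> convergent (\<lambda>n. \<integral>s. indicator A s * \<bar>\<phi> n s\<bar> powr p \<partial>lborel)"
  shows "(\<lambda>n. \<integral>s. \<bar>\<phi> n s - g s\<bar> powr p \<partial>lborel) \<longlonglongrightarrow> 0"
proof -
  define \<psi> where "\<psi> n s = \<bar>\<phi> n s\<bar> powr p - \<bar>g s\<bar> powr p" for n s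
  define h where "h n s = \<bar>\<phi> n s - g s\<bar> powr p" for n s
  define k where "k n s = 2 powr p * \<bar>\<psi> n s\<bar>" for n s
  have [measurable]: "\<psi> n \<in> borel_measurable borel" "h n \<in> borel_measurable borel" "k n \<in> borel_measurable borel" for n
    unfolding \<psi>_def[abs_def] h_def[abs_def] k_def[abs_def] by measurable
  have i\<psi>: "integrable lborel (\<psi> n)" for n unfolding \<psi>_def[abs_def] using int int_g by simp
  have ik: "integrable lborel (k n)" for n unfolding k_def[abs_def] using i\<psi> by simp
  have "(\<lambda>n. \<integral>s. \<bar>\<psi> n s\<bar> \<partial>lborel) \<longlonglongrightarrow> 0"
  proof (rule setwise_convergent_imp_L1_null[OF i\<psi>])
    show "AE s in lborel. (\<lambda>n. \<psi> n s) \<longlonglongrightarrow> 0"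
      using lim
    proof eventually_elim
      case (elim s)
      have "(\<lambda>n. \<bar>\<phi> n s\<bar> powr p) \<longlonglongrightarrow> \<bar>g s\<bar> powr p"
        using p by (intro tendsto_powr' tendsto_rabs elim tendsto_const) auto
      from tendsto_diff[OF this tendsto_const[of "\<bar>g s\<bar> powr p"]] show ?case by (simp add: \<psi>_def)
    qed
    fix A :: "real set" assume A: "A \<in> sets borel"
    have "(\<integral>s. indicator A s * \<psi> n s \<partial>lborel)
        = (\<integral>s. indicator A s * \<bar>\<phi> n s\<bar> powr p \<partial>lborel) - (\<integral>s. indicator A s * \<bar>g s\<bar> powr p \<partial>lborel)" for n
      using integrable_mult_indicator[OF _ int, of A n] integrable_mult_indicator[OF _ int_g, of A] A
      by (subst Bochner_Integration.integral_diff[symmetric]) (auto simp: \<psi>_def right_diff_distrib)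
    then show "convergent (\<lambda>n. \<integral>s. indicator A s * \<psi> n s \<partial>lborel)"
      using convergent_diff[OF conv[OF A] convergent_const] by simp
  qed
  then have k0: "(\<lambda>n. \<integral>s. k n s \<partial>lborel) \<longlonglongrightarrow> 0"
    using tendsto_mult_left[of _ 0 _ "2 powr p"] by (simp add: k_def)
  have hk: "h n s - k n s \<le> 2 powr p * (2 * \<bar>g s\<bar> powr p)" for n s
  proof -
    have "\<bar>\<phi> n s\<bar> powr p + \<bar>g s\<bar> powr p \<le> \<bar>\<psi> n s\<bar> + 2 * \<bar>g s\<bar> powr p" by (simp add: \<psi>_def)
    then have "h n s \<le> 2 powr p * (\<bar>\<psi> n s\<bar> + 2 * \<bar>g s\<bar> powr p)"
      unfolding h_def by (intro order_trans[OF powr_abs_diff_le[OF p]] mult_left_mono) auto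
    then show ?thesis by (simp add: k_def distrib_left)
  qed
  have im: "integrable lborel (\<lambda>s. max (h n s - k n s) 0)" for n
    by (rule Bochner_Integration.integrable_bound[of _ "\<lambda>s. 2 powr p * (2 * \<bar>g s\<bar> powr p)"])
       (use hk int_g in auto)
  have m0: "(\<lambda>n. \<integral>s. max (h n s - k n s) 0 \<partial>lborel) \<longlonglongrightarrow> integral\<^sup>L lborel (\<lambda>s::real. 0)"
  proof (rule integral_dominated_convergence[where w = "\<lambda>s. 2 powr p * (2 * \<bar>g s\<bar> powr p)"])
    show "AE s in lborel. (\<lambda>n. max (h n s - k n s) 0) \<longlonglongrightarrow> 0"
      using lim
    proof eventually_elim
      case (elim s)
      have "(\<lambda>n. h n s) \<longlonglongrightarrow> \<bar>g s - g s\<bar> powr p"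
        unfolding h_def using p by (intro tendsto_powr' tendsto_rabs tendsto_diff elim tendsto_const) auto
      then have h0: "(\<lambda>n. h n s) \<longlonglongrightarrow> 0" by simp
      have "0 \<le> max (h n s - k n s) 0" "max (h n s - k n s) 0 \<le> h n s" for n by (auto simp: h_def k_def)
      then show ?case by (intro tendsto_sandwich[OF _ _ tendsto_const h0] always_eventually allI)
    qed
  qed (use hk int_g in auto)
  have ih: "integrable lborel (h n)" for n
    unfolding h_def[abs_def] by (rule Lp_distance(1)[OF p _ _ _ int int_g int_g]) measurable
  have "(\<integral>s. h n s \<partial>lborel) \<le> (\<integral>s. max (h n s - k n s) 0 \<partial>lborel) + (\<integral>s. k n s \<partial>lborel)" for n
    unfolding Bochner_Integration.integral_add[OF im ik, symmetric] by (intro integral_mono ih Bochner_Integration.integrable_add im ik) auto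
  moreover have "(\<lambda>n. (\<integral>s. max (h n s - k n s) 0 \<partial>lborel) + (\<integral>s. k n s \<partial>lborel)) \<longlonglongrightarrow> 0"
    using tendsto_add[OF m0 k0] by simp
  moreover have "0 \<le> (\<integral>s. h n s \<partial>lborel)" for n by (simp add: h_def)
  ultimately have "(\<lambda>n. \<integral>s. h n s \<partial>lborel) \<longlonglongrightarrow> 0"
    by (metis (no_types, lifting) tendsto_sandwich always_eventually tendsto_const)
  then show ?thesis by (simp add: h_def)
qed

section \<open>Stable laws through the modulus of the characteristic function\<close>

lemma additive_null_at_0_imp_linear:
  fixes m :: "real \<Rightarrow> real"
  assumes add: "\<And>s t. 0 \<le> s \<Longrightarrow> 0 \<le> t \<Longrightarrow> m (s + t) = m s + m t"
    and lim: "(m \<longlongrightarrow> 0) (at_right 0)" and t: "0 \<le> t"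
  shows "m t = t * m 1"
proof -
  have m0: "m 0 = 0" using add[of 0 0] by simp
  have mult: "m (real n * t) = real n * m t" if "0 \<le> t" for n t
  proof (induction n)
    case (Suc n)
    have "m (real (Suc n) * t) = m (real n * t + t)" by (simp add: algebra_simps)
    also have "\<dots> = m (real n * t) + m t" using that by (intro add) auto
    finally show ?case using Suc by (simp add: algebra_simps)
  qed (simp add: m0)
  define r where "r n = t - real (nat \<lfloor>real (Suc n) * t\<rfloor>) / real (Suc n)" for n
  have r: "0 \<le> r n" "r n \<le> 1 / real (Suc n)" for n
  proof -
    have "0 \<le> real (Suc n) * t" using t by simp
    moreover define k where "k = nat \<lfloor>real (Suc n) * t\<rfloor>"
    ultimately have "real k \<le> real (Suc n) * t" "real (Suc n) * t \<le> real k + 1"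
      by linarith+
    then have "real k / real (Suc n) \<le> t" "t \<le> (real k + 1) / real (Suc n)"
      by (simp_all add: pos_divide_le_eq pos_le_divide_eq mult.commute del: of_nat_Suc)
    then show "0 \<le> r n" "r n \<le> 1 / real (Suc n)"
      unfolding r_def k_def[symmetric] by (simp_all add: add_divide_distrib del: of_nat_Suc)
  qed
  have eq: "m t = (t - r n) * m 1 + m (r n)" for n
  proof -
    define k where "k = nat \<lfloor>real (Suc n) * t\<rfloor>"
    have "m (real k / real (Suc n)) = real k / real (Suc n) * m 1"
      using mult[of "1 / real (Suc n)" k] mult[of "1 / real (Suc n)" "Suc n"] by (simp add: field_simps del: of_nat_Suc)
    moreover have "t = real k / real (Suc n) + r n" by (simp add: r_def k_def)
    moreover have "m (real k / real (Suc n) + r n) = m (real k / real (Suc n)) + m (r n)" by (intro add r) simp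
    ultimately show ?thesis by simp
  qed
  have r0: "r \<longlonglongrightarrow> 0"
    by (rule tendsto_sandwich[OF always_eventually always_eventually tendsto_const LIMSEQ_inverse_real_of_nat])
       (use r in \<open>auto simp: inverse_eq_divide\<close>)
  have "(\<lambda>n. m (r n)) \<longlonglongrightarrow> 0"
  proof (rule LIMSEQ_I)
    fix e :: real assume e: "0 < e"
    from lim e have "\<forall>\<^sub>F x in at_right 0. \<bar>m x\<bar> < e" by (auto dest!: tendstoD simp: dist_real_def)
    then obtain b where b: "0 < b" "\<And>x. 0 < x \<Longrightarrow> x < b \<Longrightarrow> \<bar>m x\<bar> < e" by (auto simp: eventually_at_right_field)
    from LIMSEQ_D[OF r0 b(1)] obtain N where N: "\<And>n. n \<ge> N \<Longrightarrow> \<bar>r n\<bar> < b" by auto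
    then have "\<bar>m (r n)\<bar> < e" if "n \<ge> N" for n
      using b(2)[of "r n"] r(1)[of n] N[OF that] e m0 by (cases "r n = 0") auto
    then show "\<exists>N. \<forall>n\<ge>N. norm (m (r n) - 0) < e" by auto
  qed
  then have "(\<lambda>n. (t - r n) * m 1 + m (r n)) \<longlonglongrightarrow> (t - 0) * m 1 + 0"
    by (intro tendsto_intros r0)
  then have "(\<lambda>n::nat. m t) \<longlonglongrightarrow> t * m 1" by (simp flip: eq)
  then show ?thesis by (simp add: LIMSEQ_const_iff)
qed

lemma additive_nonneg_imp_linear:
  fixes q :: "real \<Rightarrow> real"
  assumes add: "\<And>s t. 0 < s \<Longrightarrow> 0 < t \<Longrightarrow> q (s + t) = q s + q t"
    and nonneg: "\<And>t. 0 < t \<Longrightarrow> 0 \<le> q t" and t: "0 < t"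
  shows "q t = t * q 1"
proof -
  define m where "m s = (if s = 0 then 0 else q s)" for s
  have mult: "real (Suc n) * q s = q (real (Suc n) * s)" if "0 < s" for n s
  proof (induction n)
    case (Suc n)
    have "q (real (Suc (Suc n)) * s) = q (real (Suc n) * s + s)" by (simp add: algebra_simps)
    also have "\<dots> = q (real (Suc n) * s) + q s" using that by (intro add) auto
    finally show ?case using Suc by (simp add: algebra_simps)
  qed simp
  have "(m \<longlongrightarrow> 0) (at_right 0)"
  proof (rule tendstoI)
    fix e :: real assume e: "0 < e"
    obtain n where n: "q 1 < real (Suc n) * e" using reals_Archimedean3[OF e] by (metis mult.commute mult_less_cancel_right_pos less_trans of_nat_less_iff lessI e)
    have "q s < e" if s: "0 < s" "s < 1 / real (Suc n)" for s
    proof -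
      have "real (Suc n) * s < 1" using s(2) by (simp add: pos_less_divide_eq mult.commute del: of_nat_Suc)
      then have "q 1 = real (Suc n) * q s + q (1 - real (Suc n) * s)"
        using add[of "real (Suc n) * s" "1 - real (Suc n) * s"] mult[OF s(1), of n] s(1) by (simp del: of_nat_Suc)
      then have "real (Suc n) * q s < real (Suc n) * e" using nonneg[of "1 - real (Suc n) * s"] \<open>real (Suc n) * s < 1\<close> n by linarith
      then show ?thesis by (simp del: of_nat_Suc)
    qed
    then have "dist (m s) 0 < e" if "0 < s" "s < 1 / real (Suc n)" for s
      using that nonneg[of s] by (simp add: m_def)
    then show "\<forall>\<^sub>F s in at_right 0. dist (m s) 0 < e"
      unfolding eventually_at_right_field by (intro exI[of _ "1 / real (Suc n)"]) auto
  qed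
  from additive_null_at_0_imp_linear[OF _ this, of t] show ?thesis using t add by (auto simp: m_def)
qed

text \<open>The squared modulus is the characteristic function of the difference of two independent copies. It does
not change under translations, so the shift \<open>d\<close> in the stability relation and the skewness of the law disappear from it.\<close>

definition sq_char :: "real measure \<Rightarrow> real \<Rightarrow> real" where
  "sq_char \<mu> \<theta> = (cmod (char \<mu> \<theta>))\<^sup>2"

lemma char_distr:
  assumes "X \<in> borel_measurable M"
  shows "char (distr M borel X) \<theta> = (\<integral>\<omega>. iexp (\<theta> * X \<omega>) \<partial>M)"
  using assms unfolding char_def by (subst integral_distr) auto

lemma real_distributionI: "prob_space \<mu> \<Longrightarrow> sets \<mu> = sets borel \<Longrightarrow> real_distribution \<mu>"
  by (metis real_distribution.intro real_distribution_axioms.intro sets_eq_imp_space_eq space_borel)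

lemma (in prob_space) real_distribution_distr': "X \<in> borel_measurable M \<Longrightarrow> real_distribution (distr M borel X)"
  by (intro real_distributionI prob_space_distr) auto

lemma sq_char_affine:
  assumes "sets \<mu> = sets borel"
  shows "sq_char (distr \<mu> borel (\<lambda>x. a * x + b)) \<theta> = sq_char \<mu> (a * \<theta>)"
proof -
  have [measurable_cong]: "sets \<mu> = sets borel" by fact
  have "char (distr \<mu> borel (\<lambda>x. a * x + b)) \<theta> = (\<integral>x. iexp (\<theta> * b) * iexp (a * \<theta> * x) \<partial>\<mu>)"
    by (subst char_distr) (auto simp: exp_add[symmetric] algebra_simps intro!: Bochner_Integration.integral_cong)
  also have "\<dots> = iexp (\<theta> * b) * char \<mu> (a * \<theta>)" by (simp add: char_def)
  finally show ?thesis by (simp add: sq_char_def norm_mult)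
qed

lemma char_convolution:
  assumes "prob_space \<mu>" "prob_space \<nu>" and sets: "sets \<mu> = sets borel" "sets \<nu> = sets borel"
  shows "char (convolution \<mu> \<nu>) \<theta> = char \<mu> \<theta> * char \<nu> \<theta>"
proof -
  interpret \<mu>: prob_space \<mu> by fact
  interpret \<nu>: prob_space \<nu> by fact
  interpret pair_prob_space \<mu> \<nu> ..
  note [measurable_cong] = sets
  have i: "integrable (\<mu> \<Otimes>\<^sub>M \<nu>) (\<lambda>p. iexp (\<theta> * fst p) * iexp (\<theta> * snd p))"
    by (rule P.integrable_const_bound[of _ 1]) (auto simp: norm_mult)
  have "char (convolution \<mu> \<nu>) \<theta> = (\<integral>p. iexp (\<theta> * fst p) * iexp (\<theta> * snd p) \<partial>(\<mu> \<Otimes>\<^sub>M \<nu>))"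
    unfolding convolution_def
    by (subst char_distr) (auto simp: case_prod_beta' exp_add[symmetric] algebra_simps intro!: Bochner_Integration.integral_cong)
  also have "\<dots> = (\<integral>x. \<integral>y. iexp (\<theta> * x) * iexp (\<theta> * y) \<partial>\<nu> \<partial>\<mu>)"
    using integral_fst'[OF i] by simp
  also have "\<dots> = char \<mu> \<theta> * char \<nu> \<theta>" by (simp add: char_def)
  finally show ?thesis .
qed

lemma sq_char_nonneg: "0 \<le> sq_char \<mu> \<theta>" by (simp add: sq_char_def)

lemma (in real_distribution) sq_char_le_1: "sq_char M \<theta> \<le> 1"
  using cmod_char_le_1[of \<theta>] by (simp add: sq_char_def power_le_one)

lemma (in real_distribution) sq_char_0: "sq_char M 0 = 1" by (simp add: sq_char_def char_zero)

lemma char_minus: "char \<mu> (- \<theta>) = cnj (char \<mu> \<theta>)"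
  unfolding char_def Bochner_Integration.integral_cnj[symmetric]
  by (intro Bochner_Integration.integral_cong refl) (simp add: exp_cnj)

lemma sq_char_minus: "sq_char \<mu> (- \<theta>) = sq_char \<mu> \<theta>"
  by (simp add: sq_char_def char_minus)

text \<open>Stability makes \<open>u \<mapsto> r(u\<^sup>1\<^sup>/\<^sup>\<beta>)\<close> turn sums into products on the positive reals, where \<open>r\<close> is the squared
modulus. It has no zero: a zero at \<open>\<theta>\<close> would propagate to \<open>k\<^sup>n \<theta>\<close> for a contraction factor \<open>k\<close>, and hence to 0.\<close>

lemma stable_sq_char:
  assumes \<mu>: "prob_space \<mu>" "sets \<mu> = sets borel" and \<beta>: "0 < \<beta>" and st: "stable_law \<beta> \<mu>"
  obtains c where "0 \<le> c" and "\<And>\<theta>. sq_char \<mu> \<theta> = exp (- c * \<bar>\<theta>\<bar> powr \<beta>)"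
proof -
  interpret real_distribution \<mu> by (rule real_distributionI[OF \<mu>])
  note [measurable_cong] = \<mu>(2)
  define r where "r = sq_char \<mu>"
  have mult: "r (a * \<theta>) * r (b * \<theta>) = r ((a powr \<beta> + b powr \<beta>) powr (1 / \<beta>) * \<theta>)" if "0 < a" "0 < b" for a b \<theta>
  proof -
    from st that obtain d where d: "convolution (distr \<mu> borel (\<lambda>x. a * x)) (distr \<mu> borel (\<lambda>x. b * x)) =
        distr \<mu> borel (\<lambda>x. (a powr \<beta> + b powr \<beta>) powr (1 / \<beta>) * x + d)"
      unfolding stable_law_def by blast
    have "char (convolution (distr \<mu> borel (\<lambda>x. a * x)) (distr \<mu> borel (\<lambda>x. b * x))) \<theta>
        = char (distr \<mu> borel (\<lambda>x. a * x)) \<theta> * char (distr \<mu> borel (\<lambda>x. b * x)) \<theta>"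
      by (rule char_convolution) (auto intro!: prob_space_distr)
    then have "sq_char (convolution (distr \<mu> borel (\<lambda>x. a * x)) (distr \<mu> borel (\<lambda>x. b * x))) \<theta>
       = sq_char (distr \<mu> borel (\<lambda>x. a * x)) \<theta> * sq_char (distr \<mu> borel (\<lambda>x. b * x)) \<theta>"
      by (simp add: sq_char_def norm_mult power_mult_distrib)
    then show ?thesis
      unfolding d using sq_char_affine[OF \<mu>(2), of _ _ \<theta>] sq_char_affine[OF \<mu>(2), of _ 0 \<theta>] by (simp add: r_def)
  qed
  have r_cont: "isCont r \<theta>" for \<theta> unfolding r_def sq_char_def by (intro continuous_intros isCont_char)
  have r0: "r 0 = 1" and r1: "r \<theta> \<le> 1" "0 \<le> r \<theta>" and rm: "r (- \<theta>) = r \<theta>" for \<theta>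
    by (simp_all add: r_def sq_char_0 sq_char_le_1 sq_char_nonneg sq_char_minus)
  define k where "k = (1/2 :: real) powr (1 / \<beta>)"
  have k: "0 < k" "k < 1" and k\<beta>: "k powr \<beta> = 1/2"
    using \<beta> powr_less_mono2[of "1 / \<beta>" "1/2" 1] by (auto simp: k_def powr_powr)
  have r_pos: "0 < r \<theta>" for \<theta>
  proof (rule ccontr)
    assume "\<not> 0 < r \<theta>"
    then have z: "r \<theta> = 0" using r1(2)[of \<theta>] by simp
    have half: "r (k * x) * r (k * x) = r x" for x using mult[OF k(1) k(1), of x] k\<beta> by simp
    have zn: "r (k ^ n * \<theta>) = 0" for n
    proof (induction n)
      case (Suc n)
      then show ?case using half[of "k ^ n * \<theta>"] by (simp add: mult_ac)
    qed (simp add: z)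
    have "(\<lambda>n. k ^ n * \<theta>) \<longlonglongrightarrow> 0 * \<theta>" by (intro tendsto_mult_right LIMSEQ_power_zero) (use k in simp)
    then have "(\<lambda>n. r (k ^ n * \<theta>)) \<longlonglongrightarrow> r 0" using isCont_tendsto_compose[OF r_cont] by fastforce
    then show False by (simp add: zn r0 LIMSEQ_const_iff)
  qed
  define q where "q u = - ln (r (u powr (1 / \<beta>)))" for u
  have q_lin: "q t = t * q 1" if "0 < t" for t
  proof (rule additive_nonneg_imp_linear[OF _ _ that])
    fix s t :: real assume st: "0 < s" "0 < t"
    have e: "r (s powr (1 / \<beta>)) * r (t powr (1 / \<beta>)) = r ((s + t) powr (1 / \<beta>))"
      using mult[of "s powr (1/\<beta>)" "t powr (1/\<beta>)" 1] st \<beta> by (simp add: powr_powr)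
    then have "ln (r ((s + t) powr (1 / \<beta>))) = ln (r (s powr (1 / \<beta>))) + ln (r (t powr (1 / \<beta>)))"
      unfolding e[symmetric] using r_pos by (subst ln_mult_pos) auto
    then show "q (s + t) = q s + q t" by (simp add: q_def)
  next
    fix t :: real show "0 \<le> q t" using r1[of "t powr (1/\<beta>)"] r_pos[of "t powr (1/\<beta>)"] by (simp add: q_def)
  qed
  have q1: "0 \<le> q 1" using r1[of 1] r_pos[of 1] by (simp add: q_def)
  have pos: "r \<theta> = exp (- q 1 * \<theta> powr \<beta>)" if "0 < \<theta>" for \<theta>
  proof -
    have "q (\<theta> powr \<beta>) = - ln (r \<theta>)" using that \<beta> by (simp add: q_def powr_powr)
    then have "ln (r \<theta>) = - q 1 * \<theta> powr \<beta>" using q_lin[of "\<theta> powr \<beta>"] that by (simp add: mult.commute)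
    then show ?thesis using r_pos[of \<theta>] by (metis exp_ln)
  qed
  have "r \<theta> = exp (- q 1 * \<bar>\<theta>\<bar> powr \<beta>)" for \<theta>
    using pos[of \<theta>] pos[of "- \<theta>"] rm[of \<theta>] r0 by (cases \<theta> "0::real" rule: linorder_cases) auto
  then show thesis using that[OF q1] by (simp add: r_def)
qed

text \<open>The right-hand side is a multiple of the average of \<open>1 - cos(\<theta> x)\<close> over \<open>\<theta>\<close> in \<open>[0, 1]\<close>, see
\<open>truncated_second_moment_le\<close>.\<close>

lemma min_1_sq_le_sinc:
  fixes x :: real
  assumes "x \<noteq> 0"
  shows "min 1 (x\<^sup>2) \<le> 15 / 2 * (1 - sin x / x)"
proof -
  have pos: "min 1 (y\<^sup>2) \<le> 15 / 2 * (1 - sin y / y)" if "0 < y" for y :: real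
  proof (cases "y \<le> 2")
    case True
    have "\<bar>sin y - (\<Sum>m<5. sin_coeff m * y ^ m)\<bar> \<le> inverse (fact 5) * \<bar>y\<bar> ^ 5" by (rule Maclaurin_sin_bound)
    moreover have "(\<Sum>m<5. sin_coeff m * y ^ m) = y - y ^ 3 / 6"
    proof -
      have "{..<5::nat} = {0, 1, 2, 3, 4}" by auto
      then show ?thesis by (simp add: sin_coeff_def fact_numeral)
    qed
    moreover have "inverse (fact 5) * \<bar>y\<bar> ^ 5 = y ^ 5 / 120" using that by (simp add: fact_numeral)
    ultimately have "sin y \<le> y - y ^ 3 / 6 + y ^ 5 / 120" by linarith
    also have "\<dots> = y * (1 - y\<^sup>2 / 6 + y\<^sup>2 * y\<^sup>2 / 120)" by (simp add: algebra_simps eval_nat_numeral)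
    finally have "sin y / y \<le> 1 - y\<^sup>2 / 6 + y\<^sup>2 * y\<^sup>2 / 120" using that by (simp add: pos_divide_le_eq mult.commute)
    moreover have "y\<^sup>2 * y\<^sup>2 \<le> y\<^sup>2 * 4" using power_mono[OF True, of 2] that by (intro mult_left_mono) auto
    ultimately have "y\<^sup>2 \<le> 15 / 2 * (1 - sin y / y)" by simp
    then show ?thesis by simp
  next
    case False
    then have "sin y / y \<le> 1 / 2" using that by (intro frac_le) auto
    then show ?thesis by simp
  qed
  show ?thesis using pos[of x] pos[of "- x"] assms by (cases "0 < x") auto
qed

lemma (in real_distribution) truncated_second_moment_le:
  assumes G: "0 \<le> G" and char: "\<And>\<theta>. 0 \<le> \<theta> \<Longrightarrow> \<theta> \<le> 1 \<Longrightarrow> 1 - G \<le> Re (char M \<theta>)"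
  shows "(\<integral>x. min 1 (x\<^sup>2) \<partial>M) \<le> 15 / 2 * G"
proof -
  define U where "U = density lborel (\<lambda>x. ennreal (indicator {0..1::real} x))"
  have [measurable_cong]: "sets U = sets borel" by (simp add: U_def)
  have intU: "(\<integral>x. f x \<partial>U) = (\<integral>x. f x * indicator {0..1} x \<partial>lborel)" if [measurable]: "f \<in> borel_measurable borel" for f :: "real \<Rightarrow> real"
    unfolding U_def by (subst integral_density) (auto simp: mult.commute)
  interpret U: prob_space U
    by standard (simp add: U_def emeasure_density ennreal_indicator)
  interpret pp: pair_prob_space M U ..
  have i: "integrable (M \<Otimes>\<^sub>M U) (\<lambda>(x, \<theta>). 1 - cos (\<theta> * x))"
    by (rule pp.P.integrable_const_bound[of _ 2]) (auto intro!: order_trans[OF abs_triangle_ineq4] simp: add_mono[OF order_refl abs_cos_le_one, of 1, simplified])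
  have sinc: "min 1 (x\<^sup>2) \<le> 15 / 2 * (\<integral>\<theta>. 1 - cos (\<theta> * x) \<partial>U)" for x
  proof (cases "x = 0")
    case False
    have "(\<integral>\<theta>. 1 - cos (\<theta> * x) \<partial>U) = (\<integral>\<theta>. (1 - cos (\<theta> * x)) * indicator {0..1} \<theta> \<partial>lborel)"
      by (rule intU) measurable
    also have "\<dots> = (1 - sin (1 * x) / x) - (0 - sin (0 * x) / x)"
      using False by (intro integral_FTC_Icc_real) (auto intro!: derivative_eq_intros continuous_intros)
    finally show ?thesis using min_1_sq_le_sinc[OF False] by simp
  qed (auto intro!: Bochner_Integration.integral_nonneg)
  have "(\<integral>x. min 1 (x\<^sup>2) \<partial>M) \<le> (\<integral>x. 15 / 2 * (\<integral>\<theta>. 1 - cos (\<theta> * x) \<partial>U) \<partial>M)"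
  proof (rule integral_mono)
    show "integrable M (\<lambda>x. min 1 (x\<^sup>2))" by (rule integrable_const_bound[of _ 1]) auto
    show "integrable M (\<lambda>x. 15 / 2 * (\<integral>\<theta>. 1 - cos (\<theta> * x) \<partial>U))"
      using pp.integrable_fst[OF i] by simp
  qed (rule sinc)
  also have "\<dots> = 15 / 2 * (\<integral>\<theta>. (\<integral>x. 1 - cos (\<theta> * x) \<partial>M) \<partial>U)"
    using pp.Fubini_integral[OF i] by simp
  also have "\<dots> \<le> 15 / 2 * (\<integral>\<theta>. G \<partial>U)"
  proof (intro mult_left_mono integral_mono_AE)
    show "integrable U (\<lambda>\<theta>. \<integral>x. 1 - cos (\<theta> * x) \<partial>M)" using pp.integrable_snd[OF i] by simp
    have ae: "AE \<theta> in U. \<theta> \<in> {0..1}" unfolding U_def by (subst AE_density) (auto simp: indicator_def)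
    show "AE \<theta> in U. (\<integral>x. 1 - cos (\<theta> * x) \<partial>M) \<le> G"
      using ae
    proof eventually_elim
      case (elim \<theta>)
      have "integrable M (\<lambda>x. cos (\<theta> * x))" by (rule integrable_const_bound[of _ 1]) auto
      then have "(\<integral>x. 1 - cos (\<theta> * x) \<partial>M) = 1 - (\<integral>x. cos (\<theta> * x) \<partial>M)" by (simp add: prob_space[simplified])
      also have "(\<integral>x. cos (\<theta> * x) \<partial>M) = Re (char M \<theta>)"
      proof -
        have "integrable M (\<lambda>x. iexp (\<theta> * x))" by (rule integrable_const_bound[of _ 1]) auto
        then have "Re (char M \<theta>) = (\<integral>x. Re (iexp (\<theta> * x)) \<partial>M)" unfolding char_def by (rule integral_Re[symmetric])
        then show ?thesis by (simp add: cis_conv_exp[symmetric] flip: of_real_mult)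
      qed
      finally show ?case using char[of \<theta>] elim by simp
    qed
  qed auto
  finally show ?thesis by (simp add: U.prob_space)
qed

lemma (in real_distribution) truncated_second_moment_scaled:
  assumes G: "0 \<le> G" and \<tau>: "0 < \<tau>" and \<beta>: "0 < \<beta>" and char: "\<And>\<theta>. 1 - G * \<bar>\<theta>\<bar> powr \<beta> \<le> Re (char M \<theta>)"
  shows "(\<integral>x. min 1 ((x / \<tau>)\<^sup>2) \<partial>M) \<le> 15 / 2 * (G * \<tau> powr (- \<beta>))"
proof -
  interpret d: real_distribution "distr M borel (\<lambda>x. x / \<tau>)" by (rule real_distribution_distr') simp
  have "(\<integral>x. min 1 ((x / \<tau>)\<^sup>2) \<partial>M) = (\<integral>x. min 1 (x\<^sup>2) \<partial>distr M borel (\<lambda>x. x / \<tau>))"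
    by (subst integral_distr) auto
  also have "\<dots> \<le> 15 / 2 * (G * \<tau> powr (- \<beta>))"
  proof (rule d.truncated_second_moment_le)
    fix \<theta> :: real assume \<theta>: "0 \<le> \<theta>" "\<theta> \<le> 1"
    have "\<bar>\<theta> / \<tau>\<bar> powr \<beta> = \<theta> powr \<beta> * \<tau> powr (- \<beta>)"
      using \<theta> \<tau> by (simp add: powr_divide powr_minus_divide)
    also have "\<dots> \<le> 1 * \<tau> powr (- \<beta>)"
      using powr_mono2[of \<beta> \<theta> 1] \<beta> \<theta> by (intro mult_right_mono) auto
    finally have "1 - G * \<tau> powr (- \<beta>) \<le> 1 - G * \<bar>\<theta> / \<tau>\<bar> powr \<beta>"
      using G by (simp add: mult_left_mono)
    also have "\<dots> \<le> Re (char M (\<theta> / \<tau>))" by (rule char)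
    also have "char M (\<theta> / \<tau>) = char (distr M borel (\<lambda>x. x / \<tau>)) \<theta>"
      by (subst char_distr) (auto simp: char_def)
    finally show "1 - G * \<tau> powr (- \<beta>) \<le> Re (char (distr M borel (\<lambda>x. x / \<tau>)) \<theta>)" .
  qed (use G in simp)
  finally show ?thesis .
qed

text \<open>The constant 15 times the sum of a geometric series with ratio \<open>2\<^sup>1\<^sup>-\<^sup>\<beta>\<close>, which converges for \<open>\<beta> > 1\<close>.\<close>

definition moment_const :: "real \<Rightarrow> real" where
  "moment_const \<beta> = 15 / (1 - 2 powr (1 - \<beta>))"

text \<open>A dyadic decomposition: beyond \<open>\<tau>\<close>, \<open>\<bar>x\<bar>\<close> is at most twice the scale \<open>\<tau> 2\<^sup>j\<close> just below it, and there the truncated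
square of \<open>x / (\<tau> 2\<^sup>j)\<close> equals one. The truncated second moments at these scales decay like 2 to the power \<open>-j \<beta>\<close>.\<close>

lemma (in real_distribution) first_moment_le:
  assumes G: "0 \<le> G" and \<tau>: "0 < \<tau>" and \<beta>: "1 < \<beta>" and char: "\<And>\<theta>. 1 - G * \<bar>\<theta>\<bar> powr \<beta> \<le> Re (char M \<theta>)"
  shows "integrable M (\<lambda>x. x)" and "(\<integral>x. \<bar>x\<bar> \<partial>M) \<le> \<tau> + moment_const \<beta> * \<tau> powr (1 - \<beta>) * G"
proof -
  define r where "r = 2 powr (1 - \<beta>)"
  have r: "0 < r" "r < 1" using \<beta> by (auto simp: r_def powr_less_one)
  define f where "f j x = 2 * (\<tau> * 2 ^ j) * min 1 ((x / (\<tau> * 2 ^ j))\<^sup>2)" for j :: nat and x :: real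
  have f0: "0 \<le> f j x" for j x using \<tau> by (simp add: f_def)
  have [measurable]: "f j \<in> borel_measurable borel" for j unfolding f_def[abs_def] by measurable
  have pw: "ennreal \<bar>x\<bar> \<le> ennreal \<tau> + (\<Sum>j. ennreal (f j x))" for x
  proof (cases "\<bar>x\<bar> \<le> \<tau>")
    case True
    then have "ennreal \<bar>x\<bar> \<le> ennreal \<tau>" by (rule ennreal_leI)
    then show ?thesis by (simp add: add_increasing2)
  next
    case False
    define J where "J = nat \<lfloor>log 2 (\<bar>x\<bar> / \<tau>)\<rfloor>"
    have q: "1 \<le> \<bar>x\<bar> / \<tau>" using False \<tau> by simp
    then have l: "0 \<le> log 2 (\<bar>x\<bar> / \<tau>)" by simp
    have "2 powr real J \<le> \<bar>x\<bar> / \<tau>" "\<bar>x\<bar> / \<tau> \<le> 2 powr (real J + 1)"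
      using l q by (subst le_log_iff[symmetric] log_le_iff[symmetric]; simp add: J_def; linarith)+
    then have J: "\<tau> * 2 ^ J \<le> \<bar>x\<bar>" "\<bar>x\<bar> \<le> 2 * (\<tau> * 2 ^ J)"
      using \<tau> by (simp_all add: powr_realpow powr_add field_simps)
    have "1 \<le> \<bar>x / (\<tau> * 2 ^ J)\<bar>" using J(1) \<tau> by (simp add: abs_mult)
    then have "1 \<le> (x / (\<tau> * 2 ^ J))\<^sup>2" by (metis abs_le_square_iff abs_one one_power2)
    then have "\<bar>x\<bar> \<le> f J x" using J(2) by (simp add: f_def)
    then have "ennreal \<bar>x\<bar> \<le> ennreal (f J x)" by (rule ennreal_leI)
    also have "\<dots> = (\<Sum>j\<in>{J}. ennreal (f j x))" by simp
    also have "\<dots> \<le> (\<Sum>j. ennreal (f j x))" by (intro sum_le_suminf) auto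
    finally show ?thesis by (simp add: add_increasing)
  qed
  have f_int: "(\<integral>\<^sup>+ x. ennreal (f j x) \<partial>M) \<le> ennreal (15 * \<tau> powr (1 - \<beta>) * G * r ^ j)" for j
  proof -
    have i: "integrable M (\<lambda>x. min 1 ((x / (\<tau> * 2 ^ j))\<^sup>2))" by (rule integrable_const_bound[of _ 1]) auto
    have "(\<integral>\<^sup>+ x. ennreal (f j x) \<partial>M) = ennreal (2 * (\<tau> * 2 ^ j) * (\<integral>x. min 1 ((x / (\<tau> * 2 ^ j))\<^sup>2) \<partial>M))"
      using i \<tau> by (subst nn_integral_eq_integral) (auto simp: f_def[abs_def])
    also have "\<dots> \<le> ennreal (2 * (\<tau> * 2 ^ j) * (15 / 2 * (G * (\<tau> * 2 ^ j) powr (- \<beta>))))"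
      using \<tau> \<beta> by (intro ennreal_leI mult_left_mono truncated_second_moment_scaled[OF G _ _ char]) auto
    also have "2 * (\<tau> * 2 ^ j) * (15 / 2 * (G * (\<tau> * 2 ^ j) powr (- \<beta>))) = 15 * G * (\<tau> * 2 ^ j) powr (1 - \<beta>)"
      using \<tau> by (simp add: powr_diff powr_minus field_simps)
    also have "(\<tau> * 2 ^ j) powr (1 - \<beta>) = \<tau> powr (1 - \<beta>) * r ^ j"
      using \<tau> by (simp add: powr_mult r_def powr_realpow[symmetric] powr_powr mult.commute)
    finally show ?thesis by (simp add: mult_ac)
  qed
  have "(\<integral>\<^sup>+ x. ennreal \<bar>x\<bar> \<partial>M) \<le> (\<integral>\<^sup>+ x. ennreal \<tau> + (\<Sum>j. ennreal (f j x)) \<partial>M)"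
    by (intro nn_integral_mono pw)
  also have "\<dots> = ennreal \<tau> + (\<Sum>j. \<integral>\<^sup>+ x. ennreal (f j x) \<partial>M)"
    by (subst nn_integral_add) (auto simp: nn_integral_suminf emeasure_space_1[simplified])
  also have "\<dots> \<le> ennreal \<tau> + (\<Sum>j. ennreal (15 * \<tau> powr (1 - \<beta>) * G * r ^ j))"
    by (intro add_left_mono suminf_le f_int) auto
  also have "(\<Sum>j. ennreal (15 * \<tau> powr (1 - \<beta>) * G * r ^ j)) = ennreal (moment_const \<beta> * \<tau> powr (1 - \<beta>) * G)"
  proof -
    have "(\<lambda>j. 15 * \<tau> powr (1 - \<beta>) * G * r ^ j) sums (15 * \<tau> powr (1 - \<beta>) * G * (1 / (1 - r)))"
      using r by (intro sums_mult geometric_sums) auto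
    then show ?thesis
      using r G by (subst suminf_ennreal_eq) (auto simp: moment_const_def r_def mult_ac)
  qed
  also have "ennreal \<tau> + \<dots> = ennreal (\<tau> + moment_const \<beta> * \<tau> powr (1 - \<beta>) * G)"
    using \<tau> G r by (intro ennreal_plus[symmetric]) (auto simp: moment_const_def r_def)
  finally have nn: "(\<integral>\<^sup>+ x. ennreal \<bar>x\<bar> \<partial>M) \<le> ennreal (\<tau> + moment_const \<beta> * \<tau> powr (1 - \<beta>) * G)" .
  then have fin: "(\<integral>\<^sup>+ x. ennreal \<bar>x\<bar> \<partial>M) < \<infinity>" by (simp add: le_less_trans)
  show i: "integrable M (\<lambda>x. x)" by (rule integrableI_bounded) (use fin in auto)
  have "0 \<le> \<tau> + moment_const \<beta> * \<tau> powr (1 - \<beta>) * G" using \<tau> G r by (auto simp: moment_const_def r_def)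
  then show "(\<integral>x. \<bar>x\<bar> \<partial>M) \<le> \<tau> + moment_const \<beta> * \<tau> powr (1 - \<beta>) * G"
    using nn i by (subst (asm) nn_integral_eq_integral) auto
qed

lemma (in prob_space) symmetrization:
  assumes X[measurable]: "X \<in> borel_measurable M"
  shows "real_distribution (distr (M \<Otimes>\<^sub>M M) borel (\<lambda>(x, y). X x - X y))"
    and "char (distr (M \<Otimes>\<^sub>M M) borel (\<lambda>(x, y). X x - X y)) \<theta> = sq_char (distr M borel X) \<theta>"
proof -
  let ?d = "distr (M \<Otimes>\<^sub>M M) borel (\<lambda>(x, y). X x - X y)"
  interpret pp: pair_prob_space M M ..
  show "real_distribution (?d)"
    by (rule pp.P.real_distribution_distr') simp
  have i: "integrable (M \<Otimes>\<^sub>M M) (\<lambda>p. iexp (\<theta> * X (fst p)) * iexp (- \<theta> * X (snd p)))"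
    by (rule pp.P.integrable_const_bound[of _ 1]) (auto simp: norm_mult)
  have "char (?d) \<theta>
      = (\<integral>p. iexp (\<theta> * X (fst p)) * iexp (- \<theta> * X (snd p)) \<partial>(M \<Otimes>\<^sub>M M))"
    by (subst char_distr)
       (auto simp: case_prod_beta' exp_add[symmetric] algebra_simps intro!: Bochner_Integration.integral_cong)
  also have "\<dots> = (\<integral>x. \<integral>y. iexp (\<theta> * X x) * iexp (- \<theta> * X y) \<partial>M \<partial>M)"
    using pp.integral_fst'[OF i] by simp
  also have "\<dots> = char (distr M borel X) \<theta> * char (distr M borel X) (- \<theta>)"
    unfolding char_distr[OF X] by simp
  also have "\<dots> = char (distr M borel X) \<theta> * cnj (char (distr M borel X) \<theta>)"
    by (simp only: char_minus)
  also have "\<dots> = sq_char (distr M borel X) \<theta>" unfolding sq_char_def by (rule complex_norm_square[symmetric])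
  finally show "char (?d) \<theta> = sq_char (distr M borel X) \<theta>" .
qed

text \<open>The bound holds with the same constant for all laws of this form, as it uses only
\<open>1 - exp(-u) \<le> u\<close> for the symmetrization.\<close>

lemma (in prob_space) stable_difference_truncated_second_moment:
  assumes X[measurable]: "X \<in> borel_measurable M" and G: "0 \<le> G" and \<beta>: "0 < \<beta>"
    and sq: "\<And>\<theta>. sq_char (distr M borel X) \<theta> = exp (- G * \<bar>\<theta>\<bar> powr \<beta>)"
  shows "(\<integral>x. \<integral>y. min 1 ((X x - X y)\<^sup>2) \<partial>M \<partial>M) \<le> 15 / 2 * G"
proof -
  interpret pp: pair_prob_space M M ..
  let ?d = "distr (M \<Otimes>\<^sub>M M) borel (\<lambda>(x, y). X x - X y)"
  interpret d: real_distribution ?d by (rule symmetrization[OF X])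
  have i: "integrable (M \<Otimes>\<^sub>M M) (\<lambda>p. min 1 ((X (fst p) - X (snd p))\<^sup>2))"
    by (rule pp.P.integrable_const_bound[of _ 1]) auto
  have "(\<integral>x. \<integral>y. min 1 ((X x - X y)\<^sup>2) \<partial>M \<partial>M) = (\<integral>p. min 1 ((X (fst p) - X (snd p))\<^sup>2) \<partial>(M \<Otimes>\<^sub>M M))"
    using pp.integral_fst'[OF i] by simp
  also have "\<dots> = (\<integral>x. min 1 ((x / 1)\<^sup>2) \<partial>?d)" by (subst integral_distr) (auto simp: case_prod_beta')
  also have "\<dots> \<le> 15 / 2 * (G * 1 powr (- \<beta>))"
  proof (rule d.truncated_second_moment_scaled[OF G _ \<beta>])
    fix \<theta> show "1 - G * \<bar>\<theta>\<bar> powr \<beta> \<le> Re (char ?d \<theta>)"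
      unfolding symmetrization[OF X] sq using exp_ge_add_one_self[of "- (G * \<bar>\<theta>\<bar> powr \<beta>)"] by simp
  qed simp
  finally show ?thesis by simp
qed

lemma (in prob_space) stable_centered_first_moment:
  assumes X[measurable]: "X \<in> borel_measurable M" and G: "0 \<le> G" and \<tau>: "0 < \<tau>" and \<beta>: "1 < \<beta>"
    and sq: "\<And>\<theta>. sq_char (distr M borel X) \<theta> = exp (- G * \<bar>\<theta>\<bar> powr \<beta>)"
  shows "integrable M X" and "(\<integral>x. \<bar>X x - (\<integral>x. X x \<partial>M)\<bar> \<partial>M) \<le> \<tau> + moment_const \<beta> * \<tau> powr (1 - \<beta>) * G"
proof -
  interpret pp: pair_prob_space M M ..
  let ?d = "distr (M \<Otimes>\<^sub>M M) borel (\<lambda>(x, y). X x - X y)"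
  interpret d: real_distribution ?d by (rule symmetrization[OF X])
  have char: "1 - G * \<bar>\<theta>\<bar> powr \<beta> \<le> Re (char ?d \<theta>)" for \<theta>
    unfolding symmetrization[OF X] sq using exp_ge_add_one_self[of "- (G * \<bar>\<theta>\<bar> powr \<beta>)"] by simp
  note fm = d.first_moment_le[OF G \<tau> \<beta> char]
  have i: "integrable (M \<Otimes>\<^sub>M M) (\<lambda>p. X (fst p) - X (snd p))"
    using fm(1) by (subst (asm) integrable_distr_eq) (auto simp: case_prod_beta')
  from pp.AE_integrable_fst'[OF i] have "AE x in M. integrable M (\<lambda>y. X x - X y)" by simp
  then obtain x where x: "integrable M (\<lambda>y. X x - X y)" using AE_False by (metis (mono_tags, lifting) eventually_mono)
  have "integrable M (\<lambda>y. X x - (X x - X y))" by (rule Bochner_Integration.integrable_diff[OF _ x]) simp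
  then show iX: "integrable M X" by simp
  have "(\<integral>x. \<bar>X x - (\<integral>x. X x \<partial>M)\<bar> \<partial>M) \<le> (\<integral>x. \<integral>y. \<bar>X x - X y\<bar> \<partial>M \<partial>M)"
  proof (rule integral_mono)
    show "integrable M (\<lambda>x. \<integral>y. \<bar>X x - X y\<bar> \<partial>M)" using pp.integrable_fst'[OF integrable_abs[OF i]] by simp
    fix x
    have "X x - (\<integral>x. X x \<partial>M) = (\<integral>y. X x - X y \<partial>M)" using iX by (simp add: prob_space)
    then show "\<bar>X x - (\<integral>x. X x \<partial>M)\<bar> \<le> (\<integral>y. \<bar>X x - X y\<bar> \<partial>M)" by (simp only: integral_abs_bound)
  qed (use iX in auto)
  also have "\<dots> = (\<integral>p. \<bar>X (fst p) - X (snd p)\<bar> \<partial>(M \<Otimes>\<^sub>M M))"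
    using pp.integral_fst'[OF integrable_abs[OF i]] by simp
  also have "\<dots> = (\<integral>x. \<bar>x\<bar> \<partial>?d)" by (subst integral_distr) (auto simp: case_prod_beta')
  also have "\<dots> \<le> \<tau> + moment_const \<beta> * \<tau> powr (1 - \<beta>) * G" by (rule fm(2))
  finally show "(\<integral>x. \<bar>X x - (\<integral>x. X x \<partial>M)\<bar> \<partial>M) \<le> \<tau> + moment_const \<beta> * \<tau> powr (1 - \<beta>) * G" .
qed

section \<open>The stable process and its random measure\<close>

lemma (in prob_space) indep_vars_reindex:
  assumes e: "inj_on e I" and ind: "indep_vars N X (e ` I)"
  shows "indep_vars (\<lambda>i. N (e i)) (\<lambda>i. X (e i)) I"
  unfolding indep_vars_def2 indep_sets_def
proof (intro conjI ballI allI impI)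
  show "random_variable (N (e i)) (X (e i))" if "i \<in> I" for i using ind that by (auto simp: indep_vars_def2)
  then show "{X (e i) -` A \<inter> space M |A. A \<in> sets (N (e i))} \<subseteq> events" if "i \<in> I" for i
    using that by (auto intro: measurable_sets)
  fix J A assume J: "J \<subseteq> I" "J \<noteq> {}" "finite J" and A: "A \<in> (\<Pi> j\<in>J. {X (e j) -` A \<inter> space M |A. A \<in> sets (N (e j))})"
  define B where "B k = A (inv_into I e k)" for k
  have Be: "B (e j) = A j" if "j \<in> J" for j using that J e by (auto simp: B_def)
  have "prob (\<Inter>k\<in>e ` J. B k) = (\<Prod>k\<in>e ` J. prob (B k))"
  proof -
    have "B \<in> (\<Pi> k\<in>e ` J. {X k -` A \<inter> space M |A. A \<in> sets (N k)})"     proof (rule Pi_I)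
      fix k assume "k \<in> e ` J"
      then obtain j where j: "j \<in> J" "k = e j" by auto
      show "B k \<in> {X k -` A \<inter> space M |A. A \<in> sets (N k)}" using Pi_mem[OF A j(1)] Be[OF j(1)] j(2) by simp
    qed
    moreover have "e ` J \<subseteq> e ` I" "e ` J \<noteq> {}" "finite (e ` J)" using J by auto
    ultimately show ?thesis using ind unfolding indep_vars_def2 indep_sets_def by blast
  qed
  then show "prob (\<Inter>j\<in>J. A j) = (\<Prod>j\<in>J. prob (A j))"
    using inj_on_subset[OF e J(1)] by (simp add: prod.reindex Be cong: INF_cong_simp prod.cong)
qed

text \<open>On an event of probability above one half the variable is small, so its distance to a large constant would be large there.\<close>

lemma (in prob_space) abs_const_less_of_mean_close:
  fixes D :: "'a \<Rightarrow> real"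
  assumes D[measurable]: "D \<in> borel_measurable M" and i: "integrable M (\<lambda>\<omega>. \<bar>D \<omega> - d\<bar>)"
    and E: "expectation (\<lambda>\<omega>. \<bar>D \<omega> - d\<bar>) < e / 4" and p: "prob {\<omega> \<in> space M. \<bar>D \<omega>\<bar> > e / 2} < 1 / 2"
    and e: "0 < e"
  shows "\<bar>d\<bar> < e"
proof (rule ccontr)
  let ?A = "{\<omega> \<in> space M. \<bar>D \<omega>\<bar> > e / 2}"
  assume "\<not> ?thesis"
  then have de: "e \<le> \<bar>d\<bar>" by simp
  have "(e / 2) * (1 / 2) \<le> (e / 2) * prob (space M - ?A)"
    using p e prob_compl[of ?A] by (intro mult_left_mono) auto
  also have "\<dots> = expectation (\<lambda>\<omega>. (e / 2) * indicator (space M - ?A) \<omega>)" by simp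
  also have "\<dots> \<le> expectation (\<lambda>\<omega>. \<bar>D \<omega> - d\<bar>)"
  proof (intro integral_mono i)
    show "integrable M (\<lambda>\<omega>. (e / 2) * indicator (space M - ?A) \<omega>)"
      by (intro integrable_mult_right integrable_real_indicator) (auto simp: less_top[symmetric])
    fix \<omega> assume "\<omega> \<in> space M"
    show "(e / 2) * indicator (space M - ?A) \<omega> \<le> \<bar>D \<omega> - d\<bar>"
    proof (cases "\<omega> \<in> ?A")
      case False
      then have "\<bar>D \<omega>\<bar> \<le> e / 2" using \<open>\<omega> \<in> space M\<close> by auto
      then have "e / 2 \<le> \<bar>D \<omega> - d\<bar>" using de by linarith
      then show ?thesis using e by (auto split: split_indicator)
    qed simp
  qed
  finally show False using E by simp
qed

lemma (in prob_space) AE_tendsto_imp_prob_tendsto: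
  fixes D :: "nat \<Rightarrow> 'a \<Rightarrow> real"
  assumes [measurable]: "\<And>n. D n \<in> borel_measurable M" and lim: "AE \<omega> in M. (\<lambda>n. D n \<omega>) \<longlonglongrightarrow> 0" and e: "0 < e"
  shows "(\<lambda>n. prob {\<omega> \<in> space M. \<bar>D n \<omega>\<bar> > e}) \<longlonglongrightarrow> 0"
proof -
  have "(\<lambda>n. expectation (indicator {\<omega> \<in> space M. \<bar>D n \<omega>\<bar> > e})) \<longlonglongrightarrow> expectation (\<lambda>\<omega>. 0 :: real)"
  proof (rule integral_dominated_convergence[where w = "\<lambda>_. 1"])
    show "AE \<omega> in M. (\<lambda>n. indicat_real {\<omega> \<in> space M. \<bar>D n \<omega>\<bar> > e} \<omega>) \<longlonglongrightarrow> 0"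
      using lim
    proof eventually_elim
      case (elim \<omega>)
      from LIMSEQ_D[OF elim e] obtain N where N: "\<And>n. n \<ge> N \<Longrightarrow> \<bar>D n \<omega>\<bar> < e" by auto
      then have "indicat_real {\<omega> \<in> space M. \<bar>D n \<omega>\<bar> > e} \<omega> = 0" if "n \<ge> N" for n
        using N[OF that] by (auto split: split_indicator)
      then show ?case by (intro tendsto_eventually eventually_sequentiallyI[of N])
    qed
  qed (auto split: split_indicator)
  then show ?thesis by simp
qed

lemma (in prob_space) AE_tendsto_imp_sq_char_tendsto:
  fixes X :: "nat \<Rightarrow> 'a \<Rightarrow> real"
  assumes [measurable]: "\<And>n. X n \<in> borel_measurable M" "Y \<in> borel_measurable M"
    and lim: "AE \<omega> in M. (\<lambda>n. X n \<omega>) \<longlonglongrightarrow> Y \<omega>"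
  shows "(\<lambda>n. sq_char (distr M borel (X n)) \<theta>) \<longlonglongrightarrow> sq_char (distr M borel Y) \<theta>"
proof -
  have "(\<lambda>n. expectation (\<lambda>\<omega>. iexp (\<theta> * X n \<omega>))) \<longlonglongrightarrow> expectation (\<lambda>\<omega>. iexp (\<theta> * Y \<omega>))"
  proof (rule integral_dominated_convergence[where w = "\<lambda>_. 1"])
    show "AE \<omega> in M. (\<lambda>n. iexp (\<theta> * X n \<omega>)) \<longlonglongrightarrow> iexp (\<theta> * Y \<omega>)"
      using lim
    proof eventually_elim
      case (elim \<omega>)
      then show ?case by (intro tendsto_intros)
    qed
  qed auto
  then show ?thesis unfolding sq_char_def char_distr[OF assms(1)] char_distr[OF assms(2)] by (intro tendsto_intros)
qed

lemma (in prob_space) sq_char_sum_indep: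
  assumes "indep_vars (\<lambda>_. borel) X I"
  shows "sq_char (distr M borel (\<lambda>\<omega>. \<Sum>i\<in>I. X i \<omega>)) \<theta> = (\<Prod>i\<in>I. sq_char (distr M borel (X i)) \<theta>)"
  unfolding sq_char_def char_distr_sum[OF assms] by (simp add: prod_norm prod_power_distrib[symmetric])

text \<open>Together with \<open>\<beta>\<close>, the two constants \<open>scale\<close> and \<open>drift\<close> carry all that is used about the law of
\<open>L\<close>: the modulus of its characteristic function, and its mean.\<close>

locale stable_levy = prob_space M for M :: "'a measure" +
  fixes L :: "real \<Rightarrow> 'a \<Rightarrow> real" and \<beta> :: real
  assumes levy: "two_sided_levy_process M L" and stable: "stable_law \<beta> (distr M borel (L 1))"
    and \<beta>_gt_1: "1 < \<beta>" and \<beta>_less_2: "\<beta> < 2"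
begin

definition scale :: real where "scale = - ln (sq_char (distr M borel (L 1)) 1)"
definition drift :: real where "drift = expectation (L 1)"

lemma L_measurable[measurable]: "L t \<in> borel_measurable M"
  using levy by (simp add: two_sided_levy_process_def)

lemma L_0: "AE \<omega> in M. L 0 \<omega> = 0"
  using levy by (simp add: two_sided_levy_process_def)

lemma increments_indep:
  "strict_mono ts \<Longrightarrow> indep_vars (\<lambda>_. borel) (\<lambda>i \<omega>. L (ts (Suc i)) \<omega> - L (ts i) \<omega>) {..<n::nat}"
  using levy by (simp add: two_sided_levy_process_def)

lemma increments_stationary:
  "0 \<le> h \<Longrightarrow> distr M borel (\<lambda>\<omega>. L (s + h) \<omega> - L s \<omega>) = distr M borel (\<lambda>\<omega>. L (t + h) \<omega> - L t \<omega>)"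
  using levy by (simp add: two_sided_levy_process_def)

lemma stochastic_continuity:
  "0 < \<epsilon> \<Longrightarrow> ((\<lambda>s. prob {\<omega> \<in> space M. \<bar>L s \<omega> - L t \<omega>\<bar> > \<epsilon>}) \<longlongrightarrow> 0) (at t)"
  using levy by (simp add: two_sided_levy_process_def)

lemma scale_nonneg: "0 \<le> scale" and sq_char_L1: "sq_char (distr M borel (L 1)) \<theta> = exp (- scale * \<bar>\<theta>\<bar> powr \<beta>)"
proof -
  have "prob_space (distr M borel (L 1))" by (rule prob_space_distr) simp
  from stable_sq_char[OF this _ _ stable] \<beta>_gt_1 obtain c where c: "0 \<le> c"
    "\<And>\<theta>. sq_char (distr M borel (L 1)) \<theta> = exp (- c * \<bar>\<theta>\<bar> powr \<beta>)" by auto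
  then have "scale = c" by (simp add: scale_def)
  with c show "0 \<le> scale" "sq_char (distr M borel (L 1)) \<theta> = exp (- scale * \<bar>\<theta>\<bar> powr \<beta>)" by auto
qed

lemma char_increment_split:
  assumes "u < v" "v < w"
  shows "char (distr M borel (\<lambda>\<omega>. L w \<omega> - L u \<omega>)) \<theta>
    = char (distr M borel (\<lambda>\<omega>. L v \<omega> - L u \<omega>)) \<theta> * char (distr M borel (\<lambda>\<omega>. L w \<omega> - L v \<omega>)) \<theta>"
proof -
  \<comment> \<open>independence is stated for increasing sequences; the points after \<open>w\<close> only complete such a sequence\<close>
  define ts where "ts i = (if i = 0 then u else if i = 1 then v else w + real (i - 2))" for i :: nat
  have "strict_mono ts"
    unfolding strict_mono_Suc_iff
  proof
    fix i :: nat
    show "ts i < ts (Suc i)" using assms by (cases i; cases "i - 1") (auto simp: ts_def)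
  qed
  from char_distr_sum[OF increments_indep[OF this, of 2]]
  have "char (distr M borel (\<lambda>\<omega>. \<Sum>i\<in>{..<2::nat}. L (ts (Suc i)) \<omega> - L (ts i) \<omega>)) \<theta>
     = (\<Prod>i\<in>{..<2::nat}. char (distr M borel (\<lambda>\<omega>. L (ts (Suc i)) \<omega> - L (ts i) \<omega>)) \<theta>)" .
  then show ?thesis by (simp add: ts_def numeral_2_eq_2 lessThan_Suc)
qed

text \<open>The modulus is multiplicative in the length of the increment and at most one, hence exponential in the
length. It has no zero, because its value at length one is positive.\<close>

lemma sq_char_increment:
  assumes "s \<le> t"
  shows "sq_char (distr M borel (\<lambda>\<omega>. L t \<omega> - L s \<omega>)) \<theta> = exp (- (scale * (t - s)) * \<bar>\<theta>\<bar> powr \<beta>)"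
proof -
  define \<rho> where "\<rho> h = sq_char (distr M borel (\<lambda>\<omega>. L h \<omega> - L 0 \<omega>)) \<theta>" for h
  have shift: "sq_char (distr M borel (\<lambda>\<omega>. L (s + h) \<omega> - L s \<omega>)) \<theta> = \<rho> h" if "0 \<le> h" for s h
    using increments_stationary[OF that, of s 0] by (simp add: \<rho>_def)
  have mult: "\<rho> (s + t) = \<rho> s * \<rho> t" if "0 < s" "0 < t" for s t
    using char_increment_split[of 0 s "s + t" \<theta>] shift[of t s] that
    by (simp add: \<rho>_def sq_char_def norm_mult power_mult_distrib)
  have le1: "\<rho> h \<le> 1" "0 \<le> \<rho> h" for h
  proof -
    interpret d: real_distribution "distr M borel (\<lambda>\<omega>. L h \<omega> - L 0 \<omega>)" by (rule real_distribution_distr') simp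
    show "\<rho> h \<le> 1" "0 \<le> \<rho> h" by (simp_all add: \<rho>_def d.sq_char_le_1 sq_char_nonneg)
  qed
  have \<rho>1: "\<rho> 1 = exp (- scale * \<bar>\<theta>\<bar> powr \<beta>)"
  proof -
    have "distr M borel (\<lambda>\<omega>. L 1 \<omega> - L 0 \<omega>) = distr M borel (L 1)"
      by (rule distr_cong_AE) (use L_0 in auto)
    then show ?thesis by (simp add: \<rho>_def sq_char_L1)
  qed
  have \<rho>n: "0 < \<rho> (real (Suc n))" for n
  proof (induction n)
    case (Suc n)
    have "\<rho> (real (Suc (Suc n))) = \<rho> (real (Suc n)) * \<rho> 1" using mult[of "real (Suc n)" 1] by (simp add: add.commute)
    then show ?case using Suc \<rho>1 by simp
  qed (simp add: \<rho>1)
  have pos: "0 < \<rho> h" if "0 < h" for h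
  proof -
    obtain n where n: "h < real n" using reals_Archimedean2 by blast
    then have "\<rho> (real (Suc n)) = \<rho> h * \<rho> (real (Suc n) - h)" using mult[of h "real (Suc n) - h"] that by simp
    then have "\<rho> h \<noteq> 0" using \<rho>n[of n] by auto
    then show ?thesis using le1(2)[of h] by simp
  qed
  have lin: "- ln (\<rho> h) = h * (scale * \<bar>\<theta>\<bar> powr \<beta>)" if "0 < h" for h
  proof -
    have "- ln (\<rho> h) = h * (- ln (\<rho> 1))"
    proof (rule additive_nonneg_imp_linear[OF _ _ that, of "\<lambda>h. - ln (\<rho> h)"])
      fix s t :: real assume st: "0 < s" "0 < t"
      show "- ln (\<rho> (s + t)) = - ln (\<rho> s) + - ln (\<rho> t)"
        unfolding mult[OF st] using pos st by (subst ln_mult_pos) auto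
    next
      fix t :: real assume "0 < t"
      then show "0 \<le> - ln (\<rho> t)" using le1[of t] pos[of t] by simp
    qed
    then show ?thesis by (simp add: \<rho>1)
  qed
  have "\<rho> (t - s) = exp (- (scale * (t - s)) * \<bar>\<theta>\<bar> powr \<beta>)"
  proof (cases "s = t")
    case True
    have "char (distr M borel (\<lambda>\<omega>. L 0 \<omega> - L 0 \<omega>)) \<theta> = 1"
      by (subst char_distr) (auto simp: prob_space)
    then show ?thesis using True by (simp add: \<rho>_def sq_char_def)
  next
    case False
    then have h: "0 < t - s" using assms by simp
    have "ln (\<rho> (t - s)) = - (scale * (t - s)) * \<bar>\<theta>\<bar> powr \<beta>" using lin[OF h] by (simp add: mult_ac)
    then show ?thesis using pos[OF h] by (metis exp_ln)
  qed
  then show ?thesis using shift[of "t - s" s] assms by simp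
qed

lemma moment_of_scale:
  assumes "X \<in> borel_measurable M" "0 \<le> c" "\<And>\<theta>. sq_char (distr M borel X) \<theta> = exp (- (scale * c) * \<bar>\<theta>\<bar> powr \<beta>)"
  shows "integrable M X"
    and "0 < \<tau> \<Longrightarrow> expectation (\<lambda>\<omega>. \<bar>X \<omega> - expectation X\<bar>) \<le> \<tau> + moment_const \<beta> * \<tau> powr (1 - \<beta>) * (scale * c)"
  using stable_centered_first_moment[OF assms(1) mult_nonneg_nonneg[OF scale_nonneg assms(2)] _ \<beta>_gt_1 assms(3)] zero_less_one
  by blast+

lemma increment_moment:
  assumes "s \<le> t"
  shows "integrable M (\<lambda>\<omega>. L t \<omega> - L s \<omega>)"
    and "0 < \<tau> \<Longrightarrow> expectation (\<lambda>\<omega>. \<bar>L t \<omega> - L s \<omega> - expectation (\<lambda>\<omega>. L t \<omega> - L s \<omega>)\<bar>)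
       \<le> \<tau> + moment_const \<beta> * \<tau> powr (1 - \<beta>) * (scale * (t - s))"
  using moment_of_scale[OF _ _ sq_char_increment[OF assms]] assms by simp_all

text \<open>The mean is additive in the length. It tends to zero with the length: a short increment is close in mean to
its expectation by the moment bound, and close to zero in probability by stochastic continuity.\<close>

lemma mean_increment:
  assumes "s \<le> t"
  shows "expectation (\<lambda>\<omega>. L t \<omega> - L s \<omega>) = drift * (t - s)"
proof -
  define m where "m h = expectation (\<lambda>\<omega>. L h \<omega> - L 0 \<omega>)" for h
  have shift: "expectation (\<lambda>\<omega>. L (s + h) \<omega> - L s \<omega>) = m h" if "0 \<le> h" for s h
  proof -
    have "expectation (\<lambda>\<omega>. L (s + h) \<omega> - L s \<omega>) = (\<integral>x. x \<partial>distr M borel (\<lambda>\<omega>. L (s + h) \<omega> - L s \<omega>))"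
      by (subst integral_distr) auto
    also have "\<dots> = (\<integral>x. x \<partial>distr M borel (\<lambda>\<omega>. L (0 + h) \<omega> - L 0 \<omega>))" by (simp only: increments_stationary[OF that, of s 0])
    also have "\<dots> = m h" by (subst integral_distr) (auto simp: m_def)
    finally show ?thesis .
  qed
  have add: "m (s + t) = m s + m t" if "0 \<le> s" "0 \<le> t" for s t
  proof -
    have "m (s + t) = expectation (\<lambda>\<omega>. (L s \<omega> - L 0 \<omega>) + (L (s + t) \<omega> - L s \<omega>))" by (simp add: m_def)
    also have "\<dots> = m s + expectation (\<lambda>\<omega>. L (s + t) \<omega> - L s \<omega>)"
      unfolding m_def using increment_moment(1)[of 0 s] increment_moment(1)[of s "s + t"] that
      by (subst Bochner_Integration.integral_add) auto
    finally show ?thesis using shift[OF that(2), of s] by simp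
  qed
  have "(m \<longlongrightarrow> 0) (at_right 0)"
  proof (rule tendstoI)
    fix e :: real assume e: "0 < e"
    define \<delta> where "\<delta> = e / 16"
    define K where "K = moment_const \<beta> * \<delta> powr (1 - \<beta>) * scale"
    have "((\<lambda>s. prob {\<omega> \<in> space M. \<bar>L s \<omega> - L 0 \<omega>\<bar> > e / 2}) \<longlongrightarrow> 0) (at_right 0)"
      using stochastic_continuity[of "e/2" 0] e by (auto intro: tendsto_mono[OF at_le])
    then have ev1: "\<forall>\<^sub>F h in at_right 0. prob {\<omega> \<in> space M. \<bar>L h \<omega> - L 0 \<omega>\<bar> > e / 2} < 1 / 2"
      by (rule order_tendstoD) simp
    have "((\<lambda>h. K * h) \<longlongrightarrow> K * 0) (at_right 0)" by (intro tendsto_intros)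
    then have ev2: "\<forall>\<^sub>F h in at_right 0. K * h < \<delta>"
      using e by (intro order_tendstoD(2)[of _ 0]) (auto simp: \<delta>_def)
    have ev3: "\<forall>\<^sub>F h in at_right 0. 0 < (h::real)" by (rule eventually_at_right_less)
    show "\<forall>\<^sub>F h in at_right 0. dist (m h) 0 < e"
      using ev1 ev2 ev3
    proof eventually_elim
      case (elim h)
      have iD: "integrable M (\<lambda>\<omega>. \<bar>L h \<omega> - L 0 \<omega> - m h\<bar>)" using increment_moment(1)[of 0 h] elim by auto
      have "expectation (\<lambda>\<omega>. \<bar>L h \<omega> - L 0 \<omega> - m h\<bar>) \<le> \<delta> + K * h"
        using increment_moment(2)[of 0 h \<delta>] elim e by (simp add: m_def K_def \<delta>_def mult_ac)
      also have "\<dots> < e / 4" using elim e by (simp add: \<delta>_def)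
      finally show ?case using abs_const_less_of_mean_close[OF _ iD _ elim(1) e] by simp
    qed
  qed
  from additive_null_at_0_imp_linear[OF add this, of "t - s"] have "m (t - s) = (t - s) * m 1" using assms by simp
  moreover have "m 1 = drift"
    unfolding m_def drift_def using L_0 by (intro integral_cong_AE) auto
  ultimately show ?thesis using shift[of "t - s" s] assms by (simp add: mult.commute)
qed

end

locale levy_measure = stable_levy +
  fixes \<Lambda> :: "real set \<Rightarrow> 'a \<Rightarrow> real"
  assumes random_measure: "levy_random_measure M L \<Lambda>"
begin

definition dring :: "real set \<Rightarrow> bool" where
  "dring A \<longleftrightarrow> A \<in> sets borel \<and> bounded A"

lemma dringD: "dring A \<Longrightarrow> A \<in> sets borel" "dring A \<Longrightarrow> bounded A" by (auto simp: dring_def)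

lemma dring_subset: "dring A \<Longrightarrow> B \<in> sets borel \<Longrightarrow> B \<subseteq> A \<Longrightarrow> dring B"
  by (auto simp: dring_def intro: bounded_subset)

lemma dring_empty: "dring {}" by (simp add: dring_def)

lemma dring_finite_measure: "dring A \<Longrightarrow> A \<in> fmeasurable lborel"
  using emeasure_bounded_finite[of A] by (auto simp: dring_def fmeasurable_def)

lemma measure_dring_Diff:
  assumes "dring A" "dring B" "B \<subseteq> A"
  shows "measure lborel (A - B) = measure lborel A - measure lborel B"
  using assms emeasure_bounded_finite[of A] by (intro measure_Diff) (auto simp: dring_def less_top)

lemma \<Lambda>_measurable: "dring A \<Longrightarrow> \<Lambda> A \<in> borel_measurable M"
  using random_measure by (simp add: levy_random_measure_def dring_def)

lemma \<Lambda>_sequence: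
  assumes "\<And>n. dring (A n)" "disjoint_family A"
  shows "indep_vars (\<lambda>_. borel) (\<lambda>n. \<Lambda> (A n)) UNIV"
    and "bounded (\<Union>n. A n) \<Longrightarrow> AE \<omega> in M. (\<lambda>n. \<Lambda> (A n) \<omega>) sums \<Lambda> (\<Union>n. A n) \<omega>"
  using random_measure assms unfolding levy_random_measure_def dring_def by blast+

lemma \<Lambda>_Ioc: "s \<le> t \<Longrightarrow> AE \<omega> in M. \<Lambda> {s<..t} \<omega> = L t \<omega> - L s \<omega>"
  using random_measure by (simp add: levy_random_measure_def)

lemma \<Lambda>_empty: "AE \<omega> in M. \<Lambda> {} \<omega> = 0"
  using \<Lambda>_Ioc[of 0 0] by simp

text \<open>Independence and additivity are given for sequences; a finite family is padded with empty sets.\<close>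

lemma \<Lambda>_finite_family:
  fixes C :: "'i \<Rightarrow> real set"
  assumes I: "finite I" and C: "\<And>i. i \<in> I \<Longrightarrow> dring (C i)" and disj: "disjoint_family_on C I"
  shows "indep_vars (\<lambda>_. borel) (\<lambda>i. \<Lambda> (C i)) I"
    and "AE \<omega> in M. \<Lambda> (\<Union>i\<in>I. C i) \<omega> = (\<Sum>i\<in>I. \<Lambda> (C i) \<omega>)"
proof -
  obtain e where e: "bij_betw e I {..<card I}" using ex_bij_betw_finite_nat[OF I] by (metis atLeast0LessThan)
  define d where "d = the_inv_into I e"
  have d: "bij_betw d {..<card I} I" unfolding d_def by (rule bij_betw_the_inv_into[OF e])
  have de: "d (e i) = i" if "i \<in> I" for i
    unfolding d_def using e that by (meson bij_betw_imp_inj_on the_inv_into_f_f)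
  define A where "A n = (if n < card I then C (d n) else {})" for n
  have dI: "d n \<in> I" if "n < card I" for n using d that by (auto simp: bij_betw_def)
  have A: "dring (A n)" for n using C dI by (auto simp: A_def dring_empty)
  have Adisj: "disjoint_family A"
    unfolding disjoint_family_on_def
  proof (intro ballI impI)
    fix m n :: nat assume "m \<noteq> n"
    then show "A m \<inter> A n = {}"
      using disj dI[of m] dI[of n] d unfolding A_def disjoint_family_on_def bij_betw_def inj_on_def
      by (auto split: if_splits)
  qed
  have eq: "\<Lambda> (A (e i)) = \<Lambda> (C i)" if "i \<in> I" for i
    using that e de by (auto simp: A_def bij_betw_def)
  have "indep_vars (\<lambda>_. borel) (\<lambda>n. \<Lambda> (A n)) (e ` I)"
    by (rule indep_vars_subset[OF \<Lambda>_sequence(1)[OF A Adisj]]) simp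
  then have "indep_vars (\<lambda>_. borel) (\<lambda>i. \<Lambda> (A (e i))) I"
    using e by (intro indep_vars_reindex[of e I "\<lambda>_. borel" "\<lambda>n. \<Lambda> (A n)"]) (auto simp: bij_betw_def)
  then show "indep_vars (\<lambda>_. borel) (\<lambda>i. \<Lambda> (C i)) I"
    by (subst indep_vars_cong[OF refl _ refl]) (auto simp: eq)
  have U: "(\<Union>n. A n) = (\<Union>i\<in>I. C i)"
  proof -
    have "(\<Union>n. A n) = (\<Union>n\<in>{..<card I}. C (d n))" by (auto simp: A_def split: if_splits)
    also have "\<dots> = (\<Union>i\<in>d ` {..<card I}. C i)" by simp
    also have "d ` {..<card I} = I" using d by (simp add: bij_betw_def)
    finally show ?thesis .
  qed
  have "bounded (\<Union>n. A n)" unfolding U using I C by (auto simp: dring_def)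
  from \<Lambda>_sequence(2)[OF A Adisj this] \<Lambda>_empty
  show "AE \<omega> in M. \<Lambda> (\<Union>i\<in>I. C i) \<omega> = (\<Sum>i\<in>I. \<Lambda> (C i) \<omega>)"
  proof eventually_elim
    case (elim \<omega>)
    have "(\<lambda>n. \<Lambda> (A n) \<omega>) sums (\<Sum>n<card I. \<Lambda> (A n) \<omega>)"
      by (rule sums_finite) (auto simp: A_def elim)
    with elim have "\<Lambda> (\<Union>n. A n) \<omega> = (\<Sum>n<card I. \<Lambda> (A n) \<omega>)" by (meson sums_unique2)
    also have "\<dots> = (\<Sum>n<card I. \<Lambda> (C (d n)) \<omega>)" by (intro sum.cong) (auto simp: A_def)
    also have "\<dots> = (\<Sum>i\<in>I. \<Lambda> (C i) \<omega>)" by (rule sum.reindex_bij_betw[OF d])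
    finally show ?case by (simp add: U)
  qed
qed

lemma \<Lambda>_diff:
  assumes AB: "dring A" "dring B" "B \<subseteq> A"
  shows "AE \<omega> in M. \<Lambda> A \<omega> = \<Lambda> B \<omega> + \<Lambda> (A - B) \<omega>"
    and "sq_char (distr M borel (\<Lambda> A)) \<theta> = sq_char (distr M borel (\<Lambda> B)) \<theta> * sq_char (distr M borel (\<Lambda> (A - B))) \<theta>"
proof -
  let ?C = "case_bool B (A - B)"
  have C: "dring (?C b)" for b
    using AB dring_subset[OF AB(1), of "A - B"] by (auto split: bool.split simp: dring_def)
  have disj: "disjoint_family_on ?C UNIV" by (auto simp: disjoint_family_on_def split: bool.split)
  have U: "(\<Union>b\<in>UNIV. ?C b) = A" using AB(3) by (auto simp: UNIV_bool)
  note fam = \<Lambda>_finite_family[OF finite C disj]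
  show ae: "AE \<omega> in M. \<Lambda> A \<omega> = \<Lambda> B \<omega> + \<Lambda> (A - B) \<omega>" using fam(2) unfolding U by (auto simp: UNIV_bool elim!: eventually_mono)
  have m: "\<Lambda> (?C b) \<in> borel_measurable M" for b by (rule \<Lambda>_measurable[OF C])
  have "distr M borel (\<Lambda> A) = distr M borel (\<lambda>\<omega>. \<Sum>b\<in>UNIV. \<Lambda> (?C b) \<omega>)"
    by (rule distr_cong_AE) (use fam(2) \<Lambda>_measurable[OF AB(1)] m in \<open>auto simp: U\<close>)
  then show "sq_char (distr M borel (\<Lambda> A)) \<theta> = sq_char (distr M borel (\<Lambda> B)) \<theta> * sq_char (distr M borel (\<Lambda> (A - B))) \<theta>"
    using sq_char_sum_indep[OF fam(1)] by (simp add: UNIV_bool mult.commute)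
qed

lemma dring_Ioc: "dring {s<..t}" by (auto simp: dring_def bounded_subset[OF bounded_closed_interval[of s t]])

text \<open>The bounded half-open intervals form an intersection-stable generator of the Borel sets. Complements are
not bounded, so the argument is carried out for traces on a fixed interval that contains \<open>A\<close>.\<close>

lemma dring_induct [consumes 1, case_names interval diff union]:
  assumes A: "dring A"
    and ioc: "\<And>s t. s \<le> t \<Longrightarrow> P {s<..t}"
    and diff: "\<And>A B. dring A \<Longrightarrow> dring B \<Longrightarrow> B \<subseteq> A \<Longrightarrow> P A \<Longrightarrow> P B \<Longrightarrow> P (A - B)"
    and union: "\<And>C :: nat \<Rightarrow> real set. (\<And>i. dring (C i)) \<Longrightarrow> disjoint_family C \<Longrightarrow> dring (\<Union>i. C i) \<Longrightarrow> (\<And>i. P (C i)) \<Longrightarrow> P (\<Union>i. C i)"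
  shows "P A"
proof -
  obtain r where "\<And>x. x \<in> A \<Longrightarrow> \<bar>x\<bar> \<le> r" using A by (auto simp: dring_def bounded_iff)
  then have r: "A \<subseteq> {- r..r}" by (fastforce simp: abs_le_iff)
  define I where "I = {- r - 1<..r + 1}"
  have AI: "A \<subseteq> I" using r by (force simp: I_def)
  have P_empty: "P {}" using ioc[of 0 0] by simp
  have dI: "dring (B \<inter> I)" if "B \<in> sets borel" for B
    by (rule dring_subset[OF dring_Ioc]) (use that in \<open>auto simp: I_def\<close>)
  have P_I: "P (UNIV \<inter> I)" unfolding I_def
  proof (cases "- r - 1 \<le> r + 1")
    case False
    then show "P (UNIV \<inter> {- r - 1<..r + 1})" using P_empty by simp
  qed (simp add: ioc)
  have A_sig: "A \<in> sigma_sets UNIV (range (\<lambda>(a, b). {a <.. b::real}))"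
    using dringD(1)[OF A] unfolding borel_sigma_sets_Ioc by simp
  have stab: "Int_stable (range (\<lambda>(a, b). {a <.. b::real}))"
  proof (rule Int_stableI)
    fix A B assume "A \<in> range (\<lambda>(a, b). {a <.. b::real})" "B \<in> range (\<lambda>(a, b). {a <.. b::real})"
    then obtain a b a' b' where "A = {a<..b}" "B = {a'<..b'}" by auto
    then have "A \<inter> B = (case (max a a', min b b') of (a, b) \<Rightarrow> {a<..b})" by auto
    then show "A \<inter> B \<in> range (\<lambda>(a, b). {a <.. b::real})" by (metis rangeI)
  qed
  have "P (A \<inter> I)"
  proof (rule sigma_sets_induct_disjoint[OF stab subset_Pow_Union[of _, THEN order_trans] A_sig, where P = "\<lambda>B. P (B \<inter> I)"])
    show "Pow (\<Union> (range (\<lambda>(a, b). {a <.. b::real}))) \<subseteq> Pow UNIV" by simp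
    fix B assume "B \<in> range (\<lambda>(a, b). {a <.. b::real})"
    then obtain a b where B: "B = {a<..b}" by auto
    have e: "B \<inter> I = {max a (- r - 1)<..min b (r + 1)}" by (auto simp: B I_def)
    show "P (B \<inter> I)"
    proof (cases "max a (- r - 1) \<le> min b (r + 1)")
      case True
      then show ?thesis unfolding e by (rule ioc)
    next
      case False
      then have "B \<inter> I = {}" unfolding e by (intro greaterThanAtMost_empty) linarith
      then show ?thesis using P_empty by simp
    qed
  next
    show "P ({} \<inter> I)" using P_empty by simp
  next
    fix B assume "B \<in> sigma_sets UNIV (range (\<lambda>(a, b). {a <.. b::real}))" and PB: "P (B \<inter> I)"
    then have B: "B \<in> sets borel" unfolding borel_sigma_sets_Ioc by simp
    have "(UNIV - B) \<inter> I = (UNIV \<inter> I) - (B \<inter> I)" by auto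
    moreover have "P ((UNIV \<inter> I) - (B \<inter> I))" using B by (intro diff dI P_I PB) auto
    ultimately show "P ((UNIV - B) \<inter> I)" by simp
  next
    fix C :: "nat \<Rightarrow> real set"
    assume disj: "disjoint_family C" and C: "range C \<subseteq> sigma_sets UNIV (range (\<lambda>(a, b). {a <.. b::real}))"
      and PC: "\<And>i. P (C i \<inter> I)"
    have Cb: "C i \<in> sets borel" for i using C unfolding borel_sigma_sets_Ioc by auto
    have "P (\<Union>i. C i \<inter> I)"
    proof (rule union)
      show "disjoint_family (\<lambda>i. C i \<inter> I)" using disj by (auto simp: disjoint_family_on_def)
      have "(\<Union>i. C i \<inter> I) = (\<Union>i. C i) \<inter> I" by auto
      then show "dring (\<Union>i. C i \<inter> I)" using dI[of "\<Union>i. C i"] Cb by auto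
    qed (use Cb dI PC in auto)
    then show "P ((\<Union>i. C i) \<inter> I)" by (simp add: Int_UN_distrib2)
  qed
  moreover have "A \<inter> I = A" using AI by blast
  ultimately show ?thesis by simp
qed

lemma measure_UNION_sums:
  assumes "\<And>i :: nat. dring (C i)" "disjoint_family C" "dring (\<Union>i. C i)"
  shows "(\<lambda>i. measure lborel (C i)) sums measure lborel (\<Union>i. C i)"
proof (rule measure_UNION)
  show "emeasure lborel (\<Union>i. C i) \<noteq> \<infinity>" using dring_finite_measure[OF assms(3)] by (auto simp: fmeasurable_def)
qed (use assms in \<open>auto simp: dring_def\<close>)

lemma sq_char_\<Lambda>:
  assumes "dring A"
  shows "sq_char (distr M borel (\<Lambda> A)) \<theta> = exp (- (scale * measure lborel A) * \<bar>\<theta>\<bar> powr \<beta>)"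
  using assms
proof (induction rule: dring_induct)
  case (interval s t)
  have "distr M borel (\<Lambda> {s<..t}) = distr M borel (\<lambda>\<omega>. L t \<omega> - L s \<omega>)"
    by (rule distr_cong_AE) (use \<Lambda>_Ioc[OF interval] \<Lambda>_measurable[OF dring_Ioc] in auto)
  then show ?case using sq_char_increment[OF interval] interval by simp
next
  case (diff A B)
  have mA: "measure lborel A = measure lborel B + measure lborel (A - B)"
    using measure_dring_Diff[OF diff(1-3)] by simp
  from diff(4) have "exp (- (scale * measure lborel B) * \<bar>\<theta>\<bar> powr \<beta>) * sq_char (distr M borel (\<Lambda> (A - B))) \<theta>
     = exp (- (scale * measure lborel B) * \<bar>\<theta>\<bar> powr \<beta>) * exp (- (scale * measure lborel (A - B)) * \<bar>\<theta>\<bar> powr \<beta>)"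
    unfolding \<Lambda>_diff(2)[OF diff(1-3)] diff(5) mA exp_add[symmetric] by (simp add: algebra_simps)
  then show ?case by simp
next
  case (union C)
  have m: "\<Lambda> (C i) \<in> borel_measurable M" for i using \<Lambda>_measurable union(1) by blast
  have "(\<lambda>n. sq_char (distr M borel (\<lambda>\<omega>. \<Sum>i<n. \<Lambda> (C i) \<omega>)) \<theta>) \<longlonglongrightarrow> sq_char (distr M borel (\<Lambda> (\<Union>i. C i))) \<theta>"
    using \<Lambda>_sequence(2)[OF union(1,2) dringD(2)[OF union(3)]] m \<Lambda>_measurable[OF union(3)]
    by (intro AE_tendsto_imp_sq_char_tendsto) (auto simp: sums_def)
  moreover have "sq_char (distr M borel (\<lambda>\<omega>. \<Sum>i<n. \<Lambda> (C i) \<omega>)) \<theta> = exp (- (scale * (\<Sum>i<n. measure lborel (C i))) * \<bar>\<theta>\<bar> powr \<beta>)" for n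
    using sq_char_sum_indep[OF indep_vars_subset[OF \<Lambda>_sequence(1)[OF union(1,2)]], of "{..<n}" \<theta>]
    by (simp add: union(4) exp_sum[symmetric] sum_distrib_left sum_distrib_right sum_negf)
  moreover have "(\<lambda>n. exp (- (scale * (\<Sum>i<n. measure lborel (C i))) * \<bar>\<theta>\<bar> powr \<beta>))
      \<longlonglongrightarrow> exp (- (scale * measure lborel (\<Union>i. C i)) * \<bar>\<theta>\<bar> powr \<beta>)"
    using measure_UNION_sums[OF union(1-3)] unfolding sums_def by (intro tendsto_intros)
  ultimately show ?case by (simp add: LIMSEQ_unique)
qed

lemma \<Lambda>_moment:
  assumes A: "dring A"
  shows "integrable M (\<Lambda> A)"
    and "0 < \<tau> \<Longrightarrow> expectation (\<lambda>\<omega>. \<bar>\<Lambda> A \<omega> - expectation (\<Lambda> A)\<bar>) \<le> \<tau> + moment_const \<beta> * \<tau> powr (1 - \<beta>) * (scale * measure lborel A)"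
  using moment_of_scale[OF \<Lambda>_measurable[OF A] measure_nonneg sq_char_\<Lambda>[OF A]] by blast+

text \<open>For a disjoint union, additivity holds almost surely along the series. The measure \<open>B n\<close> of
the remainder tends to zero almost surely and, by the moment bound, it is close in mean to its expectation. So its
expectation tends to zero.\<close>

lemma mean_\<Lambda>:
  assumes "dring A"
  shows "expectation (\<Lambda> A) = drift * measure lborel A"
  using assms
proof (induction rule: dring_induct)
  case (interval s t)
  have "expectation (\<Lambda> {s<..t}) = expectation (\<lambda>\<omega>. L t \<omega> - L s \<omega>)"
    by (rule integral_cong_AE) (use \<Lambda>_Ioc[OF interval] \<Lambda>_measurable[OF dring_Ioc] in auto)
  then show ?case using mean_increment[OF interval] interval by simp
next
  case (diff A B)
  have AB: "dring (A - B)" using diff(1-3) by (auto intro: dring_subset[OF diff(1)] simp: dring_def)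
  have "expectation (\<Lambda> A) = expectation (\<lambda>\<omega>. \<Lambda> B \<omega> + \<Lambda> (A - B) \<omega>)"
    by (rule integral_cong_AE) (use \<Lambda>_diff(1)[OF diff(1-3)] \<Lambda>_measurable diff(1,2) AB in auto)
  also have "\<dots> = expectation (\<Lambda> B) + expectation (\<Lambda> (A - B))"
    using \<Lambda>_moment(1) diff(2) AB by simp
  finally have "expectation (\<Lambda> (A - B)) = drift * measure lborel A - drift * measure lborel B" using diff by simp
  also have "\<dots> = drift * measure lborel (A - B)"
    using measure_dring_Diff[OF diff(1-3)] by (simp add: right_diff_distrib)
  finally show ?case .
next
  case (union C)
  let ?U = "\<Union>i. C i"
  define S where "S n \<omega> = (\<Sum>i<n. \<Lambda> (C i) \<omega>)" for n \<omega>
  define B where "B n = ?U - (\<Union>i<n. C i)" for n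
  have iC: "integrable M (\<Lambda> (C i))" and iU: "integrable M (\<Lambda> ?U)" for i using \<Lambda>_moment(1) union(1,3) by blast+
  have iS: "integrable M (S n)" for n unfolding S_def[abs_def] using iC by simp
  have dn: "dring (\<Union>i<n. C i)" for n using union(1) by (auto simp: dring_def)
  have Bd: "dring (B n)" for n unfolding B_def by (rule dring_subset[OF union(3)]) (use dn union(3) in \<open>auto simp: dring_def\<close>)
  have fin: "AE \<omega> in M. \<Lambda> (\<Union>i<n. C i) \<omega> = S n \<omega>" for n
    unfolding S_def using union(2) by (intro \<Lambda>_finite_family(2) union(1)) (auto simp: disjoint_family_on_def)
  have BS: "AE \<omega> in M. \<Lambda> (B n) \<omega> = \<Lambda> ?U \<omega> - S n \<omega>" for n
  proof -
    have "AE \<omega> in M. \<Lambda> ?U \<omega> = \<Lambda> (\<Union>i<n. C i) \<omega> + \<Lambda> (B n) \<omega>"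
      unfolding B_def by (rule \<Lambda>_diff(1)[OF union(3) dn]) auto
    with fin[of n] show ?thesis by eventually_elim simp
  qed
  have mB: "measure lborel (B n) = measure lborel ?U - (\<Sum>i<n. measure lborel (C i))" for n
  proof -
    have "emeasure lborel (C i) \<noteq> \<infinity>" for i using dring_finite_measure[OF union(1)[of i]] by (auto simp: fmeasurable_def)
    then have "measure lborel (\<Union>i<n. C i) = (\<Sum>i<n. measure lborel (C i))"
      using union(1,2) by (intro measure_finite_Union) (auto simp: disjoint_family_on_def dring_def fmeasurable_def)
    then show ?thesis
      unfolding B_def using measure_dring_Diff[OF union(3) dn, of n] by auto
  qed
  have mB0: "(\<lambda>n. measure lborel (B n)) \<longlonglongrightarrow> 0"
    using tendsto_diff[OF tendsto_const measure_UNION_sums[OF union(1-3), unfolded sums_def], of "measure lborel ?U"]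
    by (simp add: mB)
  have "AE \<omega> in M. \<forall>n. \<Lambda> (B n) \<omega> = \<Lambda> ?U \<omega> - S n \<omega>" by (simp add: AE_all_countable BS)
  then have AEB: "AE \<omega> in M. (\<lambda>n. \<Lambda> (B n) \<omega>) \<longlonglongrightarrow> 0"
    using \<Lambda>_sequence(2)[OF union(1,2) dringD(2)[OF union(3)]]
  proof eventually_elim
    case (elim \<omega>)
    from tendsto_diff[OF tendsto_const elim(2)[unfolded sums_def], of "\<Lambda> ?U \<omega>"]
    show ?case using elim(1) by (simp add: S_def)
  qed
  have "(\<lambda>n. expectation (\<Lambda> (B n))) \<longlonglongrightarrow> 0"
  proof (rule tendstoI)
    fix e :: real assume e: "0 < e"
    define \<delta> where "\<delta> = e / 16"
    define K where "K = moment_const \<beta> * \<delta> powr (1 - \<beta>) * scale"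
    have ev1: "\<forall>\<^sub>F n in sequentially. prob {\<omega> \<in> space M. \<bar>\<Lambda> (B n) \<omega>\<bar> > e / 2} < 1 / 2"
      using AE_tendsto_imp_prob_tendsto[OF \<Lambda>_measurable[OF Bd] AEB, of "e / 2"] e by (intro order_tendstoD(2)[of _ 0]) auto
    have "(\<lambda>n. K * measure lborel (B n)) \<longlonglongrightarrow> K * 0" by (intro tendsto_intros mB0)
    then have ev2: "\<forall>\<^sub>F n in sequentially. K * measure lborel (B n) < \<delta>"
      using e by (intro order_tendstoD(2)[of _ 0]) (auto simp: \<delta>_def)
    show "\<forall>\<^sub>F n in sequentially. dist (expectation (\<Lambda> (B n))) 0 < e"
      using ev1 ev2
    proof eventually_elim
      case (elim n)
      have i: "integrable M (\<lambda>\<omega>. \<bar>\<Lambda> (B n) \<omega> - expectation (\<Lambda> (B n))\<bar>)" using \<Lambda>_moment(1)[OF Bd] by simp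
      have "expectation (\<lambda>\<omega>. \<bar>\<Lambda> (B n) \<omega> - expectation (\<Lambda> (B n))\<bar>) \<le> \<delta> + K * measure lborel (B n)"
        using \<Lambda>_moment(2)[OF Bd, of \<delta> n] e by (simp add: K_def \<delta>_def mult_ac)
      also have "\<dots> < e / 4" using elim e by (simp add: \<delta>_def)
      finally show ?case using abs_const_less_of_mean_close[OF \<Lambda>_measurable[OF Bd] i _ elim(1) e] by simp
    qed
  qed
  moreover have "expectation (\<Lambda> (B n)) = expectation (\<Lambda> ?U) - drift * (\<Sum>i<n. measure lborel (C i))" for n
  proof -
    have "expectation (\<Lambda> (B n)) = expectation (\<lambda>\<omega>. \<Lambda> ?U \<omega> - S n \<omega>)"
      by (rule integral_cong_AE) (use BS \<Lambda>_measurable[OF Bd] iU iS in auto)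
    also have "\<dots> = expectation (\<Lambda> ?U) - (\<Sum>i<n. expectation (\<Lambda> (C i)))"
      using iU iS iC by (simp add: S_def)
    finally show ?thesis by (simp add: union(4) sum_distrib_left)
  qed
  moreover have "(\<lambda>n. expectation (\<Lambda> ?U) - drift * (\<Sum>i<n. measure lborel (C i))) \<longlonglongrightarrow> expectation (\<Lambda> ?U) - drift * measure lborel ?U"
    using measure_UNION_sums[OF union(1-3)] unfolding sums_def by (intro tendsto_intros)
  ultimately have "0 = expectation (\<Lambda> ?U) - drift * measure lborel ?U" by (simp add: LIMSEQ_unique)
  then show ?case by simp
qed

end

section \<open>Integrals of step functions\<close>

lemma integrand_stepD:
  assumes "integrand_step \<phi>"
  shows "finite (range \<phi>)" "\<phi> -` {y} \<in> sets borel" "bounded {s. \<phi> s \<noteq> 0}" "\<phi> \<in> borel_measurable borel"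
proof -
  show "finite (range \<phi>)" "bounded {s. \<phi> s \<noteq> 0}" using assms by (auto simp: integrand_step_def simple_function_def)
  show m: "\<phi> \<in> borel_measurable borel" using assms by (auto simp: integrand_step_def intro: borel_measurable_simple_function)
  show "\<phi> -` {y} \<in> sets borel" using measurable_sets[OF m, of "{y}"] by simp
qed

text \<open>A partition of the line into finitely many Borel cells, all but one bounded, given by the
  index of the cell that contains a point.\<close>

definition cell_map :: "(real \<Rightarrow> 'v) \<Rightarrow> 'v \<Rightarrow> bool" where
  "cell_map \<psi> p0 \<longleftrightarrow> finite (range \<psi>) \<and> (\<forall>p. \<psi> -` {p} \<in> sets borel) \<and> bounded {s. \<psi> s \<noteq> p0}"

lemma cell_disjoint: "disjoint_family_on (\<lambda>p. A \<inter> \<psi> -` {p}) R"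
  by (auto simp: disjoint_family_on_def)

lemma cell_map_integrand_step: "integrand_step \<phi> \<Longrightarrow> cell_map \<phi> 0"
  using integrand_stepD by (auto simp: cell_map_def)

lemma cell_map_pair:
  assumes "cell_map \<psi> p" "cell_map \<kappa> q"
  shows "cell_map (\<lambda>s. (\<psi> s, \<kappa> s)) (p, q)"
  unfolding cell_map_def
proof (intro conjI allI)
  show "finite (range (\<lambda>s. (\<psi> s, \<kappa> s)))"
    by (rule finite_subset[of _ "range \<psi> \<times> range \<kappa>"]) (use assms in \<open>auto simp: cell_map_def\<close>)
  fix r
  have "(\<lambda>s. (\<psi> s, \<kappa> s)) -` {r} = \<psi> -` {fst r} \<inter> \<kappa> -` {snd r}" by (cases r) auto
  then show "(\<lambda>s. (\<psi> s, \<kappa> s)) -` {r} \<in> sets borel" using assms by (auto simp: cell_map_def)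
  have "{s. (\<psi> s, \<kappa> s) \<noteq> (p, q)} = {s. \<psi> s \<noteq> p} \<union> {s. \<kappa> s \<noteq> q}" by auto
  then show "bounded {s. (\<psi> s, \<kappa> s) \<noteq> (p, q)}" using assms by (auto simp: cell_map_def)
qed

lemma integrand_step_cell_map:
  assumes "cell_map \<psi> p0" "F p0 = (0::real)"
  shows "integrand_step (\<lambda>s. F (\<psi> s))"
  unfolding integrand_step_def simple_function_def
proof (intro conjI ballI)
  have r: "range (\<lambda>s. F (\<psi> s)) = F ` range \<psi>" by auto
  show "finite ((\<lambda>s. F (\<psi> s)) ` space borel)" using assms r by (auto simp: cell_map_def)
  fix y
  have "(\<lambda>s. F (\<psi> s)) -` {y} = (\<Union>p\<in>{p \<in> range \<psi>. F p = y}. \<psi> -` {p})" by auto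
  also have "\<dots> \<in> sets borel" using assms by (intro sets.finite_UN) (auto simp: cell_map_def)
  finally show "(\<lambda>s. F (\<psi> s)) -` {y} \<inter> space borel \<in> sets borel" by simp
  show "bounded {s. F (\<psi> s) \<noteq> 0}"
    by (rule bounded_subset[of "{s. \<psi> s \<noteq> p0}"]) (use assms in \<open>auto simp: cell_map_def\<close>)
qed

lemma cell_integral:
  assumes c: "cell_map \<psi> p0" and H: "H p0 = (0::real)" and A: "A \<in> sets borel"
  shows "integrable lborel (\<lambda>s. indicator A s * H (\<psi> s))"
    and "(\<integral>s. indicator A s * H (\<psi> s) \<partial>lborel) = (\<Sum>p\<in>range \<psi> - {p0}. H p * measure lborel (A \<inter> \<psi> -` {p}))"
proof -
  have fin: "finite (range \<psi> - {p0})" using c by (auto simp: cell_map_def)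
  have cell: "A \<inter> \<psi> -` {p} \<in> sets borel" "emeasure lborel (A \<inter> \<psi> -` {p}) < \<infinity>" if "p \<noteq> p0" for p
  proof -
    show "A \<inter> \<psi> -` {p} \<in> sets borel" using A c by (auto simp: cell_map_def)
    have "bounded (A \<inter> \<psi> -` {p})"
      by (rule bounded_subset[of "{s. \<psi> s \<noteq> p0}"]) (use that c in \<open>auto simp: cell_map_def\<close>)
    then show "emeasure lborel (A \<inter> \<psi> -` {p}) < \<infinity>" using emeasure_bounded_finite by blast
  qed
  have eq: "indicator A s * H (\<psi> s) = (\<Sum>p\<in>range \<psi> - {p0}. H p * indicator (A \<inter> \<psi> -` {p}) s)" for s
  proof (cases "\<psi> s = p0")
    case False
    have "(\<Sum>p\<in>range \<psi> - {p0}. H p * indicator (A \<inter> \<psi> -` {p}) s) = (\<Sum>p\<in>{\<psi> s}. H p * indicator (A \<inter> \<psi> -` {p}) s)"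
      using False fin by (intro sum.mono_neutral_right) auto
    also have "\<dots> = indicator A s * H (\<psi> s)" by (simp add: indicator_def)
    finally show ?thesis by (rule sym)
  next
    case True
    have "(\<Sum>p\<in>range \<psi> - {p0}. H p * indicator (A \<inter> \<psi> -` {p}) s) = 0"
      using True by (intro sum.neutral) (auto simp: indicator_def)
    then show ?thesis using True H by simp
  qed
  have i: "integrable lborel (\<lambda>s. H p * indicator (A \<inter> \<psi> -` {p}) s)" if "p \<in> range \<psi> - {p0}" for p
    using cell[of p] that by (intro integrable_mult_right integrable_real_indicator) auto
  show "integrable lborel (\<lambda>s. indicator A s * H (\<psi> s))" unfolding eq using i by (intro Bochner_Integration.integrable_sum)
  show "(\<integral>s. indicator A s * H (\<psi> s) \<partial>lborel) = (\<Sum>p\<in>range \<psi> - {p0}. H p * measure lborel (A \<inter> \<psi> -` {p}))"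
    unfolding eq using i by (subst Bochner_Integration.integral_sum) auto
qed

context levy_measure
begin

text \<open>By independence the moduli multiply, so the exponents add up to the integral of \<open>\<bar>F\<bar>\<^sup>\<beta>\<close>.\<close>

lemma linear_combination:
  fixes C :: "'i \<Rightarrow> real set" and F :: "'i \<Rightarrow> real"
  assumes I: "finite I" and C: "\<And>i. i \<in> I \<Longrightarrow> dring (C i)" and disj: "disjoint_family_on C I"
  defines "S \<equiv> \<lambda>\<omega>. \<Sum>i\<in>I. F i * \<Lambda> (C i) \<omega>" and "G \<equiv> scale * (\<Sum>i\<in>I. \<bar>F i\<bar> powr \<beta> * measure lborel (C i))"
  shows "S \<in> borel_measurable M" and "sq_char (distr M borel S) \<theta> = exp (- G * \<bar>\<theta>\<bar> powr \<beta>)" and "integrable M S"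
    and "0 < \<tau> \<Longrightarrow> expectation (\<lambda>\<omega>. \<bar>S \<omega> - drift * (\<Sum>i\<in>I. F i * measure lborel (C i))\<bar>)
          \<le> \<tau> + moment_const \<beta> * \<tau> powr (1 - \<beta>) * G"
proof -
  have m: "\<Lambda> (C i) \<in> borel_measurable M" if "i \<in> I" for i using \<Lambda>_measurable C that by blast
  show S_m: "S \<in> borel_measurable M" unfolding S_def using m by measurable
  have ind: "indep_vars (\<lambda>_. borel) (\<lambda>i \<omega>. F i * \<Lambda> (C i) \<omega>) I"
    by (rule indep_vars_compose2[OF \<Lambda>_finite_family(1)[OF I C disj]]) auto
  show sq: "sq_char (distr M borel S) \<theta> = exp (- G * \<bar>\<theta>\<bar> powr \<beta>)" for \<theta>
  proof -
    have "sq_char (distr M borel S) \<theta> = (\<Prod>i\<in>I. sq_char (distr M borel (\<lambda>\<omega>. F i * \<Lambda> (C i) \<omega>)) \<theta>)"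
      unfolding S_def by (rule sq_char_sum_indep[OF ind])
    also have "\<dots> = (\<Prod>i\<in>I. exp (- (scale * (\<bar>F i\<bar> powr \<beta> * measure lborel (C i))) * \<bar>\<theta>\<bar> powr \<beta>))"
    proof (intro prod.cong refl)
      fix i assume i: "i \<in> I"
      have "sq_char (distr M borel (\<lambda>\<omega>. F i * \<Lambda> (C i) \<omega>)) \<theta> = sq_char (distr M borel (\<Lambda> (C i))) (F i * \<theta>)"
        using m[OF i] by (simp add: sq_char_def char_distr mult_ac)
      also have "\<dots> = exp (- (scale * (\<bar>F i\<bar> powr \<beta> * measure lborel (C i))) * \<bar>\<theta>\<bar> powr \<beta>)"
        by (simp add: sq_char_\<Lambda>[OF C[OF i]] abs_mult powr_mult mult_ac)
      finally show "sq_char (distr M borel (\<lambda>\<omega>. F i * \<Lambda> (C i) \<omega>)) \<theta> = exp (- (scale * (\<bar>F i\<bar> powr \<beta> * measure lborel (C i))) * \<bar>\<theta>\<bar> powr \<beta>)" .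
    qed
    also have "\<dots> = exp (- G * \<bar>\<theta>\<bar> powr \<beta>)"
      by (simp add: exp_sum[OF I, symmetric] G_def sum_distrib_left sum_distrib_right sum_negf)
    finally show ?thesis .
  qed
  have G0: "0 \<le> G" unfolding G_def using scale_nonneg by (intro mult_nonneg_nonneg sum_nonneg) auto
  note sm = stable_centered_first_moment[OF S_m G0 _ \<beta>_gt_1 sq]
  show "integrable M S" using sm(1)[OF zero_less_one] .
  have "expectation S = (\<Sum>i\<in>I. F i * expectation (\<Lambda> (C i)))"
    unfolding S_def using \<Lambda>_moment(1)[OF C] by simp
  also have "\<dots> = drift * (\<Sum>i\<in>I. F i * measure lborel (C i))" by (simp add: mean_\<Lambda>[OF C] sum_distrib_left mult_ac)
  finally show "0 < \<tau> \<Longrightarrow> expectation (\<lambda>\<omega>. \<bar>S \<omega> - drift * (\<Sum>i\<in>I. F i * measure lborel (C i))\<bar>)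
          \<le> \<tau> + moment_const \<beta> * \<tau> powr (1 - \<beta>) * G" using sm(2) by simp
qed

lemma cell_dring:
  assumes "cell_map \<psi> p0" "A \<in> sets borel" "p \<noteq> p0"
  shows "dring (A \<inter> \<psi> -` {p})"
  unfolding dring_def
proof
  show "A \<inter> \<psi> -` {p} \<in> sets borel" using assms by (auto simp: cell_map_def)
  show "bounded (A \<inter> \<psi> -` {p})"
    by (rule bounded_subset[of "{s. \<psi> s \<noteq> p0}"]) (use assms in \<open>auto simp: cell_map_def\<close>)
qed

text \<open>Finite additivity on the cells that make up a level set.\<close>

lemma step_integral_cell_map:
  assumes c: "cell_map \<psi> p0" and F: "F p0 = (0::real)" and A: "A \<in> sets borel"
  shows "AE \<omega> in M. step_integral \<Lambda> A (\<lambda>s. F (\<psi> s)) \<omega> = (\<Sum>p\<in>range \<psi> - {p0}. F p * \<Lambda> (A \<inter> \<psi> -` {p}) \<omega>)"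
proof -
  let ?l = "\<lambda>p. \<Lambda> (A \<inter> \<psi> -` {p})" and ?L = "\<lambda>y. \<Lambda> (A \<inter> (\<lambda>s. F (\<psi> s)) -` {y})"
  let ?R = "range (\<lambda>s. F (\<psi> s)) - {0}" and ?S = "{p \<in> range \<psi> - {p0}. F p \<noteq> 0}"
  have fin: "finite (range \<psi> - {p0})" using c by (auto simp: cell_map_def)
  have finR: "finite ?R" using integrand_stepD(1)[OF integrand_step_cell_map[where F = F and \<psi> = \<psi>, OF c F]] by auto
  have "AE \<omega> in M. \<forall>y\<in>?R. ?L y \<omega> = (\<Sum>p\<in>{p \<in> ?S. F p = y}. ?l p \<omega>)"
  proof (intro AE_finite_allI finR)
    fix y assume y: "y \<in> ?R"
    have "A \<inter> (\<lambda>s. F (\<psi> s)) -` {y} = (\<Union>p\<in>{p \<in> ?S. F p = y}. A \<inter> \<psi> -` {p})" using y F by auto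
    moreover have "AE \<omega> in M. \<Lambda> (\<Union>p\<in>{p \<in> ?S. F p = y}. A \<inter> \<psi> -` {p}) \<omega> = (\<Sum>p\<in>{p \<in> ?S. F p = y}. ?l p \<omega>)"
      using fin by (intro \<Lambda>_finite_family(2) cell_dring[OF c A]) (auto simp: disjoint_family_on_def)
    ultimately show "AE \<omega> in M. ?L y \<omega> = (\<Sum>p\<in>{p \<in> ?S. F p = y}. ?l p \<omega>)" by simp
  qed
  then show ?thesis
  proof eventually_elim
    case (elim \<omega>)
    have "step_integral \<Lambda> A (\<lambda>s. F (\<psi> s)) \<omega> = (\<Sum>y\<in>?R. \<Sum>p\<in>{p \<in> ?S. F p = y}. F p * ?l p \<omega>)"
      unfolding step_integral_def
    proof (intro sum.cong refl)
      fix y assume "y \<in> ?R"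
      with elim have "?L y \<omega> = (\<Sum>p\<in>{p \<in> ?S. F p = y}. ?l p \<omega>)" by blast
      then have "y * ?L y \<omega> = (\<Sum>p\<in>{p \<in> ?S. F p = y}. y * ?l p \<omega>)"
        by (simp only: sum_distrib_left)
      also have "\<dots> = (\<Sum>p\<in>{p \<in> ?S. F p = y}. F p * ?l p \<omega>)" by (rule sum.cong) simp_all
      finally show "y * ?L y \<omega> = (\<Sum>p\<in>{p \<in> ?S. F p = y}. F p * ?l p \<omega>)" .
    qed
    also have "\<dots> = (\<Sum>p\<in>?S. F p * ?l p \<omega>)"
      using fin finR by (intro sum.group) auto
    also have "\<dots> = (\<Sum>p\<in>range \<psi> - {p0}. F p * ?l p \<omega>)"
      using fin by (intro sum.mono_neutral_left) auto
    finally show ?case .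
  qed
qed

lemma step_integral_measurable:
  assumes "integrand_step \<phi>" "A \<in> sets borel"
  shows "step_integral \<Lambda> A \<phi> \<in> borel_measurable M"
  unfolding step_integral_def[abs_def]
  by (intro borel_measurable_sum borel_measurable_times borel_measurable_const \<Lambda>_measurable cell_dring[OF cell_map_integrand_step[OF assms(1)] assms(2)])
     auto

lemma step_integral_sq_char:
  assumes \<phi>: "integrand_step \<phi>" and A: "A \<in> sets borel"
  shows "sq_char (distr M borel (step_integral \<Lambda> A \<phi>)) \<theta> = exp (- (scale * (\<integral>s. indicator A s * \<bar>\<phi> s\<bar> powr \<beta> \<partial>lborel)) * \<bar>\<theta>\<bar> powr \<beta>)"
proof -
  note c = cell_map_integrand_step[OF \<phi>]
  have fin: "finite (range \<phi> - {0})" using integrand_stepD(1)[OF \<phi>] by simp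
  have "step_integral \<Lambda> A \<phi> = (\<lambda>\<omega>. \<Sum>p\<in>range \<phi> - {0}. p * \<Lambda> (A \<inter> \<phi> -` {p}) \<omega>)" by (simp add: step_integral_def fun_eq_iff)
  moreover have "(\<integral>s. indicator A s * \<bar>\<phi> s\<bar> powr \<beta> \<partial>lborel) = (\<Sum>p\<in>range \<phi> - {0}. \<bar>p\<bar> powr \<beta> * measure lborel (A \<inter> \<phi> -` {p}))"
    by (rule cell_integral(2)[OF c _ A, of "\<lambda>p. \<bar>p\<bar> powr \<beta>"]) simp
  ultimately show ?thesis
    using linear_combination(2)[where F = "\<lambda>p. p" and \<theta> = \<theta>, OF fin cell_dring[OF c A] cell_disjoint] by simp
qed

text \<open>Both step functions are functions of the pair of their values, so the difference of the integrals
is the linear combination over the common refinement of their level sets.\<close>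

lemma step_integral_diff_moment:
  assumes \<phi>: "integrand_step \<phi>" and \<kappa>: "integrand_step \<kappa>" and A: "A \<in> sets borel"
  shows "integrable M (\<lambda>\<omega>. step_integral \<Lambda> A \<phi> \<omega> - step_integral \<Lambda> A \<kappa> \<omega>)"
    and "0 < \<tau> \<Longrightarrow> expectation (\<lambda>\<omega>. \<bar>step_integral \<Lambda> A \<phi> \<omega> - step_integral \<Lambda> A \<kappa> \<omega> - drift * (\<integral>s. indicator A s * (\<phi> s - \<kappa> s) \<partial>lborel)\<bar>)
      \<le> \<tau> + moment_const \<beta> * \<tau> powr (1 - \<beta>) * (scale * (\<integral>s. indicator A s * \<bar>\<phi> s - \<kappa> s\<bar> powr \<beta> \<partial>lborel))"
proof -
  let ?D = "\<lambda>\<omega>. step_integral \<Lambda> A \<phi> \<omega> - step_integral \<Lambda> A \<kappa> \<omega>" and ?d = "drift * (\<integral>s. indicator A s * (\<phi> s - \<kappa> s) \<partial>lborel)"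
  let ?n = "\<integral>s. indicator A s * \<bar>\<phi> s - \<kappa> s\<bar> powr \<beta> \<partial>lborel"
  define \<psi> where "\<psi> s = (\<phi> s, \<kappa> s)" for s
  have c: "cell_map \<psi> (0, 0)" unfolding \<psi>_def[abs_def] by (intro cell_map_pair cell_map_integrand_step \<phi> \<kappa>)
  have fin: "finite (range \<psi> - {(0, 0)})" using c by (auto simp: cell_map_def)
  let ?F = "\<lambda>p. fst p - snd p"
  define S where "S \<omega> = (\<Sum>p\<in>range \<psi> - {(0, 0)}. ?F p * \<Lambda> (A \<inter> \<psi> -` {p}) \<omega>)" for \<omega>
  have eq: "AE \<omega> in M. ?D \<omega> = S \<omega>"
  proof -
    have "(\<lambda>s. fst (\<psi> s)) = \<phi>" "(\<lambda>s. snd (\<psi> s)) = \<kappa>" by (simp_all add: \<psi>_def)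
    with step_integral_cell_map[OF c, of fst, OF _ A] step_integral_cell_map[OF c, of snd, OF _ A]
    have "AE \<omega> in M. step_integral \<Lambda> A \<phi> \<omega> = (\<Sum>p\<in>range \<psi> - {(0, 0)}. fst p * \<Lambda> (A \<inter> \<psi> -` {p}) \<omega>)"
      "AE \<omega> in M. step_integral \<Lambda> A \<kappa> \<omega> = (\<Sum>p\<in>range \<psi> - {(0, 0)}. snd p * \<Lambda> (A \<inter> \<psi> -` {p}) \<omega>)"
      by simp_all
    then show ?thesis by eventually_elim (simp add: S_def left_diff_distrib sum_subtractf)
  qed
  note m = step_integral_measurable[OF \<phi> A] step_integral_measurable[OF \<kappa> A]
  have dc: "\<And>p. p \<in> range \<psi> - {(0,0)} \<Longrightarrow> dring (A \<inter> \<psi> -` {p})" using cell_dring[OF c A] by auto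
  have dj: "disjoint_family_on (\<lambda>p. A \<inter> \<psi> -` {p}) (range \<psi> - {(0,0)})" by (rule cell_disjoint)
  note lc = linear_combination[where F = ?F, OF fin dc dj]
  have Sm: "S \<in> borel_measurable M" using lc(1) by (simp add: S_def[abs_def])
  have iS: "integrable M S" using lc(3) by (simp add: S_def[abs_def])
  show "integrable M (\<lambda>\<omega>. ?D \<omega>)"
    using Bochner_Integration.integrable_cong_AE[OF borel_measurable_diff[OF m] Sm eq] iS by blast
  assume \<tau>: "0 < \<tau>"
  have I1: "(\<integral>s. indicator A s * (\<phi> s - \<kappa> s) \<partial>lborel) = (\<Sum>p\<in>range \<psi> - {(0, 0)}. ?F p * measure lborel (A \<inter> \<psi> -` {p}))"
    using cell_integral(2)[OF c _ A, of ?F] by (simp add: \<psi>_def)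
  have I2: "?n = (\<Sum>p\<in>range \<psi> - {(0, 0)}. \<bar>?F p\<bar> powr \<beta> * measure lborel (A \<inter> \<psi> -` {p}))"
    using cell_integral(2)[OF c _ A, of "\<lambda>p. \<bar>?F p\<bar> powr \<beta>"] by (simp add: \<psi>_def)
  have "expectation (\<lambda>\<omega>. \<bar>?D \<omega> - ?d\<bar>)
      = expectation (\<lambda>\<omega>. \<bar>S \<omega> - ?d\<bar>)"
  proof (rule integral_cong_AE)
    show "AE \<omega> in M. \<bar>?D \<omega> - ?d\<bar>
      = \<bar>S \<omega> - ?d\<bar>"
      using eq by eventually_elim simp
  qed (use m Sm in measurable)
  also have "\<dots> \<le> \<tau> + moment_const \<beta> * \<tau> powr (1 - \<beta>) * (scale * ?n)"
    using lc(4)[OF _ \<tau>] unfolding I1 I2 S_def by simp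
  finally show "expectation (\<lambda>\<omega>. \<bar>?D \<omega> - ?d\<bar>)
      \<le> \<tau> + moment_const \<beta> * \<tau> powr (1 - \<beta>) * (scale * ?n)" .
qed

end

section \<open>The integral does not depend on the approximating step functions\<close>

lemma LIMSEQ_squeeze_0:
  fixes f g :: "nat \<Rightarrow> real"
  assumes "\<And>n. 0 \<le> f n" "\<And>n. f n \<le> g n" "g \<longlonglongrightarrow> 0"
  shows "f \<longlonglongrightarrow> 0"
  by (rule tendsto_sandwich[OF always_eventually always_eventually tendsto_const assms(3)]) (use assms in auto)

lemma (in prob_space) L1_limit_expectation:
  fixes U :: "nat \<Rightarrow> 'a \<Rightarrow> 'b::{banach, second_countable_topology}"
  assumes "\<And>m. integrable M (U m)" and "integrable M V" and L1: "(\<lambda>m. expectation (\<lambda>\<omega>. norm (U m \<omega> - V \<omega>))) \<longlonglongrightarrow> 0"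
  shows "(\<lambda>m. \<integral>\<omega>. U m \<omega> \<partial>M) \<longlonglongrightarrow> (\<integral>\<omega>. V \<omega> \<partial>M)"
proof -
  have "norm ((\<integral>\<omega>. U m \<omega> \<partial>M) - (\<integral>\<omega>. V \<omega> \<partial>M)) \<le> expectation (\<lambda>\<omega>. norm (U m \<omega> - V \<omega>))" for m
    using assms(1,2) integral_norm_bound[of M "\<lambda>\<omega>. U m \<omega> - V \<omega>"] by simp
  from Lim_null_comparison[OF always_eventually[OF allI, OF this] L1] show ?thesis by (simp add: LIM_zero_iff)
qed

lemma (in prob_space) conv_in_prob_imp_L1_bounded_lipschitz:
  fixes f :: "real \<Rightarrow> 'b::{banach, second_countable_topology}"
  assumes [measurable]: "\<And>n. X n \<in> borel_measurable M" "Y \<in> borel_measurable M" "f \<in> borel_measurable borel"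
    and conv: "conv_in_prob M X Y" and lip: "\<And>x y. norm (f x - f y) \<le> K * \<bar>x - y\<bar>" and B: "\<And>x. norm (f x) \<le> B"
  shows "(\<lambda>n. expectation (\<lambda>\<omega>. norm (f (X n \<omega>) - f (Y \<omega>)))) \<longlonglongrightarrow> 0"
proof (rule tendstoI)
  fix e :: real assume e: "0 < e"
  have K: "0 \<le> K" using order_trans[OF norm_ge_zero lip[of 1 0]] by simp
  have B0: "0 \<le> B" using order_trans[OF norm_ge_zero B[of 0]] .
  define d where "d = e / (2 * (K + 1))"
  have d: "0 < d" and Kd: "K * d < e / 2" using e K by (auto simp: d_def field_simps)
  have "(\<lambda>n. 2 * B * prob {\<omega> \<in> space M. \<bar>X n \<omega> - Y \<omega>\<bar> > d}) \<longlonglongrightarrow> 2 * B * 0"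
    using conv d by (intro tendsto_mult_left) (auto simp: conv_in_prob_def)
  then have "\<forall>\<^sub>F n in sequentially. 2 * B * prob {\<omega> \<in> space M. \<bar>X n \<omega> - Y \<omega>\<bar> > d} < e / 2"
    using e by (intro order_tendstoD(2)[of _ 0]) auto
  then show "\<forall>\<^sub>F n in sequentially. dist (expectation (\<lambda>\<omega>. norm (f (X n \<omega>) - f (Y \<omega>)))) 0 < e"
  proof eventually_elim
    case (elim n)
    let ?A = "{\<omega> \<in> space M. \<bar>X n \<omega> - Y \<omega>\<bar> > d}"
    have bd: "norm (f x - f y) \<le> 2 * B" for x y
      using norm_triangle_ineq4[of "f x" "f y"] B[of x] B[of y] by linarith
    have "expectation (\<lambda>\<omega>. norm (f (X n \<omega>) - f (Y \<omega>))) \<le> expectation (\<lambda>\<omega>. K * d + 2 * B * indicator ?A \<omega>)"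
    proof (rule integral_mono)
      show "integrable M (\<lambda>\<omega>. norm (f (X n \<omega>) - f (Y \<omega>)))"
        by (rule integrable_const_bound[of _ "2 * B"]) (auto simp: bd)
      show "integrable M (\<lambda>\<omega>. K * d + 2 * B * indicat_real ?A \<omega>)"
        by (intro Bochner_Integration.integrable_add integrable_mult_right integrable_real_indicator) (auto simp: less_top[symmetric])
      fix \<omega> assume \<omega>: "\<omega> \<in> space M"
      show "norm (f (X n \<omega>) - f (Y \<omega>)) \<le> K * d + 2 * B * indicator ?A \<omega>"
      proof (cases "\<omega> \<in> ?A")
        case True
        have "0 \<le> K * d" using K d by simp
        then show ?thesis using True bd[of "X n \<omega>" "Y \<omega>"] by simp
      next
        case False
        then have "\<bar>X n \<omega> - Y \<omega>\<bar> \<le> d" using \<omega> by simp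
        then have "K * \<bar>X n \<omega> - Y \<omega>\<bar> \<le> K * d" using K by (rule mult_left_mono)
        with order_trans[OF lip this] False show ?thesis by simp
      qed
    qed
    also have "\<dots> = K * d + 2 * B * prob ?A"
      by (subst Bochner_Integration.integral_add) (auto intro!: integrable_mult_right integrable_real_indicator simp: less_top[symmetric] prob_space)
    finally have "expectation (\<lambda>\<omega>. norm (f (X n \<omega>) - f (Y \<omega>))) < e" using elim Kd by linarith
    then show ?case by (simp add: dist_real_def)
  qed
qed

lemma (in prob_space) conv_in_prob_imp_sq_char:
  assumes [measurable]: "\<And>n. X n \<in> borel_measurable M" "Y \<in> borel_measurable M" and conv: "conv_in_prob M X Y"
  shows "(\<lambda>n. sq_char (distr M borel (X n)) \<theta>) \<longlonglongrightarrow> sq_char (distr M borel Y) \<theta>"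
proof -
  have lip: "cmod (iexp (\<theta> * x) - iexp (\<theta> * y)) \<le> \<bar>\<theta>\<bar> * \<bar>x - y\<bar>" for x y
  proof -
    have "iexp (\<theta> * x) - iexp (\<theta> * y) = iexp (\<theta> * y) * (iexp (\<theta> * (x - y)) - 1)"
      by (simp add: right_diff_distrib exp_diff field_simps)
    then have "cmod (iexp (\<theta> * x) - iexp (\<theta> * y)) = cmod (iexp (\<theta> * (x - y)) - 1)" by (simp add: norm_mult)
    also have "\<dots> \<le> \<bar>\<theta> * (x - y)\<bar>" using iexp_approx1[of "\<theta> * (x - y)" 0] by simp
    finally show ?thesis by (simp add: abs_mult)
  qed
  have 1: "(\<lambda>n. expectation (\<lambda>\<omega>. cmod (iexp (\<theta> * X n \<omega>) - iexp (\<theta> * Y \<omega>)))) \<longlonglongrightarrow> 0"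
    by (rule conv_in_prob_imp_L1_bounded_lipschitz[where f = "\<lambda>x. iexp (\<theta> * x)" and B = 1, OF _ _ _ conv lip]) auto
  have int: "integrable M (\<lambda>\<omega>. iexp (\<theta> * Z \<omega>))" if [measurable]: "Z \<in> borel_measurable M" for Z
    by (rule integrable_const_bound[of _ 1]) auto
  have "(\<lambda>n. expectation (\<lambda>\<omega>. iexp (\<theta> * X n \<omega>))) \<longlonglongrightarrow> expectation (\<lambda>\<omega>. iexp (\<theta> * Y \<omega>))"
    by (rule L1_limit_expectation[OF int int 1]) simp_all
  then show ?thesis unfolding sq_char_def char_distr[OF assms(1)] char_distr[OF assms(2)] by (intro tendsto_intros)
qed

lemma (in prob_space) conv_in_prob_of_mean_close:
  fixes D :: "nat \<Rightarrow> 'a \<Rightarrow> real"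
  assumes i: "\<And>n. integrable M (D n)" and E: "(\<lambda>n. expectation (\<lambda>\<omega>. \<bar>D n \<omega> - d n\<bar>)) \<longlonglongrightarrow> 0" and d: "d \<longlonglongrightarrow> 0"
  shows "conv_in_prob M D (\<lambda>_. 0)"
  unfolding conv_in_prob_def
proof (intro allI impI)
  fix e :: real assume e: "0 < e"
  have [measurable]: "D n \<in> borel_measurable M" for n using i by auto
  have bound: "prob {\<omega> \<in> space M. \<bar>D n \<omega> - 0\<bar> > e} \<le> (expectation (\<lambda>\<omega>. \<bar>D n \<omega> - d n\<bar>) + \<bar>d n\<bar>) / e" for n
  proof -
    have "prob {\<omega> \<in> space M. \<bar>D n \<omega> - 0\<bar> > e} \<le> prob {\<omega> \<in> space M. \<bar>D n \<omega>\<bar> \<ge> e}"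
      by (intro finite_measure_mono) auto
    also have "\<dots> \<le> expectation (\<lambda>\<omega>. \<bar>D n \<omega>\<bar>) / e"
      using i e by (intro integral_Markov_inequality_measure[where A = "{}"]) auto
    also have "expectation (\<lambda>\<omega>. \<bar>D n \<omega>\<bar>) \<le> expectation (\<lambda>\<omega>. \<bar>D n \<omega> - d n\<bar> + \<bar>d n\<bar>)"
      using i by (intro integral_mono) auto
    also have "\<dots> = expectation (\<lambda>\<omega>. \<bar>D n \<omega> - d n\<bar>) + \<bar>d n\<bar>" using i by (simp add: prob_space)
    finally show ?thesis using e by (simp add: divide_right_mono)
  qed
  have "(\<lambda>n. (expectation (\<lambda>\<omega>. \<bar>D n \<omega> - d n\<bar>) + \<bar>d n\<bar>) / e) \<longlonglongrightarrow> (0 + \<bar>0\<bar>) / e"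
    using e by (intro tendsto_intros E d) auto
  then have "(\<lambda>n. (expectation (\<lambda>\<omega>. \<bar>D n \<omega> - d n\<bar>) + \<bar>d n\<bar>) / e) \<longlonglongrightarrow> 0" by simp
  then show "(\<lambda>n. prob {\<omega> \<in> space M. \<bar>D n \<omega> - 0\<bar> > e}) \<longlonglongrightarrow> 0"
    by (rule LIMSEQ_squeeze_0[OF measure_nonneg bound])
qed

lemma (in prob_space) conv_in_prob_add:
  assumes [measurable]: "\<And>n. X n \<in> borel_measurable M" "Y \<in> borel_measurable M" "\<And>n. X' n \<in> borel_measurable M" "Y' \<in> borel_measurable M"
    and conv: "conv_in_prob M X Y" "conv_in_prob M X' Y'"
  shows "conv_in_prob M (\<lambda>n \<omega>. X n \<omega> + X' n \<omega>) (\<lambda>\<omega>. Y \<omega> + Y' \<omega>)"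
  unfolding conv_in_prob_def
proof (intro allI impI)
  fix e :: real assume e: "0 < e"
  let ?A = "\<lambda>n. {\<omega> \<in> space M. \<bar>X n \<omega> - Y \<omega>\<bar> > e / 2}" and ?A' = "\<lambda>n. {\<omega> \<in> space M. \<bar>X' n \<omega> - Y' \<omega>\<bar> > e / 2}"
  let ?S = "\<lambda>n. {\<omega> \<in> space M. \<bar>X n \<omega> + X' n \<omega> - (Y \<omega> + Y' \<omega>)\<bar> > e}"
  let ?p = "\<lambda>n. prob (?A n) + prob (?A' n)"
  have bound: "prob (?S n) \<le> ?p n" for n
  proof -
    have "prob (?S n)
      \<le> prob (?A n \<union> ?A' n)"
    proof (intro finite_measure_mono subsetI)
      fix \<omega> assume \<omega>: "\<omega> \<in> ?S n"
      then have "\<bar>X n \<omega> - Y \<omega>\<bar> > e / 2 \<or> \<bar>X' n \<omega> - Y' \<omega>\<bar> > e / 2" by auto argo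
      then show "\<omega> \<in> ?A n \<union> ?A' n"
        using \<omega> by auto
    qed auto
    also have "\<dots> \<le> ?p n" by (rule measure_Un_le) auto
    finally show ?thesis .
  qed
  have e2: "0 < e / 2" using e by simp
  have "?p \<longlonglongrightarrow> 0 + 0"
    using conv(1)[unfolded conv_in_prob_def, rule_format, OF e2] conv(2)[unfolded conv_in_prob_def, rule_format, OF e2]
    by (rule tendsto_add)
  then have "?p \<longlonglongrightarrow> 0" by simp
  then show "(\<lambda>n. prob (?S n)) \<longlonglongrightarrow> 0"
    by (rule LIMSEQ_squeeze_0[OF measure_nonneg bound])
qed

lemma conv_in_prob_minus: "conv_in_prob M X Y \<Longrightarrow> conv_in_prob M (\<lambda>n \<omega>. - X n \<omega>) (\<lambda>\<omega>. - Y \<omega>)"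
proof -
  have "\<bar>- X n \<omega> - - Y \<omega>\<bar> = \<bar>X n \<omega> - Y \<omega>\<bar>" for n \<omega> by linarith
  then show "conv_in_prob M X Y \<Longrightarrow> conv_in_prob M (\<lambda>n \<omega>. - X n \<omega>) (\<lambda>\<omega>. - Y \<omega>)" by (simp add: conv_in_prob_def)
qed

lemma (in prob_space) conv_in_prob_AE_cong:
  assumes [measurable]: "\<And>n. X n \<in> borel_measurable M" "\<And>n. X' n \<in> borel_measurable M" "Y \<in> borel_measurable M"
    and eq: "\<And>n. AE \<omega> in M. X n \<omega> = X' n \<omega>" and conv: "conv_in_prob M X Y"
  shows "conv_in_prob M X' Y"
proof -
  have "prob {\<omega> \<in> space M. \<bar>X n \<omega> - Y \<omega>\<bar> > e} = prob {\<omega> \<in> space M. \<bar>X' n \<omega> - Y \<omega>\<bar> > e}" for n e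
    by (rule finite_measure_eq_AE) (use eq[of n] in \<open>auto elim!: eventually_mono\<close>)
  then show ?thesis using conv by (simp add: conv_in_prob_def)
qed

context levy_measure
begin

lemma step_Lp_integrable:
  assumes "integrand_step \<phi>"
  shows "integrable lborel \<phi>" "0 < p \<Longrightarrow> integrable lborel (\<lambda>s. \<bar>\<phi> s\<bar> powr p)"
  using cell_integral(1)[OF cell_map_integrand_step[OF assms], of "\<lambda>x. x" UNIV]
    cell_integral(1)[OF cell_map_integrand_step[OF assms], of "\<lambda>x. \<bar>x\<bar> powr p" UNIV] by simp_all

text \<open>The characteristic function of the limit does not vanish near zero. At a point \<open>\<theta> \<noteq> 0\<close> where it is nonzero, the
moduli of the approximations converge to a positive limit, and their logarithms are multiples of the integrals.\<close>

lemma setwise_norm_convergent: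
  assumes \<phi>: "\<And>n. integrand_step (\<phi> n)" and A: "A \<in> sets borel" and J: "J \<in> borel_measurable M"
    and conv: "conv_in_prob M (\<lambda>n. step_integral \<Lambda> A (\<phi> n)) J" and scale: "scale \<noteq> 0"
  shows "convergent (\<lambda>n. \<integral>s. indicator A s * \<bar>\<phi> n s\<bar> powr \<beta> \<partial>lborel)"
proof -
  let ?a = "\<lambda>n. \<integral>s. indicator A s * \<bar>\<phi> n s\<bar> powr \<beta> \<partial>lborel"
  interpret d: real_distribution "distr M borel J" by (rule real_distribution_distr'[OF J])
  let ?r = "sq_char (distr M borel J)"
  have "isCont ?r 0" unfolding sq_char_def by (intro continuous_intros d.isCont_char)
  moreover have "0 < ?r 0" using d.sq_char_0 by simp
  ultimately have "\<forall>\<^sub>F \<theta> in at 0. 0 < ?r \<theta>" by (auto simp: isCont_def intro: order_tendstoD(1))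
  then have "\<forall>\<^sub>F \<theta> in at 0. 0 < ?r \<theta> \<and> \<theta> \<noteq> 0" by (rule eventually_conj) (simp add: eventually_at_filter)
  then obtain \<theta> where \<theta>: "0 < ?r \<theta>" "\<theta> \<noteq> 0" using eventually_happens'[OF at_neq_bot] by blast
  define k where "k = scale * \<bar>\<theta>\<bar> powr \<beta>"
  have k: "0 < k" using scale scale_nonneg \<theta> by (simp add: k_def)
  have "(\<lambda>n. sq_char (distr M borel (step_integral \<Lambda> A (\<phi> n))) \<theta>) \<longlonglongrightarrow> ?r \<theta>"
    by (rule conv_in_prob_imp_sq_char[OF step_integral_measurable[OF \<phi> A] J conv])
  then have "(\<lambda>n. exp (- k * ?a n)) \<longlonglongrightarrow> ?r \<theta>"
    by (simp add: step_integral_sq_char[OF \<phi> A] k_def mult_ac)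
  from tendsto_ln[OF this] \<theta> have "(\<lambda>n. - k * ?a n) \<longlonglongrightarrow> ln (?r \<theta>)" by simp
  from tendsto_divide[OF this tendsto_const[of "- k"]] k have "?a \<longlonglongrightarrow> ln (?r \<theta>) / - k" by simp
  then show ?thesis by (auto simp: convergent_def)
qed

text \<open>The difference of two step integrals is close in mean to the deterministic number \<open>?d\<close>, because the step
functions are close in \<open>L\<^sup>\<beta>\<close>, and close to zero in probability, because both integrals are close to \<open>J\<close>. So \<open>?d\<close> is small.\<close>

lemma setwise_drift_convergent:
  assumes \<phi>: "\<And>n. integrand_step (\<phi> n)" and A: "A \<in> sets borel" and J: "J \<in> borel_measurable M"
    and conv: "conv_in_prob M (\<lambda>n. step_integral \<Lambda> A (\<phi> n)) J"
    and g: "g \<in> borel_measurable borel" "integrable lborel (\<lambda>s. \<bar>g s\<bar> powr \<beta>)"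
    and Lp: "(\<lambda>n. scale * (\<integral>s. \<bar>\<phi> n s - g s\<bar> powr \<beta> \<partial>lborel)) \<longlonglongrightarrow> 0"
  shows "convergent (\<lambda>n. drift * (\<integral>s. indicator A s * \<phi> n s \<partial>lborel))"
proof (subst Cauchy_convergent_iff[symmetric], rule CauchyI)
  fix e :: real assume e: "0 < e"
  let ?B = "\<lambda>n. {\<omega> \<in> space M. \<bar>step_integral \<Lambda> A (\<phi> n) \<omega> - J \<omega>\<bar> > e / 4}" and ?n = "\<lambda>n. \<integral>s. \<bar>\<phi> n s - g s\<bar> powr \<beta> \<partial>lborel"
  have \<beta>0: "0 < \<beta>" using \<beta>_gt_1 by simp
  define \<delta> where "\<delta> = e / 16"
  define K where "K = moment_const \<beta> * \<delta> powr (1 - \<beta>)"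
  have K0: "0 \<le> K" using \<beta>_gt_1 powr_less_one[of 2 "1 - \<beta>"] by (simp add: K_def moment_const_def)
  have [measurable]: "\<phi> n \<in> borel_measurable borel" for n using integrand_stepD[OF \<phi>] by blast
  note [measurable] = g(1) step_integral_measurable[OF \<phi> A] J
  note i\<phi> = step_Lp_integrable[OF \<phi>]
  note Lp_dist = Lp_distance[OF \<beta>0 _ g(1) _ i\<phi>(2)[OF \<beta>0] g(2) i\<phi>(2)[OF \<beta>0]]
  let ?N = "\<lambda>n. scale * ?n n"
  have "(\<lambda>n. K * (2 powr \<beta> * ?N n)) \<longlonglongrightarrow> K * (2 powr \<beta> * 0)" by (intro tendsto_intros Lp)
  then have ev1: "\<forall>\<^sub>F n in sequentially. K * (2 powr \<beta> * ?N n) < \<delta>"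
    using e by (intro order_tendstoD(2)[of _ 0]) (auto simp: \<delta>_def)
  have "0 < e / 4" using e by simp
  from conv[unfolded conv_in_prob_def, rule_format, OF this]
  have ev2: "\<forall>\<^sub>F n in sequentially. prob (?B n) < 1 / 4"
    by (rule order_tendstoD(2)) simp
  from eventually_conj[OF ev1 ev2] obtain n0 where n0: "\<And>n. n \<ge> n0 \<Longrightarrow> K * (2 powr \<beta> * ?N n) < \<delta>"
    "\<And>n. n \<ge> n0 \<Longrightarrow> prob (?B n) < 1 / 4"
    by (auto simp: eventually_sequentially)
  show "\<exists>n0. \<forall>m\<ge>n0. \<forall>n\<ge>n0. norm (drift * (\<integral>s. indicator A s * \<phi> m s \<partial>lborel) - drift * (\<integral>s. indicator A s * \<phi> n s \<partial>lborel)) < e"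
  proof (intro exI[of _ n0] allI impI)
    fix m n assume mn: "m \<ge> n0" "n \<ge> n0"
    let ?D = "\<lambda>\<omega>. step_integral \<Lambda> A (\<phi> m) \<omega> - step_integral \<Lambda> A (\<phi> n) \<omega>"
    let ?d = "drift * (\<integral>s. indicator A s * (\<phi> m s - \<phi> n s) \<partial>lborel)"
    note sd = step_integral_diff_moment[OF \<phi>[of m] \<phi>[of n] A]
    have "expectation (\<lambda>\<omega>. \<bar>?D \<omega> - ?d\<bar>) \<le> \<delta> + K * (scale * (\<integral>s. indicator A s * \<bar>\<phi> m s - \<phi> n s\<bar> powr \<beta> \<partial>lborel))"
      using sd(2)[where \<tau> = \<delta>] e by (simp add: \<delta>_def K_def)
    also have "\<dots> \<le> \<delta> + K * (scale * (2 powr \<beta> * (?n m + ?n n)))"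
      by (intro add_left_mono mult_left_mono Lp_dist(2) K0 scale_nonneg) simp_all
    also have "\<dots> = \<delta> + K * (2 powr \<beta> * ?N m) + K * (2 powr \<beta> * ?N n)" by (simp add: algebra_simps)
    also have "\<dots> < e / 4" using n0(1)[OF mn(1)] n0(1)[OF mn(2)] e unfolding \<delta>_def by linarith
    finally have E: "expectation (\<lambda>\<omega>. \<bar>?D \<omega> - ?d\<bar>) < e / 4" .
    have P: "prob {\<omega> \<in> space M. \<bar>?D \<omega>\<bar> > e / 2} < 1 / 2"
    proof -
      have "prob {\<omega> \<in> space M. \<bar>?D \<omega>\<bar> > e / 2}
        \<le> prob (?B m \<union> ?B n)"
      proof (intro finite_measure_mono subsetI)
        fix \<omega> assume \<omega>: "\<omega> \<in> {\<omega> \<in> space M. \<bar>?D \<omega>\<bar> > e / 2}"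
        then have "\<bar>step_integral \<Lambda> A (\<phi> m) \<omega> - J \<omega>\<bar> > e / 4 \<or> \<bar>step_integral \<Lambda> A (\<phi> n) \<omega> - J \<omega>\<bar> > e / 4" by auto argo
        then show "\<omega> \<in> ?B m \<union> ?B n"
          using \<omega> by auto
      qed auto
      also have "\<dots> \<le> prob (?B m) + prob (?B n)"
        by (rule measure_Un_le) auto
      finally show ?thesis using n0(2)[OF mn(1)] n0(2)[OF mn(2)] by simp
    qed
    have "\<bar>?d\<bar> < e"
      by (rule abs_const_less_of_mean_close[OF _ _ E P e]) (use sd(1) in auto)
    moreover have "(\<integral>s. indicator A s * (\<phi> m s - \<phi> n s) \<partial>lborel) = (\<integral>s. indicator A s * \<phi> m s \<partial>lborel) - (\<integral>s. indicator A s * \<phi> n s \<partial>lborel)"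
      using integrable_mult_indicator[OF _ i\<phi>(1), of A m] integrable_mult_indicator[OF _ i\<phi>(1), of A n] A
      by (subst Bochner_Integration.integral_diff[symmetric]) (auto simp: right_diff_distrib)
    ultimately show "norm (drift * (\<integral>s. indicator A s * \<phi> m s \<partial>lborel) - drift * (\<integral>s. indicator A s * \<phi> n s \<partial>lborel)) < e"
      by (simp add: right_diff_distrib)
  qed
qed

text \<open>The integrals of \<open>\<phi> n\<close> over all Borel sets converge, which forces \<open>\<phi> n\<close> to converge to \<open>g\<close> in \<open>L\<^sup>\<beta>\<close> and, unless the drift is
zero, in \<open>L\<^sup>1\<close>. Hence the integrals of \<open>\<kappa> n - \<phi> n\<close> are close in mean to their expectations, which tend to zero. If
\<open>scale\<close> or \<open>drift\<close> is zero, the corresponding convergence may fail, but then it enters with the factor zero.\<close>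

lemma levy_integral_approx:
  assumes \<phi>: "\<And>n. integrand_step (\<phi> n)" and lim: "AE s in lborel. (\<lambda>n. \<phi> n s) \<longlonglongrightarrow> g s"
    and J: "\<And>A. A \<in> sets borel \<Longrightarrow> \<exists>J\<in>borel_measurable M. conv_in_prob M (\<lambda>n. step_integral \<Lambda> A (\<phi> n)) J"
    and I: "I \<in> borel_measurable M" "conv_in_prob M (\<lambda>n. step_integral \<Lambda> UNIV (\<phi> n)) I"
    and g: "g \<in> borel_measurable borel" "integrable lborel g" "integrable lborel (\<lambda>s. \<bar>g s\<bar> powr \<beta>)"
    and \<kappa>: "\<And>n. integrand_step (\<kappa> n)"
    and \<kappa>1: "(\<lambda>n. \<integral>s. \<bar>\<kappa> n s - g s\<bar> \<partial>lborel) \<longlonglongrightarrow> 0"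
    and \<kappa>\<beta>: "(\<lambda>n. \<integral>s. \<bar>\<kappa> n s - g s\<bar> powr \<beta> \<partial>lborel) \<longlonglongrightarrow> 0"
  shows "conv_in_prob M (\<lambda>n. step_integral \<Lambda> UNIV (\<kappa> n)) I"
proof -
  let ?n = "\<lambda>f h :: real \<Rightarrow> real. \<integral>s. \<bar>f s - h s\<bar> powr \<beta> \<partial>lborel"
  have \<beta>0: "0 < \<beta>" using \<beta>_gt_1 by simp
  have [measurable]: "\<phi> n \<in> borel_measurable borel" "\<kappa> n \<in> borel_measurable borel" for n using integrand_stepD \<phi> \<kappa> by blast+
  note [measurable] = g(1) I(1) step_integral_measurable[OF \<phi>, of UNIV, simplified] step_integral_measurable[OF \<kappa>, of UNIV, simplified]
  note i\<phi> = step_Lp_integrable[OF \<phi>] and i\<kappa> = step_Lp_integrable[OF \<kappa>]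
  have Lp: "(\<lambda>n. scale * ?n (\<phi> n) g) \<longlonglongrightarrow> 0"
  proof (cases "scale = 0")
    case False
    have "(\<lambda>n. ?n (\<phi> n) g) \<longlonglongrightarrow> 0"
    proof (rule setwise_convergent_powr_imp_Lp[OF \<beta>0 _ g(1) i\<phi>(2)[OF \<beta>0] g(3) lim])
      fix A :: "real set" assume A: "A \<in> sets borel"
      from J[OF A] obtain JA where JA: "JA \<in> borel_measurable M" "conv_in_prob M (\<lambda>n. step_integral \<Lambda> A (\<phi> n)) JA" ..
      show "convergent (\<lambda>n. \<integral>s. indicator A s * \<bar>\<phi> n s\<bar> powr \<beta> \<partial>lborel)"
        by (rule setwise_norm_convergent[OF \<phi> A JA False])
    qed simp
    from tendsto_mult_left[OF this, of scale] show ?thesis by simp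
  qed simp
  have drift0: "(\<lambda>n. drift * (\<integral>s. \<phi> n s - g s \<partial>lborel)) \<longlonglongrightarrow> 0"
  proof (cases "drift = 0")
    case False
    have "(\<lambda>n. \<integral>s. \<bar>\<phi> n s - g s\<bar> \<partial>lborel) \<longlonglongrightarrow> 0"
    proof (rule setwise_convergent_imp_L1_null)
      show "AE s in lborel. (\<lambda>n. \<phi> n s - g s) \<longlonglongrightarrow> 0" using lim by eventually_elim (simp add: LIM_zero)
      fix A :: "real set" assume A: "A \<in> sets borel"
      from J[OF A] obtain JA where "JA \<in> borel_measurable M" "conv_in_prob M (\<lambda>n. step_integral \<Lambda> A (\<phi> n)) JA" ..
      from setwise_drift_convergent[OF \<phi> A this g(1,3) Lp]
      have "convergent (\<lambda>n. \<integral>s. indicator A s * \<phi> n s \<partial>lborel)" using False by (simp add: convergent_mult_const_iff)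
      moreover have "(\<integral>s. indicator A s * (\<phi> n s - g s) \<partial>lborel) = (\<integral>s. indicator A s * \<phi> n s \<partial>lborel) - (\<integral>s. indicator A s * g s \<partial>lborel)" for n
        using integrable_mult_indicator[OF _ i\<phi>(1), of A n] integrable_mult_indicator[OF _ g(2), of A] A
        by (subst Bochner_Integration.integral_diff[symmetric]) (auto simp: right_diff_distrib)
      ultimately show "convergent (\<lambda>n. \<integral>s. indicator A s * (\<phi> n s - g s) \<partial>lborel)"
        by (simp add: convergent_diff_const_right_iff)
    qed (use i\<phi>(1) g(2) in simp)
    then have "(\<lambda>n. \<integral>s. \<phi> n s - g s \<partial>lborel) \<longlonglongrightarrow> 0"
      by (rule Lim_null_comparison[rotated, OF _ always_eventually]) simp
    from tendsto_mult_left[OF this, of drift] show ?thesis by simp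
  qed simp
  have \<kappa>0: "(\<lambda>n. drift * (\<integral>s. \<kappa> n s - g s \<partial>lborel)) \<longlonglongrightarrow> 0"
  proof -
    have "(\<lambda>n. \<integral>s. \<kappa> n s - g s \<partial>lborel) \<longlonglongrightarrow> 0"
      by (rule Lim_null_comparison[OF _ \<kappa>1]) (auto intro!: always_eventually integral_abs_bound)
    from tendsto_mult_left[OF this, of drift] show ?thesis by simp
  qed
  let ?D = "\<lambda>n \<omega>. step_integral \<Lambda> UNIV (\<kappa> n) \<omega> - step_integral \<Lambda> UNIV (\<phi> n) \<omega>"
  let ?d = "\<lambda>n. drift * (\<integral>s. \<kappa> n s - \<phi> n s \<partial>lborel)"
  have d0: "?d \<longlonglongrightarrow> 0"
  proof -
    have "?d n = drift * (\<integral>s. \<kappa> n s - g s \<partial>lborel) - drift * (\<integral>s. \<phi> n s - g s \<partial>lborel)" for n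
      using i\<phi>(1)[of n] i\<kappa>(1)[of n] g(2) by (simp add: algebra_simps)
    then show ?thesis using tendsto_diff[OF \<kappa>0 drift0] by simp
  qed
  let ?N = "\<lambda>n. scale * ?n (\<kappa> n) (\<phi> n)"
  have N0: "?N \<longlonglongrightarrow> 0"
  proof -
    have "?n (\<kappa> n) (\<phi> n) \<le> 2 powr \<beta> * (?n (\<kappa> n) g + ?n (\<phi> n) g)" for n
      using Lp_distance(2)[where A = UNIV, OF \<beta>0 _ g(1) _ i\<kappa>(2)[OF \<beta>0] g(3) i\<phi>(2)[OF \<beta>0], of n n] by simp
    then have le: "?N n \<le> 2 powr \<beta> * (scale * ?n (\<kappa> n) g + scale * ?n (\<phi> n) g)" for n
      using mult_left_mono[OF _ scale_nonneg] by (fastforce simp: algebra_simps)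
    have "(\<lambda>n. 2 powr \<beta> * (scale * ?n (\<kappa> n) g + scale * ?n (\<phi> n) g)) \<longlonglongrightarrow> 2 powr \<beta> * (scale * 0 + 0)"
      by (intro tendsto_intros \<kappa>\<beta> Lp)
    then have lim0: "(\<lambda>n. 2 powr \<beta> * (scale * ?n (\<kappa> n) g + scale * ?n (\<phi> n) g)) \<longlonglongrightarrow> 0" by simp
    show ?thesis
      by (rule LIMSEQ_squeeze_0[OF _ le lim0]) (simp add: scale_nonneg)
  qed
  have E0: "(\<lambda>n. expectation (\<lambda>\<omega>. \<bar>?D n \<omega> - ?d n\<bar>)) \<longlonglongrightarrow> 0"
  proof (rule tendstoI)
    fix e :: real assume e: "0 < e"
    define K where "K = moment_const \<beta> * (e / 2) powr (1 - \<beta>)"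
    have "(\<lambda>n. K * ?N n) \<longlonglongrightarrow> K * 0" by (intro tendsto_intros N0)
    then have "\<forall>\<^sub>F n in sequentially. K * ?N n < e / 2" using e by (intro order_tendstoD(2)[of _ 0]) auto
    then show "\<forall>\<^sub>F n in sequentially. dist (expectation (\<lambda>\<omega>. \<bar>?D n \<omega> - ?d n\<bar>)) 0 < e"
    proof eventually_elim
      case (elim n)
      have "expectation (\<lambda>\<omega>. \<bar>?D n \<omega> - ?d n\<bar>) \<le> e / 2 + K * ?N n"
        using step_integral_diff_moment(2)[where A = UNIV and \<tau> = "e / 2", OF \<kappa>[of n] \<phi>[of n]] e by (simp add: K_def)
      then show ?case using elim by (simp add: dist_real_def)
    qed
  qed
  have "conv_in_prob M ?D (\<lambda>_. 0)"
    by (rule conv_in_prob_of_mean_close[OF _ E0 d0]) (use step_integral_diff_moment(1)[OF \<kappa> \<phi>, of UNIV] in simp)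
  from conv_in_prob_add[OF _ _ _ _ this I(2)] show ?thesis by simp
qed

end

section \<open>The kernel of the noise\<close>

definition noise_kernel :: "real \<Rightarrow> real \<Rightarrow> real" where
  "noise_kernel a x = pos_powr x a - pos_powr (x - 1) a"

lemma pos_powr_measurable[measurable]: "(\<lambda>x. pos_powr x a) \<in> borel_measurable borel"
  unfolding pos_powr_def by measurable

lemma noise_kernel_measurable[measurable]: "noise_kernel a \<in> borel_measurable borel"
  unfolding noise_kernel_def[abs_def] pos_powr_def by measurable

lemma noise_kernel_nonpos: "x \<le> 0 \<Longrightarrow> noise_kernel a x = 0"
  and noise_kernel_le_1: "0 < x \<Longrightarrow> x \<le> 1 \<Longrightarrow> noise_kernel a x = x powr a"
  and noise_kernel_gt_1: "1 < x \<Longrightarrow> noise_kernel a x = x powr a - (x - 1) powr a"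
  by (auto simp: noise_kernel_def pos_powr_def max_def)

lemma noise_kernel_deriv_gt_1:
  "1 < x \<Longrightarrow> ((\<lambda>x. (x - 1) powr a - x powr a) has_real_derivative a * ((x - 1) powr (a - 1) - x powr (a - 1))) (at x)" for x a :: real
  by (auto intro!: derivative_eq_intros simp: powr_diff field_simps)

lemma abs_noise_kernel_gt_1:
  assumes "a \<le> 0" "1 < x"
  shows "\<bar>noise_kernel a x\<bar> = (x - 1) powr a - x powr a"
proof -
  have "x powr a \<le> (x - 1) powr a" using assms by (intro powr_mono2') auto
  then show ?thesis using assms by (simp add: noise_kernel_gt_1)
qed

lemma noise_kernel_tail:
  assumes a: "a \<le> 0" and x: "1 < x"
  shows "\<bar>noise_kernel a x\<bar> \<le> \<bar>a\<bar> * (x - 1) powr (a - 1)"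
proof -
  obtain z where z: "x - 1 < z" "z < x" and eq: "x powr a - (x - 1) powr a = (x - (x - 1)) * (a * z powr (a - 1))"
  proof -
    have "\<exists>z>x - 1. z < x \<and> x powr a - (x - 1) powr a = (x - (x - 1)) * (a * z powr (a - 1))"
      using x by (intro MVT2 has_real_derivative_powr) auto
    then show ?thesis using that by blast
  qed
  have "\<bar>noise_kernel a x\<bar> = \<bar>a\<bar> * z powr (a - 1)" using eq x by (simp add: noise_kernel_gt_1 abs_mult)
  also have "\<dots> \<le> \<bar>a\<bar> * (x - 1) powr (a - 1)" using a z x by (intro mult_left_mono powr_mono2') auto
  finally show ?thesis .
qed

text \<open>Between its two singularities, and after the second one, the kernel decreases in absolute
value. The hypothesis \<open>same\<close> puts both points on one side of the second singularity.\<close>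

lemma noise_kernel_decreasing:
  assumes a: "a \<le> 0" and xy: "0 < x" "x \<le> y" and same: "y \<le> 1 \<or> 1 < x"
  shows "\<bar>noise_kernel a y\<bar> \<le> \<bar>noise_kernel a x\<bar>"
proof (cases "y \<le> 1")
  case True
  then show ?thesis using assms by (simp add: noise_kernel_le_1 powr_mono2')
next
  case False
  then have x: "1 < x" using same by simp
  have "(y - 1) powr a - y powr a \<le> (x - 1) powr a - x powr a"
  proof (rule DERIV_nonpos_imp_nonincreasing[OF xy(2)])
    fix z assume z: "x \<le> z" "z \<le> y"
    have "z powr (a - 1) \<le> (z - 1) powr (a - 1)" using a z x by (intro powr_mono2') auto
    then have "a * ((z - 1) powr (a - 1) - z powr (a - 1)) \<le> 0" using a by (intro mult_nonpos_nonneg) auto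
    then show "\<exists>d. ((\<lambda>x. (x - 1) powr a - x powr a) has_real_derivative d) (at z) \<and> d \<le> 0"
      using noise_kernel_deriv_gt_1[of z a] z x by auto
  qed
  then show ?thesis using x xy a by (simp add: abs_noise_kernel_gt_1)
qed

lemma noise_kernel_isCont:
  assumes "x \<noteq> 0" "x \<noteq> 1"
  shows "isCont (noise_kernel a) x"
proof -
  have c: "isCont (\<lambda>x. pos_powr x a) y" if "y \<noteq> 0" for y
  proof (cases "0 < y")
    case True
    have "isCont (\<lambda>x. x powr a) y" using True by (intro continuous_intros) auto
    moreover have "\<forall>\<^sub>F x in nhds y. pos_powr x a = x powr a"
      using eventually_nhds_in_open[of "{0<..}" y] True by (auto elim!: eventually_mono simp: pos_powr_def)
    ultimately show ?thesis by (subst isCont_cong) auto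
  next
    case False
    have "\<forall>\<^sub>F x in nhds y. pos_powr x a = 0"
      using eventually_nhds_in_open[of "{..<0}" y] False that by (auto elim!: eventually_mono simp: pos_powr_def max_def)
    then show ?thesis by (subst isCont_cong[of _ "\<lambda>_. 0"]) auto
  qed
  have "isCont (\<lambda>x. pos_powr (x - 1) a) x"
    using isCont_o2[of x "\<lambda>x. x - 1" "\<lambda>x. pos_powr x a"] c[of "x - 1"] assms by (auto intro!: continuous_intros)
  then show ?thesis unfolding noise_kernel_def[abs_def] using c[OF assms(1)] by (rule continuous_diff[rotated])
qed

lemma noise_kernel_Lp:
  assumes a: "a < 0" and p: "1 \<le> p" and ap: "- 1 < a * p"
  shows "integrable lborel (\<lambda>x. \<bar>noise_kernel a x\<bar> powr p)"
proof -
  have near: "set_integrable lborel {0..1} (\<lambda>x. x powr (a * p))"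
  proof -
    have "(\<lambda>x. x powr (a * p)) absolutely_integrable_on {0..1}"
      by (intro nonnegative_absolutely_integrable_1 integrable_on_powr_from_0) (use ap in auto)
    then show ?thesis unfolding set_integrable_def by (subst (asm) integrable_completion) auto
  qed
  have far: "set_integrable lborel {1..} (\<lambda>x. x powr ((a - 1) * p))"
  proof -
    have "a * p < 0" using a p by (intro mult_neg_pos) auto
    then have "(a - 1) * p < - 1" using p by (simp add: left_diff_distrib)
    then have "(\<lambda>x. x powr ((a - 1) * p)) absolutely_integrable_on {1..}"
      using has_integral_powr_to_inf[of "(a - 1) * p" 1] by (intro nonnegative_absolutely_integrable_1) auto
    then show ?thesis unfolding set_integrable_def by (subst (asm) integrable_completion) auto
  qed
  let ?n = "\<lambda>x. indicator {0..1} x * x powr (a * p)" and ?f = "\<lambda>x. \<bar>a\<bar> powr p * (indicator {1..} x * x powr ((a - 1) * p))"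
  have i1: "integrable lborel ?n" using near by (simp add: set_integrable_def)
  have i2: "integrable lborel ?f" using far by (simp add: set_integrable_def)
  have i1': "integrable lborel (\<lambda>x. ?n (- 1 + 1 * x))" using i1 by (intro lborel_integrable_real_affine) auto
  have i2': "integrable lborel (\<lambda>x. ?f (- 1 + 1 * x))" using i2 by (intro lborel_integrable_real_affine) auto
  have norm_mono: "norm y \<le> norm z" if "0 \<le> y" "y \<le> z" for y z :: real using that by simp
  show ?thesis
  proof (rule Bochner_Integration.integrable_bound)
    show "integrable lborel (\<lambda>x. ?n x + ?n (- 1 + 1 * x) + ?f (- 1 + 1 * x))"
      by (intro Bochner_Integration.integrable_add i1 i1' i2')
    show "AE x in lborel. norm (\<bar>noise_kernel a x\<bar> powr p) \<le> norm (?n x + ?n (- 1 + 1 * x) + ?f (- 1 + 1 * x))"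
    proof (rule AE_I2)
      fix x :: real
      have nn: "0 \<le> ?n y" "0 \<le> ?f y" for y by (auto simp: indicator_def)
      consider "x \<le> 0" | "0 < x" "x \<le> 1" | "1 < x" "x \<le> 2" | "2 < x" by linarith
      then have "\<bar>noise_kernel a x\<bar> powr p \<le> ?n x + ?n (- 1 + 1 * x) + ?f (- 1 + 1 * x)"
      proof cases
        case 1
        then show ?thesis using nn by (simp add: noise_kernel_nonpos add_nonneg_nonneg del: mult_1)
      next
        case 2
        then have "\<bar>noise_kernel a x\<bar> powr p = ?n x" by (simp add: noise_kernel_le_1 powr_powr)
        then show ?thesis using nn(1)[of "- 1 + 1 * x"] nn(2)[of "- 1 + 1 * x"] by linarith
      next
        case 3
        have "\<bar>noise_kernel a x\<bar> \<le> (x - 1) powr a" using abs_noise_kernel_gt_1[of a x] a 3 by simp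
        then have "\<bar>noise_kernel a x\<bar> powr p \<le> ((x - 1) powr a) powr p" using p by (intro powr_mono2) auto
        also have "\<dots> = ?n (- 1 + 1 * x)" using 3 by (simp add: powr_powr algebra_simps)
        finally show ?thesis using nn(1)[of x] nn(2)[of "- 1 + 1 * x"] by linarith
      next
        case 4
        have "\<bar>noise_kernel a x\<bar> \<le> \<bar>a\<bar> * (x - 1) powr (a - 1)" using noise_kernel_tail[of a x] a 4 by simp
        then have "\<bar>noise_kernel a x\<bar> powr p \<le> (\<bar>a\<bar> * (x - 1) powr (a - 1)) powr p" using p by (intro powr_mono2) auto
        also have "\<dots> = ?f (- 1 + 1 * x)" using 4 by (simp add: powr_mult powr_powr algebra_simps)
        finally show ?thesis using nn(1)[of x] nn(1)[of "- 1 + 1 * x"] by linarith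
      qed
      then show "norm (\<bar>noise_kernel a x\<bar> powr p) \<le> norm (?n x + ?n (- 1 + 1 * x) + ?f (- 1 + 1 * x))"
        by (rule norm_mono[rotated]) (rule powr_ge_zero)
    qed
  qed measurable
qed

section \<open>Riemann sums for the noise\<close>

text \<open>The discrete primitive of \<open>f\<close> that vanishes at 0, for times of either sign.\<close>

definition int_sum :: "(int \<Rightarrow> real) \<Rightarrow> int \<Rightarrow> real" where
  "int_sum f t = (\<Sum>u\<in>{1..t}. f u) - (\<Sum>u\<in>{t + 1..0}. f u)"

lemma int_sum_0: "int_sum f 0 = 0" by (simp add: int_sum_def)

lemma int_sum_step: "int_sum f t - int_sum f (t - 1) = f t"
proof (cases "1 \<le> t")
  case True
  then have "{1..t} = insert t {1..t - 1}" by auto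
  then show ?thesis using True by (simp add: int_sum_def)
next
  case False
  then have "{t..0} = insert t {t + 1..0}" by auto
  then show ?thesis using False by (simp add: int_sum_def)
qed

lemma int_sum_unique:
  assumes step: "\<And>t. h t - h (t - 1) = f t" and h0: "h 0 = 0"
  shows "h t = int_sum f t"
proof (induction t rule: int_induct[where k = 0])
  case base
  then show ?case by (simp add: h0 int_sum_0)
next
  case (step1 i)
  then show ?case using step[of "i + 1"] int_sum_step[of f "i + 1"] by simp
next
  case (step2 i)
  then show ?case using step[of i] int_sum_step[of f i] by simp
qed

text \<open>One sum over a symmetric range with signs, to which linearity applies for both signs of \<open>t\<close>.\<close>

lemma int_sum_mono_zero:
  "int_sum f t = (\<Sum>u\<in>{- \<bar>t\<bar>..\<bar>t\<bar>}. (if 1 \<le> u \<and> u \<le> t then 1 else if t < u \<and> u \<le> 0 then - 1 else 0) * f u)"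
proof -
  have "(\<Sum>u\<in>{- \<bar>t\<bar>..\<bar>t\<bar>}. (if 1 \<le> u \<and> u \<le> t then 1 else if t < u \<and> u \<le> 0 then - 1 else 0) * f u)
     = (\<Sum>u\<in>{- \<bar>t\<bar>..\<bar>t\<bar>}. (if u \<in> {1..t} then f u else 0) - (if u \<in> {t + 1..0} then f u else 0))"
    by (intro sum.cong refl) auto
  also have "\<dots> = (\<Sum>u\<in>{- \<bar>t\<bar>..\<bar>t\<bar>} \<inter> {1..t}. f u) - (\<Sum>u\<in>{- \<bar>t\<bar>..\<bar>t\<bar>} \<inter> {t + 1..0}. f u)"
    by (simp only: sum_subtractf sum.inter_restrict finite_atLeastAtMost_int)
  also have "{- \<bar>t\<bar>..\<bar>t\<bar>} \<inter> {1..t} = {1..t}" by auto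
  also have "{- \<bar>t\<bar>..\<bar>t\<bar>} \<inter> {t + 1..0} = {t + 1..0}" by auto
  finally show ?thesis by (simp add: int_sum_def)
qed

lemma powr_sum_le:
  fixes x :: "'i \<Rightarrow> real"
  assumes U: "finite U" and p: "0 < p"
  shows "\<bar>\<Sum>u\<in>U. x u\<bar> powr p \<le> real (card U) powr p * (\<Sum>u\<in>U. \<bar>x u\<bar> powr p)"
proof (cases "U = {}")
  case False
  define m where "m = Max ((\<lambda>u. \<bar>x u\<bar>) ` U)"
  have "m \<in> (\<lambda>u. \<bar>x u\<bar>) ` U" unfolding m_def using U False by (intro Max_in) auto
  then obtain u0 where u0: "u0 \<in> U" "m = \<bar>x u0\<bar>" by auto
  have "\<bar>\<Sum>u\<in>U. x u\<bar> \<le> (\<Sum>u\<in>U. \<bar>x u\<bar>)" by (rule sum_abs)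
  also have "\<dots> \<le> real (card U) * m" using U by (intro sum_bounded_above) (auto simp: m_def)
  finally have "\<bar>\<Sum>u\<in>U. x u\<bar> powr p \<le> (real (card U) * m) powr p" using p by (intro powr_mono2) auto
  also have "\<dots> = real (card U) powr p * \<bar>x u0\<bar> powr p" using u0 by (simp add: powr_mult)
  also have "\<dots> \<le> real (card U) powr p * (\<Sum>u\<in>U. \<bar>x u\<bar> powr p)"
    using u0 U by (intro mult_left_mono member_le_sum[of u0 U "\<lambda>u. \<bar>x u\<bar> powr p"]) auto
  finally show ?thesis .
qed simp

text \<open>The kernel sampled at the left end point of the cell of the grid of mesh \<open>1 / m\<close> that
  contains the integration variable; the cell has index \<open>j\<close>. The cut at distance \<open>m\<close> leaves finitely many cells.\<close>

definition sampled_kernel :: "real \<Rightarrow> nat \<Rightarrow> int \<Rightarrow> int \<Rightarrow> real" where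
  "sampled_kernel a m u j = (if real_of_int u - real_of_int j / real m \<le> real m then noise_kernel a (real_of_int u - real_of_int j / real m) else 0)"

definition cell_index :: "nat \<Rightarrow> real \<Rightarrow> int" where
  "cell_index m s = \<lceil>s * real m\<rceil> - 1"

lemma cell_index_eq_iff:
  "0 < m \<Longrightarrow> cell_index m s = j \<longleftrightarrow> s \<in> {real_of_int j / real m<..(real_of_int j + 1) / real m}"
  by (auto simp: cell_index_def pos_divide_less_eq pos_le_divide_eq ceiling_eq_iff) linarith+

lemma sampled_kernel_eq_0:
  assumes "0 < m" "j \<notin> {u * int m - int (m * m)..<u * int m}"
  shows "sampled_kernel a m u j = 0"
proof (cases "j < u * int m")
  case True
  then have "j < u * int m - int (m * m)" using assms by simp
  then have "real_of_int j < real_of_int (u * int m - int (m * m))" by (simp only: of_int_less_iff)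
  then have "real_of_int j < real_of_int u * real m - real m * real m" by (simp only: of_int_mult of_int_diff of_int_of_nat_eq of_nat_mult)
  then have "real m < real_of_int u - real_of_int j / real m" using assms(1) by (simp add: field_simps)
  then show ?thesis by (simp add: sampled_kernel_def)
next
  case False
  then have "real_of_int (u * int m) \<le> real_of_int j" by (simp only: of_int_le_iff not_less)
  then have "real_of_int u * real m \<le> real_of_int j" by (simp only: of_int_mult of_int_of_nat_eq)
  then have "real_of_int u - real_of_int j / real m \<le> 0" using assms(1) by (simp add: field_simps)
  then show ?thesis by (simp add: sampled_kernel_def noise_kernel_nonpos)
qed

lemma cell_index_grid_le:
  assumes m: "0 < m" and s: "real_of_int v < s"
  shows "real_of_int v \<le> real_of_int (cell_index m s) / real m"
proof -
  have "real_of_int v < (real_of_int (cell_index m s) + 1) / real m"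
    using cell_index_eq_iff[OF m, of s "cell_index m s"] s by auto
  then have "real_of_int (v * int m) < real_of_int (cell_index m s + 1)" using m by (simp add: pos_less_divide_eq)
  then have "v * int m < cell_index m s + 1" by (simp only: of_int_less_iff)
  then have "real_of_int (v * int m) \<le> real_of_int (cell_index m s)" by (simp only: of_int_le_iff)
  then show ?thesis using m by (simp add: pos_le_divide_eq)
qed

text \<open>The left end point of a cell is farther in the past than the points of the cell, so the sampled value is
the smaller one on each piece on which the kernel is monotone. The jumps at integer lags are grid points.\<close>

lemma sampled_kernel_le:
  assumes a: "a \<le> 0" and m: "0 < m" and s: "s \<noteq> real_of_int u" "s \<noteq> real_of_int u - 1"
  shows "\<bar>sampled_kernel a m u (cell_index m s)\<bar> \<le> \<bar>noise_kernel a (real_of_int u - s)\<bar>"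
proof -
  define j where "j = cell_index m s"
  define x' where "x' = real_of_int u - real_of_int j / real m"
  have j: "real_of_int j / real m < s" "s \<le> (real_of_int j + 1) / real m"
    using cell_index_eq_iff[OF m, of s j] by (auto simp: j_def)
  have x': "real_of_int u - s < x'" using j by (simp add: x'_def)
  consider "s > real_of_int u" | "real_of_int u - 1 < s" "s < real_of_int u" | "s < real_of_int u - 1" using s by linarith
  then have "\<bar>noise_kernel a x'\<bar> \<le> \<bar>noise_kernel a (real_of_int u - s)\<bar>"
  proof cases
    case 1
    then have "x' \<le> 0" using cell_index_grid_le[OF m] by (simp add: x'_def j_def)
    then show ?thesis by (simp add: noise_kernel_nonpos)
  next
    case 2
    then have "x' \<le> 1" using cell_index_grid_le[OF m, of "u - 1" s] by (simp add: x'_def j_def)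
    then show ?thesis using 2 x' by (intro noise_kernel_decreasing a) auto
  next
    case 3
    then show ?thesis using x' by (intro noise_kernel_decreasing a) auto
  qed
  then show ?thesis by (simp add: sampled_kernel_def j_def[symmetric] x'_def)
qed

lemma sampled_kernel_tendsto:
  assumes s: "s \<noteq> real_of_int u" "s \<noteq> real_of_int u - 1"
  shows "(\<lambda>m. sampled_kernel a (Suc m) u (cell_index (Suc m) s)) \<longlonglongrightarrow> noise_kernel a (real_of_int u - s)"
proof -
  define x' where "x' m = real_of_int u - real_of_int (cell_index (Suc m) s) / real (Suc m)" for m
  have j: "real_of_int (cell_index (Suc m) s) / real (Suc m) < s" "s \<le> (real_of_int (cell_index (Suc m) s) + 1) / real (Suc m)" for m
    using cell_index_eq_iff[of "Suc m" s "cell_index (Suc m) s"] by auto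
  have b: "real_of_int u - s \<le> x' m" "x' m \<le> (real_of_int u - s) + inverse (real (Suc m))" for m
    using j[of m] by (simp_all add: x'_def add_divide_distrib inverse_eq_divide del: of_nat_Suc)
  have "(\<lambda>m. (real_of_int u - s) + inverse (real (Suc m))) \<longlonglongrightarrow> (real_of_int u - s) + 0"
    by (intro tendsto_intros LIMSEQ_inverse_real_of_nat)
  then have lim: "x' \<longlonglongrightarrow> real_of_int u - s"
    by (intro tendsto_sandwich[OF always_eventually always_eventually tendsto_const, of "real_of_int u - s" x']) (use b in auto)
  obtain N :: nat where N: "real_of_int u - s + 1 \<le> real N" using real_arch_simple by blast
  have "x' m \<le> real (Suc m)" if "m \<ge> N" for m
  proof -
    have "inverse (real (Suc m)) \<le> 1" by (simp add: inverse_eq_divide)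
    then show ?thesis using b(2)[of m] N that by linarith
  qed
  then have ev: "\<forall>\<^sub>F m in sequentially. noise_kernel a (x' m) = sampled_kernel a (Suc m) u (cell_index (Suc m) s)"
    by (intro eventually_sequentiallyI[of N]) (simp add: sampled_kernel_def x'_def)
  have "(\<lambda>m. noise_kernel a (x' m)) \<longlonglongrightarrow> noise_kernel a (real_of_int u - s)"
    using isCont_tendsto_compose[OF noise_kernel_isCont lim] s by auto
  then show ?thesis using ev by (rule Lim_transform_eventually)
qed

text \<open>At integer times the motion is the discrete primitive of the noise, also on the level of
kernels. This reduces the kernel of the motion to shifts of the kernel of the noise.\<close>

lemma motion_kernel_eq_int_sum:
  "pos_powr (real_of_int t - s) a - pos_powr (- s) a = int_sum (\<lambda>u. noise_kernel a (real_of_int u - s)) t"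
proof (rule int_sum_unique)
  fix t show "pos_powr (real_of_int t - s) a - pos_powr (- s) a - (pos_powr (real_of_int (t - 1) - s) a - pos_powr (- s) a)
     = noise_kernel a (real_of_int t - s)"
    by (simp add: noise_kernel_def algebra_simps)
qed simp

lemma abs_int_sum_powr_le:
  assumes p: "0 < p"
  shows "\<bar>int_sum f t\<bar> powr p \<le> real (card {- \<bar>t\<bar>..\<bar>t\<bar>}) powr p * (\<Sum>u\<in>{- \<bar>t\<bar>..\<bar>t\<bar>}. \<bar>f u\<bar> powr p)"
  unfolding int_sum_mono_zero
  by (rule order_trans[OF powr_sum_le[OF _ p]]) (auto simp: abs_mult intro!: mult_left_mono sum_mono powr_mono2 p[THEN less_imp_le])

lemma int_sum_diff: "int_sum f t - int_sum g t = int_sum (\<lambda>u. f u - g u) t"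
  by (simp add: int_sum_def sum_subtractf)

lemma noise_kernel_shift_Lp:
  assumes "a < 0" "1 \<le> p" "- 1 < a * p"
  shows "integrable lborel (\<lambda>s. \<bar>noise_kernel a (real_of_int u - s)\<bar> powr p)"
  using lborel_integrable_real_affine[OF noise_kernel_Lp[OF assms], of "- 1" "real_of_int u"] by simp

lemma motion_kernel_Lp:
  assumes a: "a < 0" "1 \<le> p" "- 1 < a * p"
  shows "integrable lborel (\<lambda>s. \<bar>pos_powr (real_of_int t - s) a - pos_powr (- s) a\<bar> powr p)"
proof -
  let ?k = "\<lambda>s. pos_powr (real_of_int t - s) a - pos_powr (- s) a"
  let ?b = "\<lambda>s. real (card {- \<bar>t\<bar>..\<bar>t\<bar>}) powr p * (\<Sum>u\<in>{- \<bar>t\<bar>..\<bar>t\<bar>}. \<bar>noise_kernel a (real_of_int u - s)\<bar> powr p)"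
  show ?thesis
  proof (rule Bochner_Integration.integrable_bound[of _ ?b])
    show "integrable lborel ?b"
      by (intro integrable_mult_right Bochner_Integration.integrable_sum noise_kernel_shift_Lp a)
    show "AE s in lborel. norm (\<bar>?k s\<bar> powr p) \<le> norm (?b s)"
    proof (rule AE_I2)
      fix s show "norm (\<bar>?k s\<bar> powr p) \<le> norm (?b s)"
        unfolding motion_kernel_eq_int_sum
        using abs_int_sum_powr_le[of p "\<lambda>u. noise_kernel a (real_of_int u - s)" t] a(2) by simp
    qed
  qed (unfold pos_powr_def, measurable)
qed

definition motion_step :: "real \<Rightarrow> nat \<Rightarrow> int \<Rightarrow> real \<Rightarrow> real" where
  "motion_step a m t s = int_sum (\<lambda>u. sampled_kernel a m u (cell_index m s)) t"

lemma cell_index_measurable[measurable]: "cell_index m \<in> borel \<rightarrow>\<^sub>M count_space UNIV"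
  unfolding cell_index_def[abs_def] by measurable

lemma motion_step_Lp:
  assumes a: "a < 0" "1 \<le> p" "- 1 < a * p"
  shows "(\<lambda>m. \<integral>s. \<bar>motion_step a (Suc m) t s - (pos_powr (real_of_int t - s) a - pos_powr (- s) a)\<bar> powr p \<partial>lborel) \<longlonglongrightarrow> 0"
proof -
  let ?k = "\<lambda>s. pos_powr (real_of_int t - s) a - pos_powr (- s) a" and ?n = "\<lambda>u s. noise_kernel a (real_of_int u - s)"
  let ?f = "\<lambda>m s. \<bar>motion_step a (Suc m) t s - ?k s\<bar> powr p" and ?q = "\<lambda>m u s. sampled_kernel a (Suc m) u (cell_index (Suc m) s)"
  let ?U = "{- \<bar>t\<bar>..\<bar>t\<bar>}"
  let ?K = "real (card ?U) powr p"
  have p: "0 < p" using a by simp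
  have ms: "(\<lambda>s. motion_step a m t s) \<in> borel_measurable borel" for m
  proof -
    have "(\<lambda>s. (\<lambda>j. int_sum (\<lambda>u. sampled_kernel a m u j) t) (cell_index m s)) \<in> borel_measurable borel"
      by (rule measurable_compose[OF cell_index_measurable]) simp
    then show ?thesis by (simp add: motion_step_def)
  qed
  have mk: "(\<lambda>s. pos_powr (real_of_int t - s) a - pos_powr (- s) a) \<in> borel_measurable borel"
    unfolding pos_powr_def by measurable
  have AE_s: "AE s in lborel. \<forall>u\<in>?U. s \<noteq> real_of_int u \<and> s \<noteq> real_of_int u - 1"
    by (intro AE_finite_allI AE_conjI AE_lborel_singleton) simp
  have "(\<lambda>m. \<integral>s. ?f m s \<partial>lborel) \<longlonglongrightarrow> integral\<^sup>L lborel (\<lambda>s::real. 0)"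
  proof (rule integral_dominated_convergence[where w = "\<lambda>s. ?K * (\<Sum>u\<in>?U. 2 powr p * \<bar>?n u s\<bar> powr p)"])
    show "integrable lborel (\<lambda>s. ?K * (\<Sum>u\<in>?U. 2 powr p * \<bar>?n u s\<bar> powr p))"
      by (intro integrable_mult_right Bochner_Integration.integrable_sum noise_kernel_shift_Lp a)
    show "(\<lambda>s. ?f m s) \<in> borel_measurable lborel" for m
      using ms[of "Suc m"] mk by measurable
    show "AE s in lborel. norm (?f m s)
        \<le> ?K * (\<Sum>u\<in>?U. 2 powr p * \<bar>?n u s\<bar> powr p)" for m
      using AE_s
    proof eventually_elim
      case (elim s)
      have "norm (?f m s)
        \<le> ?K * (\<Sum>u\<in>?U. \<bar>?q m u s - ?n u s\<bar> powr p)"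
        unfolding motion_kernel_eq_int_sum motion_step_def int_sum_diff using abs_int_sum_powr_le[OF p] by simp
      also have "\<dots> \<le> ?K * (\<Sum>u\<in>?U. 2 powr p * \<bar>?n u s\<bar> powr p)"
      proof (intro mult_left_mono sum_mono)
        fix u assume u: "u \<in> ?U"
        have "\<bar>?q m u s\<bar> \<le> \<bar>?n u s\<bar>"
          using elim u a by (intro sampled_kernel_le) auto
        then have "\<bar>?q m u s - ?n u s\<bar> \<le> 2 * \<bar>?n u s\<bar>"
          by linarith
        then have "\<bar>?q m u s - ?n u s\<bar> powr p \<le> (2 * \<bar>?n u s\<bar>) powr p"
          using p by (intro powr_mono2) auto
        then show "\<bar>?q m u s - ?n u s\<bar> powr p \<le> 2 powr p * \<bar>?n u s\<bar> powr p"
          by (simp add: powr_mult)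
      qed simp
      finally show ?case .
    qed
    show "AE s in lborel. (\<lambda>m. ?f m s) \<longlonglongrightarrow> 0"
      using AE_s
    proof eventually_elim
      case (elim s)
      have "(\<lambda>m. motion_step a (Suc m) t s - ?k s) \<longlonglongrightarrow> 0"
        unfolding motion_kernel_eq_int_sum motion_step_def int_sum_mono_zero LIM_zero_iff
        using elim by (intro tendsto_sum tendsto_mult_left sampled_kernel_tendsto) auto
      then have "(\<lambda>m. ?f m s) \<longlonglongrightarrow> \<bar>0\<bar> powr p"
        using p by (intro tendsto_powr' tendsto_rabs tendsto_const) auto
      then show ?case by simp
    qed
  qed simp
  then show ?thesis by simp
qed

context stable_levy
begin

definition cell_increment :: "nat \<Rightarrow> int \<Rightarrow> 'a \<Rightarrow> real" where
  "cell_increment m j \<omega> = L ((real_of_int j + 1) / real m) \<omega> - L (real_of_int j / real m) \<omega>"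

definition riemann_noise :: "real \<Rightarrow> nat \<Rightarrow> int \<Rightarrow> 'a \<Rightarrow> real" where
  "riemann_noise a m t \<omega> =
     (\<Sum>j\<in>{t * int m - int (m * m)..<t * int m}. sampled_kernel a m t j * cell_increment m j \<omega>)"

lemma cell_increment_measurable[measurable]: "cell_increment m j \<in> borel_measurable M"
  unfolding cell_increment_def[abs_def] by measurable

lemma riemann_noise_measurable[measurable]: "riemann_noise a m t \<in> borel_measurable M"
  unfolding riemann_noise_def[abs_def] by measurable

lemma int_sum_riemann_measurable[measurable]: "(\<lambda>\<omega>. int_sum (\<lambda>u. riemann_noise a m u \<omega>) t) \<in> borel_measurable M"
  unfolding int_sum_def by measurable

end

context levy_measure
begin

text \<open>The cells of the grid are the level sets of \<open>\<psi>\<close>, with all cells outside of the range of the sum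
merged into the unbounded one.\<close>

lemma step_integral_motion_step:
  assumes m: "0 < m"
  shows "integrand_step (motion_step a m t)"
    and "AE \<omega> in M. step_integral \<Lambda> UNIV (motion_step a m t) \<omega> = int_sum (\<lambda>u. riemann_noise a m u \<omega>) t"
proof -
  define lo hi where "lo = - \<bar>t\<bar> * int m - int (m * m)" and "hi = \<bar>t\<bar> * int m"
  define F where "F p = (case p of None \<Rightarrow> 0 | Some j \<Rightarrow> int_sum (\<lambda>u. sampled_kernel a m u j) t)" for p
  define h where "h j = (if lo \<le> j \<and> j < hi then Some j else None)" for j
  define \<psi> where "\<psi> s = h (cell_index m s)" for s
  have mc4: "\<psi> -` {Some j} = {real_of_int j / real m<..(real_of_int j + 1) / real m}" if "j \<in> {lo..<hi}" for j
  proof -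
    have "\<psi> -` {Some j} = {s. cell_index m s = j}" using that by (auto simp: \<psi>_def h_def split: if_splits)
    then show ?thesis unfolding cell_index_eq_iff[OF m] by auto
  qed
  have mc3: "range \<psi> - {None} = Some ` {lo..<hi}"
  proof
    show "range \<psi> - {None} \<subseteq> Some ` {lo..<hi}" by (auto simp: \<psi>_def h_def split: if_splits)
    show "Some ` {lo..<hi} \<subseteq> range \<psi> - {None}"
    proof
      fix p assume "p \<in> Some ` {lo..<hi}"
      then obtain j where j: "p = Some j" "j \<in> {lo..<hi}" by auto
      have "cell_index m ((real_of_int j + 1) / real m) = j"
        using m by (subst cell_index_eq_iff[OF m]) (auto simp: divide_strict_right_mono)
      then have "\<psi> ((real_of_int j + 1) / real m) = p" using j by (simp add: \<psi>_def h_def)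
      then show "p \<in> range \<psi> - {None}" using j by (metis DiffI option.distinct(1) rangeI singletonD)
    qed
  qed
  have mc1: "cell_map \<psi> None"
    unfolding cell_map_def
  proof (intro conjI allI)
    show "finite (range \<psi>)"
      by (rule finite_subset[of _ "insert None (Some ` {lo..<hi})"]) (auto simp: \<psi>_def h_def)
    fix p
    have "\<psi> -` {p} = cell_index m -` (h -` {p})" by (auto simp: \<psi>_def)
    then show "\<psi> -` {p} \<in> sets borel" using measurable_sets[OF cell_index_measurable, of "h -` {p}" m] by simp
  next
    have "{s. \<psi> s \<noteq> None} \<subseteq> {real_of_int lo / real m..(real_of_int hi) / real m}"
    proof
      fix s assume "s \<in> {s. \<psi> s \<noteq> None}"
      then have j: "lo \<le> cell_index m s" "cell_index m s < hi" by (auto simp: \<psi>_def h_def split: if_splits)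
      have s: "real_of_int (cell_index m s) / real m < s" "s \<le> (real_of_int (cell_index m s) + 1) / real m"
        using cell_index_eq_iff[OF m, of s "cell_index m s"] by auto
      have "real_of_int lo / real m \<le> real_of_int (cell_index m s) / real m" using j by (intro divide_right_mono) auto
      moreover have "(real_of_int (cell_index m s) + 1) / real m \<le> real_of_int hi / real m" using j by (intro divide_right_mono) auto
      ultimately show "s \<in> {real_of_int lo / real m..(real_of_int hi) / real m}" using s by auto
    qed
    then show "bounded {s. \<psi> s \<noteq> None}" by (rule bounded_subset[rotated]) simp
  qed
  have zero: "int_sum (\<lambda>u. sampled_kernel a m u j) t = 0" if "\<not> (lo \<le> j \<and> j < hi)" for j
  proof -
    have "sampled_kernel a m u j = 0" if u: "u \<in> {- \<bar>t\<bar>..\<bar>t\<bar>}" for u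
    proof (rule sampled_kernel_eq_0[OF m])
      have "u * int m \<le> \<bar>t\<bar> * int m" using u by (intro mult_right_mono) auto
      moreover have "- \<bar>t\<bar> * int m \<le> u * int m" using u by (intro mult_right_mono) auto
      ultimately show "j \<notin> {u * int m - int (m * m)..<u * int m}" using \<open>\<not> (lo \<le> j \<and> j < hi)\<close> by (auto simp: lo_def hi_def)
    qed
    then show ?thesis unfolding int_sum_mono_zero by (intro sum.neutral) auto
  qed
  have mc2: "motion_step a m t = (\<lambda>s. F (\<psi> s))"
    by (rule ext) (auto simp: motion_step_def F_def \<psi>_def h_def zero)
  have F0: "F None = 0" by (simp add: F_def)
  show "integrand_step (motion_step a m t)" unfolding mc2 by (rule integrand_step_cell_map[where F = F and \<psi> = \<psi>, OF mc1 F0])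
  have "AE \<omega> in M. \<forall>j\<in>{lo..<hi}. \<Lambda> (UNIV \<inter> \<psi> -` {Some j}) \<omega> = cell_increment m j \<omega>"
  proof (intro AE_finite_allI)
    fix j assume j: "j \<in> {lo..<hi}"
    have "real_of_int j / real m \<le> (real_of_int j + 1) / real m" by (intro divide_right_mono) auto
    from \<Lambda>_Ioc[OF this] show "AE \<omega> in M. \<Lambda> (UNIV \<inter> \<psi> -` {Some j}) \<omega> = cell_increment m j \<omega>"
      by (simp add: mc4[OF j] cell_increment_def)
  qed simp
  with step_integral_cell_map[where F = F and \<psi> = \<psi> and A = UNIV, OF mc1 F0]
  have "AE \<omega> in M. step_integral \<Lambda> UNIV (motion_step a m t) \<omega> = (\<Sum>j\<in>{lo..<hi}. F (Some j) * cell_increment m j \<omega>)"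
    by (auto simp: mc2 mc3 sum.reindex elim!: eventually_elim2)
  moreover have "(\<Sum>j\<in>{lo..<hi}. F (Some j) * cell_increment m j \<omega>) = int_sum (\<lambda>u. riemann_noise a m u \<omega>) t" for \<omega>
  proof -
    let ?e = "\<lambda>u::int. (if 1 \<le> u \<and> u \<le> t then 1 else if t < u \<and> u \<le> 0 then - 1 else 0 :: real)"
    have row: "(\<Sum>j\<in>{lo..<hi}. sampled_kernel a m u j * cell_increment m j \<omega>) = riemann_noise a m u \<omega>" if u: "u \<in> {- \<bar>t\<bar>..\<bar>t\<bar>}" for u
      unfolding riemann_noise_def
    proof (rule sum.mono_neutral_right)
      have "u * int m \<le> \<bar>t\<bar> * int m" using u by (intro mult_right_mono) auto
      moreover have "- \<bar>t\<bar> * int m \<le> u * int m" using u by (intro mult_right_mono) auto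
      ultimately show "{u * int m - int (m * m)..<u * int m} \<subseteq> {lo..<hi}" by (auto simp: lo_def hi_def)
      show "\<forall>i\<in>{lo..<hi} - {u * int m - int (m * m)..<u * int m}. sampled_kernel a m u i * cell_increment m i \<omega> = 0"
        by (auto simp: sampled_kernel_eq_0[OF m])
    qed simp
    have "(\<Sum>j\<in>{lo..<hi}. F (Some j) * cell_increment m j \<omega>)
       = (\<Sum>j\<in>{lo..<hi}. \<Sum>u\<in>{- \<bar>t\<bar>..\<bar>t\<bar>}. ?e u * (sampled_kernel a m u j * cell_increment m j \<omega>))"
      by (simp add: F_def int_sum_mono_zero sum_distrib_right mult.assoc)
    also have "\<dots> = (\<Sum>u\<in>{- \<bar>t\<bar>..\<bar>t\<bar>}. ?e u * (\<Sum>j\<in>{lo..<hi}. sampled_kernel a m u j * cell_increment m j \<omega>))"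
      by (subst sum.swap) (simp only: sum_distrib_left)
    also have "\<dots> = (\<Sum>u\<in>{- \<bar>t\<bar>..\<bar>t\<bar>}. ?e u * riemann_noise a m u \<omega>)" by (intro sum.cong refl) (simp only: row)
    also have "\<dots> = int_sum (\<lambda>u. riemann_noise a m u \<omega>) t" by (rule int_sum_mono_zero[symmetric])
    finally show ?thesis .
  qed
  ultimately show "AE \<omega> in M. step_integral \<Lambda> UNIV (motion_step a m t) \<omega> = int_sum (\<lambda>u. riemann_noise a m u \<omega>) t" by simp
qed

end

context stable_levy
begin

lemma motion_riemann:
  assumes a: "a < 0" "- 1 < a * \<beta>"
    and Y: "has_levy_integral M L (\<lambda>s. pos_powr (real_of_int t - s) a - pos_powr (- s) a) I"
  shows "conv_in_prob M (\<lambda>m \<omega>. int_sum (\<lambda>u. riemann_noise a (Suc m) u \<omega>) t) I"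
proof -
  define g where "g s = pos_powr (real_of_int t - s) a - pos_powr (- s) a" for s
  from Y obtain \<Lambda> \<phi> where I: "I \<in> borel_measurable M" and \<Lambda>: "levy_random_measure M L \<Lambda>" and \<phi>: "\<And>n. integrand_step (\<phi> n)"
    and lim: "AE s in lborel. (\<lambda>n. \<phi> n s) \<longlonglongrightarrow> g s"
    and J: "\<And>A. A \<in> sets borel \<Longrightarrow> \<exists>J\<in>borel_measurable M. conv_in_prob M (\<lambda>n. step_integral \<Lambda> A (\<phi> n)) J"
    and conv: "conv_in_prob M (\<lambda>n. step_integral \<Lambda> UNIV (\<phi> n)) I"
    unfolding has_levy_integral_def g_def by blast
  interpret levy_measure M L \<beta> \<Lambda> by unfold_locales (rule \<Lambda>)
  have a1: "- 1 < a * 1"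
  proof -
    have "a * \<beta> \<le> a * 1" using a(1) \<beta>_gt_1 by (intro mult_left_mono_neg) auto
    then show ?thesis using a(2) by linarith
  qed
  have gm: "g \<in> borel_measurable borel" unfolding g_def[abs_def] pos_powr_def by measurable
  have g1: "integrable lborel g"
    using motion_kernel_Lp[OF a(1) _ a1, of t] gm by (intro integrable_abs_cancel[of _ g]) (auto simp: g_def[abs_def])
  have g\<beta>: "integrable lborel (\<lambda>s. \<bar>g s\<bar> powr \<beta>)"
    using motion_kernel_Lp[OF a(1) _ a(2), of t] \<beta>_gt_1 by (simp add: g_def)
  note sm = step_integral_motion_step[OF zero_less_Suc]
  have k1: "(\<lambda>m. \<integral>s. \<bar>motion_step a (Suc m) t s - g s\<bar> \<partial>lborel) \<longlonglongrightarrow> 0"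
    using motion_step_Lp[OF a(1) _ a1, of t] by (simp add: g_def)
  have k\<beta>: "(\<lambda>m. \<integral>s. \<bar>motion_step a (Suc m) t s - g s\<bar> powr \<beta> \<partial>lborel) \<longlonglongrightarrow> 0"
    using motion_step_Lp[OF a(1) _ a(2), of t] \<beta>_gt_1 by (simp add: g_def)
  have "conv_in_prob M (\<lambda>m. step_integral \<Lambda> UNIV (motion_step a (Suc m) t)) I"
    by (rule levy_integral_approx[OF \<phi> lim J I conv gm g1 g\<beta> sm(1) k1 k\<beta>])
  then show ?thesis
    by (rule conv_in_prob_AE_cong[rotated 4]) (use sm(2) step_integral_measurable[OF sm(1), of UNIV] I in auto)
qed

text \<open>The approximations are obtained for the motion, whose kernel is the one that is integrated,
and differenced afterwards.\<close>

lemma noise_riemann: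
  assumes a: "a < 0" "- 1 < a * \<beta>"
    and Y: "\<And>t. has_levy_integral M L (\<lambda>s. pos_powr (t - s) a - pos_powr (- s) a) (Y t)"
  shows "conv_in_prob M (\<lambda>m. riemann_noise a (Suc m) t) (\<lambda>\<omega>. Y (real_of_int t) \<omega> - Y (real_of_int t - 1) \<omega>)"
proof -
  have Ym: "Y t \<in> borel_measurable M" for t using Y[of t] by (simp add: has_levy_integral_def)
  note c = motion_riemann[OF a Y]
  have "conv_in_prob M (\<lambda>m \<omega>. int_sum (\<lambda>u. riemann_noise a (Suc m) u \<omega>) t + - int_sum (\<lambda>u. riemann_noise a (Suc m) u \<omega>) (t - 1))
     (\<lambda>\<omega>. Y (real_of_int t) \<omega> + - Y (real_of_int (t - 1)) \<omega>)"
    using Ym by (intro conv_in_prob_add conv_in_prob_minus c) auto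
  moreover have "int_sum (\<lambda>u. riemann_noise a (Suc m) u \<omega>) t + - int_sum (\<lambda>u. riemann_noise a (Suc m) u \<omega>) (t - 1) = riemann_noise a (Suc m) t \<omega>" for m \<omega>
    using int_sum_step[of "\<lambda>u. riemann_noise a (Suc m) u \<omega>" t] by simp
  ultimately show ?thesis by simp
qed

end

section \<open>Stationarity and the limiting variance\<close>

context stable_levy
begin

lemma cell_increment_indep:
  assumes m: "0 < m"
  shows "indep_vars (\<lambda>_. borel) (cell_increment m) {lo..<hi}"
proof -
  define ts where "ts i = (real_of_int lo + real i) / real m" for i :: nat
  have "strict_mono ts"
    unfolding strict_mono_Suc_iff ts_def using m by (auto intro!: divide_strict_right_mono)
  from increments_indep[OF this, of "nat (hi - lo)"]
  have "indep_vars (\<lambda>_. borel) (\<lambda>i. cell_increment m (lo + int i)) {..<nat (hi - lo)}"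
    by (rule iffD1[OF indep_vars_cong, rotated -1]) (auto simp: cell_increment_def ts_def fun_eq_iff add_ac)
  moreover have "(\<lambda>j. nat (j - lo)) ` {lo..<hi} = {..<nat (hi - lo)}"
  proof (intro equalityI subsetI)
    fix i assume "i \<in> {..<nat (hi - lo)}"
    then show "i \<in> (\<lambda>j. nat (j - lo)) ` {lo..<hi}" by (intro image_eqI[of _ _ "lo + int i"]) auto
  qed auto
  ultimately have "indep_vars (\<lambda>_. borel) (\<lambda>i. cell_increment m (lo + int i)) ((\<lambda>j. nat (j - lo)) ` {lo..<hi})" by simp
  moreover have "inj_on (\<lambda>j. nat (j - lo)) {lo..<hi}" by (auto simp: inj_on_def)
  ultimately have "indep_vars (\<lambda>_. borel) (\<lambda>j. cell_increment m (lo + int (nat (j - lo)))) {lo..<hi}"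
    by (intro indep_vars_reindex[where e = "\<lambda>j. nat (j - lo)" and N = "\<lambda>_. borel" and X = "\<lambda>i. cell_increment m (lo + int i)"])
  then show ?thesis by (rule iffD1[OF indep_vars_cong, rotated -1]) auto
qed

lemma cell_increment_law:
  assumes m: "0 < m"
  shows "distr M borel (cell_increment m j) = distr M borel (cell_increment m 0)"
proof -
  have "(real_of_int j + 1) / real m = real_of_int j / real m + 1 / real m" by (simp add: add_divide_distrib)
  then show ?thesis
    using increments_stationary[of "1 / real m" "real_of_int j / real m" 0] by (simp add: cell_increment_def[abs_def])
qed

lemma cell_increment_family_law:
  assumes m: "0 < m" and ne: "lo < hi"
  shows "distr M (PiM {lo..<hi} (\<lambda>_. borel)) (\<lambda>\<omega>. \<lambda>j\<in>{lo..<hi}. cell_increment m (j + c) \<omega>)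
    = PiM {lo..<hi} (\<lambda>_. distr M borel (cell_increment m 0))"
proof -
  have img: "(\<lambda>j. j + c) ` {lo..<hi} = {lo + c..<hi + c}" by (simp add: image_add_int_atLeastLessThan)
  have "indep_vars (\<lambda>_. borel) (\<lambda>j. cell_increment m (j + c)) {lo..<hi}"
    by (rule indep_vars_reindex[where e = "\<lambda>j. j + c" and N = "\<lambda>_. borel" and X = "cell_increment m"])
      (simp_all only: img cell_increment_indep[OF m], simp add: inj_on_def)
  then have "distr M (PiM {lo..<hi} (\<lambda>_. borel)) (\<lambda>\<omega>. \<lambda>j\<in>{lo..<hi}. cell_increment m (j + c) \<omega>)
    = PiM {lo..<hi} (\<lambda>j. distr M borel (cell_increment m (j + c)))"
    using ne by (subst (asm) indep_vars_iff_distr_eq_PiM) auto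
  then show ?thesis by (simp only: cell_increment_law[OF m, of "_ + c"])
qed

lemma sampled_kernel_shift:
  assumes "0 < m" shows "sampled_kernel a m (t + \<tau>) (j + \<tau> * int m) = sampled_kernel a m t j"
proof -
  have "real_of_int (t + \<tau>) - real_of_int (j + \<tau> * int m) / real m = real_of_int t - real_of_int j / real m"
    using assms by (simp add: add_divide_distrib)
  then show ?thesis by (simp only: sampled_kernel_def)
qed

text \<open>Shifting time by \<open>\<tau>\<close> shifts the cells by \<open>\<tau> m\<close>. The family of shifted increments has the same
product law.\<close>

lemma riemann_noise_stationary:
  fixes G :: "real \<Rightarrow> real \<Rightarrow> real"
  assumes m: "0 < m" and [measurable]: "case_prod G \<in> borel_measurable (borel \<Otimes>\<^sub>M borel)"
  shows "expectation (\<lambda>\<omega>. G (riemann_noise a m (s + \<tau>) \<omega>) (riemann_noise a m (t + \<tau>) \<omega>))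
       = expectation (\<lambda>\<omega>. G (riemann_noise a m s \<omega>) (riemann_noise a m t \<omega>))"
proof -
  define lo where "lo = min s t * int m - int (m * m)"
  define hi where "hi = max s t * int m + 1"
  have st: "lo \<le> u * int m - int (m * m)" "u * int m < hi" if "u = s \<or> u = t" for u
    using that m by (auto simp: lo_def hi_def intro!: mult_right_mono)
  have ne: "lo < hi" using st[of s] m by linarith
  define R where "R u x = (\<Sum>j\<in>{u * int m - int (m * m)..<u * int m}. sampled_kernel a m u j * x j)" for u :: int and x :: "int \<Rightarrow> real"
  have Rm: "R u \<in> borel_measurable (PiM {lo..<hi} (\<lambda>_. borel))" if "u = s \<or> u = t" for u
    unfolding R_def
  proof (intro borel_measurable_sum borel_measurable_times borel_measurable_const measurable_component_singleton)
    fix j assume "j \<in> {u * int m - int (m * m)..<u * int m}"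
    then show "j \<in> {lo..<hi}" using st[OF that] by auto
  qed
  have GRm: "(\<lambda>x. G (R s x) (R t x)) \<in> borel_measurable (PiM {lo..<hi} (\<lambda>_. borel))"
    using measurable_compose[OF measurable_Pair[OF Rm Rm] assms(2), of s t] by simp
  have rn: "riemann_noise a m (u + c) \<omega> = R u (\<lambda>j\<in>{lo..<hi}. cell_increment m (j + c * int m) \<omega>)" if "u = s \<or> u = t" for u c \<omega>
  proof -
    have "riemann_noise a m (u + c) \<omega> = (\<Sum>j\<in>(\<lambda>j. j + c * int m) ` {u * int m - int (m * m)..<u * int m}. sampled_kernel a m (u + c) j * cell_increment m j \<omega>)"
      unfolding riemann_noise_def by (intro sum.cong) (auto simp: image_add_int_atLeastLessThan algebra_simps)
    also have "\<dots> = (\<Sum>j\<in>{u * int m - int (m * m)..<u * int m}. sampled_kernel a m u j * cell_increment m (j + c * int m) \<omega>)"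
      by (subst sum.reindex) (auto simp: sampled_kernel_shift[OF m])
    also have "\<dots> = R u (\<lambda>j\<in>{lo..<hi}. cell_increment m (j + c * int m) \<omega>)"
      unfolding R_def using st[OF that] by (intro sum.cong refl) auto
    finally show ?thesis .
  qed
  have fm: "(\<lambda>\<omega>. \<lambda>j\<in>{lo..<hi}. cell_increment m (j + c) \<omega>) \<in> M \<rightarrow>\<^sub>M PiM {lo..<hi} (\<lambda>_. borel)" for c
    by (intro measurable_restrict) simp
  have val: "expectation (\<lambda>\<omega>. G (riemann_noise a m (s + c) \<omega>) (riemann_noise a m (t + c) \<omega>))
      = (\<integral>x. G (R s x) (R t x) \<partial>PiM {lo..<hi} (\<lambda>_. distr M borel (cell_increment m 0)))" for c
  proof -
    have "expectation (\<lambda>\<omega>. G (riemann_noise a m (s + c) \<omega>) (riemann_noise a m (t + c) \<omega>))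
      = (\<integral>x. G (R s x) (R t x) \<partial>distr M (PiM {lo..<hi} (\<lambda>_. borel)) (\<lambda>\<omega>. \<lambda>j\<in>{lo..<hi}. cell_increment m (j + c * int m) \<omega>))"
      by (subst integral_distr[OF fm GRm]) (simp add: rn)
    then show ?thesis by (simp only: cell_increment_family_law[OF m ne])
  qed
  show ?thesis using val[of \<tau>] val[of 0] by simp
qed

lemma noise_stationary:
  fixes f :: "real \<Rightarrow> real"
  assumes X[measurable]: "\<And>t. X t \<in> borel_measurable M" and conv: "\<And>t. conv_in_prob M (\<lambda>m. riemann_noise a (Suc m) t) (X t)"
    and f: "\<And>x y. \<bar>f x - f y\<bar> \<le> K * \<bar>x - y\<bar>" "\<And>x. \<bar>f x\<bar> \<le> B" "f \<in> borel_measurable borel"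
  shows "expectation (\<lambda>\<omega>. f (X (s + \<tau>) \<omega>)) = expectation (\<lambda>\<omega>. f (X s \<omega>))"
    and "expectation (\<lambda>\<omega>. f (X (s + \<tau>) \<omega>) * f (X (t + \<tau>) \<omega>)) = expectation (\<lambda>\<omega>. f (X s \<omega>) * f (X t \<omega>))"
proof -
  note [measurable] = f(3)
  let ?R = "\<lambda>m. riemann_noise a (Suc m)"
  note L1 = conv_in_prob_imp_L1_bounded_lipschitz[where f = f and K = K and B = B, OF riemann_noise_measurable X f(3) conv, unfolded real_norm_def, OF f(1,2)]
  have B0: "0 \<le> B" using f(2)[of 0] by linarith
  have i1: "integrable M (\<lambda>\<omega>. f (Z \<omega>))" if [measurable]: "Z \<in> borel_measurable M" for Z
    by (rule integrable_const_bound[of _ B]) (auto simp: f)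
  have i2: "integrable M (\<lambda>\<omega>. f (Z \<omega>) * f (Z' \<omega>))" if [measurable]: "Z \<in> borel_measurable M" "Z' \<in> borel_measurable M" for Z Z'
    by (rule integrable_const_bound[of _ "B * B"]) (auto simp: f abs_mult B0 intro!: mult_mono)
  have lim1: "(\<lambda>m. expectation (\<lambda>\<omega>. f (?R m u \<omega>))) \<longlonglongrightarrow> expectation (\<lambda>\<omega>. f (X u \<omega>))" for u
    by (rule L1_limit_expectation[OF i1 i1]) (use L1 in simp_all)
  have lim2: "(\<lambda>m. expectation (\<lambda>\<omega>. f (?R m u \<omega>) * f (?R m v \<omega>))) \<longlonglongrightarrow> expectation (\<lambda>\<omega>. f (X u \<omega>) * f (X v \<omega>))" for u v
  proof (rule L1_limit_expectation[OF i2 i2])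
    let ?d = "\<lambda>m \<omega>. f (?R m u \<omega>) * f (?R m v \<omega>) - f (X u \<omega>) * f (X v \<omega>)" and ?e = "\<lambda>m u \<omega>. \<bar>f (?R m u \<omega>) - f (X u \<omega>)\<bar>"
    have ie: "integrable M (?e m u)" for m u using i1[of "?R m u"] i1[of "X u"] by simp
    show "(\<lambda>m. expectation (\<lambda>\<omega>. norm (?d m \<omega>))) \<longlonglongrightarrow> 0"
      unfolding real_norm_def
    proof (rule Lim_null_comparison[OF always_eventually], rule allI)
      fix m
      have "expectation (\<lambda>\<omega>. \<bar>?d m \<omega>\<bar>) \<le> expectation (\<lambda>\<omega>. B * ?e m u \<omega> + B * ?e m v \<omega>)"
      proof (rule integral_mono)
        show "integrable M (\<lambda>\<omega>. \<bar>?d m \<omega>\<bar>)" using i2[of "?R m u" "?R m v"] i2[of "X u" "X v"] by simp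
        show "integrable M (\<lambda>\<omega>. B * ?e m u \<omega> + B * ?e m v \<omega>)" using ie[of m u] ie[of m v] by simp
        fix \<omega>
        have "?d m \<omega> = (f (?R m u \<omega>) - f (X u \<omega>)) * f (?R m v \<omega>) + f (X u \<omega>) * (f (?R m v \<omega>) - f (X v \<omega>))" by (simp add: algebra_simps)
        then have "\<bar>?d m \<omega>\<bar> \<le> ?e m u \<omega> * \<bar>f (?R m v \<omega>)\<bar> + \<bar>f (X u \<omega>)\<bar> * ?e m v \<omega>"
          by (simp only: abs_mult[symmetric] abs_triangle_ineq)
        also have "\<dots> \<le> ?e m u \<omega> * B + B * ?e m v \<omega>" by (intro add_mono mult_left_mono mult_right_mono f) auto
        finally show "\<bar>?d m \<omega>\<bar> \<le> B * ?e m u \<omega> + B * ?e m v \<omega>" by (simp add: mult.commute)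
      qed
      also have "\<dots> = B * expectation (?e m u) + B * expectation (?e m v)" using ie[of m u] ie[of m v] by simp
      finally show "norm (expectation (\<lambda>\<omega>. \<bar>?d m \<omega>\<bar>)) \<le> B * expectation (?e m u) + B * expectation (?e m v)" by simp
      show "(\<lambda>m. B * expectation (?e m u) + B * expectation (?e m v)) \<longlonglongrightarrow> 0"
        using tendsto_add[OF tendsto_mult_left[OF L1[of u], of B] tendsto_mult_left[OF L1[of v], of B]] by simp
    qed
  qed simp_all
  have "expectation (\<lambda>\<omega>. f (?R m (s + \<tau>) \<omega>)) = expectation (\<lambda>\<omega>. f (?R m s \<omega>))" for m
    using riemann_noise_stationary[of "Suc m" "\<lambda>x y. f x" a s \<tau> s] by simp
  with lim1[of "s + \<tau>"] lim1[of s] show "expectation (\<lambda>\<omega>. f (X (s + \<tau>) \<omega>)) = expectation (\<lambda>\<omega>. f (X s \<omega>))"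
    by (simp add: LIMSEQ_unique)
  have "expectation (\<lambda>\<omega>. f (?R m (s + \<tau>) \<omega>) * f (?R m (t + \<tau>) \<omega>)) = expectation (\<lambda>\<omega>. f (?R m s \<omega>) * f (?R m t \<omega>))" for m
    using riemann_noise_stationary[of "Suc m" "\<lambda>x y. f x * f y" a s \<tau> t] by simp
  with lim2[of "s + \<tau>" "t + \<tau>"] lim2[of s t]
  show "expectation (\<lambda>\<omega>. f (X (s + \<tau>) \<omega>) * f (X (t + \<tau>) \<omega>)) = expectation (\<lambda>\<omega>. f (X s \<omega>) * f (X t \<omega>))"
    by (simp add: LIMSEQ_unique)
qed

end

lemma summable_on_int_imp_integrable:
  fixes c :: "int \<Rightarrow> real"
  assumes "c summable_on UNIV"
  shows "integrable (count_space UNIV) c" and "(\<integral>j. c j \<partial>count_space UNIV) = infsum c UNIV"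
proof -
  have "(\<lambda>j. norm (c j)) summable_on UNIV" by (rule iffD1[OF summable_on_iff_abs_summable_on_real assms])
  then have abs: "Infinite_Set_Sum.abs_summable_on c UNIV" by (rule iffD1[OF abs_summable_equivalent])
  then show "integrable (count_space UNIV) c" by (simp add: Infinite_Set_Sum.abs_summable_on_def)
  show "(\<integral>j. c j \<partial>count_space UNIV) = infsum c UNIV"
    using infsetsum_infsum[OF abs] by (simp add: infsetsum_def)
qed

text \<open>The lag \<open>j\<close> occurs for between \<open>n - \<bar>j\<bar>\<close> and \<open>n\<close> pairs, so the claim is dominated convergence in
the sum over lags.\<close>

lemma averaged_double_sum_tendsto:
  fixes c :: "int \<Rightarrow> real"
  assumes c: "c summable_on UNIV"
  shows "(\<lambda>n. (\<Sum>s\<in>{1..int n}. \<Sum>t\<in>{1..int n}. c (t - s)) / real n) \<longlonglongrightarrow> infsum c UNIV"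
proof -
  note ci = summable_on_int_imp_integrable[OF c]
  define K where "K n j = {s\<in>{1..int n}. s + j \<in> {1..int n}}" for n j
  have fin: "finite (K n j)" for n j by (rule finite_subset[of _ "{1..int n}"]) (auto simp: K_def)
  have sum_eq: "(\<Sum>s\<in>{1..int n}. \<Sum>t\<in>{1..int n}. c (t - s)) / real n
      = (\<integral>j. real (card (K n j)) / real n * c j \<partial>count_space UNIV)" for n
  proof -
    have row: "(\<Sum>t\<in>{1..int n}. c (t - s)) = (\<integral>j. of_bool (s + j \<in> {1..int n}) * c j \<partial>count_space UNIV)" for s
    proof -
      have sub: "{j \<in> UNIV. of_bool (s + j \<in> {1..int n}) * c j \<noteq> 0} \<subseteq> {1 - s..int n - s}" by auto
      then have "(\<integral>j. of_bool (s + j \<in> {1..int n}) * c j \<partial>count_space UNIV)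
          = (\<Sum>j | j \<in> UNIV \<and> of_bool (s + j \<in> {1..int n}) * c j \<noteq> 0. of_bool (s + j \<in> {1..int n}) * c j)"
        by (intro lebesgue_integral_count_space_finite_support) (rule finite_subset, auto)
      also have "\<dots> = (\<Sum>j\<in>{1 - s..int n - s}. of_bool (s + j \<in> {1..int n}) * c j)"
        by (rule sum.mono_neutral_left) (use sub in auto)
      also have "\<dots> = (\<Sum>t\<in>{1..int n}. c (t - s))"
        by (rule sum.reindex_bij_witness[of _ "\<lambda>t. t - s" "\<lambda>j. s + j"]) auto
      finally show ?thesis by simp
    qed
    have i: "integrable (count_space UNIV) (\<lambda>j. of_bool (s + j \<in> {1..int n}) * c j)" for s
      by (rule Bochner_Integration.integrable_bound[OF ci(1)]) auto
    have "(\<Sum>s\<in>{1..int n}. \<Sum>t\<in>{1..int n}. c (t - s)) = (\<integral>j. (\<Sum>s\<in>{1..int n}. of_bool (s + j \<in> {1..int n}) * c j) \<partial>count_space UNIV)"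
      by (simp only: row Bochner_Integration.integral_sum[OF i])
    also have "\<dots> = (\<integral>j. real (card (K n j)) * c j \<partial>count_space UNIV)"
    proof (rule Bochner_Integration.integral_cong[OF refl])
      fix j show "(\<Sum>s\<in>{1..int n}. of_bool (s + j \<in> {1..int n}) * c j) = real (card (K n j)) * c j"
        by (simp add: K_def sum_distrib_right[symmetric] of_bool_def sum.If_cases Int_def del: atLeastAtMost_iff)
    qed
    also have "\<dots> / real n = (\<integral>j. real (card (K n j)) * c j / real n \<partial>count_space UNIV)" by simp
    finally show ?thesis by simp
  qed
  have le1: "real (card (K n j)) / real n \<le> 1" for n j
  proof -
    have "card (K n j) \<le> card {1..int n}" by (intro card_mono) (auto simp: K_def)
    then show ?thesis by (cases "n = 0") (auto simp: divide_le_eq)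
  qed
  have lower: "1 - real_of_int \<bar>j\<bar> / real n \<le> real (card (K n j)) / real n" if n: "0 < n" for n j
  proof -
    have "card {1 + max 0 (- j)..int n - max 0 j} \<le> card (K n j)"
      by (intro card_mono fin) (auto simp: K_def)
    then have "real n - real_of_int \<bar>j\<bar> \<le> real (card (K n j))" by (simp add: max_def split: if_splits)
    then have "(real n - real_of_int \<bar>j\<bar>) / real n \<le> real (card (K n j)) / real n" by (rule divide_right_mono) simp
    then show ?thesis using n by (simp add: diff_divide_distrib)
  qed
  have lim1: "(\<lambda>n. real (card (K n j)) / real n) \<longlonglongrightarrow> 1" for j
  proof (rule real_tendsto_sandwich)
    show "\<forall>\<^sub>F n in sequentially. 1 - real_of_int \<bar>j\<bar> / real n \<le> real (card (K n j)) / real n"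
      using eventually_gt_at_top[of 0] by eventually_elim (rule lower)
    show "\<forall>\<^sub>F n in sequentially. real (card (K n j)) / real n \<le> 1" by (simp add: le1)
    show "(\<lambda>n. 1 - real_of_int \<bar>j\<bar> / real n) \<longlonglongrightarrow> 1"
      using tendsto_diff[OF tendsto_const[of 1] lim_const_over_n[of "real_of_int \<bar>j\<bar>"]] by simp
  qed simp
  have "(\<lambda>n. \<integral>j. real (card (K n j)) / real n * c j \<partial>count_space UNIV) \<longlonglongrightarrow> (\<integral>j. c j \<partial>count_space UNIV)"
  proof (rule integral_dominated_convergence[where w = "\<lambda>j. \<bar>c j\<bar>"])
    show "integrable (count_space UNIV) (\<lambda>j. \<bar>c j\<bar>)" using ci(1) by simp
    show "AE j in count_space UNIV. (\<lambda>n. real (card (K n j)) / real n * c j) \<longlonglongrightarrow> c j"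
      using tendsto_mult_right[OF lim1] by simp
    show "AE j in count_space UNIV. norm (real (card (K n j)) / real n * c j) \<le> \<bar>c j\<bar>" for n
      using mult_right_mono[OF le1 abs_ge_zero[of "c _"]] by (simp add: abs_mult)
  qed auto
  then show ?thesis by (simp only: sum_eq ci(2))
qed

lemma (in prob_space) stationary_sum_variance:
  fixes \<xi> :: "int \<Rightarrow> 'a \<Rightarrow> real"
  assumes [measurable]: "\<And>t. \<xi> t \<in> borel_measurable M" and B: "\<And>t \<omega>. \<bar>\<xi> t \<omega>\<bar> \<le> B"
    and st1: "\<And>s t. expectation (\<xi> s) = expectation (\<xi> t)"
    and st2: "\<And>s t \<tau>. expectation (\<lambda>\<omega>. \<xi> (s + \<tau>) \<omega> * \<xi> (t + \<tau>) \<omega>) = expectation (\<lambda>\<omega>. \<xi> s \<omega> * \<xi> t \<omega>)"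
  defines "U \<equiv> \<lambda>n \<omega>. real n powr (- (1/2)) * (\<Sum>t\<in>{1..int n}. \<xi> t \<omega> - expectation (\<xi> 1))"
  shows "expectation (U n) = 0"
    and "var M (U n) = (\<Sum>s\<in>{1..int n}. \<Sum>t\<in>{1..int n}. covariance M (\<xi> 0) (\<xi> (t - s))) / real n"
proof -
  have B0: "0 \<le> B" using B[of 0 undefined] by linarith
  have i1: "integrable M (\<xi> t)" for t by (rule integrable_const_bound[of _ B]) (auto simp: B)
  have i2: "integrable M (\<lambda>\<omega>. \<xi> s \<omega> * \<xi> t \<omega>)" for s t
    by (rule integrable_const_bound[of _ "B * B"]) (auto simp: B abs_mult B0 intro!: mult_mono)
  define e where "e = expectation (\<xi> 1)"
  have e: "expectation (\<xi> t) = e" for t unfolding e_def by (rule st1)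
  define \<zeta> where "\<zeta> t \<omega> = \<xi> t \<omega> - e" for t \<omega>
  have \<zeta>2: "(\<lambda>\<omega>. \<zeta> s \<omega> * \<zeta> t \<omega>) = (\<lambda>\<omega>. \<xi> s \<omega> * \<xi> t \<omega> - e * \<xi> s \<omega> - e * \<xi> t \<omega> + e * e)" for s t
    by (auto simp: \<zeta>_def algebra_simps)
  have i\<zeta>: "integrable M (\<lambda>\<omega>. \<zeta> s \<omega> * \<zeta> t \<omega>)" for s t unfolding \<zeta>2 using i1 i2 by simp
  have \<zeta>val: "expectation (\<lambda>\<omega>. \<zeta> s \<omega> * \<zeta> t \<omega>) = expectation (\<lambda>\<omega>. \<xi> s \<omega> * \<xi> t \<omega>) - e * e" for s t
    unfolding \<zeta>2 using i1 i2 by (simp add: e prob_space)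
  have cov: "covariance M (\<xi> 0) (\<xi> (t - s)) = expectation (\<lambda>\<omega>. \<zeta> s \<omega> * \<zeta> t \<omega>)" for s t
    using st2[of 0 s "t - s"] \<zeta>val[of 0 "t - s"] \<zeta>val[of s t] by (simp add: covariance_def e \<zeta>_def[symmetric])
  have U: "U n = (\<lambda>\<omega>. real n powr (- (1/2)) * (\<Sum>t\<in>{1..int n}. \<zeta> t \<omega>))" by (simp add: U_def \<zeta>_def e_def)
  have i\<zeta>1: "integrable M (\<zeta> t)" for t unfolding \<zeta>_def using i1 by simp
  have "expectation (\<zeta> t) = 0" for t unfolding \<zeta>_def using i1 by (simp add: e prob_space)
  then show E0: "expectation (U n) = 0" unfolding U using i\<zeta>1 by simp
  have sq: "(real n powr (- (1/2)))\<^sup>2 = inverse (real n)"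
    by (cases "n = 0") (simp_all add: powr_minus power_inverse powr_half_sqrt)
  have "var M (U n) = expectation (\<lambda>\<omega>. inverse (real n) * (\<Sum>s\<in>{1..int n}. \<Sum>t\<in>{1..int n}. \<zeta> s \<omega> * \<zeta> t \<omega>))"
    unfolding var_def covariance_def E0
    by (intro Bochner_Integration.integral_cong refl)
      (simp only: U sq[symmetric] power2_eq_square sum_product[symmetric] diff_zero mult_ac)
  also have "\<dots> = inverse (real n) * (\<Sum>s\<in>{1..int n}. \<Sum>t\<in>{1..int n}. expectation (\<lambda>\<omega>. \<zeta> s \<omega> * \<zeta> t \<omega>))"
    using i\<zeta> by simp
  finally show "var M (U n) = (\<Sum>s\<in>{1..int n}. \<Sum>t\<in>{1..int n}. covariance M (\<xi> 0) (\<xi> (t - s))) / real n"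
    by (simp add: cov divide_inverse mult.commute)
qed

text \<open>A positive value of the infinite sum includes its convergence, as divergent sums have the value zero.\<close>

lemma (in prob_space) stationary_sum_variance_tendsto:
  fixes \<xi> :: "int \<Rightarrow> 'a \<Rightarrow> real"
  assumes "\<And>t. \<xi> t \<in> borel_measurable M" and "\<And>t \<omega>. \<bar>\<xi> t \<omega>\<bar> \<le> B"
    and "\<And>s t. expectation (\<xi> s) = expectation (\<xi> t)"
    and "\<And>s t \<tau>. expectation (\<lambda>\<omega>. \<xi> (s + \<tau>) \<omega> * \<xi> (t + \<tau>) \<omega>) = expectation (\<lambda>\<omega>. \<xi> s \<omega> * \<xi> t \<omega>)"
    and pos: "0 < (\<Sum>\<^sub>\<infinity>j\<in>UNIV. covariance M (\<xi> 0) (\<xi> j))"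
  shows "(\<lambda>n. var M (\<lambda>\<omega>. real n powr (- (1/2)) * (\<Sum>t\<in>{1..int n}. \<xi> t \<omega> - expectation (\<xi> 1))))
    \<longlonglongrightarrow> (\<Sum>\<^sub>\<infinity>j\<in>UNIV. covariance M (\<xi> 0) (\<xi> j))"
proof -
  have "(\<lambda>j. covariance M (\<xi> 0) (\<xi> j)) summable_on UNIV"
    using pos infsum_not_exists[of "\<lambda>j. covariance M (\<xi> 0) (\<xi> j)" UNIV] by force
  from averaged_double_sum_tendsto[OF this] show ?thesis
    by (simp only: stationary_sum_variance(2)[OF assms(1-4)])
qed

section \<open>Blocks of unit length\<close>

text \<open>Block \<open>k\<close> consists of the cells in the unit interval that starts at \<open>k + 1 - m\<close>. The first block is the
earliest one that reaches time 1, the kernel being cut at distance \<open>m\<close>. From the end of the block to time \<open>t\<close> it takes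
\<open>t + (m - 2) - k\<close>, which is the lag used below.\<close>

definition block :: "nat \<Rightarrow> nat \<Rightarrow> int set" where
  "block m k = {(int k + 1 - int m) * int m..<(int k + 2 - int m) * int m}"

definition block_weight :: "real \<Rightarrow> nat \<Rightarrow> int \<Rightarrow> nat \<Rightarrow> (int \<Rightarrow> real) \<Rightarrow> real" where
  "block_weight a m t k y = (\<Sum>j\<in>block m k. sampled_kernel a m t j * y j)"

lemma sum_blocks: "(\<Sum>k<N. \<Sum>j\<in>block m k. g j) = (\<Sum>j\<in>{(1 - int m) * int m..<(int N + 1 - int m) * int m}. g j)"
proof (induction N)
  case (Suc N)
  have "(1 - int m) * int m \<le> (int N + 1 - int m) * int m" "(int N + 1 - int m) * int m \<le> (int N + 2 - int m) * int m"
    by (auto intro!: mult_right_mono)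
  moreover have "int (Suc N) + 1 - int m = int N + 2 - int m" by simp
  ultimately have "{(1 - int m) * int m..<(int (Suc N) + 1 - int m) * int m} = {(1 - int m) * int m..<(int N + 1 - int m) * int m} \<union> block m N"
    by (auto simp only: block_def atLeastLessThan_iff Un_iff)
  then show ?case using Suc by (simp add: block_def, subst sum.union_disjoint) auto
qed simp

lemma block_disjoint: "disjoint_family_on (block m) I"
proof -
  have "block m k \<inter> block m l = {}" if "k < l" for k l
  proof -
    have "(int k + 2 - int m) * int m \<le> (int l + 1 - int m) * int m" using that by (intro mult_right_mono) auto
    then show ?thesis by (auto simp: block_def)
  qed
  then show ?thesis unfolding disjoint_family_on_def by (metis Int_commute linorder_neqE_nat)
qed

lemma block_card: "card (block m k) = m"
proof -
  have "(int k + 2 - int m) * int m - (int k + 1 - int m) * int m = int m" by (simp add: algebra_simps)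
  then show ?thesis by (simp add: block_def)
qed

lemma block_lag:
  assumes m: "0 < m" and j: "j \<in> block m k"
  shows "real_of_int (t + (int m - 2) - int k) < real_of_int t - real_of_int j / real m"
    and "real_of_int t - real_of_int j / real m \<le> real_of_int (t + (int m - 2) - int k) + 1"
proof -
  have "real_of_int ((int k + 1 - int m) * int m) \<le> real_of_int j" "real_of_int j < real_of_int ((int k + 2 - int m) * int m)"
    using j unfolding block_def by (simp_all only: of_int_le_iff of_int_less_iff atLeastLessThan_iff)
  then have "(real k + 1 - real m) * real m \<le> real_of_int j" "real_of_int j < (real k + 2 - real m) * real m" by simp_all
  then have "real k + 1 - real m \<le> real_of_int j / real m" "real_of_int j / real m < real k + 2 - real m"
    using m by (simp_all add: le_divide_eq divide_less_eq)
  then show "real_of_int (t + (int m - 2) - int k) < real_of_int t - real_of_int j / real m"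
    and "real_of_int t - real_of_int j / real m \<le> real_of_int (t + (int m - 2) - int k) + 1" by simp_all
qed

lemma block_kernel_tail:
  assumes m: "0 < m" and j: "j \<in> block m k" and d: "2 \<le> t + (int m - 2) - int k" and a: "a \<le> 0"
  shows "\<bar>sampled_kernel a m t j\<bar> \<le> \<bar>a\<bar> * ((real_of_int (t + (int m - 2) - int k) + 1) / 3) powr (a - 1)"
proof -
  let ?d = "real_of_int (t + (int m - 2) - int k)" and ?u = "real_of_int t - real_of_int j / real m"
  have d2: "2 \<le> ?d" using d by linarith
  have u: "?d < ?u" using block_lag(1)[OF m j] .
  have u': "0 < (?d + 1) / 3" "(?d + 1) / 3 \<le> ?u - 1"
  proof -
    have "0 < (d + 1) / 3 \<and> (d + 1) / 3 \<le> u - 1" if "2 \<le> d" "d < u" for d u :: real using that by simp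
    from this[OF d2 u] show "0 < (?d + 1) / 3" "(?d + 1) / 3 \<le> ?u - 1" by blast+
  qed
  have "\<bar>noise_kernel a ?u\<bar> \<le> \<bar>a\<bar> * (?u - 1) powr (a - 1)" using a u d2 by (intro noise_kernel_tail) auto
  also have "\<dots> \<le> \<bar>a\<bar> * ((?d + 1) / 3) powr (a - 1)" using a u' by (intro mult_left_mono powr_mono2') auto
  finally show ?thesis using d2 by (auto simp: sampled_kernel_def)
qed

context stable_levy
begin

definition block_law :: "nat \<Rightarrow> nat \<Rightarrow> (int \<Rightarrow> real) measure" where
  "block_law m k = distr M (PiM (block m k) (\<lambda>_. borel)) (\<lambda>\<omega>. \<lambda>j\<in>block m k. cell_increment m j \<omega>)"

lemma block_restrict_measurable[measurable]:
  "(\<lambda>\<omega>. \<lambda>j\<in>block m k. cell_increment m j \<omega>) \<in> M \<rightarrow>\<^sub>M PiM (block m k) (\<lambda>_. borel)"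
  by (intro measurable_restrict) simp

lemma block_law_prob: "prob_space (block_law m k)"
  unfolding block_law_def by (rule prob_space_distr) simp

lemma sets_block_law[measurable_cong]: "sets (block_law m k) = sets (PiM (block m k) (\<lambda>_. borel))"
  by (simp add: block_law_def)

lemma block_weight_measurable: "block_weight a m t k \<in> borel_measurable (PiM (block m k) (\<lambda>_. borel))"
  unfolding block_weight_def[abs_def]
  by (intro borel_measurable_sum borel_measurable_times borel_measurable_const measurable_component_singleton)

lemma block_weight_restrict:
  "block_weight a m t k (\<lambda>j\<in>block m k. cell_increment m j \<omega>) = (\<Sum>j\<in>block m k. sampled_kernel a m t j * cell_increment m j \<omega>)"
  by (auto simp: block_weight_def intro!: sum.cong)

text \<open>The restriction to disjoint index sets of an independent family is an independent family
of vectors, so the blocks are coordinates of a product space.\<close>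

lemma blocks_law:
  assumes m: "0 < m" and N: "0 < N"
  shows "distr M (PiM {..<N} (block_law m)) (\<lambda>\<omega>. \<lambda>k\<in>{..<N}. \<lambda>j\<in>block m k. cell_increment m j \<omega>) = PiM {..<N} (block_law m)"
proof -
  have "indep_vars (\<lambda>_. borel) (cell_increment m) (\<Union>k<N. block m k)"
  proof (rule indep_vars_subset[OF cell_increment_indep[OF m, of "(1 - int m) * int m" "(int N + 1 - int m) * int m"]], rule subsetI)
    fix j assume "j \<in> (\<Union>k<N. block m k)"
    then obtain k where k: "k < N" "j \<in> block m k" by auto
    have "(1 - int m) * int m \<le> (int k + 1 - int m) * int m" "(int k + 2 - int m) * int m \<le> (int N + 1 - int m) * int m"
      using k(1) by (auto intro!: mult_right_mono)
    then show "j \<in> {(1 - int m) * int m..<(int N + 1 - int m) * int m}" using k(2) by (auto simp: block_def)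
  qed
  from indep_vars_restrict[OF this _ block_disjoint, of "{..<N}"]
  have "indep_vars (\<lambda>k. PiM (block m k) (\<lambda>_. borel)) (\<lambda>k \<omega>. \<lambda>j\<in>block m k. cell_increment m j \<omega>) {..<N}" by blast
  then have "distr M (PiM {..<N} (\<lambda>k. PiM (block m k) (\<lambda>_. borel))) (\<lambda>\<omega>. \<lambda>k\<in>{..<N}. \<lambda>j\<in>block m k. cell_increment m j \<omega>)
      = PiM {..<N} (\<lambda>k. distr M (PiM (block m k) (\<lambda>_. borel)) (\<lambda>\<omega>. \<lambda>j\<in>block m k. cell_increment m j \<omega>))"
    using N by (subst (asm) indep_vars_iff_distr_eq_PiM') auto
  moreover have "sets (PiM {..<N} (\<lambda>k. PiM (block m k) (\<lambda>_. borel))) = sets (PiM {..<N} (block_law m))"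
    by (intro sets_PiM_cong refl) (simp add: sets_block_law)
  ultimately show ?thesis by (simp add: block_law_def[symmetric] cong: distr_cong)
qed

lemma riemann_noise_blocks:
  assumes m: "0 < m" and t: "1 \<le> t" "t \<le> int n"
  shows "riemann_noise a m t \<omega> = (\<Sum>k<n + m - 1. block_weight a m t k (\<lambda>j\<in>block m k. cell_increment m j \<omega>))"
proof -
  have "(\<Sum>k<n + m - 1. block_weight a m t k (\<lambda>j\<in>block m k. cell_increment m j \<omega>))
      = (\<Sum>j\<in>{(1 - int m) * int m..<(int (n + m - 1) + 1 - int m) * int m}. sampled_kernel a m t j * cell_increment m j \<omega>)"
    unfolding block_weight_restrict by (rule sum_blocks)
  also have "\<dots> = riemann_noise a m t \<omega>"
    unfolding riemann_noise_def
  proof (rule sum.mono_neutral_right)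
    have "(1 - int m) * int m \<le> t * int m - int (m * m)" "t * int m \<le> (int (n + m - 1) + 1 - int m) * int m"
      using t m mult_right_mono[of 1 t "int m"] mult_right_mono[of t "int n" "int m"] by (auto simp: algebra_simps of_nat_diff)
    then show "{t * int m - int (m * m)..<t * int m} \<subseteq> {(1 - int m) * int m..<(int (n + m - 1) + 1 - int m) * int m}" by auto
  qed (auto simp: sampled_kernel_eq_0[OF m])
  finally show ?thesis ..
qed

lemma block_weight_sq_char:
  assumes m: "0 < m"
  shows "sq_char (distr (block_law m k) borel (block_weight a m t k)) \<theta>
    = exp (- (\<Sum>j\<in>block m k. scale / real m * \<bar>sampled_kernel a m t j\<bar> powr \<beta>) * \<bar>\<theta>\<bar> powr \<beta>)"
proof -
  note [measurable] = block_weight_measurable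
  let ?\<kappa> = "sampled_kernel a m t"
  have "distr (block_law m k) borel (block_weight a m t k) = distr M borel (\<lambda>\<omega>. \<Sum>j\<in>block m k. ?\<kappa> j * cell_increment m j \<omega>)"
    unfolding block_law_def by (subst distr_distr) (auto simp: comp_def block_weight_restrict)
  moreover have "indep_vars (\<lambda>_. borel) (\<lambda>j \<omega>. ?\<kappa> j * cell_increment m j \<omega>) (block m k)"
    unfolding block_def
    by (rule indep_vars_compose2[OF cell_increment_indep[OF m], where Y = "\<lambda>j x. ?\<kappa> j * x"]) simp
  moreover have "sq_char (distr M borel (\<lambda>\<omega>. ?\<kappa> j * cell_increment m j \<omega>)) \<theta>
      = exp (- (scale / real m * \<bar>?\<kappa> j\<bar> powr \<beta>) * \<bar>\<theta>\<bar> powr \<beta>)" for j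
  proof -
    have "sq_char (distr M borel (\<lambda>\<omega>. ?\<kappa> j * cell_increment m j \<omega>)) \<theta> = sq_char (distr M borel (cell_increment m j)) (?\<kappa> j * \<theta>)"
      using sq_char_affine[of "distr M borel (cell_increment m j)" "?\<kappa> j" 0 \<theta>] by (simp add: distr_distr comp_def)
    also have "\<dots> = exp (- (scale * ((real_of_int j + 1) / real m - real_of_int j / real m)) * \<bar>?\<kappa> j * \<theta>\<bar> powr \<beta>)"
      unfolding cell_increment_def[abs_def] by (rule sq_char_increment) (simp add: divide_right_mono)
    finally show ?thesis by (simp add: abs_mult powr_mult add_divide_distrib mult_ac)
  qed
  ultimately show ?thesis
    by (simp add: sq_char_sum_indep exp_sum[symmetric] block_def sum_distrib_right sum_negf)
qed

text \<open>The first summand covers lags from 2 on, where the kernel has its power tail, and 3 bounds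
\<open>(d + 1) / (d - 1)\<close>; the second covers the lags 0 and 1, where the truncated moment is at most one.\<close>

definition lag_const :: "real \<Rightarrow> real" where
  "lag_const a = sqrt (15 / 2 * scale * \<bar>a\<bar> powr \<beta> * 3 powr ((1 - a) * \<beta>) + 2 powr ((1 - a) * \<beta>))"

lemma lag_const_nonneg: "0 \<le> lag_const a" using scale_nonneg by (simp add: lag_const_def)

text \<open>The weight of a block is stable with a scale that is the integral over the block of the power
\<open>\<beta>\<close> of the sampled kernel.\<close>

lemma block_weight_lag_bound:
  assumes m: "0 < m" and a: "a < 0"
  shows "(\<integral>y. \<integral>z. min 1 ((block_weight a m t k y - block_weight a m t k z)\<^sup>2) \<partial>block_law m k \<partial>block_law m k)
    \<le> (lag_const a * lag_weight ((1 - a) * \<beta> / 2) (t + (int m - 2) - int k))\<^sup>2" (is "?I \<le> _")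
proof -
  interpret B: prob_space "block_law m k" by (rule block_law_prob)
  let ?d = "t + (int m - 2) - int k" and ?q = "(1 - a) * \<beta>"
  have q: "0 < ?q" using a \<beta>_gt_1 by (intro mult_pos_pos) auto
  have X[measurable]: "block_weight a m t k \<in> borel_measurable (block_law m k)"
    using block_weight_measurable by (simp cong: measurable_cong_sets add: sets_block_law)
  consider "?d < 0" | "0 \<le> ?d" "?d < 2" | "2 \<le> ?d" by linarith
  then show ?thesis
  proof cases
    case 1
    have "sampled_kernel a m t j = 0" if "j \<in> block m k" for j
      using block_lag(2)[OF m that, of t] 1 by (simp add: sampled_kernel_def noise_kernel_nonpos)
    then have "block_weight a m t k y = 0" for y by (simp add: block_weight_def)
    then show ?thesis by simp
  next
    case 2
    have sq: "(lag_const a * lag_weight (?q / 2) ?d)\<^sup>2 = (lag_const a)\<^sup>2 * (real_of_int ?d + 1) powr (- ?q)"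
      using 2(1) by (simp add: lag_weight_def power_mult_distrib powr_power)
    have "?I \<le> 1"
    proof -
      have i: "integrable (block_law m k) (\<lambda>z. min 1 ((block_weight a m t k y - block_weight a m t k z)\<^sup>2))" for y
        by (rule B.integrable_const_bound[of _ 1]) auto
      have le: "(\<integral>z. min 1 ((block_weight a m t k y - block_weight a m t k z)\<^sup>2) \<partial>block_law m k) \<le> 1" for y
        by (rule B.integral_le_const[OF i]) simp
      show ?thesis by (rule B.integral_le_const, rule B.integrable_const_bound[of _ 1]) (use le in auto)
    qed
    also have "1 = 2 powr ?q * 2 powr (- ?q)" by (simp add: powr_add[symmetric])
    also have "\<dots> \<le> (lag_const a)\<^sup>2 * (real_of_int ?d + 1) powr (- ?q)"
      using q 2 scale_nonneg by (intro mult_mono powr_mono2') (auto simp: lag_const_def)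
    finally show ?thesis by (simp only: sq)
  next
    case 3
    have d3: "2 \<le> real_of_int ?d" using 3 by linarith
    have sq: "(lag_const a * lag_weight (?q / 2) ?d)\<^sup>2 = (lag_const a)\<^sup>2 * (real_of_int ?d + 1) powr (- ?q)"
      using 3 by (simp add: lag_weight_def power_mult_distrib powr_power)
    let ?G = "\<Sum>j\<in>block m k. scale / real m * \<bar>sampled_kernel a m t j\<bar> powr \<beta>"
    have "?I \<le> 15 / 2 * ?G"
      by (rule B.stable_difference_truncated_second_moment[OF X])
        (use \<beta>_gt_1 scale_nonneg in \<open>auto simp: block_weight_sq_char[OF m] intro!: sum_nonneg\<close>)
    also have "?G \<le> (\<Sum>j\<in>block m k. scale / real m * (\<bar>a\<bar> powr \<beta> * 3 powr ?q * (real_of_int ?d + 1) powr (- ?q)))"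
    proof (intro sum_mono mult_left_mono)
      fix j assume j: "j \<in> block m k"
      have "\<bar>sampled_kernel a m t j\<bar> powr \<beta> \<le> (\<bar>a\<bar> * ((real_of_int ?d + 1) / 3) powr (a - 1)) powr \<beta>"
        using \<beta>_gt_1 a by (intro powr_mono2 block_kernel_tail[OF m j 3]) auto
      also have "\<dots> = \<bar>a\<bar> powr \<beta> * ((real_of_int ?d + 1) / 3) powr (- ?q)"
        using d3 by (simp add: powr_mult powr_powr algebra_simps)
      also have "((real_of_int ?d + 1) / 3) powr (- ?q) = 3 powr ?q * (real_of_int ?d + 1) powr (- ?q)"
      proof -
        have "(x / 3) powr (- r) = 3 powr r * x powr (- r)" if "0 \<le> x" for x r :: real
          using that by (simp add: powr_divide powr_minus_divide)
        then show ?thesis using d3 by simp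
      qed
      finally show "\<bar>sampled_kernel a m t j\<bar> powr \<beta> \<le> \<bar>a\<bar> powr \<beta> * 3 powr ?q * (real_of_int ?d + 1) powr (- ?q)" by (simp only: mult.assoc)
    qed (use scale_nonneg in simp)
    also have "\<dots> = scale * \<bar>a\<bar> powr \<beta> * 3 powr ?q * (real_of_int ?d + 1) powr (- ?q)"
      using m by (simp add: block_card)
    also have "15 / 2 * \<dots> \<le> (lag_const a)\<^sup>2 * (real_of_int ?d + 1) powr (- ?q)"
      unfolding mult.assoc[symmetric] using scale_nonneg by (intro mult_right_mono) (auto simp: lag_const_def)
    finally show ?thesis by (simp add: sq)
  qed
qed

end

section \<open>Normal approximation of functionals of the noise\<close>

context stable_levy
begin

definition noise_functional :: "(real \<Rightarrow> real) \<Rightarrow> real \<Rightarrow> nat \<Rightarrow> (int \<Rightarrow> 'a \<Rightarrow> real) \<Rightarrow> 'a \<Rightarrow> real" where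
  "noise_functional f s n X \<omega> = s * (\<Sum>t\<in>{1..int n}. f (X t \<omega>) - expectation (\<lambda>\<eta>. f (X t \<eta>)))"

lemma noise_functional_basics:
  assumes X[measurable]: "\<And>t. X t \<in> borel_measurable M" and f[measurable]: "f \<in> borel_measurable borel"
    and fb: "\<And>x. \<bar>f x\<bar> \<le> c" and s: "0 \<le> s"
  shows "noise_functional f s n X \<in> borel_measurable M"
    and "\<And>\<omega>. \<bar>noise_functional f s n X \<omega>\<bar> \<le> s * (real n * (2 * c))"
    and "expectation (noise_functional f s n X) = 0"
proof -
  show m: "noise_functional f s n X \<in> borel_measurable M" unfolding noise_functional_def[abs_def] by measurable
  have i: "integrable M (\<lambda>\<omega>. f (X t \<omega>))" for t by (rule integrable_const_bound[of _ c]) (auto simp: fb)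
  have e: "\<bar>expectation (\<lambda>\<eta>. f (X t \<eta>))\<bar> \<le> c" for t
    using integral_le_const[OF i[of t], of c] integral_ge_const[OF i[of t], of "- c"] fb by (auto simp: abs_le_iff minus_le_iff)
  show "\<bar>noise_functional f s n X \<omega>\<bar> \<le> s * (real n * (2 * c))" for \<omega>
  proof -
    have "\<bar>\<Sum>t\<in>{1..int n}. f (X t \<omega>) - expectation (\<lambda>\<eta>. f (X t \<eta>))\<bar> \<le> (\<Sum>t\<in>{1..int n}. \<bar>f (X t \<omega>) - expectation (\<lambda>\<eta>. f (X t \<eta>))\<bar>)"
      by (rule sum_abs)
    also have "\<dots> \<le> (\<Sum>t\<in>{1..int n}. 2 * c)"
    proof (rule sum_mono)
      fix t show "\<bar>f (X t \<omega>) - expectation (\<lambda>\<eta>. f (X t \<eta>))\<bar> \<le> 2 * c" using fb[of "X t \<omega>"] e[of t] by linarith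
    qed
    finally show ?thesis using s by (auto simp: noise_functional_def abs_mult intro!: mult_left_mono)
  qed
  show "expectation (noise_functional f s n X) = 0"
    unfolding noise_functional_def[abs_def] using i by (simp add: prob_space)
qed

text \<open>The Riemann sums are functions of the blocks, so \<open>stein_rate\<close> applies on the product space of the block laws. The bound
does not depend on the mesh of the grid.\<close>

lemma stein_riemann_noise:
  fixes \<phi> \<phi>' f :: "real \<Rightarrow> real"
  assumes m: "0 < m" and n: "0 < n" and a: "a < 0" and \<gamma>: "\<gamma> = (1 - a) * \<beta> - 2" "0 < \<gamma>" "\<gamma> < 1"
    and f: "truncated_smooth c f"
    and s: "0 \<le> s" and \<kappa>: "0 \<le> \<kappa>" "s * c \<le> \<kappa> * real n powr (- (1/2))"
    and reg: "stein_regular C \<phi> \<phi>'"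
    and C: "0 \<le> C"
  defines "U \<equiv> noise_functional f s n (riemann_noise a m)"
  shows "\<bar>expectation (\<lambda>\<omega>. \<phi>' (U \<omega>) - U \<omega> * \<phi> (U \<omega>))\<bar>
    \<le> stein_rate_const C (lag_const a) \<gamma> \<kappa> * (1 + expectation (\<lambda>\<omega>. (U \<omega>)\<^sup>2)) * (real n powr (- \<gamma> / 2) + \<bar>1 - expectation (\<lambda>\<omega>. (U \<omega>)\<^sup>2)\<bar>)"
proof -
  note [measurable] = truncated_smoothD(2)[OF f]
  \<comment> \<open>the blocks that meet the range of the kernel for some time from 1 to \<open>n\<close>\<close>
  define N where "N = n + m - 1"
  have N: "0 < N" using m n by (simp add: N_def)
  define \<Phi> where "\<Phi> \<omega> = (\<lambda>k\<in>{..<N}. \<lambda>j\<in>block m k. cell_increment m j \<omega>)" for \<omega>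
  let ?P = "PiM {..<N} (block_law m)"
  have P: "distr M ?P \<Phi> = ?P" unfolding \<Phi>_def using blocks_law[OF m N] .
  have \<Phi>m: "\<Phi> \<in> M \<rightarrow>\<^sub>M ?P"
    unfolding \<Phi>_def by (rule measurable_restrict) (simp add: block_restrict_measurable cong: measurable_cong_sets[OF refl sets_block_law])
  define e where "e t = expectation (\<lambda>\<eta>. f (riemann_noise a m t \<eta>))" for t
  define W where "W w = s * (\<Sum>t\<in>{1..int n}. f (\<Sum>k<N. block_weight a m t k (w k)) - e t)" for w
  have W\<Phi>: "W (\<Phi> \<omega>) = U \<omega>" for \<omega>
    unfolding W_def U_def noise_functional_def e_def
    by (intro arg_cong2[where f = times] sum.cong refl arg_cong2[where f = minus] arg_cong[where f = f])
      (simp add: riemann_noise_blocks[OF m, of _ n] N_def \<Phi>_def)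
  interpret bl: prob_space "block_law m k" for k by (rule block_law_prob)
  interpret ic: independent_coordinates "block_law m" N
    by unfold_locales auto
  have Xm: "block_weight a m t k \<in> borel_measurable (block_law m k)" for t k
    using block_weight_measurable by (simp cong: measurable_cong_sets add: sets_block_law)
  have q2: "(1 - a) * \<beta> / 2 = 1 + \<gamma> / 2" using \<gamma>(1) by (simp add: field_simps)
  have sf: "smooth_functional (block_law m) N W {1..int n}
    (\<lambda>t k y z. min 1 \<bar>block_weight a m t k y - block_weight a m t k z\<bar>) (s * c)
    (\<lambda>t k. lag_const a * lag_weight (1 + \<gamma> / 2) (t + (int m - 2) - int k))"
    unfolding W_def
  proof (rule ic.smooth_functional_of_linear_sums)
    show "(\<integral>y. \<integral>z. min 1 ((block_weight a m t k y - block_weight a m t k z)\<^sup>2) \<partial>block_law m k \<partial>block_law m k)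
      \<le> (lag_const a * lag_weight (1 + \<gamma> / 2) (t + (int m - 2) - int k))\<^sup>2" for t k
      using block_weight_lag_bound[OF m a, where t = t and k = k] by (simp only: q2)
  qed (use Xm f s in \<open>auto intro!: mult_nonneg_nonneg lag_const_nonneg lag_weight_nonneg\<close>)
  then interpret sf: smooth_functional "block_law m" N W "{1..int n}"
    "\<lambda>t k y z. min 1 \<bar>block_weight a m t k y - block_weight a m t k z\<bar>" "s * c"
    "\<lambda>t k. lag_const a * lag_weight (1 + \<gamma> / 2) (t + (int m - 2) - int k)" .
  have Wm: "W \<in> borel_measurable ?P" using sf.bounded_W by (simp add: ic.bounded_rv_def)
  have tr: "(\<integral>w. F (W w) \<partial>?P) = expectation (\<lambda>\<omega>. F (U \<omega>))" if "F \<in> borel_measurable borel" for F :: "real \<Rightarrow> real"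
  proof -
    have "(\<integral>w. F (W w) \<partial>?P) = (\<integral>w. F (W w) \<partial>distr M ?P \<Phi>)" by (simp only: P)
    also have "\<dots> = expectation (\<lambda>\<omega>. F (W (\<Phi> \<omega>)))" by (rule integral_distr[OF \<Phi>m measurable_compose[OF Wm that]])
    finally show ?thesis by (simp only: W\<Phi>)
  qed
  note [measurable] = stein_regularD(1,2)[OF reg, THEN borel_measurable_continuous_onI]
  have EW: "(\<integral>w. W w \<partial>?P) = 0"
    using tr[of "\<lambda>x. x"] noise_functional_basics(3)[where X = "riemann_noise a m" and n = n, OF riemann_noise_measurable truncated_smoothD(2,3)[OF f] s] by (simp add: U_def)
  have E2: "expectation (\<lambda>\<omega>. (U \<omega>)\<^sup>2) = (\<integral>w. (W w)\<^sup>2 \<partial>?P)" using tr[of "\<lambda>x. x\<^sup>2"] by simp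
  have "\<bar>\<integral>w. \<phi>' (W w) - W w * \<phi> (W w) \<partial>?P\<bar>
    \<le> stein_rate_const C (lag_const a) \<gamma> \<kappa> * (1 + expectation (\<lambda>\<omega>. (U \<omega>)\<^sup>2)) * (real n powr (- \<gamma> / 2) + \<bar>1 - expectation (\<lambda>\<omega>. (U \<omega>)\<^sup>2)\<bar>)"
    by (rule stein_rate[OF sf n lag_const_nonneg \<gamma>(2,3) \<kappa> EW E2 reg C])
  then show ?thesis using tr[of "\<lambda>x. \<phi>' x - x * \<phi> x"] by simp
qed

lemma noise_functional_L1:
  assumes X: "\<And>t. X t \<in> borel_measurable M" and conv: "\<And>t. conv_in_prob M (\<lambda>m. riemann_noise a (Suc m) t) (X t)"
    and "truncated_smooth c f" and s: "0 \<le> s"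
  shows "(\<lambda>m. expectation (\<lambda>\<omega>. \<bar>noise_functional f s n (riemann_noise a (Suc m)) \<omega> - noise_functional f s n X \<omega>\<bar>)) \<longlonglongrightarrow> 0"
proof -
  let ?R = "\<lambda>m. riemann_noise a (Suc m)"
  note f = truncated_smoothD(5,3,2)[OF assms(3)]
  note [measurable] = X f(3)
  define D where "D m t = expectation (\<lambda>\<omega>. \<bar>f (?R m t \<omega>) - f (X t \<omega>)\<bar>)" for m t
  let ?e = "\<lambda>(X :: int \<Rightarrow> 'a \<Rightarrow> real) t. expectation (\<lambda>\<eta>. f (X t \<eta>))" and ?S = "\<lambda>m \<omega>. \<Sum>t\<in>{1..int n}. \<bar>f (?R m t \<omega>) - f (X t \<omega>)\<bar> + D m t"
  let ?c = "\<lambda>(X :: int \<Rightarrow> 'a \<Rightarrow> real) t \<omega>. f (X t \<omega>) - ?e X t"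
  have D: "(\<lambda>m. D m t) \<longlonglongrightarrow> 0" for t unfolding D_def by (rule conv_in_prob_imp_L1_bounded_lipschitz[where f = f and K = c and B = c, OF riemann_noise_measurable X f(3) conv, unfolded real_norm_def, OF f(1,2)])
  have i: "integrable M (\<lambda>\<omega>. f (Z \<omega>))" if [measurable]: "Z \<in> borel_measurable M" for Z
    by (rule integrable_const_bound[of _ c]) (auto simp: f)
  have le: "expectation (\<lambda>\<omega>. \<bar>noise_functional f s n (?R m) \<omega> - noise_functional f s n X \<omega>\<bar>) \<le> s * (\<Sum>t\<in>{1..int n}. 2 * D m t)" for m
  proof -
    have pt: "\<bar>noise_functional f s n (?R m) \<omega> - noise_functional f s n X \<omega>\<bar>
        \<le> s * ?S m \<omega>" for \<omega>
    proof -
      have mean: "\<bar>?e (?R m) t - ?e X t\<bar> \<le> D m t" for t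
      proof -
        have "?e (?R m) t - ?e X t = expectation (\<lambda>\<eta>. f (?R m t \<eta>) - f (X t \<eta>))"
          using i[of "?R m t"] i[of "X t"] by simp
        then show ?thesis using integral_abs_bound[of M "\<lambda>\<eta>. f (?R m t \<eta>) - f (X t \<eta>)"] by (simp add: D_def)
      qed
      have "\<bar>(?c (?R m) t \<omega>) - (?c X t \<omega>)\<bar>
          \<le> \<bar>f (?R m t \<omega>) - f (X t \<omega>)\<bar> + D m t" for t using mean[of t] by linarith
      then have "(\<Sum>t\<in>{1..int n}. \<bar>(?c (?R m) t \<omega>) - (?c X t \<omega>)\<bar>)
          \<le> ?S m \<omega>" by (rule sum_mono)
      then have "\<bar>\<Sum>t\<in>{1..int n}. (?c (?R m) t \<omega>) - (?c X t \<omega>)\<bar>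
          \<le> ?S m \<omega>" by (rule order.trans[OF sum_abs])
      then show ?thesis
        unfolding noise_functional_def right_diff_distrib[symmetric] sum_subtractf[symmetric] abs_mult abs_of_nonneg[OF s]
        by (rule mult_left_mono[OF _ s])
    qed
    have i1: "integrable M (\<lambda>\<omega>. \<bar>f (?R m t \<omega>) - f (X t \<omega>)\<bar>)" for t using i[of "?R m t"] i[of "X t"] by simp
    have "expectation (\<lambda>\<omega>. \<bar>noise_functional f s n (?R m) \<omega> - noise_functional f s n X \<omega>\<bar>)
        \<le> expectation (\<lambda>\<omega>. s * ?S m \<omega>)"
    proof (rule integral_mono')
      show "integrable M (\<lambda>\<omega>. s * ?S m \<omega>)" using i1 by simp
    qed (use pt order.trans[OF abs_ge_zero pt] in auto)
    also have "\<dots> = s * (\<Sum>t\<in>{1..int n}. 2 * D m t)" using i1 by (simp add: D_def prob_space)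
    finally show ?thesis .
  qed
  show ?thesis
  proof (rule Lim_null_comparison[OF always_eventually], rule allI)
    show "norm (expectation (\<lambda>\<omega>. \<bar>noise_functional f s n (?R m) \<omega> - noise_functional f s n X \<omega>\<bar>)) \<le> s * (\<Sum>t\<in>{1..int n}. 2 * D m t)" for m
      using le by simp
    have "(\<lambda>m. s * (\<Sum>t\<in>{1..int n}. 2 * D m t)) \<longlonglongrightarrow> s * (\<Sum>t\<in>{1..int n}. 2 * 0)"
      by (intro tendsto_mult_left tendsto_sum D)
    then show "(\<lambda>m. s * (\<Sum>t\<in>{1..int n}. 2 * D m t)) \<longlonglongrightarrow> 0" by simp
  qed
qed

end

lemma (in prob_space) locally_lipschitz_expectation_limit:
  fixes U :: "nat \<Rightarrow> 'a \<Rightarrow> real"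
  assumes Um[measurable]: "\<And>m. U m \<in> borel_measurable M" and Vm[measurable]: "V \<in> borel_measurable M"
    and b: "\<And>m \<omega>. \<bar>U m \<omega>\<bar> \<le> b" "\<And>\<omega>. \<bar>V \<omega>\<bar> \<le> b"
    and L1: "(\<lambda>m. expectation (\<lambda>\<omega>. \<bar>U m \<omega> - V \<omega>\<bar>)) \<longlonglongrightarrow> 0"
    and g: "g \<in> borel_measurable borel" "\<And>x y. \<bar>x\<bar> \<le> b \<Longrightarrow> \<bar>y\<bar> \<le> b \<Longrightarrow> \<bar>g x - g y\<bar> \<le> D * \<bar>x - y\<bar>"
  shows "integrable M (\<lambda>\<omega>. g (V \<omega>))" and "(\<lambda>m. expectation (\<lambda>\<omega>. g (U m \<omega>))) \<longlonglongrightarrow> expectation (\<lambda>\<omega>. g (V \<omega>))"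
proof -
  note [measurable] = g(1)
  have b0: "0 \<le> b" using b(2)[of undefined] by linarith
  have i: "integrable M (\<lambda>\<omega>. g (Z \<omega>))" "integrable M Z" if [measurable]: "Z \<in> borel_measurable M" and Zb: "\<And>\<omega>. \<bar>Z \<omega>\<bar> \<le> b" for Z
  proof -
    have "\<bar>g (Z \<omega>)\<bar> \<le> \<bar>g 0\<bar> + \<bar>D\<bar> * b" for \<omega>
    proof -
      have "\<bar>g (Z \<omega>) - g 0\<bar> \<le> D * \<bar>Z \<omega> - 0\<bar>" by (rule g(2)) (use Zb b0 in auto)
      also have "\<dots> \<le> \<bar>D\<bar> * b" using Zb[of \<omega>] by (intro mult_mono) auto
      finally show ?thesis by linarith
    qed
    then show "integrable M (\<lambda>\<omega>. g (Z \<omega>))" by (intro integrable_const_bound[of _ "\<bar>g 0\<bar> + \<bar>D\<bar> * b"]) auto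
    show "integrable M Z" by (intro integrable_const_bound[of _ b]) (auto simp: Zb)
  qed
  show iV: "integrable M (\<lambda>\<omega>. g (V \<omega>))" by (rule i(1)[OF Vm b(2)])
  show "(\<lambda>m. expectation (\<lambda>\<omega>. g (U m \<omega>))) \<longlonglongrightarrow> expectation (\<lambda>\<omega>. g (V \<omega>))"
  proof (rule L1_limit_expectation[OF i(1)[OF Um b(1)] iV], unfold real_norm_def, rule Lim_null_comparison[OF always_eventually], rule allI)
    fix m
    have "expectation (\<lambda>\<omega>. \<bar>g (U m \<omega>) - g (V \<omega>)\<bar>) \<le> expectation (\<lambda>\<omega>. D * \<bar>U m \<omega> - V \<omega>\<bar>)"
      using i[OF Um b(1)] i[OF Vm b(2)] by (intro integral_mono g(2) b) auto
    then show "norm (expectation (\<lambda>\<omega>. \<bar>g (U m \<omega>) - g (V \<omega>)\<bar>)) \<le> D * expectation (\<lambda>\<omega>. \<bar>U m \<omega> - V \<omega>\<bar>)" by simp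
    show "(\<lambda>m. D * expectation (\<lambda>\<omega>. \<bar>U m \<omega> - V \<omega>\<bar>)) \<longlonglongrightarrow> 0" using tendsto_mult_left[OF L1, of D] by simp
  qed
qed

context stable_levy
begin

text \<open>The second moment of the approximations tends to one, which leaves twice the constant.\<close>

lemma noise_lipschitz_test_bound:
  fixes f h \<phi> \<phi>' :: "real \<Rightarrow> real"
  assumes X: "\<And>t. X t \<in> borel_measurable M" and conv: "\<And>t. conv_in_prob M (\<lambda>m. riemann_noise a (Suc m) t) (X t)"
    and n: "0 < n" and a: "a < 0" and \<gamma>: "\<gamma> = (1 - a) * \<beta> - 2" "0 < \<gamma>" "\<gamma> < 1"
    and f: "truncated_smooth c f"
    and s: "0 \<le> s" and \<kappa>: "0 \<le> \<kappa>" "s * c \<le> \<kappa> * real n powr (- (1/2))"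
    and unit: "expectation (\<lambda>\<omega>. (noise_functional f s n X \<omega>)\<^sup>2) = 1"
    and h: "1-lipschitz_on UNIV h"
    and eq: "\<And>x. \<phi>' x - x * \<phi> x = h x - \<mu>"
    and reg: "stein_regular C \<phi> \<phi>'"
    and C: "0 \<le> C"
  shows "\<bar>expectation (\<lambda>\<omega>. h (noise_functional f s n X \<omega>)) - \<mu>\<bar> \<le> 2 * stein_rate_const C (lag_const a) \<gamma> \<kappa> * real n powr (- \<gamma> / 2)"
proof -
  define U where "U m = noise_functional f s n (riemann_noise a (Suc m))" for m
  let ?V = "noise_functional f s n X" and ?K = "stein_rate_const C (lag_const a) \<gamma> \<kappa>" and ?b = "s * (real n * (2 * c))"
  note bU = noise_functional_basics[where X = "riemann_noise a (Suc m)" and n = n for m, OF riemann_noise_measurable truncated_smoothD(2,3)[OF f] s, folded U_def]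
  note bV = noise_functional_basics[OF X truncated_smoothD(2,3)[OF f] s, of n]
  have L1: "(\<lambda>m. expectation (\<lambda>\<omega>. \<bar>U m \<omega> - ?V \<omega>\<bar>)) \<longlonglongrightarrow> 0"
    unfolding U_def by (rule noise_functional_L1[OF X conv f s])
  note lim = locally_lipschitz_expectation_limit[OF bU(1) bV(1) bU(2) bV(2) L1]
  have hl: "\<bar>h x - h y\<bar> \<le> 1 * \<bar>x - y\<bar>" for x y using h by (auto simp: lipschitz_on_def dist_real_def)
  have hm: "h \<in> borel_measurable borel"
    by (rule borel_measurable_continuous_onI[OF lipschitz_on_continuous_on[OF h]])
  have lim2: "(\<lambda>m. expectation (\<lambda>\<omega>. (U m \<omega>)\<^sup>2)) \<longlonglongrightarrow> 1"
    unfolding unit[symmetric]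
  proof (rule lim(2))
    fix x y :: real assume xy: "\<bar>x\<bar> \<le> ?b" "\<bar>y\<bar> \<le> ?b"
    have "x\<^sup>2 - y\<^sup>2 = (x + y) * (x - y)" by (simp add: power2_eq_square algebra_simps)
    then have "\<bar>x\<^sup>2 - y\<^sup>2\<bar> = \<bar>x + y\<bar> * \<bar>x - y\<bar>" by (simp add: abs_mult)
    also have "\<dots> \<le> (2 * ?b) * \<bar>x - y\<bar>" using xy by (intro mult_right_mono) auto
    finally show "\<bar>x\<^sup>2 - y\<^sup>2\<bar> \<le> (2 * ?b) * \<bar>x - y\<bar>" .
  qed measurable
  have limh: "(\<lambda>m. expectation (\<lambda>\<omega>. h (U m \<omega>) - \<mu>)) \<longlonglongrightarrow> expectation (\<lambda>\<omega>. h (?V \<omega>) - \<mu>)"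
    by (rule lim(2)[where D = 1]) (use hm hl in auto)
  let ?B = "\<lambda>m. ?K * (1 + expectation (\<lambda>\<omega>. (U m \<omega>)\<^sup>2)) * (real n powr (- \<gamma> / 2) + \<bar>1 - expectation (\<lambda>\<omega>. (U m \<omega>)\<^sup>2)\<bar>)"
  have "\<bar>expectation (\<lambda>\<omega>. h (U m \<omega>) - \<mu>)\<bar> \<le> ?B m" for m
    using stein_riemann_noise[OF zero_less_Suc n a \<gamma> f s \<kappa> reg C, of m]
    unfolding U_def[symmetric] eq .
  moreover have "?B \<longlonglongrightarrow> ?K * (1 + 1) * (real n powr (- \<gamma> / 2) + \<bar>1 - 1\<bar>)"
    by (intro tendsto_intros lim2)
  ultimately have "\<bar>expectation (\<lambda>\<omega>. h (?V \<omega>) - \<mu>)\<bar> \<le> ?K * (1 + 1) * (real n powr (- \<gamma> / 2) + \<bar>1 - 1\<bar>)"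
    by (intro tendsto_le[OF sequentially_bot _ tendsto_rabs[OF limh]] always_eventually allI) auto
  moreover have "expectation (\<lambda>\<omega>. h (?V \<omega>) - \<mu>) = expectation (\<lambda>\<omega>. h (?V \<omega>)) - \<mu>"
    using lim(1)[of h 1] hm hl by (simp add: prob_space)
  ultimately show ?thesis by simp
qed

end

section \<open>Distances to the normal law\<close>

lemma distributed_std_normal_expectation:
  assumes Z: "distributed N lborel Z std_normal_density" and h: "h \<in> borel_measurable borel"
  shows "(\<integral>\<omega>. h (Z \<omega>) \<partial>N) = (\<integral>x. h x * std_normal_density x \<partial>lborel)"
  using distributed_integral[OF Z, of h] h by (simp add: mult.commute)

lemma lipschitz_ramp: "1-lipschitz_on UNIV (\<lambda>y. min \<epsilon> (max 0 (x + \<epsilon> - y)))" for x \<epsilon> :: real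
  by (rule lipschitz_onI) (auto simp: dist_real_def min_def max_def)

lemma normal_interval_prob_le:
  assumes "prob_space N" and Z: "distributed N lborel Z std_normal_density" and \<epsilon>: "0 \<le> \<epsilon>"
  shows "measure N {\<omega> \<in> space N. Z \<omega> \<le> x + \<epsilon>} \<le> measure N {\<omega> \<in> space N. Z \<omega> \<le> x} + \<epsilon>"
proof -
  let ?I = "{\<omega> \<in> space N. Z \<omega> \<in> {x<..x + \<epsilon>}}"
  interpret prob_space N by fact
  have [measurable]: "Z \<in> borel_measurable N" using distributed_measurable[OF Z] by simp
  have le1: "std_normal_density y \<le> 1" for y
  proof -
    have "1 \<le> sqrt (2 * pi)" using pi_gt3 by simp
    moreover have "exp (- y\<^sup>2 / 2) \<le> 1" by simp
    ultimately have "exp (- y\<^sup>2 / 2) \<le> sqrt (2 * pi)" by linarith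
    then show ?thesis by (simp add: std_normal_density_def divide_le_eq)
  qed
  have "{\<omega> \<in> space N. Z \<omega> \<le> x + \<epsilon>} = {\<omega> \<in> space N. Z \<omega> \<le> x} \<union> ?I" using \<epsilon> by auto
  then have "measure N {\<omega> \<in> space N. Z \<omega> \<le> x + \<epsilon>} \<le> measure N {\<omega> \<in> space N. Z \<omega> \<le> x} + measure N ?I"
    by (simp add: measure_Un_le)
  also have "measure N ?I = (\<integral>\<omega>. indicator {x<..x + \<epsilon>} (Z \<omega>) \<partial>N)"
  proof -
    have "(\<integral>\<omega>. indicator {x<..x + \<epsilon>} (Z \<omega>) \<partial>N) = (\<integral>\<omega>. indicator ?I \<omega> \<partial>N)"
      by (rule Bochner_Integration.integral_cong) (auto simp: indicator_def)
    also have "\<dots> = measure N (?I \<inter> space N)" by (rule Bochner_Integration.integral_indicator)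
    also have "?I \<inter> space N = ?I" by blast
    finally show ?thesis ..
  qed
  also have "\<dots> = (\<integral>y. indicator {x<..x + \<epsilon>} y * std_normal_density y \<partial>lborel)"
    by (rule distributed_std_normal_expectation[OF Z]) simp
  also have "\<dots> \<le> (\<integral>y. indicator {x<..x + \<epsilon>} y \<partial>lborel)"
  proof (rule integral_mono')
    show "integrable lborel (\<lambda>y. indicator {x<..x + \<epsilon>} y :: real)" using \<epsilon> by (intro integrable_real_indicator) auto
  qed (use le1 in \<open>auto simp: indicator_def\<close>)
  also have "\<dots> = \<epsilon>" using \<epsilon> by simp
  finally show ?thesis by simp
qed

lemma wasserstein_dist_le_of_test_bound:
  assumes Z: "distributed N lborel Z std_normal_density"
    and test: "\<And>h. 1-lipschitz_on UNIV h \<Longrightarrow> \<bar>(\<integral>\<omega>. h (F \<omega>) \<partial>M) - (\<integral>x. h x * std_normal_density x \<partial>lborel)\<bar> \<le> \<delta>"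
  shows "wasserstein_dist M F N Z \<le> ereal \<delta>"
  unfolding wasserstein_dist_def
proof (rule SUP_least)
  fix h :: "real \<Rightarrow> real" assume "h \<in> {h. 1-lipschitz_on UNIV h}"
  then have h: "1-lipschitz_on UNIV h" by simp
  have "h \<in> borel_measurable borel" by (rule borel_measurable_continuous_onI[OF lipschitz_on_continuous_on[OF h]])
  then show "ereal \<bar>(\<integral>\<omega>. h (F \<omega>) \<partial>M) - (\<integral>\<omega>. h (Z \<omega>) \<partial>N)\<bar> \<le> ereal \<delta>"
    using test[OF h] by (simp add: distributed_std_normal_expectation[OF Z])
qed

text \<open>A ramp of width and height \<open>\<epsilon>\<close> is Lipschitz with constant one. Dividing by the height costs \<open>\<delta> / \<epsilon>\<close>, and
the width costs at most \<open>\<epsilon>\<close>, as the normal density is at most one.\<close>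

lemma kolmogorov_dist_le_of_test_bound:
  assumes M: "prob_space M" and N: "prob_space N" and F[measurable]: "F \<in> borel_measurable M" and Z: "distributed N lborel Z std_normal_density"
    and test: "\<And>h. 1-lipschitz_on UNIV h \<Longrightarrow> \<bar>(\<integral>\<omega>. h (F \<omega>) \<partial>M) - (\<integral>x. h x * std_normal_density x \<partial>lborel)\<bar> \<le> \<delta>"
    and \<epsilon>: "0 < \<epsilon>"
  shows "kolmogorov_dist M F N Z \<le> ereal (\<delta> / \<epsilon> + \<epsilon>)"
proof -
  interpret M: prob_space M by fact
  interpret N: prob_space N by fact
  have Zm[measurable]: "Z \<in> borel_measurable N" using distributed_measurable[OF Z] by simp
  define h where "h x y = min \<epsilon> (max 0 (x + \<epsilon> - y))" for x y :: real
  have [measurable]: "h x \<in> borel_measurable borel" for x unfolding h_def by measurable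
  \<comment> \<open>the ramp lies between the scaled indicators of the two half-lines that it joins\<close>
  have sandwich: "\<epsilon> * measure R {\<omega> \<in> space R. G \<omega> \<le> x} \<le> (\<integral>\<omega>. h x (G \<omega>) \<partial>R)"
      "(\<integral>\<omega>. h x (G \<omega>) \<partial>R) \<le> \<epsilon> * measure R {\<omega> \<in> space R. G \<omega> \<le> x + \<epsilon>}"
    if R: "prob_space R" and [measurable]: "G \<in> borel_measurable R" for R :: "'c measure" and G x
  proof -
    interpret R: prob_space R by fact
    have i: "integrable R (\<lambda>\<omega>. h x (G \<omega>))"
      by (rule R.integrable_const_bound[of _ \<epsilon>]) (use \<epsilon> in \<open>auto simp: h_def\<close>)
    have ind: "(\<integral>\<omega>. \<epsilon> * indicator {\<omega> \<in> space R. G \<omega> \<le> z} \<omega> \<partial>R) = \<epsilon> * measure R {\<omega> \<in> space R. G \<omega> \<le> z}"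
      "integrable R (\<lambda>\<omega>. \<epsilon> * indicator {\<omega> \<in> space R. G \<omega> \<le> z} \<omega>)" for z
      by (simp_all add: R.emeasure_finite less_top[symmetric])
    show "\<epsilon> * measure R {\<omega> \<in> space R. G \<omega> \<le> x} \<le> (\<integral>\<omega>. h x (G \<omega>) \<partial>R)"
      unfolding ind(1)[symmetric] by (rule integral_mono[OF ind(2) i]) (use \<epsilon> in \<open>auto simp: h_def indicator_def\<close>)
    show "(\<integral>\<omega>. h x (G \<omega>) \<partial>R) \<le> \<epsilon> * measure R {\<omega> \<in> space R. G \<omega> \<le> x + \<epsilon>}"
      unfolding ind(1)[symmetric] by (rule integral_mono[OF i ind(2)]) (use \<epsilon> in \<open>auto simp: h_def indicator_def\<close>)
  qed
  have close: "\<bar>(\<integral>\<omega>. h x (F \<omega>) \<partial>M) - (\<integral>\<omega>. h x (Z \<omega>) \<partial>N)\<bar> \<le> \<delta>" for x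
    using test[OF lipschitz_ramp[of \<epsilon> x]] distributed_std_normal_expectation[OF Z, of "h x"] by (simp add: h_def[abs_def])
  have "\<bar>measure M {\<omega> \<in> space M. F \<omega> \<le> x} - measure N {\<omega> \<in> space N. Z \<omega> \<le> x}\<bar> \<le> \<delta> / \<epsilon> + \<epsilon>" for x
  proof -
    let ?p = "\<lambda>z. measure M {\<omega> \<in> space M. F \<omega> \<le> z}" and ?g = "\<lambda>z. measure N {\<omega> \<in> space N. Z \<omega> \<le> z}"
    have "\<epsilon> * ?p x \<le> \<epsilon> * ?g (x + \<epsilon>) + \<delta>"
      using sandwich(1)[OF M F, of x] close[of x] sandwich(2)[OF N Zm, of x] by linarith
    also have "\<dots> \<le> \<epsilon> * (?g x + \<epsilon>) + \<delta>"
      using normal_interval_prob_le[OF N Z, of \<epsilon> x] \<epsilon> by simp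
    finally have up: "?p x \<le> ?g x + (\<delta> / \<epsilon> + \<epsilon>)" using \<epsilon> by (simp add: field_simps)
    have "\<epsilon> * ?g x \<le> \<epsilon> * (?g (x - \<epsilon>) + \<epsilon>)"
      using normal_interval_prob_le[OF N Z, of \<epsilon> "x - \<epsilon>"] \<epsilon> by simp
    moreover have "\<epsilon> * ?g (x - \<epsilon>) \<le> \<epsilon> * ?p x + \<delta>"
      using sandwich(1)[OF N Zm, of "x - \<epsilon>"] close[of "x - \<epsilon>"] sandwich(2)[OF M F, of "x - \<epsilon>"] by simp
    ultimately have "?g x \<le> ?p x + (\<delta> / \<epsilon> + \<epsilon>)" using \<epsilon> by (simp add: field_simps)
    with up show ?thesis by linarith
  qed
  then show ?thesis unfolding kolmogorov_dist_def by (intro SUP_least) simp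
qed

text \<open>This gives one constant for all \<open>n\<close> with \<open>v n > 0\<close>, including the finitely many \<open>n\<close> before \<open>v n\<close> is close
to its limit.\<close>

lemma tendsto_pos_imp_positive_values_bounded_below:
  fixes v :: "nat \<Rightarrow> real"
  assumes "v \<longlonglongrightarrow> l" "0 < l"
  obtains v0 where "0 < v0" "\<And>n. 0 < v n \<Longrightarrow> v0 \<le> v n"
proof -
  have "\<forall>\<^sub>F n in sequentially. l / 2 < v n" using assms by (intro order_tendstoD) auto
  then obtain n0 where n0: "\<And>n. n0 \<le> n \<Longrightarrow> l / 2 < v n" by (auto simp: eventually_sequentially)
  define A where "A = insert (l / 2) (v ` {n \<in> {..<n0}. 0 < v n})"
  have A: "finite A" "A \<noteq> {}" "\<And>y. y \<in> A \<Longrightarrow> 0 < y" using assms(2) by (auto simp: A_def)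
  show thesis
  proof (rule that[of "Min A"])
    show "0 < Min A" using A Min_in by blast
    fix n assume "0 < v n"
    show "Min A \<le> v n"
    proof (cases "n < n0")
      case True
      then show ?thesis using \<open>0 < v n\<close> A(1) by (intro Min_le) (auto simp: A_def)
    next
      case False
      then have "l / 2 < v n" using n0[of n] by simp
      moreover have "Min A \<le> l / 2" by (rule Min_le[OF A(1)]) (simp add: A_def)
      ultimately show ?thesis by linarith
    qed
  qed
qed

theorem corollary1p3:
  fixes M :: "'a measure" and N :: "'b measure"
    and L X Y :: "real \<Rightarrow> 'a \<Rightarrow> real"
    and \<beta> H :: real and f :: "real \<Rightarrow> real"
    and V :: "nat \<Rightarrow> 'a \<Rightarrow> real" and v :: "nat \<Rightarrow> real" and Z :: "'b \<Rightarrow> real"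
  assumes "prob_space M"
    and "1 < \<beta>" and "\<beta> < 2" and "0 < H" and "H < 1 - 1 / \<beta>"
    and "stable_levy_process M \<beta> L"
    and "linear_fractional_stable_motion M L \<beta> H Y"
    and "\<And>t \<omega>. X t \<omega> = Y t \<omega> - Y (t - 1) \<omega>"
    and "f \<in> C_b2"
    and "\<And>n \<omega>. V n \<omega> =
           real n powr (- (1 / 2)) * (\<Sum>t = 1..n. f (X (real t) \<omega>) - (\<integral>\<eta>. f (X 1 \<eta>) \<partial>M))"
    and "\<And>n. v n = sqrt (var M (V n))"
    and "(\<Sum>\<^sub>\<infinity>j\<in>(UNIV :: int set).
           covariance M (\<lambda>\<omega>. f (X 0 \<omega>)) (\<lambda>\<omega>. f (X (real_of_int j) \<omega>))) > 0"
    and "prob_space N"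
    and "distributed N lborel Z std_normal_density"
  shows "\<exists>C::real. C > 0 \<and> (\<forall>n::nat. v n > 0 \<longrightarrow>
           wasserstein_dist M (\<lambda>\<omega>. V n \<omega> / v n) N Z
             \<le> ereal (C * real n powr ((1 + \<beta> * (H - 1)) / 2)) \<and>
           kolmogorov_dist M (\<lambda>\<omega>. V n \<omega> / v n) N Z
             \<le> ereal (C * real n powr ((1 + \<beta> * (H - 1)) / 4)))"
proof -
  interpret prob_space M by (rule assms(1))
  interpret stable_levy M L \<beta>
    using assms(2,3,6) by unfold_locales (auto simp: stable_levy_process_def)
  define a where "a = H - 1 / \<beta>"
  define \<gamma> where "\<gamma> = (1 - a) * \<beta> - 2"
  have \<gamma>_eq: "\<gamma> = \<beta> * (1 - H) - 1" using assms(2) by (simp add: \<gamma>_def a_def field_simps)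
  have H\<beta>: "H * \<beta> < \<beta> - 1" using assms(2,5) by (simp add: field_simps)
  have a: "a < 0" "- 1 < a * \<beta>"
  proof -
    have "a * \<beta> = H * \<beta> - 1" using assms(2) by (simp add: a_def field_simps)
    then show "- 1 < a * \<beta>" using assms(2,4) by simp
    have "a * \<beta> < 0" using \<open>a * \<beta> = H * \<beta> - 1\<close> H\<beta> assms(3) by linarith
    then show "a < 0" using assms(2) by (simp add: mult_less_0_iff)
  qed
  have \<gamma>: "0 < \<gamma>" "\<gamma> < 1"
    using H\<beta> assms(2,3) mult_pos_pos[OF assms(4), of \<beta>] by (auto simp: \<gamma>_eq algebra_simps)
  obtain c where tf: "truncated_smooth c f" using C_b2_imp_truncated_smooth[OF assms(9)] by blast
  note c = truncated_smoothD(1)[OF tf] and f = truncated_smoothD(2)[OF tf]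
  define X' where "X' t = X (real_of_int t)" for t
  have Y: "has_levy_integral M L (\<lambda>s. pos_powr (t - s) a - pos_powr (- s) a) (Y t)" for t
    using assms(7) by (simp add: linear_fractional_stable_motion_def a_def)
  have X'_eq: "X' t = (\<lambda>\<omega>. Y (real_of_int t) \<omega> - Y (real_of_int t - 1) \<omega>)" for t
    by (simp add: X'_def assms(8) fun_eq_iff)
  have conv: "conv_in_prob M (\<lambda>m. riemann_noise a (Suc m) t) (X' t)" for t
    unfolding X'_eq by (rule noise_riemann[OF a Y])
  have X': "X' t \<in> borel_measurable M" for t
    using Y unfolding X'_eq by (auto simp: has_levy_integral_def intro!: borel_measurable_diff)
  note [measurable] = X' f
  note stationary = noise_stationary[of X' a f c, OF X' conv truncated_smoothD(5,3,2)[OF tf]]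
  define \<xi> where "\<xi> t \<omega> = f (X' t \<omega>)" for t \<omega>
  have \<xi>: "\<xi> t \<in> borel_measurable M" "\<bar>\<xi> t \<omega>\<bar> \<le> c" for t \<omega> unfolding \<xi>_def[abs_def] by (simp_all add: truncated_smoothD(3)[OF tf])
  have st1: "expectation (\<xi> s) = expectation (\<xi> t)" for s t
    using stationary(1)[of t "s - t"] by (simp add: \<xi>_def[abs_def])
  have st2: "expectation (\<lambda>\<omega>. \<xi> (s + \<tau>) \<omega> * \<xi> (t + \<tau>) \<omega>) = expectation (\<lambda>\<omega>. \<xi> s \<omega> * \<xi> t \<omega>)" for s t \<tau>
    using stationary(2) by (simp add: \<xi>_def)
  have V_eq: "V n = (\<lambda>\<omega>. real n powr (- (1/2)) * (\<Sum>t\<in>{1..int n}. \<xi> t \<omega> - expectation (\<xi> 1)))" for n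
  proof
    fix \<omega>
    have "(\<Sum>t = 1..n. f (X (real t) \<omega>) - (\<integral>\<eta>. f (X 1 \<eta>) \<partial>M)) = (\<Sum>t\<in>{1..int n}. \<xi> t \<omega> - expectation (\<xi> 1))"
      by (rule sum.reindex_bij_witness[of _ nat int]) (auto simp: \<xi>_def[abs_def] X'_def)
    then show "V n \<omega> = real n powr (- (1/2)) * (\<Sum>t\<in>{1..int n}. \<xi> t \<omega> - expectation (\<xi> 1))" by (simp only: assms(10))
  qed
  have pos: "0 < (\<Sum>\<^sub>\<infinity>j\<in>UNIV. covariance M (\<xi> 0) (\<xi> j))"
    using assms(12) by (simp add: \<xi>_def[abs_def] X'_def)
  have "(\<lambda>n. var M (V n)) \<longlonglongrightarrow> (\<Sum>\<^sub>\<infinity>j\<in>UNIV. covariance M (\<xi> 0) (\<xi> j))"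
    unfolding V_eq by (rule stationary_sum_variance_tendsto[OF \<xi> st1 st2 pos])
  then have "v \<longlonglongrightarrow> sqrt (\<Sum>\<^sub>\<infinity>j\<in>UNIV. covariance M (\<xi> 0) (\<xi> j))"
    unfolding assms(11) by (rule tendsto_real_sqrt)
  then obtain v0 where v0: "0 < v0" "\<And>n. 0 < v n \<Longrightarrow> v0 \<le> v n"
    using tendsto_pos_imp_positive_values_bounded_below pos by (metis real_sqrt_gt_zero)
  have EV: "expectation (V n) = 0" for n
    unfolding V_eq by (rule stationary_sum_variance(1)[OF \<xi> st1 st2])
  obtain C where C: "0 \<le> C"
    and stein: "\<And>h. 1-lipschitz_on UNIV h \<Longrightarrow> \<exists>\<phi> \<phi>'. stein_regular C \<phi> \<phi>' \<and>
      (\<forall>x. \<phi>' x - x * \<phi> x = h x - (\<integral>y. h y * std_normal_density y \<partial>lborel))"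
    by (rule stein_equation_solution) blast
  define \<kappa> where "\<kappa> = c / v0"
  have \<kappa>: "0 \<le> \<kappa>" using c v0(1) by (simp add: \<kappa>_def)
  define K where "K = 2 * stein_rate_const C (lag_const a) \<gamma> \<kappa>"
  have K: "0 \<le> K" using stein_rate_const_nonneg[OF C lag_const_nonneg \<gamma> \<kappa>] by (simp add: K_def)
  have n_pos: "0 < n" if "0 < v n" for n
    using that by (intro gr0I) (simp add: assms(11) V_eq var_def covariance_def)
  have test: "\<bar>expectation (\<lambda>\<omega>. h (V n \<omega> / v n)) - (\<integral>x. h x * std_normal_density x \<partial>lborel)\<bar> \<le> K * real n powr (- \<gamma> / 2)"
    if vn: "0 < v n" and h: "1-lipschitz_on UNIV h" for n h
  proof -
    note n = n_pos[OF vn]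
    define s where "s = real n powr (- (1/2)) / v n"
    have s: "0 \<le> s" using vn by (simp add: s_def)
    have s\<kappa>: "s * c \<le> \<kappa> * real n powr (- (1/2))"
    proof -
      have "c / v n \<le> c / v0" using v0 vn c by (intro divide_left_mono) auto
      from mult_right_mono[OF this, of "real n powr (- (1/2))"] show ?thesis by (simp add: s_def \<kappa>_def mult.commute)
    qed
    have F: "noise_functional f s n X' = (\<lambda>\<omega>. V n \<omega> / v n)"
    proof
      fix \<omega>
      have "expectation (\<lambda>\<eta>. f (X' t \<eta>)) = expectation (\<xi> 1)" for t using st1[of t 1] by (simp add: \<xi>_def[abs_def])
      then show "noise_functional f s n X' \<omega> = V n \<omega> / v n" by (simp add: noise_functional_def V_eq s_def \<xi>_def)
    qed
    have "(v n)\<^sup>2 = var M (V n)" using vn by (simp add: assms(11) real_sqrt_gt_0_iff)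
    also have "\<dots> = expectation (\<lambda>\<omega>. (V n \<omega>)\<^sup>2)" by (simp add: var_def covariance_def EV power2_eq_square)
    finally have unit: "expectation (\<lambda>\<omega>. (noise_functional f s n X' \<omega>)\<^sup>2) = 1"
      unfolding F power_divide using vn by (metis Bochner_Integration.integral_divide_zero divide_self_if less_irrefl power_not_zero)
    obtain \<phi> \<phi>' where reg: "stein_regular C \<phi> \<phi>'"
      and eq: "\<And>x. \<phi>' x - x * \<phi> x = h x - (\<integral>y. h y * std_normal_density y \<partial>lborel)"
      using stein[OF h] by blast
    show ?thesis
      using noise_lipschitz_test_bound[OF X' conv n a(1) \<gamma>_def \<gamma> tf s \<kappa> s\<kappa> unit h eq reg C]
      unfolding F K_def .
  qed
  have e2: "(1 + \<beta> * (H - 1)) / 2 = - \<gamma> / 2" and e4: "(1 + \<beta> * (H - 1)) / 4 = - \<gamma> / 4"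
    by (simp_all add: \<gamma>_eq algebra_simps)
  show ?thesis
  proof (intro exI[of _ "K + 1"] conjI allI impI)
    show "0 < K + 1" using K by simp
    fix n assume vn: "0 < v n"
    note n = n_pos[OF vn] and tb = test[OF vn]
    have "wasserstein_dist M (\<lambda>\<omega>. V n \<omega> / v n) N Z \<le> ereal (K * real n powr (- \<gamma> / 2))"
      by (rule wasserstein_dist_le_of_test_bound[OF assms(14) tb])
    also have "\<dots> \<le> ereal ((K + 1) * real n powr (- \<gamma> / 2))" by (simp add: mult_right_mono)
    finally show "wasserstein_dist M (\<lambda>\<omega>. V n \<omega> / v n) N Z \<le> ereal ((K + 1) * real n powr ((1 + \<beta> * (H - 1)) / 2))"
      by (simp only: e2)
    have Vm: "(\<lambda>\<omega>. V n \<omega> / v n) \<in> borel_measurable M" unfolding V_eq by (intro borel_measurable_divide borel_measurable_times borel_measurable_sum borel_measurable_diff \<xi>) auto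
    have "kolmogorov_dist M (\<lambda>\<omega>. V n \<omega> / v n) N Z
        \<le> ereal (K * real n powr (- \<gamma> / 2) / real n powr (- \<gamma> / 4) + real n powr (- \<gamma> / 4))"
      using n by (intro kolmogorov_dist_le_of_test_bound[OF assms(1,13) Vm assms(14) tb]) auto
    also have "K * real n powr (- \<gamma> / 2) / real n powr (- \<gamma> / 4) = K * real n powr (- \<gamma> / 4)"
    proof -
      have "- \<gamma> / 2 = - \<gamma> / 4 + - \<gamma> / 4" by simp
      then show ?thesis using n by (simp only: powr_add) simp
    qed
    finally show "kolmogorov_dist M (\<lambda>\<omega>. V n \<omega> / v n) N Z \<le> ereal ((K + 1) * real n powr ((1 + \<beta> * (H - 1)) / 4))"
      by (simp add: e4 distrib_right)
  qed
qed

end
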